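(* For every natural number $m\geqslant 1$, $$\limsup_{n\to\infty}\frac{\min(d_{n+1},\dots,d_{n+m})}{g(n)\log n}>0.$$
   Context: Let $p_1<p_2<\dots$ be the sequence of all primes and $d_n=p_{n+1}-p_n$. Let $\log_\nu$ denote the $\nu$-fold iterated natural logarithm, and put $g(x)=\dfrac{\log_2 x\,\log_4 x}{(\log_3 x)^2}$ (for $x$ large enough that this is defined and positive). *)

theory Defs
  imports
    Complex_Main
    "HOL-Library.Infinite_Set"
    "HOL-Library.Liminf_Limsup"
    "HOL-Library.Extended_Real"
    "HOL-Computational_Algebra.Primes"
begin

text \<open>
  The library's \<^const>\<open>enumerate\<close> counts from 0, while the primes are numbered
  from 1 here, so that \<open>nth_prime 1 = 2\<close>. The index 0 carries no meaning.
\<close>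

definition nth_prime :: "nat \<Rightarrow> nat" where
  "nth_prime n = enumerate {p::nat. prime p} (n - 1)"

lemma strict_mono_on_nth_prime: "strict_mono_on {1..} nth_prime"
  by (rule strict_mono_onI)
    (auto simp: nth_prime_def primes_infinite intro!: enumerate_mono)

lemma nth_prime_image: "nth_prime ` {1..} = {p. prime p}"
proof -
  have "{1::nat..} = range Suc"
    by (auto simp: image_iff Suc_le_eq gr0_conv_Suc)
  then have "nth_prime ` {1..} = range (enumerate {p::nat. prime p})"
    by (simp add: nth_prime_def image_image)
  then show ?thesis by (simp add: range_enumerate primes_infinite)
qed

definition prime_gap :: "nat \<Rightarrow> real" where
  "prime_gap n = real (nth_prime (n + 1)) - real (nth_prime n)"

definition iter_ln :: "nat \<Rightarrow> real \<Rightarrow> real" where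
  "iter_ln k x = (ln ^^ k) x"

text \<open>
  For small \<open>x\<close> the iterated logarithms are not meaningful and \<open>gap_scale x\<close> is an
  arbitrary value; only the behaviour for \<open>x\<close> tending to infinity matters.
\<close>

definition gap_scale :: "real \<Rightarrow> real" where
  "gap_scale x = iter_ln 2 x * iter_ln 4 x / (iter_ln 3 x)\<^sup>2"

end

(*
  The primes in (y, z] with z = x / (ln x)^5 are made to divide a modulus Q, so that N + j with Q | N can
  be prime only for j coprime to Q: either j = k q with q > z prime and k small, or j is y-smooth (rare
  by Rankin's trick).

  Primes of size exp x are dense in every reduced class mod Q, possibly after dropping one prime r
  from Q. Indeed Selberg's formula yields a density function on the group of units mod Q, and a class
  poor in primes forces a subgroup H of index two under whose translations the density hardly changes.
  If Q and all Q / r had poor classes, then H would contain the kernels of all reductions mod Q / r;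
  but these generate the whole group.

  In the matrix of translates of a window of length U by the multiples N of Q, an average row thus
  contains as many primes as wished, while upper bound sieves for pairs bound the second moment and
  show that few rows contain two primes closer than a small multiple of U. Some row therefore has more
  than m primes, all of them far apart.
*)
theory Submission
 imports Defs "HOL-Number_Theory.Number_Theory" "HOL-Number_Theory.Prime_Powers" "HOL-Analysis.Analysis" "HOL-Real_Asymp.Real_Asymp"
begin

section \<open>Mertens' estimates\<close>

text \<open>The obstacle is the size of Q, which grows like an exponential of z = x / (ln x)^5.
  Lower bounds for primes in all classes to such a modulus are usually drawn from zero-free regions,
  where one exceptional real zero has to be removed by deleting a prime from Q. Here no L-functions
  occur: the exceptional character shows itself as the subgroup H. Selberg's formula by itself
  cannot exclude density 2 on one coset of a subgroup of index two and density 0 on the other, which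
  is why the moduli Q / r are compared with Q. Only a positive proportion of the expected primes is
  sought, so a fixed number of cells with fixed numerical margins is enough.

  The length U is the one for which an average row contains a bounded number of primes; its constant
  c brings this number above m, and the separation constant is chosen after c. The primes found have
  logarithms of order x, and so have their indices n. Hence ln x, ln ln x and ln ln ln x correspond
  to the second, third and fourth iterated logarithms of n, and U is of the order of g(n) log
  n.\<close>

definition natseg :: "real => real => nat set" where
 "natseg a b = {n. a < real n & real n <= b}"

abbreviation primes_in :: "real => real => nat set" where
 "primes_in a b \<equiv> {p\<in>natseg a b. prime p}"

lemma finite_natseg [simp]: "finite (natseg a b)"
proof -
 have "natseg a b \<subseteq> {..nat \<lceil>b\<rceil>}" unfolding natseg_def by (auto simp: le_nat_iff) linarith
 thus ?thesis using finite_subset by blast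
qed

lemma natseg_0: "natseg 0 b = {1..nat \<lfloor>b\<rfloor>}"
 unfolding natseg_def by (auto simp: nat_le_iff le_nat_iff le_floor_iff Suc_le_eq) linarith

lemma natseg_0_nat: "natseg 0 (real n) = {1..n}"
 by (simp add: natseg_0)

text \<open>Chebyshev's identity: \<open>ln k\<close> is the sum of \<open>mangoldt\<close> over the
  divisors of k, and \<open>n div d\<close> of the numbers up to n are multiples of d.\<close>

lemma ln_fact_conv_mangoldt:
 "ln (fact n) = (\<Sum>d=1..n. mangoldt d * real (n div d))"
proof -
 have "ln (fact n) = (\<Sum>k=1..n. ln (real k))" by (simp add: fact_prod) (subst ln_prod, auto)
 also have "... = (\<Sum>k=1..n. \<Sum>d\<in>{d\<in>{1..n}. d dvd k}. mangoldt d)"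
 proof (rule sum.cong[OF refl])
  fix k assume k: "k \<in> {1..n}"
  have "{d\<in>{1..n}. d dvd k} = {d. d dvd k}" using k by (auto dest: dvd_imp_le dvd_pos_nat simp: Suc_le_eq intro!: Nat.gr0I)
  have "(\<Sum>d | d dvd k. mangoldt d :: real) = ln (real k)" using mangoldt_sum[of k, where 'a = real] k by simp
  with \<open>{d\<in>{1..n}. d dvd k} = {d. d dvd k}\<close> show "ln (real k) = (\<Sum>d\<in>{d\<in>{1..n}. d dvd k}. mangoldt d)" by simp
 qed
 also have "... = (\<Sum>d=1..n. \<Sum>k\<in>{k\<in>{1..n}. d dvd k}. mangoldt d)" by (rule sum.swap_restrict) auto
 also have "... = (\<Sum>d=1..n. mangoldt d * real (n div d))"
 proof (rule sum.cong[OF refl])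
  fix d assume d: "d \<in> {1..n}"
  have "{k\<in>{1..n}. d dvd k} = (%j. d * j) ` {1..n div d}"
  proof (intro equalityI subsetI)
   fix k assume "k \<in> {k\<in>{1..n}. d dvd k}"
   then obtain j where "k = d * j" "1 <= k" "k <= n" by auto
   then have "j <= n div d" "j >= 1" using d by (auto simp: less_eq_div_iff_mult_less_eq mult.commute Suc_le_eq intro: Nat.gr0I)
   with \<open>k = d * j\<close> show "k \<in> (%j. d * j) ` {1..n div d}" by auto
  next
   fix k assume "k \<in> (%j. d * j) ` {1..n div d}"
   then show "k \<in> {k\<in>{1..n}. d dvd k}" using d by (auto simp: less_eq_div_iff_mult_less_eq mult.commute Suc_le_eq)
  qed
  moreover have "inj_on (%j. d * j) {1..n div d}" using d by (auto simp: inj_on_def)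
  ultimately have "card {k\<in>{1..n}. d dvd k} = n div d" by (simp add: card_image)
  then show "(\<Sum>k\<in>{k\<in>{1..n}. d dvd k}. mangoldt d) = mangoldt d * real (n div d)" by simp
 qed
 finally show ?thesis .
qed

lemma ln_fact_le: "ln (fact n) <= real n * ln (real n)"
proof (cases "n = 0")
 case False
 have "fact n <= real n ^ n" using fact_le_power[of n] by simp
 then have "ln (fact n) <= ln (real n ^ n)" using False by (subst ln_le_cancel_iff) auto
 then show ?thesis using False by (simp add: ln_realpow)
qed auto

lemma ln_fact_ge: "n >= 1 ==> ln (fact n) >= real n * ln (real n) - real n"
proof (induction n rule: dec_induct)
 case (step n)
 have "ln (1 + 1 / real n) <= 1 / real n" using step by (intro ln_add_one_self_le_self) auto
 moreover have "1 + 1 / real n = real (Suc n) / real n" using step by (simp add: field_simps)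
 ultimately have "ln (real (Suc n)) - ln (real n) <= 1 / real n" using step by (simp add: ln_div)
 then have "real n * (ln (real (Suc n)) - ln (real n)) <= 1" using step by (simp add: field_simps)
 moreover have "ln (fact (Suc n)) = ln (real (Suc n)) + ln (fact n)" using ln_mult[of "real (Suc n)" "fact n"] by (simp only: fact_Suc of_nat_fact) simp
 ultimately show ?case using step.IH by (simp add: algebra_simps)
qed auto

text \<open>Chebyshev's comparison of \<open>fact n\<close> with the square of
  \<open>fact (n div 2)\<close>: with m = n div 2, the coefficient
  \<open>n div d - 2 * (m div d)\<close> is never negative and is at least 1 for m < d <= n. Odd n
  are included at the price of a second factor \<open>2 ^ n\<close>, hence
  \<open>ln 4\<close>.\<close>

lemma psi_half: "(\<Sum>d=1..n. mangoldt d) <= (\<Sum>d=1..n div 2. mangoldt d) + real n * ln 4"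
proof -
 define m where "m = n div 2"
 have "(\<Sum>d\<in>{m<..n}. mangoldt d :: real) <= (\<Sum>d=1..n. mangoldt d * (real (n div d) - 2 * real (m div d)))"
 proof -
  have "(\<Sum>d\<in>{m<..n}. mangoldt d) <= (\<Sum>d\<in>{m<..n}. mangoldt d * (real (n div d) - 2 * real (m div d)))"
  proof (rule sum_mono)
   fix d assume d: "d \<in> {m<..n}"
   then have "m div d = 0" "n div d >= 1" by (auto simp: Suc_le_eq div_greater_zero_iff)
   then show "(mangoldt d :: real) <= mangoldt d * (real (n div d) - 2 * real (m div d))" using mangoldt_nonneg[of d] by (simp add: mult_le_cancel_left1)
  qed
  also have "... <= (\<Sum>d=1..n. mangoldt d * (real (n div d) - 2 * real (m div d)))"
  proof (rule sum_mono2)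
   fix d assume "d \<in> {1..n} - {m<..n}"
   have "2 * (m div d) <= n div d" unfolding m_def by (metis div_le_mono div_mult2_eq mult.commute mult_le_mono1
      div_times_less_eq_dividend)
   then have "2 * real (m div d) <= real (n div d)" by (metis of_nat_le_iff of_nat_mult of_nat_numeral)
   then show "0 <= (mangoldt d :: real) * (real (n div d) - 2 * real (m div d))" by (intro mult_nonneg_nonneg mangoldt_nonneg) auto
  qed auto
  finally show ?thesis .
 qed
 also have "... = ln (fact n) - 2 * (\<Sum>d=1..n. mangoldt d * real (m div d))" unfolding ln_fact_conv_mangoldt sum_distrib_left by (simp add: sum_subtractf [symmetric] algebra_simps)
 also have "(\<Sum>d=1..n. mangoldt d * real (m div d)) = (\<Sum>d=1..m. mangoldt d * real (m div d))" by (rule sum.mono_neutral_right) (auto simp: m_def)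
 also have "... = ln (fact m)" by (rule ln_fact_conv_mangoldt [symmetric])
 also have "ln (fact n) - 2 * ln (fact m) <= real n * ln 4"
 proof -
  have "fact n = (fact m * fact (n - m) * (n choose m) :: nat)" using binomial_fact_lemma[of m n] by (simp add: m_def)
  moreover have "fact (n - m) <= (fact m * 2 ^ n :: nat)"
  proof (cases "even n")
   case True then show ?thesis by (auto simp: m_def elim!: evenE)
  next
   case False
   then have "n - m = Suc m" by (auto simp: m_def elim!: oddE)
   moreover have "Suc m <= 2 ^ n" using less_exp[of n] False by (metis Suc_leI m_def div_less_dividend dvd_0_right le_less_trans less_imp_le not_gr_zero one_less_numeral_iff semiring_norm(76))
   ultimately have "fact (n - m) = fact m * Suc m" "Suc m <= 2 ^ n" by (auto simp: algebra_simps)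
   then show ?thesis by (metis mult_le_mono2)
  qed
  moreover have "n choose m <= 2 ^ n" by (rule binomial_le_pow2)
  ultimately have "fact n <= (fact m * (fact m * 2 ^ n) * 2 ^ n :: nat)" by (simp add: mult_le_mono)
  also have "... = (fact m)^2 * 4 ^ n" by (simp add: power2_eq_square power_mult_distrib [symmetric] algebra_simps)
  finally have "real (fact n) <= real ((fact m)^2 * 4 ^ n)" by (rule of_nat_mono)
  then have "ln (fact n) <= ln ((fact m)^2 * 4 ^ n :: real)" by (subst ln_le_cancel_iff) auto
  also have "... = 2 * ln (fact m) + real n * ln 4" by (simp add: ln_mult ln_realpow)
  finally show ?thesis by simp
 qed
 finally have "(\<Sum>d\<in>{m<..n}. mangoldt d :: real) <= real n * ln 4" .
 moreover have "{1..n} = {1..m} \<union> {m<..n}" by (auto simp: m_def)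
 then have "(\<Sum>d=1..n. mangoldt d :: real) = (\<Sum>d=1..m. mangoldt d) + (\<Sum>d\<in>{m<..n}. mangoldt d)" by (simp add: sum.union_disjoint ivl_disj_int)
 ultimately show ?thesis by (simp add: m_def)
qed

text \<open>Iterated halving: since \<open>ln 4 <= 3/2\<close>, the bound 3n reproduces
  itself.\<close>

lemma psi_le: "(\<Sum>d=1..n. mangoldt d) <= 3 * real n"
proof (induction n rule: less_induct)
 case (less n)
 have ln4: "ln 4 <= (3/2::real)"
 proof -
  have "ln 4 = 2 * ln (2::real)" using ln_realpow[of 2 2] by simp
  then show ?thesis using ln2_le_25_over_36 by simp
 qed
 show ?case
 proof (cases "n = 0")
  case False
  have "(\<Sum>d=1..n. mangoldt d) <= (\<Sum>d=1..n div 2. mangoldt d) + real n * ln 4" by (rule psi_half)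
  also have "... <= 3 * real (n div 2) + real n * (3/2)" using less[of "n div 2"] False ln4 by (intro add_mono mult_left_mono) auto
  also have "... <= 3 * real n" by linarith
  finally show ?thesis .
 qed auto
qed

text \<open>Replacing \<open>n div d\<close> by n / d in Chebyshev's identity costs at most the sum
  bounded in \<open>psi_le\<close>, which is of the order of the error n in
  \<open>ln (fact n) = n ln n + O(n)\<close>.\<close>

lemma mertens_nat:
 assumes "n >= 1"
 shows "\<bar>(\<Sum>d=1..n. mangoldt d / real d) - ln (real n)\<bar> <= 3"
proof -
 let ?S = "\<Sum>d=1..n. mangoldt d / real d"
 have "real n * ?S - (\<Sum>d=1..n. mangoldt d) <= ln (fact n)" unfolding ln_fact_conv_mangoldt sum_distrib_left sum_subtractf [symmetric]
 proof (rule sum_mono)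
  fix d assume "d \<in> {1..n}"
  have "real n / real d - 1 <= real (n div d)" using floor_divide_of_nat_eq[of n d, where 'a=real] by linarith
  then have "mangoldt d * (real n / real d - 1) <= mangoldt d * real (n div d)" by (intro mult_left_mono mangoldt_nonneg)
  then show "real n * (mangoldt d / real d) - mangoldt d <= mangoldt d * real (n div d)" by (simp add: algebra_simps)
 qed
 then have "real n * ?S <= real n * ln (real n) + real n * 3" using psi_le[of n] ln_fact_le[of n] by simp
 then have "real n * ?S <= real n * (ln (real n) + 3)" by (simp add: algebra_simps)
 then have 1: "?S <= ln (real n) + 3" using assms by (subst (asm) mult_le_cancel_left_pos) auto
 have "ln (fact n) <= real n * ?S" unfolding ln_fact_conv_mangoldt sum_distrib_left
 proof (rule sum_mono)
  fix d assume "d \<in> {1..n}"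
  have "real (n div d) <= real n / real d" using floor_divide_of_nat_eq[of n d, where 'a=real] by linarith
  then have "mangoldt d * real (n div d) <= mangoldt d * (real n / real d)" by (intro mult_left_mono mangoldt_nonneg)
  then show "mangoldt d * real (n div d) <= real n * (mangoldt d / real d)" by (simp add: algebra_simps)
 qed
 then have "real n * (ln (real n) - 1) <= real n * ?S" using ln_fact_ge[OF assms] by (simp add: algebra_simps)
 then have "ln (real n) - 1 <= ?S" using assms by (subst (asm) mult_le_cancel_left_pos) auto
 with 1 show ?thesis by linarith
qed

lemma mertens:
 assumes "T >= 1"
 shows "\<bar>(\<Sum>d\<in>natseg 0 T. mangoldt d / real d) - ln T\<bar> <= 4"
proof -
 define n where "n = nat \<lfloor>T\<rfloor>"
 have "1 <= \<lfloor>T\<rfloor>" using assms by simp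
 then have "n > 0" unfolding n_def zero_less_nat_eq by linarith
 then have n: "n > 0" "real n = of_int \<lfloor>T\<rfloor>" using \<open>1 <= \<lfloor>T\<rfloor>\<close> by (auto simp: n_def)
 then have n: "n > 0" "real n <= T" "T <= 2 * real n" using floor_correct[of T] by linarith+
 have "ln (real n) <= ln T" using n by simp
 moreover have "ln T <= ln (2 * real n)" using n assms by (subst ln_le_cancel_iff) auto
 moreover have "ln (2 * real n) = ln 2 + ln (real n)" using n by (simp add: ln_mult)
 moreover have "ln (2::real) <= 1" using ln_2_less_1 by simp
 moreover have "\<bar>(\<Sum>d\<in>natseg 0 T. mangoldt d / real d) - ln (real n)\<bar> <= 3" using mertens_nat[of n] n unfolding natseg_0 n_def [symmetric] by simp
 ultimately show ?thesis by linarith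
qed

text \<open>Only proper prime powers contribute. The series still converges with the exponent 3/4 in
  place of 1; the spare quarter power becomes a saving \<open>exp (- (x / 8))\<close> when the terms
  exceed \<open>exp (x / 2)\<close>, as in \<open>good_modulus\<close>.\<close>

abbreviation prime_power_sum where
 "prime_power_sum D \<equiv> (\<Sum>d\<in>{d\<in>D. \<not> prime d}. mangoldt d / real d powr (3/4))"

lemma prime_power_sum_bounded:
 "\<exists>C\<ge>0. \<forall>D. finite D --> prime_power_sum D <= C"
proof -
 have sm: "summable (%n. real n powr (-(5/4)))" by (subst summable_real_powr_iff) auto
 define S where "S = (\<Sum>n. real n powr (-(5/4)))"
 define C where "C = 12 * S"
 have "S >= 0" unfolding S_def by (intro suminf_nonneg sm) auto
 have "prime_power_sum D <= C" if D: "finite D" for D :: "nat set"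
 proof -
  define E where "E = {d\<in>D. \<not> prime d & primepow d}"
  have fE: "finite E" using D by (simp add: E_def)
  define N where "N = Suc (Max (insert 1 E))"
  define g where "g = (%(p::nat,k::nat). p ^ k)"
  define P where "P = {p. prime p & p < N} \<times> {2..<N}"
  have bd: "d < N" if "d \<in> E" for d using that fE by (simp add: N_def less_Suc_eq_le)
  have sub: "E \<subseteq> g ` P"
  proof
   fix d assume d: "d \<in> E"
   then obtain p k where pk: "prime p" "k > 0" "d = p ^ k" unfolding E_def primepow_def by auto
   with d have "k ~= 1" by (auto simp: E_def)
   with pk have "k >= 2" by linarith
   have "p <= p ^ k" using pk by (intro self_le_power prime_ge_1_nat)
   moreover have "k < p ^ k" using pk less_exp[of k] prime_ge_2_nat[of p] by (meson le_less_trans less_imp_le less_le_trans power_mono zero_le)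
   ultimately have "(p,k) \<in> P" using pk \<open>k >= 2\<close> bd[OF d] by (auto simp: P_def)
   then show "d \<in> g ` P" using pk by (force simp: g_def)
  qed
  have "prime_power_sum D = (\<Sum>d\<in>E. mangoldt d / real d powr (3/4))" by (rule sum.mono_neutral_right) (use D in \<open>auto simp: E_def mangoldt_def\<close>)
  also have "... <= (\<Sum>d\<in>g ` P. mangoldt d / real d powr (3/4))" by (intro sum_mono2 sub) (auto simp: P_def mangoldt_nonneg)
  also have "... <= (\<Sum>x\<in>P. mangoldt (g x) / real (g x) powr (3/4))" by (intro sum_image_le[where f=g and g="%d. mangoldt d / real d powr (3/4)", unfolded o_def]) (auto simp: P_def mangoldt_nonneg)
  also have "... = (\<Sum>p | prime p & p < N. \<Sum>k=2..<N. mangoldt (p^k) / real (p^k) powr (3/4))" unfolding P_def g_def by (subst sum.cartesian_product) (auto simp: case_prod_unfold)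
  \<comment> \<open>With q = p powr (-3/4) <= 3/5 the geometric sum from k = 2 on is at most 3 q^2;
    together with ln p <= 4 p powr (1/4) this gives 12 p powr (-5/4).\<close>
  also have "... <= (\<Sum>p | prime p & p < N. 12 * real p powr (-(5/4)))"
  proof (rule sum_mono)
   fix p assume "p \<in> {p. prime p & p < N}"
   then have p: "prime p" "p >= 2" using prime_ge_2_nat by auto
   define q where "q = real p powr (-(3/4))"
   have q0: "q > 0" using p by (simp add: q_def)
   have "q <= 2 powr (-(3/4))" unfolding q_def using p by (intro powr_mono2') auto
   also have "... <= 3/5"
   proof -
    have "(2 powr (-(3/4))) ^ 4 = (2::real) powr (-3)" by (subst powr_realpow[symmetric]) (auto simp: powr_powr)
    also have "... = 1/8" by (simp add: powr_minus powr_numeral)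
    also have "... <= (3/5)^4" by (simp add: power_divide)
    finally have le: "(2 powr (-(3/4))) ^ 4 <= (3/5::real) ^ 4" .
    show ?thesis
    proof (rule ccontr)
     assume "\<not> ?thesis"
     then have "(3/5::real) ^ 4 < (2 powr (-(3/4))) ^ 4" by (intro power_strict_mono) linarith+
     with le show False by linarith
    qed
   qed
   finally have q: "q <= 3/5" .
   have "(\<Sum>k=2..<N. mangoldt (p^k) / real (p^k) powr (3/4)) = (\<Sum>k=2..<N. ln (real p) * q ^ k)"
   proof (rule sum.cong[OF refl])
    fix k assume "k \<in> {2..<N}"
    then have k: "k > 0" by auto
    have "real (p^k) powr (3/4) = (real p powr (3/4)) ^ k"
    proof -
     have "real (p^k) = real p powr real k" using p by (simp add: powr_realpow)
     moreover have "(real p powr (3/4)) ^ k = (real p powr (3/4)) powr real k" using p by (subst powr_realpow) auto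
     ultimately show ?thesis by (simp only: powr_powr mult.commute)
    qed
    moreover have "q = 1 / real p powr (3/4)" unfolding q_def by (rule powr_minus_divide)
    ultimately show "mangoldt (p^k) / real (p^k) powr (3/4) = ln (real p) * q ^ k" using p k by (simp add: power_divide)
   qed
   also have "... = ln (real p) * (\<Sum>k=2..<N. q ^ k)" by (simp add: sum_distrib_left)
   also have "(\<Sum>k=2..<N. q ^ k) <= 3 * q ^ 2"
   proof -
    have "(\<Sum>k=2..<N. q ^ k) <= (\<Sum>k=2..<N+2. q ^ k)" using q0 by (intro sum_mono2) auto
    also have "... = (\<Sum>k<N. q ^ (k + 2))" by (rule sum.reindex_bij_witness[of _ "%k. k + 2" "%k. k - 2"])
       (auto simp del: add_2_eq_Suc add_2_eq_Suc' power_Suc)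
    also have "... = q^2 * (\<Sum>k<N. q ^ k)" by (simp add: sum_distrib_left power2_eq_square mult.assoc)
    also have "(\<Sum>k<N. q ^ k) = (1 - q ^ N) / (1 - q)" using q by (subst sum_gp_strict) auto
    also have "... <= 1 / (1 - q)" using q q0 by (intro divide_right_mono) auto
    also have "... <= 3" using q by (simp add: field_simps)
    finally show ?thesis using q0 by (simp add: mult.commute)
   qed
   also have "ln (real p) * (3 * q^2) <= (4 * real p powr (1/4)) * (3 * q^2)"
   proof -
    have "ln (real p) = 4 * ln (real p powr (1/4))" using p by (simp add: ln_powr)
    also have "ln (real p powr (1/4)) <= real p powr (1/4)" using p by (intro ln_bound) auto
    finally show ?thesis using q0 by (intro mult_right_mono) auto
   qed
   also have "... = 12 * real p powr (-(5/4))" unfolding q_def power2_eq_square powr_add[symmetric] using p by (simp flip: powr_add)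
   finally show "(\<Sum>k=2..<N. mangoldt (p^k) / real (p^k) powr (3/4)) <= 12 * real p powr (-(5/4))" using p by (simp add: mult_left_mono)
  qed
  also have "... = 12 * (\<Sum>p | prime p & p < N. real p powr (-(5/4)))" by (simp add: sum_distrib_left)
  also have "(\<Sum>p | prime p & p < N. real p powr (-(5/4))) <= S" unfolding S_def by (intro sum_le_suminf sm) auto
  finally show ?thesis by (simp add: C_def)
 qed
 moreover have "C >= 0" using \<open>S >= 0\<close> by (simp add: C_def)
 ultimately show ?thesis by blast
qed

abbreviation log_sum where
 "log_sum T \<equiv> (\<Sum>p\<in>primes_in 0 T. ln (real p) / real p)"

lemma mertens_primes:
 "\<exists>C>0. \<forall>T\<ge>1. \<bar>log_sum T - ln T\<bar> <= C"
proof -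
 obtain C where C: "C >= 0" "\<And>D. finite D ==> prime_power_sum D <= C" using prime_power_sum_bounded by blast
 have "\<bar>log_sum T - ln T\<bar> <= C + 4" if T: "T >= 1" for T
 proof -
  have "(\<Sum>d\<in>natseg 0 T. mangoldt d / real d) =
    (\<Sum>d\<in>primes_in 0 T. mangoldt d / real d) + (\<Sum>d\<in>{p\<in>natseg 0 T. \<not> prime p}. mangoldt d / real d)" by (subst sum.union_disjoint[symmetric]) (auto intro!: sum.cong)
  moreover have "(\<Sum>d\<in>primes_in 0 T. mangoldt d / real d) = log_sum T" by (intro sum.cong) auto
  moreover have "(\<Sum>d\<in>{p\<in>natseg 0 T. \<not> prime p}. mangoldt d / real d) <= (\<Sum>d\<in>{p\<in>natseg 0 T. \<not> prime p}. mangoldt d / real d powr (3/4))"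
  proof (intro sum_mono frac_le mangoldt_nonneg order.refl)
   fix d assume "d \<in> {p\<in>natseg 0 T. \<not> prime p}"
   then have "real d >= 1" by (auto simp: natseg_def)
   then have "real d powr (3/4) <= real d powr 1" by (intro powr_mono) auto
   then show "real d powr (3/4) <= real d" "0 < real d powr (3/4)" using \<open>real d >= 1\<close> by auto
  qed
  moreover have "(\<Sum>d\<in>{p\<in>natseg 0 T. \<not> prime p}. mangoldt d / real d) >= 0" by (intro sum_nonneg) (auto simp: mangoldt_nonneg)
  moreover have "(\<Sum>d\<in>{p\<in>natseg 0 T. \<not> prime p}. mangoldt d / real d powr (3/4)) <= C" by (intro C) auto
  ultimately show ?thesis using mertens[OF T] by linarith
 qed
 then show ?thesis using C(1) by (intro exI[of _ "C+4"]) auto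
qed

text \<open>Partial summation carried out as an induction: once \<open>E n / ln n\<close> is
  removed, the increments of D are bounded by those of the telescoping expression
  \<open>(C + 1) * (1 / ln 2 - 1 / ln n)\<close>.\<close>

lemma sum_inverse_primes_nat:
 "\<exists>C>0. \<forall>n\<ge>2. \<bar>(\<Sum>p\<in>{p\<in>{1..n}. prime p}. 1 / real p) - ln (ln (real n))\<bar> <= C"
proof -
 obtain C where C: "C > 0" "\<And>T. T >= 1 ==> \<bar>log_sum T - ln T\<bar> <= C" using mertens_primes by blast
 define E where "E = (%n::nat. (\<Sum>p\<in>{p\<in>{1..n}. prime p}. ln (real p) / real p) - ln (real n))"
 define S where "S = (%n::nat. (\<Sum>p\<in>{p\<in>{1..n}. prime p}. 1 / real p))"
 define D where "D = (%n::nat. S n - ln (ln (real n)) - E n / ln (real n))"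
 have E: "\<bar>E n\<bar> <= C" if "n >= 1" for n using C(2)[of "real n"] that by (simp add: E_def natseg_0_nat)
 have key: "\<bar>D n - D 2\<bar> <= (C + 1) * (1 / ln 2 - 1 / ln (real n))" if "n >= 2" for n using that
 proof (induction n rule: dec_induct)
  case (step n)
  define A B where "A = ln (real n)" and "B = ln (real (Suc n))"
  define i where "i = (if prime (Suc n) then 1 else 0 :: real)"
  have set: "{p\<in>{1..Suc n}. prime p} = (if prime (Suc n) then insert (Suc n) {p\<in>{1..n}. prime p} else {p\<in>{1..n}. prime p})" by (auto simp: le_Suc_eq)
  have ES: "E (Suc n) = E n + i * B / real (Suc n) - (B - A)" unfolding E_def set by (auto simp: i_def A_def B_def)
  have SS: "S (Suc n) = S n + i / real (Suc n)" unfolding S_def set by (auto simp: i_def)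
  have A: "A > 0" "A < B" using step by (auto simp: A_def B_def)
  have "ln (1 + 1 / real n) <= 1 / real n" using step by (intro ln_add_one_self_le_self) auto
  moreover have "1 + 1 / real n = real (Suc n) / real n" using step by (simp add: field_simps)
  ultimately have "B - A <= 1 / real n" using step unfolding A_def B_def by (simp add: ln_div)
  also have "... <= 1" using step by simp
  finally have BA: "B - A <= 1" .
  have "D (Suc n) - D n = i / real (Suc n) - (ln B - ln A) - E (Suc n) / B + E n / A" unfolding D_def SS by (simp add: A_def B_def)
  also have "... = (B - A) / B - (ln B - ln A) + E n * (1 / A - 1 / B)"
  proof -
   have *: "i / m - L - (e + i * B / m - (B - A)) / B + e / A = (B - A) / B - L + e * (1 / A - 1 / B)"
    if "m > 0" for m L e :: real
   proof -
    have "i * B / m / B = i / m" using A that by simp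
    then have "(e + i * B / m - (B - A)) / B = e / B + i / m - (B - A) / B" unfolding add_divide_distrib diff_divide_distrib by linarith
    moreover have "e * (1 / A - 1 / B) = e / A - e / B" by (simp add: right_diff_distrib)
    ultimately show ?thesis by linarith
   qed
   show ?thesis unfolding ES by (rule *) auto
  qed
  finally have DD: "D (Suc n) - D n = (B - A) / B - (ln B - ln A) + E n * (1 / A - 1 / B)" .
  have AB: "1 / A - 1 / B = (B - A) / (A * B)" using A by (simp add: field_simps)
  have l1: "ln B - ln A <= (B - A) / A"
  proof -
   have "ln B - ln A = ln (B / A)" using A by (simp add: ln_div)
   also have "... <= B / A - 1" using A by (intro ln_le_minus_one) auto
   finally show ?thesis using A by (simp add: diff_divide_distrib)
  qed
  have l2: "ln B - ln A >= (B - A) / B"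
  proof -
   have "ln A - ln B = ln (A / B)" using A by (simp add: ln_div)
   also have "... <= A / B - 1" using A by (intro ln_le_minus_one) auto
   finally show ?thesis using A by (simp add: diff_divide_distrib)
  qed
  have "(B - A) / A - (B - A) / B = (B - A) * (1 / A - 1 / B)" by (simp add: algebra_simps)
  also have "... <= 1 * (1 / A - 1 / B)" using A BA AB by (intro mult_right_mono) auto
  finally have l3: "(B - A) / A - (B - A) / B <= 1 / A - 1 / B" by simp
  have "\<bar>v - X\<bar> <= w" if "X <= u" "X >= v" "u - v <= w" for u v w X :: real using that by linarith
  from this[OF l1 l2 l3] have "\<bar>(B - A) / B - (ln B - ln A)\<bar> <= 1 / A - 1 / B" .
  moreover have "\<bar>E n * (1 / A - 1 / B)\<bar> <= C * (1 / A - 1 / B)" unfolding abs_mult using E[of n] step AB A by (intro mult_mono) auto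
  ultimately have "\<bar>D (Suc n) - D n\<bar> <= (1 / A - 1 / B) + C * (1 / A - 1 / B)" unfolding DD by (intro order.trans[OF abs_triangle_ineq] add_mono)
  also have "... = (C + 1) * (1 / A - 1 / B)" by (simp add: distrib_right)
  finally have "\<bar>D (Suc n) - D n\<bar> <= (C + 1) * (1 / A - 1 / B)" .
  moreover have "\<bar>D n - D 2\<bar> <= (C + 1) * (1 / ln 2 - 1 / A)" using step.IH by (simp add: A_def)
  moreover have "(C + 1) * (1 / ln 2 - 1 / A) + (C + 1) * (1 / A - 1 / B) = (C + 1) * (1 / ln 2 - 1 / B)" by (simp add: algebra_simps)
  ultimately show ?case unfolding B_def by linarith
 qed auto
 have "\<bar>S n - ln (ln (real n))\<bar> <= \<bar>D 2\<bar> + (C + 1) / ln 2 + C / ln 2" if n: "n >= 2" for n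
 proof -
  have "ln 2 <= ln (real n)" using n by simp
  have "\<bar>E n / ln (real n)\<bar> <= C / ln 2" unfolding abs_divide using E[of n] n C by (intro frac_le) auto
  moreover have "(C + 1) * (1 / ln 2 - 1 / ln (real n)) <= (C + 1) / ln 2" using C n by (simp add: right_diff_distrib)
  moreover have "S n - ln (ln (real n)) = D n + E n / ln (real n)" by (simp add: D_def)
  ultimately show ?thesis using key[OF n] by linarith
 qed
 moreover have "\<bar>D 2\<bar> + (C + 1) / ln 2 + C / ln 2 > 0" using C by (intro add_nonneg_pos) auto
 ultimately show ?thesis unfolding S_def by blast
qed

abbreviation reciprocal_sum where
 "reciprocal_sum T \<equiv> (\<Sum>p\<in>primes_in 0 T. 1 / real p)"

lemma sum_inverse_primes:
 "\<exists>C>0. \<forall>T\<ge>2. \<bar>reciprocal_sum T - ln (ln T)\<bar> <= C"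
proof -
 obtain C where C: "C > 0" "\<And>n. n >= 2 ==> \<bar>(\<Sum>p\<in>{p\<in>{1..n}. prime p}. 1 / real p) - ln (ln (real n))\<bar> <= C" using sum_inverse_primes_nat by blast
 have "\<bar>reciprocal_sum T - ln (ln T)\<bar> <= C + 1" if T: "T >= 2" for T
 proof -
  define n where "n = nat \<lfloor>T\<rfloor>"
  have "2 <= \<lfloor>T\<rfloor>" using T by simp
  then have "n >= 2" "real n = of_int \<lfloor>T\<rfloor>" unfolding n_def zero_less_nat_eq by linarith+
  then have n: "n >= 2" "real n <= T" "T <= 2 * real n" using floor_correct[of T] by linarith+
  have l: "ln (real n) > 0" "ln (real n) >= ln 2" "ln (real n) <= ln T" using n by auto
  have "ln T <= ln (2 * real n)" using n T by (subst ln_le_cancel_iff) auto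
  also have "... = ln 2 + ln (real n)" using n by (simp add: ln_mult)
  also have "... <= 2 * ln (real n)" using l by simp
  finally have "ln (ln T) <= ln (2 * ln (real n))" using l by (subst ln_le_cancel_iff) auto
  also have "... = ln 2 + ln (ln (real n))" using l by (simp add: ln_mult)
  also have "... <= 1 + ln (ln (real n))" using ln_2_less_1 by simp
  finally have "ln (ln T) <= 1 + ln (ln (real n))" .
  moreover have "ln (ln (real n)) <= ln (ln T)" using l by (subst ln_le_cancel_iff) auto
  moreover have "\<bar>reciprocal_sum T - ln (ln (real n))\<bar> <= C" using C(2)[of n] n unfolding natseg_0 n_def [symmetric] by simp
  ultimately show ?thesis by linarith
 qed
 then show ?thesis using C(1) by (intro exI[of _ "C+1"]) auto
qed

definition mertens_prod :: "real => real" where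
 "mertens_prod T = (\<Prod>p\<in>primes_in 0 T. 1 - 1 / real p)"

lemma mertens_prod_pos: "mertens_prod T > 0"
 unfolding mertens_prod_def by (intro prod_pos) (auto dest: prime_gt_1_nat)

text \<open>The logarithm of a factor is - 1 / p up to a summable square, so the estimate for the
  sum of 1 / p can be exponentiated.\<close>

lemma mertens_prod_bounds:
 "\<exists>c>0. \<exists>C>0. \<forall>T\<ge>2. c / ln T <= mertens_prod T & mertens_prod T <= C / ln T"
proof -
 obtain C where C: "C > 0" "\<And>T. T >= 2 ==> \<bar>reciprocal_sum T - ln (ln T)\<bar> <= C" using sum_inverse_primes by blast
 have sm: "summable (%n. 2 * real n powr (-2))" by (intro summable_mult) (subst summable_real_powr_iff, auto)
 define S where "S = (\<Sum>n. 2 * real n powr (-2))"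
 have S0: "S >= 0" unfolding S_def by (intro suminf_nonneg sm) auto
 have "exp (- C - S) / ln T <= mertens_prod T & mertens_prod T <= exp C / ln T" if T: "T >= 2" for T
 proof -
  let ?P = "primes_in 0 T"
  have lT: "ln T > 0" using T by simp
  have eq: "ln (mertens_prod T) = (\<Sum>p\<in>?P. ln (1 - 1 / real p))" unfolding mertens_prod_def by (intro ln_prod) (auto dest: prime_gt_1_nat)
  have "(\<Sum>p\<in>?P. ln (1 - 1 / real p)) <= (\<Sum>p\<in>?P. - (1 / real p))"
  proof (rule sum_mono)
   fix p assume "p \<in> ?P"
   then have "p > 1" by (auto dest: prime_gt_1_nat)
   then show "ln (1 - 1 / real p) <= - (1 / real p)" using ln_le_minus_one[of "1 - 1 / real p"] by simp
  qed
  then have up: "ln (mertens_prod T) <= C - ln (ln T)" using C(2)[OF T] unfolding eq by (simp add: sum_negf)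
  have "(\<Sum>p\<in>?P. ln (1 - 1 / real p)) >= (\<Sum>p\<in>?P. - (1 / real p) - 2 * real p powr (-2))"
  proof (rule sum_mono)
   fix p assume "p \<in> ?P"
   then have p: "p >= 2" by (auto dest: prime_ge_2_nat)
   have "- (1 / real p) - 2 * (1 / real p)\<^sup>2 <= ln (1 - 1 / real p)" using p by (intro ln_one_minus_pos_lower_bound) auto
   moreover have "real p powr (-2) = (1 / real p)\<^sup>2" using p by (simp add: powr_minus powr_numeral power_one_over divide_inverse power_inverse)
   ultimately show "- (1 / real p) - 2 * real p powr (-2) <= ln (1 - 1 / real p)" by simp
  qed
  moreover have "(\<Sum>p\<in>?P. 2 * real p powr (-2)) <= S" unfolding S_def by (intro sum_le_suminf sm) auto
  ultimately have lo: "ln (mertens_prod T) >= - C - S - ln (ln T)" using C(2)[OF T] unfolding eq by (simp add: sum_negf sum_subtractf)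
  have "mertens_prod T = exp (ln (mertens_prod T))" using mertens_prod_pos by simp
  also have "... <= exp (C - ln (ln T))" using up by simp
  also have "... = exp C / ln T" using lT by (simp add: exp_diff)
  finally have 1: "mertens_prod T <= exp C / ln T" .
  have "exp (- C - S) / ln T = exp (- C - S - ln (ln T))" using lT by (simp add: exp_diff)
  also have "... <= exp (ln (mertens_prod T))" using lo by simp
  also have "... = mertens_prod T" using mertens_prod_pos by simp
  finally show ?thesis using 1 by simp
 qed
 then show ?thesis by (intro exI[of _ "exp (-C-S)"] conjI exI[of _ "exp C"]) auto
qed

section \<open>Sieves\<close>

lemma prod_primes_pos: "(\<And>p. p \<in> A ==> prime p) ==> \<Prod>A > (0::nat)"
 by (intro prod_pos) (auto dest: prime_gt_0_nat)

lemma prod_primes_coprime: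
 assumes "finite A" "\<And>p. p \<in> A ==> prime p" "prime q" "q \<notin> A"
 shows "coprime q (\<Prod>A :: nat)" using assms by (intro prod_coprime_right) (metis primes_coprime)

lemma prime_dvd_prod_primes:
 assumes "finite A" "\<And>p. p \<in> A ==> prime p" "prime (q::nat)" "q dvd \<Prod>A"
 shows "q \<in> A"
proof (rule ccontr)
 assume "q \<notin> A"
 then have "coprime q (\<Prod>A)" using assms by (intro prod_primes_coprime) auto
 with assms show False by (metis coprime_absorb_left not_prime_unit)
qed

lemma inj_on_prod_primes:
 assumes "\<And>A. A \<in> T ==> finite A" "\<And>A p. A \<in> T ==> p \<in> A ==> prime (p::nat)"
 shows "inj_on (%A. \<Prod>A) T"
proof (rule inj_onI)
 have *: "A \<subseteq> B" if "A \<in> T" "B \<in> T" "\<Prod>A = \<Prod>B" for A B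
 proof
  fix p assume p: "p \<in> A"
  then have "p dvd \<Prod>A" using that assms by (intro dvd_prodI) auto
  then show "p \<in> B" using that p assms prime_dvd_prod_primes[of B p] by auto
 qed
 fix A B assume "A \<in> T" "B \<in> T" "\<Prod>A = \<Prod>B"
 then show "A = B" using *[of A B] *[of B A] by auto
qed

lemma card_residue_system:
 assumes "finite A" "\<And>p. p \<in> A ==> prime p" "\<And>p. p \<in> A ==> W p \<subseteq> {..<p::nat}"
 shows "card {r\<in>{..<\<Prod>A}. \<forall>p\<in>A. r mod p \<in> W p} = (\<Prod>p\<in>A. card (W p))" using assms
proof (induction A rule: finite_induct)
 case (insert q A)
 define d where "d = \<Prod>A"
 define R where "R = {r\<in>{..<d}. \<forall>p\<in>A. r mod p \<in> W p}"
 define R' where "R' = {r\<in>{..<q * d}. \<forall>p\<in>insert q A. r mod p \<in> W p}"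
 have q: "prime q" "q > 0" using insert.prems by (auto dest: prime_gt_0_nat)
 have d0: "d > 0" unfolding d_def using insert.prems by (intro prod_primes_pos) auto
 have cop: "coprime q d" unfolding d_def using insert by (intro prod_primes_coprime) auto
 have modmod: "r mod d mod p = r mod p" if "p \<in> A" for r p using that insert.hyps unfolding d_def by (intro mod_mod_cancel dvd_prodI) auto
 have "bij_betw (%r. (r mod q, r mod d)) R' (W q \<times> R)"
 proof (rule bij_betwI')
  fix x y assume xy: "x \<in> R'" "y \<in> R'"
  have "x = y" if "(x mod q, x mod d) = (y mod q, y mod d)"
  proof -
   have "[x = y] (mod q)" "[x = y] (mod d)" using that by (auto simp: Cong.cong_def)
   then have "[x = y] (mod q * d)" using cop by (rule coprime_cong_mult_nat)
   then show ?thesis using xy by (auto simp: R'_def Cong.cong_def)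
  qed
  then show "((x mod q, x mod d) = (y mod q, y mod d)) = (x = y)" by auto
 next
  fix x assume "x \<in> R'"
  then show "(x mod q, x mod d) \<in> W q \<times> R" using d0 by (auto simp: R'_def R_def modmod)
 next
  fix y assume y: "y \<in> W q \<times> R"
  obtain u v where uv: "y = (u, v)" by (cases y)
  have uq: "u < q" using y uv insert.prems by auto
  have vd: "v < d" using y uv by (auto simp: R_def)
  obtain x where x: "x < q * d" "[x = u] (mod q)" "[x = v] (mod d)" using binary_chinese_remainder_unique_nat[OF cop, of u v] q d0 by auto
  have xu: "x mod q = u" and xv: "x mod d = v" using x uq vd by (auto simp: Cong.cong_def)
  have "x mod p \<in> W p" if "p \<in> A" for p using modmod[OF that, of x] xv y uv that by (auto simp: R_def)
  then have "x \<in> R'" using x xu y uv by (auto simp: R'_def)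
  then show "\<exists>x\<in>R'. y = (x mod q, x mod d)" using xu xv uv by auto
 qed
 then have "card R' = card (W q \<times> R)" by (rule bij_betw_same_card)
 also have "... = card (W q) * card R" by (simp add: card_cartesian_product)
 also have "card R = (\<Prod>p\<in>A. card (W p))" unfolding R_def d_def using insert by auto
 finally show ?case using insert.hyps by (simp add: R'_def d_def)
qed auto

lemma card_residue_class_interval:
 assumes "d > 0" "r < d"
 shows "\<bar>real (card {k\<in>{M<..M + K}. k mod d = r}) - real K / real d\<bar> <= (1::real)"
proof (induction K)
 case 0
 have "{k\<in>{M<..M + 0}. k mod d = r} = {}" by auto
 then show ?case by simp
next
 case (Suc K)
 \<comment> \<open>An exact formula: s is the distance from M back to the class r modulo d, so a new
   element is met whenever \<open>L + s\<close> reaches a multiple of d.\<close>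
 have count: "card {k\<in>{M<..M + L}. k mod d = r} = (L + (M + d - r) mod d) div d" for L
 proof (induction L)
  case 0
  then show ?case using assms by simp
 next
  case (Suc L)
  define s where "s = (M + d - r) mod d"
  have eq: "{k\<in>{M<..M + Suc L}. k mod d = r} = (if (M + Suc L) mod d = r then insert (M + Suc L) {k\<in>{M<..M + L}. k mod d = r} else {k\<in>{M<..M + L}. k mod d = r})" by (auto simp: le_Suc_eq)
  have "(M + Suc L) mod d = r \<longleftrightarrow> (Suc L + s) mod d = 0"
  proof -
   have "(M + Suc L) mod d = r \<longleftrightarrow> [M + Suc L = r] (mod d)" using assms by (simp add: Cong.cong_def)
   also have "... \<longleftrightarrow> [M + Suc L + (d - r) = r + (d - r)] (mod d)" by (rule cong_add_rcancel_nat [symmetric])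
   also have "... \<longleftrightarrow> (M + Suc L + (d - r)) mod d = 0" using assms by (simp add: Cong.cong_def)
   also have "M + Suc L + (d - r) = Suc L + (M + d - r)" using assms by simp
   also have "(Suc L + (M + d - r)) mod d = (Suc L + s) mod d" by (simp only: s_def mod_add_right_eq)
   finally show ?thesis .
  qed
  moreover have "(Suc L + s) div d = (L + s) div d + (if (Suc L + s) mod d = 0 then 1 else 0)" using div_Suc[of "L + s" d] by (auto simp: mod_Suc split: if_splits)
  ultimately show ?case using Suc unfolding eq s_def by (auto simp: card_insert_if)
 qed
 define s where "s = (M + d - r) mod d"
 have s: "s < d" using assms by (simp add: s_def)
 define L where "L = Suc K"
 have "real ((L + s) div d) = real_of_int \<lfloor>real (L + s) / real d\<rfloor>" by (simp only: floor_divide_of_nat_eq of_int_of_nat_eq)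
 moreover have "real (L + s) / real d = real L / real d + real s / real d" by (simp add: add_divide_distrib)
 moreover have "0 <= real s / real d" "real s / real d < 1" using s by auto
 ultimately have "\<bar>real ((L + s) div d) - real L / real d\<bar> <= 1" by linarith
 then show ?case unfolding count s_def L_def .
qed

abbreviation hitting where
 "hitting A W M K \<equiv> {k\<in>{M<..M + K}. \<forall>p\<in>A. k mod p \<in>W p}"

lemma card_residues_interval:
 assumes "finite A" "\<And>p. p \<in> A ==> prime p" "\<And>p. p \<in> A ==> W p \<subseteq> {..<p::nat}"
 shows "\<bar>real (card (hitting A W M K)) - real K * (\<Prod>p\<in>A. real (card (W p)) / real p)\<bar>
      <= (\<Prod>p\<in>A. real (card (W p)))"
proof -
 define d where "d = \<Prod>A"
 define R where "R = {r\<in>{..<d}. \<forall>p\<in>A. r mod p \<in> W p}"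
 have d0: "d > 0" unfolding d_def using assms by (intro prod_primes_pos) auto
 have modmod: "r mod d mod p = r mod p" if "p \<in> A" for r p using that assms unfolding d_def by (intro mod_mod_cancel dvd_prodI) auto
 have fR: "finite R" by (simp add: R_def)
 have cR: "real (card R) = (\<Prod>p\<in>A. real (card (W p)))" using card_residue_system[OF assms] by (simp add: R_def d_def)
 have "hitting A W M K = (\<Union>r\<in>R. {k\<in>{M<..M + K}. k mod d = r})" using d0 by (auto simp: R_def modmod)
 also have "card ... = (\<Sum>r\<in>R. card {k\<in>{M<..M + K}. k mod d = r})" using fR by (intro card_UN_disjoint) auto
 finally have "real (card (hitting A W M K)) = (\<Sum>r\<in>R. real (card {k\<in>{M<..M + K}. k mod d = r}))" by simp
 moreover have "real K * (\<Prod>p\<in>A. real (card (W p)) / real p) = (\<Sum>r\<in>R. real K / real d)" by (simp add: prod_dividef cR d_def)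
 ultimately have "\<bar>real (card (hitting A W M K)) - real K * (\<Prod>p\<in>A. real (card (W p)) / real p)\<bar>
   = \<bar>\<Sum>r\<in>R. real (card {k\<in>{M<..M + K}. k mod d = r}) - real K / real d\<bar>" by (simp add: sum_subtractf)
 also have "... <= (\<Sum>r\<in>R. \<bar>real (card {k\<in>{M<..M + K}. k mod d = r}) - real K / real d\<bar>)" by (rule sum_abs)
 also have "... <= (\<Sum>r\<in>R. 1)" using d0 by (intro sum_mono card_residue_class_interval) (auto simp: R_def)
 also have "... = (\<Prod>p\<in>A. real (card (W p)))" using cR by simp
 finally show ?thesis .
qed

section \<open>Selberg's upper bound sieve\<close>

lemma sum_alternating_between:
 assumes "finite F" "E \<subseteq> F"
 shows "(\<Sum>A\<in>{A\<in>Pow F. E \<subseteq> A}. (-1) ^ card A) = (if E = F then (-1) ^ card E else (0::real))"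
proof -
 have fE: "finite E" using assms finite_subset by blast
 have "(\<Sum>A\<in>{A\<in>Pow F. E \<subseteq> A}. (-1) ^ card A) = (\<Sum>B\<in>Pow (F - E). (-1) ^ card E * (-1::real) ^ card B)" by (rule sum.reindex_bij_witness[of _ "%B. B \<union> E" "%A. A - E"])
    (use assms fE in \<open>auto simp: card_Diff_subset card_mono power_add[symmetric] dest: finite_subset\<close>)
 also have "... = (-1) ^ card E * (\<Sum>B\<in>Pow (F - E). (-1) ^ card B)" by (simp add: sum_distrib_left)
 also have "(\<Sum>B\<in>Pow (F - E). (-1::real) ^ card B) = (\<Prod>x\<in>F - E. 1 - 1)" using prod_diff_conv_sum[of "F - E" "%_. 1::real" "%_. 1"] assms by simp
 also have "... = (if E = F then 1 else 0)" using assms by (auto simp: prod_constant power_0_left)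
 finally show ?thesis by simp
qed

text \<open>Selberg's normalising sum. Squarefree divisors are represented by their sets of primes,
  so that the Moebius function becomes \<open>(-1) ^ card A\<close> and divisibility becomes
  inclusion.\<close>

definition sieve_sum :: "nat set => (nat => real) => real => real" where
 "sieve_sum P h D = (\<Sum>A\<in>{A\<in>Pow P. real (\<Prod>A) <= D}. \<Prod>p\<in>A. h p)"

abbreviation avoiding where
 "avoiding P W M K \<equiv> {k\<in>{M<..M + K}. \<forall>p\<in>P. k mod p \<notin> W p}"

text \<open>Selberg's weights turn the quadratic form of the main term into \<open>1 / J\<close>.
  The remainder is kept crude: at most \<open>D^2\<close> pairs of weights, each weight bounded by
  D, and at most \<open>D^2\<close> residue classes for each pair, which makes
  \<open>D ^ 6\<close>.\<close>

lemma selberg_sieve: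
 fixes P :: "nat set" and W :: "nat => nat set" and D :: real
 assumes fin: "finite P" and prime: "\<And>p. p \<in> P ==> prime p" and W: "\<And>p. p \<in> P ==> W p \<subseteq> {..<p}"
  and w0: "\<And>p. p \<in> P ==> card (W p) > 0" and wp: "\<And>p. p \<in> P ==> card (W p) < p" and D: "D >= 1"
 defines "h \<equiv> (%p. real (card (W p)) / (real p - real (card (W p))))"
 shows "real (card (avoiding P W M K)) <= real K / sieve_sum P h D + D ^ 6"
proof -
 define g where "g = (%p. real (card (W p)) / real p)"
 define T where "T = {A\<in>Pow P. real (\<Prod>A) <= D}"
 define J where "J = sieve_sum P h D"
 define V where "V = (%A. \<Sum>E\<in>{E\<in>T. A \<subseteq> E}. \<Prod>p\<in>E. h p)"
 \<comment> \<open>The extremal weights. \<open>V A\<close> sums over supersets of A in T, so that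
   \<open>lam\<close> is supported on T, and dividing by J normalises \<open>lam {}\<close> to
   1.\<close>
 define lam where "lam = (%A. (-1) ^ card A * (V A / J) / (\<Prod>p\<in>A. g p))"
 have fT: "finite T" using fin by (simp add: T_def)
 have fsub: "finite A" if "A \<subseteq> P" for A using that fin finite_subset by blast
 have h0: "h p > 0" and g0: "g p > 0" and hg: "1 / g p = 1 / h p + 1" and g1: "1 / g p <= real p" if "p \<in> P" for p
 proof -
  have "real (card (W p)) >= 1" "real (card (W p)) < real p" using w0[OF that] wp[OF that] by auto
  then show "h p > 0" "g p > 0" "1 / g p = 1 / h p + 1" "1 / g p <= real p" by (auto simp: h_def g_def field_simps)
 qed
 have hP: "(\<Prod>p\<in>A. h p) > 0" and gP: "(\<Prod>p\<in>A. g p) > 0" if "A \<subseteq> P" for A using that h0 g0 by (auto intro!: prod_pos)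
 have eT: "{} \<in> T" using D by (simp add: T_def)
 have J_eq: "J = (\<Sum>E\<in>T. \<Prod>p\<in>E. h p)" by (simp add: J_def sieve_sum_def T_def)
 have hP': "(\<Prod>p\<in>A. h p) >= 0" if "A \<in> T" for A using hP[of A] that by (auto simp: T_def)
 have V0: "V A >= 0" for A unfolding V_def by (intro sum_nonneg hP') auto
 have VJ: "V A <= J" for A unfolding V_def J_eq by (intro sum_mono2 fT hP') auto
 have J0: "J > 0" unfolding J_eq using eT fT hP by (intro sum_pos) (auto simp: T_def)
 have lam0: "lam {} = 1" using J0 by (simp add: lam_def V_def J_eq)
 have prodmono: "\<Prod>A <= \<Prod>E" if "A \<subseteq> E" "E \<subseteq> P" for A E
 proof -
  have "\<Prod>E = \<Prod>A * \<Prod>(E - A)" using that fsub by (metis prod.subset_diff mult.commute)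
  moreover have "\<Prod>(E - A) >= 1" using prod_primes_pos[of "E - A"] that prime by (auto simp: Suc_le_eq)
  ultimately show ?thesis by simp
 qed
 have lam_supp: "A \<in> T" if "A \<subseteq> P" "lam A ~= 0" for A
 proof (rule ccontr)
  assume nA: "A \<notin> T"
  have "{E\<in>T. A \<subseteq> E} = {}"
  proof (rule ccontr)
   assume "{E\<in>T. A \<subseteq> E} ~= {}"
   then obtain E where E: "E \<in> T" "A \<subseteq> E" by auto
   then have "\<Prod>A <= \<Prod>E" by (intro prodmono) (auto simp: T_def)
   then have "real (\<Prod>A) <= real (\<Prod>E)" by (rule of_nat_mono)
   moreover have "real (\<Prod>E) <= D" using E(1) unfolding T_def by blast
   ultimately have "real (\<Prod>A) <= D" by (rule order.trans)
   then have "A \<in> T" using that(1) unfolding T_def by blast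
   then show False using nA by blast
  qed
  then have "V A = 0" unfolding V_def by (metis sum.empty)
  then show False using that by (simp add: lam_def)
 qed
 have lam_bd: "\<bar>lam A\<bar> <= D" if "A \<in> T" for A
 proof -
  have A: "A \<subseteq> P" "real (\<Prod>A) <= D" using that by (auto simp: T_def)
  have "\<bar>lam A\<bar> = (V A / J) * (\<Prod>p\<in>A. 1 / g p)" unfolding lam_def using V0[of A] J0 gP[OF A(1)] by (simp add: abs_mult power_abs prod_dividef)
  also have "... <= 1 * (\<Prod>p\<in>A. 1 / g p)" using VJ[of A] J0 g0 A by (intro mult_right_mono prod_nonneg) (auto intro: less_imp_le)
  also have "(\<Prod>p\<in>A. 1 / g p) <= (\<Prod>p\<in>A. real p)" using g0 g1 A by (intro prod_mono) (auto intro: less_imp_le)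
  finally show ?thesis using A by simp
 qed
 have cT: "real (card T) <= D"
 proof -
  have "inj_on (%A. \<Prod>A) T" using prime fsub by (intro inj_on_prod_primes) (auto simp: T_def)
  then have "card T = card ((%A. \<Prod>A) ` T)" by (simp add: card_image)
  also have "... <= card {1..nat \<lfloor>D\<rfloor>}"
  proof (intro card_mono subsetI)
   fix x assume "x \<in> (%A. \<Prod>A) ` T"
   then obtain A where A: "x = \<Prod>A" "A \<subseteq> P" "real (\<Prod>A) <= D" by (auto simp: T_def)
   moreover have "\<Prod>A > 0" using A prime by (intro prod_primes_pos) auto
   ultimately show "x \<in> {1..nat \<lfloor>D\<rfloor>}" by (auto simp: le_nat_floor)
  qed auto
  also have "... = nat \<lfloor>D\<rfloor>" by simp
  finally show ?thesis using D by linarith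
 qed
 define N where "N = (%A. card (hitting A W M K))"
 define I where "I = {M<..M + K}"
 define bad where "bad = (%k. {p\<in>P. k mod p \<in> W p})"
 have "real (card (avoiding P W M K)) = (\<Sum>k\<in>{k\<in>I. bad k = {}}. 1)" by (auto simp: I_def bad_def intro!: arg_cong[where f=card])
 \<comment> \<open>Where no prime is bad, the squared sum is \<open>(lam {})^2 = 1\<close>;
   elsewhere a square is not negative, so extending the range gives an upper bound.\<close>
 also have "... = (\<Sum>k\<in>{k\<in>I. bad k = {}}. (\<Sum>A\<in>Pow (bad k). lam A)\<^sup>2)" by (rule sum.cong) (auto simp: lam0)
 also have "... <= (\<Sum>k\<in>I. (\<Sum>A\<in>Pow (bad k). lam A)\<^sup>2)" by (intro sum_mono2) (auto simp: I_def)
 also have "... = (\<Sum>k\<in>I. (\<Sum>A\<in>{A\<in>Pow P. A \<subseteq> bad k}. lam A)\<^sup>2)"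
 proof -
  have "Pow (bad k) = {A\<in>Pow P. A \<subseteq> bad k}" for k by (auto simp: bad_def)
  then show ?thesis by simp
 qed
 also have "... = (\<Sum>k\<in>I. (\<Sum>A\<in>{A\<in>T. A \<subseteq> bad k}. lam A)\<^sup>2)"
 proof -
  have "(\<Sum>A\<in>{A\<in>Pow P. A \<subseteq> bad k}. lam A) = (\<Sum>A\<in>{A\<in>T. A \<subseteq> bad k}. lam A)" for k using fin lam_supp by (intro sum.mono_neutral_right) (auto simp: T_def)
  then show ?thesis by simp
 qed
 also have "... = (\<Sum>k\<in>I. \<Sum>A\<in>T. \<Sum>B\<in>T. if A \<union> B \<subseteq> bad k then lam A * lam B else 0)"
 proof (rule sum.cong[OF refl])
  fix k
  have "(\<Sum>A\<in>{A\<in>T. A \<subseteq> bad k}. lam A) = (\<Sum>A\<in>T. if A \<subseteq> bad k then lam A else 0)" using fT by (simp add: sum.inter_filter)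
  then show "(\<Sum>A\<in>{A\<in>T. A \<subseteq> bad k}. lam A)\<^sup>2 = (\<Sum>A\<in>T. \<Sum>B\<in>T. if A \<union> B \<subseteq> bad k then lam A * lam B else 0)" by (auto simp: power2_eq_square sum_product intro!: sum.cong)
 qed
 also have "... = (\<Sum>A\<in>T. \<Sum>B\<in>T. \<Sum>k\<in>I. if A \<union> B \<subseteq> bad k then lam A * lam B else 0)" by (subst sum.swap) (intro sum.cong[OF refl], rule sum.swap)
 also have "... = (\<Sum>A\<in>T. \<Sum>B\<in>T. lam A * lam B * real (N (A \<union> B)))"
 proof (intro sum.cong[OF refl])
  fix A B assume AB: "A \<in> T" "B \<in> T"
  have "(\<Sum>k\<in>I. if A \<union> B \<subseteq> bad k then lam A * lam B else 0) = (\<Sum>k\<in>{k\<in>I. A \<union> B \<subseteq> bad k}. lam A * lam B)" by (subst sum.inter_filter) (auto simp: I_def)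
  also have "{k\<in>I. A \<union> B \<subseteq> bad k} = hitting (A \<union> B) W M K" using AB by (auto simp: I_def bad_def T_def)
  finally show "(\<Sum>k\<in>I. if A \<union> B \<subseteq> bad k then lam A * lam B else 0) = lam A * lam B * real (N (A \<union> B))" by (simp add: N_def)
 qed
 also have "... <= (\<Sum>A\<in>T. \<Sum>B\<in>T. lam A * lam B * (real K * (\<Prod>p\<in>A \<union> B. g p)) + D ^ 4)"
 proof (intro sum_mono)
  fix A B assume AB: "A \<in> T" "B \<in> T"
  then have AB': "A \<subseteq> P" "B \<subseteq> P" "real (\<Prod>A) <= D" "real (\<Prod>B) <= D" by (auto simp: T_def)
  have "\<bar>real (N (A \<union> B)) - real K * (\<Prod>p\<in>A \<union> B. g p)\<bar> <= (\<Prod>p\<in>A \<union> B. real (card (W p)))"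
   unfolding N_def g_def by (intro card_residues_interval) (use AB' fsub prime W in \<open>blast intro: finite_UnI\<close>)+
  also have "... <= (\<Prod>p\<in>A \<union> B. real p)" using AB' wp by (intro prod_mono) (auto intro: less_imp_le)
  also have "... = real (\<Prod>(A \<union> B))" by simp
  also have "... <= real (\<Prod>A * \<Prod>B)"
  proof (rule of_nat_mono)
   have "\<Prod>A * \<Prod>B = \<Prod>(A \<union> B) * \<Prod>(A \<inter> B)" using AB' fsub by (simp add: prod.union_inter)
   moreover have "\<Prod>(A \<inter> B) >= 1" using prod_primes_pos[of "A \<inter> B"] AB' prime by (auto simp: Suc_le_eq)
   ultimately show "\<Prod>(A \<union> B) <= \<Prod>A * \<Prod>B" by simp
  qed
  also have "... <= D * D" using AB' D unfolding of_nat_mult by (intro mult_mono) (auto intro: prod_nonneg)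
  finally have "\<bar>lam A * lam B\<bar> * \<bar>real (N (A \<union> B)) - real K * (\<Prod>p\<in>A \<union> B. g p)\<bar> <= (D * D) * (D * D)"
   unfolding abs_mult using lam_bd[OF AB(1)] lam_bd[OF AB(2)] D by (intro mult_mono) auto
  then have "\<bar>lam A * lam B * (real (N (A \<union> B)) - real K * (\<Prod>p\<in>A \<union> B. g p))\<bar> <= D ^ 4" unfolding abs_mult by (simp add: power4_eq_xxxx mult.assoc)
  moreover have "lam A * lam B * (real (N (A \<union> B)) - real K * (\<Prod>p\<in>A \<union> B. g p)) =
    lam A * lam B * real (N (A \<union> B)) - lam A * lam B * (real K * (\<Prod>p\<in>A \<union> B. g p))" by (rule right_diff_distrib)
  ultimately show "lam A * lam B * real (N (A \<union> B)) <= lam A * lam B * (real K * (\<Prod>p\<in>A \<union> B. g p)) + D ^ 4" by linarith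
 qed
 also have "... = real K * (\<Sum>A\<in>T. \<Sum>B\<in>T. lam A * lam B * (\<Prod>p\<in>A \<union> B. g p)) + real (card T) * real (card T) * D ^ 4" by (simp add: sum.distrib sum_distrib_left algebra_simps)
 also have "(\<Sum>A\<in>T. \<Sum>B\<in>T. lam A * lam B * (\<Prod>p\<in>A \<union> B. g p)) = 1 / J"
 proof -
  \<comment> \<open>These linear forms diagonalise the quadratic form: since
    \<open>1 / g = 1 / h + 1\<close>, the product of 1 / g over the common primes of A and B expands
    over the common subsets E. The weights make \<open>z E\<close> equal to the product of h over E,
    divided by J, up to sign, and 0 outside T.\<close>
  define z where "z = (%E. \<Sum>A\<in>{A\<in>T. E \<subseteq> A}. lam A * (\<Prod>p\<in>A. g p))"
  have union: "(\<Prod>p\<in>A \<union> B. g p) = (\<Prod>p\<in>A. g p) * (\<Prod>p\<in>B. g p) * (\<Sum>E\<in>{E\<in>Pow P. E \<subseteq> A & E \<subseteq> B}. \<Prod>p\<in>E. 1 / h p)"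
   if "A \<in> T" "B \<in> T" for A B
  proof -
   have AB: "A \<subseteq> P" "B \<subseteq> P" "finite A" "finite B" using that fsub by (auto simp: T_def)
   have "(\<Sum>E\<in>{E\<in>Pow P. E \<subseteq> A & E \<subseteq> B}. \<Prod>p\<in>E. 1 / h p) = (\<Sum>E\<in>Pow (A \<inter> B). (\<Prod>p\<in>E. 1 / h p) * (\<Prod>p\<in>A \<inter> B - E. 1))"
    by (rule sum.cong) (use AB in auto)
   also have "... = (\<Prod>p\<in>A \<inter> B. 1 / h p + 1)" using AB by (subst prod_add) auto
   also have "... = (\<Prod>p\<in>A \<inter> B. 1 / g p)" using AB hg by (intro prod.cong) auto
   also have "... = 1 / (\<Prod>p\<in>A \<inter> B. g p)" by (simp add: prod_dividef)
   moreover have "(\<Prod>p\<in>A. g p) * (\<Prod>p\<in>B. g p) = (\<Prod>p\<in>A \<union> B. g p) * (\<Prod>p\<in>A \<inter> B. g p)" using AB by (simp add: prod.union_inter)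
   moreover have "(\<Prod>p\<in>A \<inter> B. g p) > 0" using AB by (intro gP) auto
   ultimately show ?thesis by simp
  qed
  have "(\<Sum>A\<in>T. \<Sum>B\<in>T. lam A * lam B * (\<Prod>p\<in>A \<union> B. g p)) =
   (\<Sum>A\<in>T. \<Sum>B\<in>T. \<Sum>E\<in>Pow P. if E \<subseteq> A & E \<subseteq> B then (lam A * (\<Prod>p\<in>A. g p)) * (lam B * (\<Prod>p\<in>B. g p)) * (\<Prod>p\<in>E. 1 / h p) else 0)"
  proof (intro sum.cong[OF refl])
   fix A B assume AB: "A \<in> T" "B \<in> T"
   show "lam A * lam B * (\<Prod>p\<in>A \<union> B. g p) = (\<Sum>E\<in>Pow P. if E \<subseteq> A & E \<subseteq> B then (lam A * (\<Prod>p\<in>A. g p)) * (lam B * (\<Prod>p\<in>B. g p)) * (\<Prod>p\<in>E. 1 / h p) else 0)"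
    unfolding union[OF AB] using fin by (simp add: sum.inter_filter[symmetric] sum_distrib_left mult_ac)
  qed
  also have "... = (\<Sum>E\<in>Pow P. \<Sum>A\<in>T. \<Sum>B\<in>T. if E \<subseteq> A & E \<subseteq> B then (lam A * (\<Prod>p\<in>A. g p)) * (lam B * (\<Prod>p\<in>B. g p)) * (\<Prod>p\<in>E. 1 / h p) else 0)"
   by (subst (2) sum.swap, subst sum.swap) (rule refl)
  also have "... = (\<Sum>E\<in>Pow P. (\<Prod>p\<in>E. 1 / h p) * (z E)\<^sup>2)"
  proof (intro sum.cong[OF refl])
   fix E
   have zE: "z E = (\<Sum>A\<in>T. if E \<subseteq> A then lam A * (\<Prod>p\<in>A. g p) else 0)" unfolding z_def using fT by (simp add: sum.inter_filter)
   define a where "a = (%A. if E \<subseteq> A then lam A * (\<Prod>p\<in>A. g p) else 0)"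
   have "(\<Prod>p\<in>E. 1 / h p) * (z E)\<^sup>2 = (\<Sum>A\<in>T. \<Sum>B\<in>T. (\<Prod>p\<in>E. 1 / h p) * (a A * a B))" unfolding zE power2_eq_square a_def [symmetric] sum_product by (simp only: sum_distrib_left)
   also have "... = (\<Sum>A\<in>T. \<Sum>B\<in>T. if E \<subseteq> A & E \<subseteq> B then (lam A * (\<Prod>p\<in>A. g p)) * (lam B * (\<Prod>p\<in>B. g p)) * (\<Prod>p\<in>E. 1 / h p) else 0)"
    by (intro sum.cong refl) (simp add: a_def)
   finally show "(\<Sum>A\<in>T. \<Sum>B\<in>T. if E \<subseteq> A & E \<subseteq> B then (lam A * (\<Prod>p\<in>A. g p)) * (lam B * (\<Prod>p\<in>B. g p)) * (\<Prod>p\<in>E. 1 / h p) else 0) = (\<Prod>p\<in>E. 1 / h p) * (z E)\<^sup>2" ..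
  qed
  also have "... = (\<Sum>E\<in>Pow P. if E \<in> T then (\<Prod>p\<in>E. h p) / J\<^sup>2 else 0)"
  proof (intro sum.cong[OF refl])
   fix E assume E: "E \<in> Pow P"
   have "z E = (\<Sum>A\<in>{A\<in>Pow P. E \<subseteq> A}. lam A * (\<Prod>p\<in>A. g p))" unfolding z_def using fin lam_supp by (intro sum.mono_neutral_left) (auto simp: T_def)
   also have "... = (\<Sum>A\<in>{A\<in>Pow P. E \<subseteq> A}. \<Sum>F\<in>{F\<in>T. A \<subseteq> F}. (-1) ^ card A * (\<Prod>p\<in>F. h p) / J)"
   proof (intro sum.cong[OF refl])
    fix A assume "A \<in> {A\<in>Pow P. E \<subseteq> A}"
    then have "(\<Prod>p\<in>A. g p) ~= 0" using gP[of A] by auto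
    then have "lam A * (\<Prod>p\<in>A. g p) = (-1) ^ card A * (V A / J)" by (simp add: lam_def)
    then show "lam A * (\<Prod>p\<in>A. g p) = (\<Sum>F\<in>{F\<in>T. A \<subseteq> F}. (-1) ^ card A * (\<Prod>p\<in>F. h p) / J)" by (simp add: V_def sum_distrib_left sum_divide_distrib)
   qed
   also have "... = (\<Sum>F\<in>T. \<Sum>A\<in>{A. A \<in> {A\<in>Pow P. E \<subseteq> A} & A \<subseteq> F}. (-1) ^ card A * (\<Prod>p\<in>F. h p) / J)" using fT fin by (intro sum.swap_restrict) auto
   also have "... = (\<Sum>F\<in>T. (\<Prod>p\<in>F. h p) / J * (if E = F then (-1) ^ card E else 0))"
   proof (intro sum.cong[OF refl])
    fix F assume F: "F \<in> T"
    have eq: "{A. A \<in> {A\<in>Pow P. E \<subseteq> A} & A \<subseteq> F} = {A\<in>Pow F. E \<subseteq> A}" using F by (auto simp: T_def)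
    have "(\<Sum>A\<in>{A. A \<in> {A\<in>Pow P. E \<subseteq> A} & A \<subseteq> F}. (-1) ^ card A * (\<Prod>p\<in>F. h p) / J) = (\<Prod>p\<in>F. h p) / J * (\<Sum>A\<in>{A\<in>Pow F. E \<subseteq> A}. (-1) ^ card A)"
     unfolding eq by (simp add: sum_distrib_left mult.commute)
    also have "(\<Sum>A\<in>{A\<in>Pow F. E \<subseteq> A}. (-1) ^ card A) = (if E = F then (-1) ^ card E else (0::real))"
    proof (cases "E \<subseteq> F")
     case True
     then show ?thesis using F fsub by (intro sum_alternating_between) (auto simp: T_def)
    next
     case False
     then have "{A\<in>Pow F. E \<subseteq> A} = {}" by auto
     then show ?thesis using False by (metis order.refl sum.empty)
    qed
    finally show "(\<Sum>A\<in>{A. A \<in> {A\<in>Pow P. E \<subseteq> A} & A \<subseteq> F}. (-1) ^ card A * (\<Prod>p\<in>F. h p) / J) = (\<Prod>p\<in>F. h p) / J * (if E = F then (-1) ^ card E else 0)" .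
   qed
   also have "... = (if E \<in> T then (\<Prod>p\<in>E. h p) / J * (-1) ^ card E else 0)" using fT by (auto simp: if_distrib sum.delta' cong: if_cong)
   finally have "z E = (if E \<in> T then (\<Prod>p\<in>E. h p) / J * (-1) ^ card E else 0)" .
   moreover have "(\<Prod>p\<in>E. h p) > 0" using E by (intro hP) auto
   ultimately show "(\<Prod>p\<in>E. 1 / h p) * (z E)\<^sup>2 = (if E \<in> T then (\<Prod>p\<in>E. h p) / J\<^sup>2 else 0)" by (simp add: prod_dividef power_mult_distrib power_divide power2_eq_square)
  qed
  also have "... = (\<Sum>E\<in>{E\<in>Pow P. E \<in> T}. (\<Prod>p\<in>E. h p) / J\<^sup>2)" by (rule sum.inter_filter [symmetric]) (use fin in simp)
  also have "{E\<in>Pow P. E \<in> T} = T" by (auto simp: T_def)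
  also have "(\<Sum>E\<in>T. (\<Prod>p\<in>E. h p) / J\<^sup>2) = J / J\<^sup>2" unfolding J_eq by (simp add: sum_divide_distrib)
  also have "... = 1 / J" using J0 by (simp add: power2_eq_square)
  finally show ?thesis .
 qed
 also have "real K * (1 / J) + real (card T) * real (card T) * D ^ 4 <= real K / J + D * D * D ^ 4" using cT D by (intro add_mono mult_mono) auto
 also have "D * D * D ^ 4 = D ^ 6" by (simp add: eval_nat_numeral)
 finally show ?thesis by (simp add: J_def)
qed

text \<open>Rankin's trick: the sum over products exceeding \<open>D\<close> costs a factor \<open>D powr (- 1 / ln v)\<close>.\<close>

abbreviation sieve_sum_bound where
 "sieve_sum_bound s \<equiv> \<forall>v\<ge>3. \<forall>P w. finite P --> (\<forall>p\<in>P. prime p & 3 <= p & real p <= v & 0 <= w p & w p <= 2) -->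
   sieve_sum P (%p. w p / (real p - w p)) (v powr s) >= (1/2) / (\<Prod>p\<in>P. 1 - w p / real p)"

lemma sieve_sum_lower_bound:
 "\<exists>s>0. sieve_sum_bound s"
proof -
 obtain C where C: "C > 0" "\<And>T. T >= 1 ==> \<bar>log_sum T - ln T\<bar> <= C" using mertens_primes by blast
 \<comment> \<open>The terms beyond D cost at most \<open>exp (4 + 4 * C)\<close> by Mertens and
   gain \<open>exp (- s)\<close>; this s leaves \<open>exp (-1)\<close>, so at least half of the
   full sum survives.\<close>
 define s where "s = 5 + 4 * C"
 have "sieve_sum P (%p. w p / (real p - w p)) (v powr s) >= (1/2) / (\<Prod>p\<in>P. 1 - w p / real p)"
  if v: "v >= 3" and fin: "finite P" and P: "\<And>p. p \<in> P ==> prime p & 3 <= p & real p <= v & 0 <= w p & w p <= 2"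
  for v :: real and P and w :: "nat => real"
 proof -
  define h where "h = (%p. w p / (real p - w p))"
  define e where "e = 1 / ln v"
  define D where "D = v powr s"
  have lv: "ln v >= 1" using v exp_le by (subst ln_ge_iff) auto
  have D0: "D > 0" using v by (simp add: D_def)
  have h0: "h p >= 0" if "p \<in> P" for p using P[OF that] by (auto simp: h_def)
  have hP: "(\<Prod>p\<in>A. h p) >= 0" if "A \<subseteq> P" for A using that h0 by (auto intro!: prod_nonneg)
  have full: "(\<Sum>A\<in>Pow P. \<Prod>p\<in>A. h p) = (\<Prod>p\<in>P. 1 + h p)" using prod_add[OF fin, of h "%_. 1"] by (simp add: add.commute)
  have hw: "1 + h p = 1 / (1 - w p / real p)" if "p \<in> P" for p
  proof -
   have "real p - w p > 0" "real p > 0" using P[OF that] by auto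
   then show ?thesis by (simp add: h_def field_simps)
  qed
  have full': "(\<Prod>p\<in>P. 1 + h p) = 1 / (\<Prod>p\<in>P. 1 - w p / real p)" using hw by (simp add: prod_dividef)
  have "(\<Sum>A\<in>{A\<in>Pow P. \<not> real (\<Prod>A) <= D}. \<Prod>p\<in>A. h p) <=
    (\<Sum>A\<in>{A\<in>Pow P. \<not> real (\<Prod>A) <= D}. (\<Prod>p\<in>A. h p) * (real (\<Prod>A) / D) powr e)"
  proof (rule sum_mono)
   fix A assume A: "A \<in> {A\<in>Pow P. \<not> real (\<Prod>A) <= D}"
   then have "real (\<Prod>A) / D >= 1" using D0 by simp
   then have "(real (\<Prod>A) / D) powr e >= 1" using lv by (intro ge_one_powr_ge_zero) (auto simp: e_def)
   then have "(\<Prod>p\<in>A. h p) * 1 <= (\<Prod>p\<in>A. h p) * (real (\<Prod>A) / D) powr e" using hP[of A] A by (intro mult_left_mono) auto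
   then show "(\<Prod>p\<in>A. h p) <= (\<Prod>p\<in>A. h p) * (real (\<Prod>A) / D) powr e" by simp
  qed
  also have "... <= (\<Sum>A\<in>Pow P. (\<Prod>p\<in>A. h p) * (real (\<Prod>A) / D) powr e)" using fin hP by (intro sum_mono2) auto
  also have "... = (\<Sum>A\<in>Pow P. (\<Prod>p\<in>A. h p * real p powr e)) * D powr (-e)"
  proof -
   have "(\<Prod>p\<in>A. h p) * (real (\<Prod>A) / D) powr e = (\<Prod>p\<in>A. h p * real p powr e) * D powr (-e)" if "A \<subseteq> P" for A
   proof -
    have "real (\<Prod>A) powr e = (\<Prod>p\<in>A. real p powr e)" by (simp add: prod_powr_distrib)
    then show ?thesis using D0 by (simp add: powr_divide prod.distrib powr_minus_divide prod_nonneg)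
   qed
   then show ?thesis by (simp add: sum_distrib_right)
  qed
  also have "(\<Sum>A\<in>Pow P. (\<Prod>p\<in>A. h p * real p powr e)) = (\<Prod>p\<in>P. 1 + h p * real p powr e)" using prod_add[OF fin, of "%p. h p * real p powr e" "%_. 1"] by (simp add: add.commute)
  also have "... <= (\<Prod>p\<in>P. (1 + h p) * exp (4 / ln v * (ln (real p) / real p)))"
  proof (rule prod_mono, intro conjI)
   fix p assume p: "p \<in> P"
   note Pp = P[OF p]
   show "0 <= 1 + h p * real p powr e" using h0[OF p] by (intro add_nonneg_nonneg mult_nonneg_nonneg) auto
   define t where "t = e * ln (real p)"
   have t: "0 <= t" "t <= 1" using Pp lv by (auto simp: t_def e_def)
   have "real p powr e = exp t" using Pp by (simp add: t_def powr_def)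
   also have "... <= 1 + t + t\<^sup>2" using t by (intro exp_bound) auto
   also have "... <= 1 + 2 * t" using t by (simp add: power2_eq_square mult_left_le)
   finally have pe: "real p powr e - 1 <= 2 * t" by simp
   have g: "h p = (1 + h p) * (w p / real p)" using Pp by (simp add: h_def field_simps)
   have "1 + h p * real p powr e = (1 + h p) + h p * (real p powr e - 1)" by (simp add: algebra_simps)
   also have "h p * (real p powr e - 1) = (1 + h p) * ((w p / real p) * (real p powr e - 1))" by (subst g) simp
   also have "(1 + h p) + ... = (1 + h p) * (1 + (w p / real p) * (real p powr e - 1))" by (simp add: algebra_simps)
   also have "... <= (1 + h p) * (1 + (2 / real p) * (2 * t))"
   proof -
    have "real p powr e >= 1" using Pp lv by (intro ge_one_powr_ge_zero) (auto simp: e_def)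
    then show ?thesis using Pp pe h0[OF p] t by (intro mult_left_mono add_left_mono mult_mono divide_right_mono) auto
   qed
   also have "... <= (1 + h p) * exp ((2 / real p) * (2 * t))" using h0[OF p] by (intro mult_left_mono exp_ge_add_one_self) auto
   finally show "1 + h p * real p powr e <= (1 + h p) * exp (4 / ln v * (ln (real p) / real p))" by (simp add: t_def e_def mult.commute)
  qed
  also have "... = (\<Prod>p\<in>P. 1 + h p) * exp (4 / ln v * (\<Sum>p\<in>P. ln (real p) / real p))" unfolding prod.distrib sum_distrib_left exp_sum[OF fin] by simp
  also have "... <= (\<Prod>p\<in>P. 1 + h p) * exp (4 + 4 * C)"
  proof -
   have "(\<Sum>p\<in>P. ln (real p) / real p) <= log_sum v" using P by (intro sum_mono2) (simp, auto simp: natseg_def dest: prime_gt_0_nat)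
   also have "... <= ln v + C"
   proof -
    have "1 <= v" using v by simp
    from C(2)[OF this] show ?thesis by linarith
   qed
   finally have "4 / ln v * (\<Sum>p\<in>P. ln (real p) / real p) <= 4 / ln v * (ln v + C)" using lv by (intro mult_left_mono) auto
   also have "... = 4 + 4 * C / ln v" using lv by (simp add: field_simps)
   also have "4 * C / ln v <= 4 * C / 1" using lv C by (intro divide_left_mono) auto
   finally show ?thesis using h0 by (intro mult_left_mono prod_nonneg) (auto simp: add_nonneg_nonneg)
  qed
  also have "D powr (-e) = exp (-s)" using v lv by (simp add: D_def e_def powr_powr) (simp add: powr_def)
  finally have tail: "(\<Sum>A\<in>{A\<in>Pow P. \<not> real (\<Prod>A) <= D}. \<Prod>p\<in>A. h p) <= (\<Prod>p\<in>P. 1 + h p) * exp (4 + 4 * C) * exp (-s)" by (simp add: mult_right_mono)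
  have "exp (4 + 4 * C) * exp (-s) = exp (-1)" by (simp add: s_def mult_exp_exp)
  also have "... <= 1/2" using exp_ge_add_one_self[of 1] by (simp add: exp_minus field_simps)
  finally have "exp (4 + 4 * C) * exp (-s) <= 1/2" .
  then have "(\<Prod>p\<in>P. 1 + h p) * (exp (4 + 4 * C) * exp (-s)) <= (\<Prod>p\<in>P. 1 + h p) * (1/2)" using h0 by (intro mult_left_mono prod_nonneg) (auto simp: add_nonneg_nonneg)
  moreover have "(\<Sum>A\<in>Pow P. \<Prod>p\<in>A. h p) = sieve_sum P h D + (\<Sum>A\<in>{A\<in>Pow P. \<not> real (\<Prod>A) <= D}. \<Prod>p\<in>A. h p)"
   unfolding sieve_sum_def using fin by (subst sum.union_disjoint[symmetric]) (auto intro!: sum.cong)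
  ultimately have "sieve_sum P h D >= (\<Prod>p\<in>P. 1 + h p) / 2" using tail full by (simp add: mult.assoc)
  moreover have "(\<Prod>p\<in>P. 1 + h p) / 2 = (1/2) / (\<Prod>p\<in>P. 1 - w p / real p)" unfolding full' by simp
  ultimately show ?thesis unfolding h_def D_def by simp
 qed
 moreover have "s > 0" using C by (simp add: s_def)
 ultimately show ?thesis by (intro exI[of _ s] conjI allI impI) simp_all
qed

text \<open>This telescoping product bounds a sieve product with at most two excluded classes per
  prime from below by about 1 / v^2.\<close>

lemma prod_one_minus_two_div:
 "m >= 2 ==> (\<Prod>n\<in>{3..m}. 1 - 2 / real n) = 2 / (real m * (real m - 1))"
proof (induction m rule: dec_induct)
 case (step m)
 have "{3..Suc m} = insert (Suc m) {3..m}" using step by auto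
 then have "(\<Prod>n\<in>{3..Suc m}. 1 - 2 / real n) = (1 - 2 / real (Suc m)) * (2 / (real m * (real m - 1)))" using step by simp
 also have "1 - 2 / real (Suc m) = (real m - 1) / real (Suc m)" by (simp add: field_simps)
 also have "(real m - 1) / real (Suc m) * (2 / (real m * (real m - 1))) = 2 / (real (Suc m) * (real (Suc m) - 1))"
 proof -
  have "d / y * (2 / (z * d)) = 2 / (y * z)" if "d > 0" for d y z :: real using that by simp
  from this[of "real m - 1" "real (Suc m)" "real m"] step show ?thesis by (simp add: mult.commute)
 qed
 finally show ?case .
qed auto

abbreviation two_class_sieve_bound where
 "two_class_sieve_bound s C \<equiv> \<forall>v\<ge>3. \<forall>P W M K. finite P -->
   (\<forall>p\<in>P. prime p & 3 <= p & real p <= v & W p \<subseteq> {..<p} & 1 <= card (W p) & card (W p) <= 2) -->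
   real K >= v powr s -->
   real (card (avoiding P W M K)) <= C * real K * (\<Prod>p\<in>P. 1 - real (card (W p)) / real p)"

text \<open>The remainder \<open>(v powr s) ^ 6\<close> of Selberg's sieve has to be absorbed by the
  main term, whose density factor may be as small as 1 / v^2. This is the origin of the exponent
  \<open>6 * s + 2\<close> for the length of the interval.\<close>

lemma upper_bound_sieve:
 "\<exists>s>0. \<exists>C>0. two_class_sieve_bound s C"
proof -
 obtain s where s: "s > 0" and sieve: "sieve_sum_bound s" using sieve_sum_lower_bound by (elim exE conjE) (rule that; assumption)
 have "real (card (avoiding P W M K)) <= 3 * real K * (\<Prod>p\<in>P. 1 - real (card (W p)) / real p)"
  if v: "v >= 3" and fin: "finite P"
   and P: "\<forall>p\<in>P. prime p & 3 <= p & real p <= v & W p \<subseteq> {..<p} & 1 <= card (W p) & card (W p) <= 2"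
   and K: "real K >= v powr (6 * s + 2)" for v :: real and P W M K
 proof -
  define G where "G = (\<Prod>p\<in>P. 1 - real (card (W p)) / real p)"
  define J where "J = sieve_sum P (%p. real (card (W p)) / (real p - real (card (W p)))) (v powr s)"
  have Pp: "prime p" "3 <= p" "real p <= v" "W p \<subseteq> {..<p}" "1 <= card (W p)" "card (W p) <= 2" if "p \<in> P" for p using P that by auto
  have Pq: "card (W p) > 0" "card (W p) < p" if "p \<in> P" for p using Pp[OF that] by linarith+
  have v1: "v powr s >= 1" using v s by (intro ge_one_powr_ge_zero) auto
  have G0: "G > 0" unfolding G_def using P by (intro prod_pos) (auto simp: field_simps)
  have J: "J >= (1/2) / G" unfolding J_def G_def by (rule sieve[rule_format, OF v fin]) (use P in auto)
  have "real (card (avoiding P W M K)) <= real K / J + (v powr s) ^ 6" unfolding J_def by (intro selberg_sieve) (use fin v1 Pp Pq in simp_all)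
  also have "real K / J <= real K / ((1/2) / G)" using J G0 by (intro divide_left_mono mult_pos_pos) (auto intro: less_le_trans[OF _ J])
  also have "... = 2 * real K * G" by simp
  also have "(v powr s) ^ 6 <= real K * G"
  proof -
   have "1 / v\<^sup>2 <= G"
   proof -
    define m where "m = nat \<lfloor>v\<rfloor>"
    have "3 <= \<lfloor>v\<rfloor>" using v by simp
    then have m: "m >= 3" "real m <= v" unfolding m_def by linarith+
    have "1 / v\<^sup>2 <= 2 / (real m * (real m - 1))" using m v by (intro frac_le) (auto simp: power2_eq_square intro!: mult_mono)
    also have "... = (\<Prod>n\<in>{3..m}. 1 - 2 / real n)" using m by (subst prod_one_minus_two_div) auto
    also have "... <= (\<Prod>n\<in>P. 1 - 2 / real n)"
    proof -
     have sub: "P \<subseteq> {3..m}" using P by (auto simp: m_def le_nat_floor)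
     have "(\<Prod>n\<in>{3..m}. 1 - 2 / real n) = (\<Prod>n\<in>{3..m} - P. 1 - 2 / real n) * (\<Prod>n\<in>P. 1 - 2 / real n)" using sub by (intro prod.subset_diff) auto
     also have "... <= 1 * (\<Prod>n\<in>P. 1 - 2 / real n)" using P by (intro mult_right_mono prod_le_1 prod_nonneg) (auto simp: field_simps)
     finally show ?thesis by simp
    qed
    also have "... <= G" unfolding G_def using P by (intro prod_mono conjI diff_left_mono divide_right_mono) (auto simp: field_simps)
    finally show ?thesis .
   qed
   then have "v powr (6 * s + 2) * (1 / v\<^sup>2) <= real K * G" using K by (intro mult_mono) auto
   moreover have "v powr (6 * s + 2) = (v powr s) ^ 6 * v\<^sup>2" using v by (simp add: powr_add powr_numeral powr_power mult.commute)
   ultimately show ?thesis using v by simp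
  qed
  finally show ?thesis by (simp add: G_def)
 qed
 then show ?thesis using s by (intro exI[of _ "6 * s + 2"] conjI exI[of _ 3]) auto
qed

section \<open>Brun's sieve by truncated inclusion and exclusion\<close>

lemma alternating_binomial_partial_sum:
 "n >= 1 ==> (\<Sum>i\<le>r. (-1) ^ i * real (n choose i)) = (-1) ^ r * real ((n - 1) choose r)"
proof (induction r)
 case (Suc r)
 obtain m where "n = Suc m" using Suc.prems by (cases n) auto
 then show ?case using Suc by (simp add: algebra_simps)
qed auto

lemma sum_subsets_card_le:
 assumes "finite S"
 shows "(\<Sum>A\<in>{A\<in>Pow S. card A <= r}. f (card A)) = (\<Sum>i\<le>r. real (card S choose i) * f i)"
proof -
 have "(\<Sum>A\<in>{A\<in>Pow S. card A <= r}. f (card A)) = (\<Sum>i\<le>r. \<Sum>A\<in>{A. A \<in> {A\<in>Pow S. card A <= r} & card A = i}. f (card A))"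
  using assms by (subst sum.group[symmetric, where T = "{..r}" and g = card]) auto
 also have "... = (\<Sum>i\<le>r. real (card S choose i) * f i)"
 proof (rule sum.cong[OF refl])
  fix i assume "i \<in> {..r}"
  then have eq: "{A. A \<in> {A\<in>Pow S. card A <= r} & card A = i} = {A. A \<subseteq> S & card A = i}" by auto
  show "(\<Sum>A\<in>{A. A \<in> {A\<in>Pow S. card A <= r} & card A = i}. f (card A)) = real (card S choose i) * f i" unfolding eq using n_subsets[OF assms, of i] by simp
 qed
 finally show ?thesis .
qed

text \<open>For nonempty S the truncated alternating sum is a single binomial coefficient
  \<open>(card S - 1) choose r\<close> up to sign, and this is at most
  \<open>card S choose Suc r\<close>.\<close>

lemma bonferroni:
 assumes "finite S"
 shows "\<bar>(if S = {} then 1 else 0) - (\<Sum>A\<in>{A\<in>Pow S. card A <= r}. (-1) ^ card A)\<bar> <= real (card {A\<in>Pow S. card A = Suc r})"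
proof (cases "S = {}")
 case True
 then have "{A\<in>Pow S. card A <= r} = {{}}" by auto
 then show ?thesis using True by simp
next
 case False
 then have n: "card S >= 1" using assms by (simp add: Suc_le_eq card_gt_0_iff)
 have "(\<Sum>A\<in>{A\<in>Pow S. card A <= r}. (-1) ^ card A) = (-1) ^ r * real ((card S - 1) choose r)"
  using sum_subsets_card_le[OF assms, of "%i. (-1) ^ i" r] alternating_binomial_partial_sum[OF n, of r] by (simp add: mult.commute)
 moreover have "(card S - 1) choose r <= card S choose Suc r" using n by (cases "card S") auto
 moreover have "card {A\<in>Pow S. card A = Suc r} = card S choose Suc r" using n_subsets[OF assms, of "Suc r"] by (simp add: Pow_def)
 ultimately show ?thesis using False by (simp add: abs_mult power_abs)
qed

lemma sum_binomial_le: "(\<Sum>i\<le>r. real (n choose i)) <= (real n + 1) ^ r"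
proof -
 have "(\<Sum>i\<le>r. real (n choose i)) <= (\<Sum>i\<le>r. real (r choose i) * real n ^ i * 1 ^ (r - i))"
 proof (rule sum_mono)
  fix i assume i: "i \<in> {..r}"
  have "real (n choose i) <= real n ^ i"
  proof (cases "i <= n")
   case True
   then show ?thesis using binomial_le_pow[of i n] by (metis of_nat_le_iff of_nat_power)
  qed (simp add: binomial_eq_0)
  moreover have "r choose i >= 1" using i by (simp add: Suc_le_eq)
  then have "real n ^ i * 1 <= real n ^ i * real (r choose i)" by (intro mult_left_mono) auto
  ultimately have "real (n choose i) <= real n ^ i * real (r choose i)" by linarith
  then show "real (n choose i) <= real (r choose i) * real n ^ i * 1 ^ (r - i)" by (simp add: mult.commute)
 qed
 also have "... = (real n + 1) ^ r" using binomial_ring[of "real n" 1 r] by simp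
 finally show ?thesis .
qed

abbreviation sieved :: "nat set => (nat => nat) => nat => nat => nat set" where
 "sieved P c M K \<equiv> {k\<in>{M<..M + K}. \<forall>p\<in>P. k mod p ~= c p}"

text \<open>Comparing different residue classes requires a two-sided estimate, which an upper bound
  sieve does not give. Sets with more than r primes are handled by a Rankin weight: inserting
  \<open>exp (card A - Suc r) >= 1\<close> allows the tail to be completed to an Euler
  product.\<close>

lemma brun_sieve:
 fixes P :: "nat set" and c :: "nat => nat"
 assumes fin: "finite P" and P: "\<And>p. p \<in> P ==> prime p" and c: "\<And>p. p \<in> P ==> c p < p"
 shows "\<bar>real (card (sieved P c M K)) - real K * (\<Prod>p\<in>P. 1 - 1 / real p)\<bar>
   <= 2 * real K * (exp (- real (Suc r)) * exp (exp 1 * (\<Sum>p\<in>P. 1 / real p))) + (real (card P) + 1) ^ Suc r"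
proof -
 define I where "I = {M<..M + K}"
 define bad where "bad = (%k. {p\<in>P. k mod p = c p})"
 define N where "N = (%A. real (card {k\<in>{M<..M + K}. \<forall>p\<in>A. k mod p = c p}))"
 define u where "u = (%A::nat set. 1 / real (\<Prod>A))"
 define Tail where "Tail = (\<Sum>A\<in>{A\<in>Pow P. card A > r}. u A)"
 have fsub: "finite A" if "A \<subseteq> P" for A using that fin finite_subset by blast
 have u0: "u A >= 0" for A by (simp add: u_def prod_nonneg)
 have N: "\<bar>N A - real K * u A\<bar> <= 1" if "A \<subseteq> P" for A
 proof -
  have "\<bar>real (card {k\<in>{M<..M + K}. \<forall>p\<in>A. k mod p \<in> {c p}}) - real K * (\<Prod>p\<in>A. real (card {c p}) / real p)\<bar>
      <= (\<Prod>p\<in>A. real (card {c p}))" using that fsub P c by (intro card_residues_interval) auto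
  then show ?thesis by (simp add: N_def u_def prod_dividef)
 qed
 have swap: "(\<Sum>k\<in>I. \<Sum>A\<in>{A\<in>Pow (bad k). Q A}. f A) = (\<Sum>A\<in>{A\<in>Pow P. Q A}. f A * N A)" for Q and f :: "nat set => real"
 proof -
  have "{A\<in>Pow (bad k). Q A} = {A. A \<in> {A\<in>Pow P. Q A} & A \<subseteq> bad k}" for k by (auto simp: bad_def)
  then have "(\<Sum>k\<in>I. \<Sum>A\<in>{A\<in>Pow (bad k). Q A}. f A) = (\<Sum>k\<in>I. \<Sum>A\<in>{A. A \<in> {A\<in>Pow P. Q A} & A \<subseteq> bad k}. f A)" by simp
  also have "... = (\<Sum>A\<in>{A\<in>Pow P. Q A}. \<Sum>k\<in>{k. k \<in> I & A \<subseteq> bad k}. f A)" using fin by (intro sum.swap_restrict) (auto simp: I_def)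
  also have "... = (\<Sum>A\<in>{A\<in>Pow P. Q A}. f A * N A)"
  proof (rule sum.cong[OF refl])
   fix A assume "A \<in> {A\<in>Pow P. Q A}"
   then have "{k. k \<in> I & A \<subseteq> bad k} = {k\<in>{M<..M + K}. \<forall>p\<in>A. k mod p = c p}" by (auto simp: I_def bad_def)
   then show "(\<Sum>k\<in>{k. k \<in> I & A \<subseteq> bad k}. f A) = f A * N A" by (simp add: N_def)
  qed
  finally show ?thesis .
 qed
 have "real (card (sieved P c M K)) = (\<Sum>k\<in>I. if bad k = {} then 1 else 0)" by (subst sum.inter_filter[symmetric]) (auto simp: I_def bad_def intro!: arg_cong[where f=card])
 then have "\<bar>real (card (sieved P c M K)) - (\<Sum>k\<in>I. \<Sum>A\<in>{A\<in>Pow (bad k). card A <= r}. (-1) ^ card A)\<bar>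
   = \<bar>\<Sum>k\<in>I. (if bad k = {} then 1 else 0) - (\<Sum>A\<in>{A\<in>Pow (bad k). card A <= r}. (-1) ^ card A)\<bar>" by (simp add: sum_subtractf)
 also have "... <= (\<Sum>k\<in>I. \<bar>(if bad k = {} then 1 else 0) - (\<Sum>A\<in>{A\<in>Pow (bad k). card A <= r}. (-1) ^ card A)\<bar>)" by (rule sum_abs)
 also have "... <= (\<Sum>k\<in>I. real (card {A\<in>Pow (bad k). card A = Suc r}))" using fin by (intro sum_mono bonferroni) (auto simp: bad_def)
 also have "... = (\<Sum>k\<in>I. \<Sum>A\<in>{A\<in>Pow (bad k). card A = Suc r}. 1)" by simp
 also have "... = (\<Sum>A\<in>{A\<in>Pow P. card A = Suc r}. 1 * N A)" by (rule swap)
 also have "... <= (\<Sum>A\<in>{A\<in>Pow P. card A = Suc r}. real K * u A + 1)" using N by (intro sum_mono) (force simp: abs_le_iff)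
 also have "... = real K * (\<Sum>A\<in>{A\<in>Pow P. card A = Suc r}. u A) + real (card {A\<in>Pow P. card A = Suc r})" by (simp add: sum.distrib sum_distrib_left)
 also have "(\<Sum>A\<in>{A\<in>Pow P. card A = Suc r}. u A) <= Tail" unfolding Tail_def using fin u0 by (intro sum_mono2) auto
 finally have 1: "\<bar>real (card (sieved P c M K)) - (\<Sum>A\<in>{A\<in>Pow P. card A <= r}. (-1) ^ card A * N A)\<bar>
   <= real K * Tail + real (card {A\<in>Pow P. card A = Suc r})" unfolding swap by (simp add: mult_left_mono)
 have "\<bar>(\<Sum>A\<in>{A\<in>Pow P. card A <= r}. (-1) ^ card A * N A) - (\<Sum>A\<in>{A\<in>Pow P. card A <= r}. (-1) ^ card A * (real K * u A))\<bar>
   = \<bar>\<Sum>A\<in>{A\<in>Pow P. card A <= r}. (-1) ^ card A * (N A - real K * u A)\<bar>" by (simp add: sum_subtractf right_diff_distrib)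
 also have "... <= (\<Sum>A\<in>{A\<in>Pow P. card A <= r}. \<bar>(-1) ^ card A * (N A - real K * u A)\<bar>)" by (rule sum_abs)
 also have "... <= (\<Sum>A\<in>{A\<in>Pow P. card A <= r}. 1)" using N by (intro sum_mono) (auto simp: abs_mult power_abs)
 finally have 2: "\<bar>(\<Sum>A\<in>{A\<in>Pow P. card A <= r}. (-1) ^ card A * N A) - (\<Sum>A\<in>{A\<in>Pow P. card A <= r}. (-1) ^ card A * (real K * u A))\<bar> <= real (card {A\<in>Pow P. card A <= r})" by simp
 have "real K * (\<Prod>p\<in>P. 1 - 1 / real p) = (\<Sum>A\<in>Pow P. (-1) ^ card A * (real K * u A))" using fin by (subst prod_diff_conv_sum) (auto simp: u_def prod_dividef sum_distrib_left mult_ac)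
 also have "... = (\<Sum>A\<in>{A\<in>Pow P. card A <= r}. (-1) ^ card A * (real K * u A)) + (\<Sum>A\<in>{A\<in>Pow P. card A > r}. (-1) ^ card A * (real K * u A))"
  using fin by (subst sum.union_disjoint[symmetric]) (auto intro!: sum.cong)
 finally have "\<bar>(\<Sum>A\<in>{A\<in>Pow P. card A <= r}. (-1) ^ card A * (real K * u A)) - real K * (\<Prod>p\<in>P. 1 - 1 / real p)\<bar>
   = \<bar>\<Sum>A\<in>{A\<in>Pow P. card A > r}. (-1) ^ card A * (real K * u A)\<bar>" by simp
 also have "... <= (\<Sum>A\<in>{A\<in>Pow P. card A > r}. \<bar>(-1) ^ card A * (real K * u A)\<bar>)" by (rule sum_abs)
 also have "... = real K * Tail" using u0 by (simp add: abs_mult power_abs Tail_def sum_distrib_left)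
 finally have 3: "\<bar>(\<Sum>A\<in>{A\<in>Pow P. card A <= r}. (-1) ^ card A * (real K * u A)) - real K * (\<Prod>p\<in>P. 1 - 1 / real p)\<bar> <= real K * Tail" .
 have "real (card {A\<in>Pow P. card A = Suc r}) + real (card {A\<in>Pow P. card A <= r}) = real (card {A\<in>Pow P. card A <= Suc r})"
  using fin by (subst of_nat_add[symmetric], subst card_Un_disjoint[symmetric]) (auto intro!: arg_cong[where f=card])
 also have "... = (\<Sum>A\<in>{A\<in>Pow P. card A <= Suc r}. 1)" by simp
 also have "... = (\<Sum>i\<le>Suc r. real (card P choose i))" using sum_subsets_card_le[OF fin, of "%_. 1" "Suc r"] by simp
 also have "... <= (real (card P) + 1) ^ Suc r" by (rule sum_binomial_le)
 finally have 4: "real (card {A\<in>Pow P. card A = Suc r}) + real (card {A\<in>Pow P. card A <= r}) <= (real (card P) + 1) ^ Suc r" .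
 have "Tail <= (\<Sum>A\<in>{A\<in>Pow P. card A > r}. exp (- real (Suc r)) * (\<Prod>p\<in>A. exp 1 / real p))" unfolding Tail_def
 proof (rule sum_mono)
  fix A assume "A \<in> {A\<in>Pow P. card A > r}"
  then have "Suc r <= card A" by auto
  then have "1 <= exp (- real (Suc r)) * exp (real (card A))" by (simp flip: exp_add)
  also have "exp (real (card A)) = (exp 1) ^ card A" using exp_of_nat_mult[of "card A" "1::real"] by simp
  finally have "1 * u A <= (exp (- real (Suc r)) * (exp 1) ^ card A) * u A" using u0 by (intro mult_right_mono) auto
  then show "u A <= exp (- real (Suc r)) * (\<Prod>p\<in>A. exp 1 / real p)" by (simp add: u_def prod_dividef)
 qed
 also have "... <= (\<Sum>A\<in>Pow P. exp (- real (Suc r)) * (\<Prod>p\<in>A. exp 1 / real p))" using fin by (intro sum_mono2) (auto intro!: mult_nonneg_nonneg prod_nonneg)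
 also have "... = exp (- real (Suc r)) * (\<Prod>p\<in>P. exp 1 / real p + 1)" using prod_add[OF fin, of "%p. exp 1 / real p" "%_. 1"] by (simp add: sum_distrib_left)
 also have "... <= exp (- real (Suc r)) * (\<Prod>p\<in>P. exp (exp 1 / real p))" by (intro mult_left_mono prod_mono) (auto simp: add_nonneg_nonneg add.commute)
 also have "(\<Prod>p\<in>P. exp (exp 1 / real p)) = exp (exp 1 * (\<Sum>p\<in>P. 1 / real p))" unfolding sum_distrib_left exp_sum[OF fin] by simp
 finally have 5: "Tail <= exp (- real (Suc r)) * exp (exp 1 * (\<Sum>p\<in>P. 1 / real p))" .
 have "\<bar>real (card (sieved P c M K)) - real K * (\<Prod>p\<in>P. 1 - 1 / real p)\<bar>
   <= 2 * real K * Tail + (real (card P) + 1) ^ Suc r" using 1 2 3 4 by linarith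
 also have "2 * real K * Tail <= 2 * real K * (exp (- real (Suc r)) * exp (exp 1 * (\<Sum>p\<in>P. 1 / real p)))" using 5 by (intro mult_left_mono) auto
 finally show ?thesis by simp
qed

section \<open>Selberg's formula on a finite abelian group\<close>

text \<open>The reflection b -> c / b is an involution; all convolutions over the group below are
  reindexed by it.\<close>

lemma (in comm_group) div_div_cancel:
 assumes "c \<in> carrier G" "b \<in> carrier G"
 shows "c \<otimes> inv (c \<otimes> inv b) = b"
proof -
 have "inv (c \<otimes> inv b) = inv c \<otimes> b" using assms by (simp add: inv_mult)
 then show ?thesis using assms by (simp add: m_assoc [symmetric])
qed

lemma (in comm_group) sum_div_reindex:
 assumes "c \<in> carrier G"
 shows "(\<Sum>b\<in>carrier G. f (c \<otimes> inv b) b) = (\<Sum>b\<in>carrier G. f b (c \<otimes> inv b))" by (rule sum.reindex_bij_witness[of _ "%b. c \<otimes> inv b" "%b. c \<otimes> inv b"])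
   (use assms in \<open>auto simp: div_div_cancel\<close>)

text \<open>Cell i stands for the interval (i - 1, i] of the logarithmic scale. Two factors in cells
  i and j have positions with sum above i + j - 2 and at most i + j; for this sum to lie in (T1, T2]
  it is necessary that T1 + 1 <= i + j <= T2 + 1.\<close>

definition sum_window :: "nat => nat => (nat \<times> nat) set" where
 "sum_window T1 T2 = {(i, j). 1 <= i & 1 <= j & T1 + 1 <= i + j & i + j <= T2 + 1}"

lemma sum_window_subset: "sum_window T1 T2 \<subseteq> {1..T2} \<times> {1..T2}"
 by (auto simp: sum_window_def)

lemma finite_sum_window [simp]: "finite (sum_window T1 T2)"
 using sum_window_subset by (rule finite_subset) auto

lemma card_sum_window:
 assumes "1 <= T1" "T1 <= T2"
 shows "2 * real (card (sum_window T1 T2)) = real T2 ^ 2 - real T1 ^ 2 + real T2 + real T1"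
proof -
 have "sum_window T1 T2 = (\<Union>u\<in>{T1..T2}. (%i. (i, Suc u - i)) ` {1..u})"
 proof (intro equalityI subsetI)
  fix z assume "z \<in> sum_window T1 T2"
  then obtain i j where z: "z = (i, j)" "1 <= i" "1 <= j" "T1 + 1 <= i + j" "i + j <= T2 + 1" by (auto simp: sum_window_def)
  then have "i + j - 1 \<in> {T1..T2}" "i \<in> {1..i + j - 1}" "j = Suc (i + j - 1) - i" by auto
  then show "z \<in> (\<Union>u\<in>{T1..T2}. (%i. (i, Suc u - i)) ` {1..u})" using z(1) by blast
 qed (auto simp: sum_window_def)
 also have "card ... = (\<Sum>u\<in>{T1..T2}. card ((%i. (i, Suc u - i)) ` {1..u}))" by (intro card_UN_disjoint) auto
 also have "... = (\<Sum>u\<in>{T1..T2}. u)" by (intro sum.cong refl) (subst card_image, auto simp: inj_on_def)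
 finally have "real (card (sum_window T1 T2)) = (\<Sum>u\<in>{T1..T2}. real u)" by simp
 moreover have "2 * (\<Sum>u\<in>{T1..T2}. real u) = real T2 ^ 2 - real T1 ^ 2 + real T2 + real T1" using assms(2)
 proof (induction T2 rule: dec_induct)
  case (step n)
  then have "{T1..Suc n} = insert (Suc n) {T1..n}" by auto
  then show ?case using step by (simp add: power2_eq_square algebra_simps)
 qed (simp add: power2_eq_square)
 ultimately show ?thesis by simp
qed

text \<open>
 \<open>x a i\<close> is the normalised density of the primes in the class \<open>a\<close> in the \<open>i\<close>-th of \<open>N\<close> cells of
 the logarithmic scale; \<open>selberg\<close> is the lower bound contained in Selberg's formula
 for the product of two primes in the class \<open>c\<close>.
\<close>

locale selberg_density = comm_group G for G (structure) +
 fixes x :: "'a => nat => real" and N i0 :: nat and e :: real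
 assumes fin: "finite (carrier G)"
  and i0: "1 <= i0" "2 * i0 <= N" and e: "0 < e" "e <= 1"
  and nonneg: "\<And>a i. a \<in> carrier G ==> 0 <= x a i"
  and upper: "\<And>a i. a \<in> carrier G ==> i0 < i ==> i <= N ==> x a i <= 2 + e"
  and avg_upper: "\<And>i. 1 <= i ==> i <= N ==> (\<Sum>a\<in>carrier G. x a i) <= (1 + e) * card (carrier G)"
  and avg_lower: "\<And>i. i0 < i ==> i <= N ==> (1 - e) * card (carrier G) <= (\<Sum>a\<in>carrier G. x a i)"
  and selberg: "\<And>c T1 T2. c \<in> carrier G ==> 2 * i0 <= T1 ==> T1 <= T2 ==> T2 <= N ==>
    card (carrier G) * (real T2 ^ 2 - real T1 ^ 2 - e * real N ^ 2) \<le>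
    card (carrier G) * real T2 * (\<Sum>i\<in>{T1<..T2}. x c i) +
    (\<Sum>b\<in>carrier G. \<Sum>(i, j)\<in>sum_window T1 T2. x b i * x (c \<otimes> inv b) j)"
begin

lemma card_pos: "real (card (carrier G)) > 0"
 using fin by (metis card_gt_0_iff of_nat_0_less_iff one_closed empty_iff)

text \<open>If c is poor in primes, the product term must supply Selberg's lower bound alone. But
  the window has about (T2^2 - T1^2) / 2 cells, each contributing at most about twice the order of
  the group, because densities are at most 2 + e and have mean about 1. The bound is thus almost
  attained: over any rectangle in the window the density at c / b, weighted by the density at b, can
  hardly fall short of its maximum.\<close>

lemma window_deficiency:
 fixes s :: real
 assumes c: "c \<in> carrier G" and T: "2 * i0 <= T1" "T1 <= T2" "T2 <= N"
  and K: "i0 <= k1" "i0 <= j1" "T1 <= k1 + j1 + 1" "k2 + j2 <= T2 + 1" "k1 <= k2" "j1 <= j2"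
  and small: "(\<Sum>i\<in>{T1<..T2}. x c i) <= s * N"
 shows "(\<Sum>b\<in>carrier G. (\<Sum>i\<in>{k1<..k2}. x b i) * ((2 + e) * (real j2 - real j1) - (\<Sum>j\<in>{j1<..j2}. x (c \<otimes> inv b) j)))
   <= card (carrier G) * real N ^ 2 * (s + 7 * e + 14 * real i0 / real N)"
proof -
 define h where "h = real (card (carrier G))"
 define W where "W = sum_window T1 T2"
 define KJ where "KJ = {k1<..k2} \<times> {j1<..j2}"
 define y where "y = (%b. c \<otimes> inv b)"
 have y: "y b \<in> carrier G" if "b \<in> carrier G" for b using that c by (simp add: y_def)
 have h0: "h > 0" using card_pos by (simp add: h_def)
 have WN: "i \<in> {1..N}" "j \<in> {1..N}" if "(i, j) \<in> W" for i j using that T(3) sum_window_subset[of T1 T2] by (auto simp: W_def)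
 \<comment> \<open>In the first i0 cells only the mean is controlled. As 2 * i0 <= T1, at most one
   of i and j is that small: the mean bound serves for the small index and the pointwise bound for
   the other.\<close>
 define W1 where "W1 = {(i, j)\<in>W. i <= i0}"
 define W2 where "W2 = {(i, j)\<in>W. j <= i0}"
 define W3 where "W3 = {(i, j)\<in>W. i0 < i & i0 < j}"
 have finW: "finite W" "finite W1" "finite W2" "finite W3" unfolding W1_def W2_def W3_def by (auto simp: W_def intro: finite_subset[OF _ finite_sum_window[of T1 T2]])
 have W1big: "i0 < j" if "(i, j) \<in> W1" for i j using that T by (auto simp: W1_def W_def sum_window_def)
 have W2big: "i0 < i" if "(i, j) \<in> W2" for i j using that T by (auto simp: W2_def W_def sum_window_def)
 have part: "W = W1 \<union> W2 \<union> W3" "W1 \<inter> W2 = {}" "(W1 \<union> W2) \<inter> W3 = {}"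
 proof -
  have "False" if "(i, j) \<in> W" "i <= i0" "j <= i0" for i j using that T by (auto simp: W_def sum_window_def)
  then show "W = W1 \<union> W2 \<union> W3" "W1 \<inter> W2 = {}" "(W1 \<union> W2) \<inter> W3 = {}" by (force simp: W1_def W2_def W3_def)+
 qed
 have KJsub: "KJ \<subseteq> W3" using K by (auto simp: KJ_def W3_def W_def sum_window_def)
 define F where "F = (%S. \<Sum>b\<in>carrier G. \<Sum>(i, j)\<in>S. x b i * x (y b) j)"
 have cW1: "real (card W1) <= real i0 * real N"
 proof -
  have "card W1 <= card ({1..i0} \<times> {1..N})" using WN by (intro card_mono) (auto simp: W1_def)
  also have "... = i0 * N" by simp
  finally show ?thesis using of_nat_mono by fastforce
 qed
 have cW2: "real (card W2) <= real i0 * real N"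
 proof -
  have "card W2 <= card ({1..N} \<times> {1..i0})" using WN by (intro card_mono) (auto simp: W2_def)
  also have "... = i0 * N" by simp
  finally show ?thesis using of_nat_mono by fastforce
 qed
 have F1: "F W1 <= 6 * h * real i0 * real N"
 proof -
  have "F W1 = (\<Sum>(i, j)\<in>W1. \<Sum>b\<in>carrier G. x b i * x (y b) j)" unfolding F_def by (subst sum.swap) (simp add: case_prod_unfold)
  also have "... <= (\<Sum>(i, j)\<in>W1. 6 * h)"
  proof (intro sum_mono, clarify)
   fix i j assume ij: "(i, j) \<in> W1"
   then have ijN: "i \<in> {1..N}" "j \<in> {1..N}" "i0 < j" using WN[of i j] W1big by (auto simp: W1_def)
   have "(\<Sum>b\<in>carrier G. x b i * x (y b) j) <= (\<Sum>b\<in>carrier G. x b i * 3)"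
   proof (intro sum_mono mult_left_mono nonneg)
    fix b assume "b \<in> carrier G"
    then show "x (y b) j <= 3" using upper[OF y, of b j] ijN e by auto
   qed
   also have "... = 3 * (\<Sum>b\<in>carrier G. x b i)" by (simp add: sum_distrib_left mult.commute)
   also have "(\<Sum>b\<in>carrier G. x b i) <= (1 + e) * h" unfolding h_def using ijN by (intro avg_upper) auto
   also have "... <= 2 * h" using e h0 by (intro mult_right_mono) auto
   finally show "(\<Sum>b\<in>carrier G. x b i * x (y b) j) <= 6 * h" by simp
  qed
  also have "... = 6 * h * real (card W1)" by (simp add: case_prod_unfold)
  also have "... <= 6 * h * (real i0 * real N)" using cW1 h0 by (intro mult_left_mono) auto
  finally show ?thesis by (simp add: mult_ac)
 qed
 have F2: "F W2 <= 6 * h * real i0 * real N"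
 proof -
  have "F W2 = (\<Sum>(i, j)\<in>W2. \<Sum>b\<in>carrier G. x b i * x (y b) j)" unfolding F_def by (subst sum.swap) (simp add: case_prod_unfold)
  also have "... <= (\<Sum>(i, j)\<in>W2. 6 * h)"
  proof (intro sum_mono, clarify)
   fix i j assume ij: "(i, j) \<in> W2"
   then have ijN: "i \<in> {1..N}" "j \<in> {1..N}" "i0 < i" using WN[of i j] W2big by (auto simp: W2_def)
   have "(\<Sum>b\<in>carrier G. x b i * x (y b) j) <= (\<Sum>b\<in>carrier G. 3 * x (y b) j)"
   proof (intro sum_mono mult_right_mono nonneg y)
    fix b assume "b \<in> carrier G"
    then show "x b i <= 3" using upper[of b i] ijN e by auto
   qed
   also have "... = 3 * (\<Sum>b\<in>carrier G. x (y b) j)" by (simp add: sum_distrib_left)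
   also have "(\<Sum>b\<in>carrier G. x (y b) j) = (\<Sum>b\<in>carrier G. x b j)" using sum_div_reindex[OF c, of "%a b. x a j"] by (simp add: y_def)
   also have "... <= (1 + e) * h" unfolding h_def using ijN by (intro avg_upper) auto
   also have "... <= 2 * h" using e h0 by (intro mult_right_mono) auto
   finally show "(\<Sum>b\<in>carrier G. x b i * x (y b) j) <= 6 * h" by simp
  qed
  also have "... = 6 * h * real (card W2)" by (simp add: case_prod_unfold)
  also have "... <= 6 * h * (real i0 * real N)" using cW2 h0 by (intro mult_left_mono) auto
  finally show ?thesis by (simp add: mult_ac)
 qed
 define Def where "Def = (\<Sum>b\<in>carrier G. (\<Sum>i\<in>{k1<..k2}. x b i) * ((2 + e) * (real j2 - real j1) - (\<Sum>j\<in>{j1<..j2}. x (y b) j)))"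
 have F3: "F W3 <= (2 + 4 * e) * h * real (card W) - Def"
 proof -
  have "F W3 <= (\<Sum>b\<in>carrier G. (\<Sum>(i, j)\<in>W3. (2 + e) * x b i) - (\<Sum>(i, j)\<in>KJ. (2 + e) * x b i - x b i * x (y b) j))" unfolding F_def
  proof (rule sum_mono)
   fix b assume b: "b \<in> carrier G"
   have le: "x b i * x (y b) j <= (2 + e) * x b i" if "(i, j) \<in> W3" for i j using upper[OF y[OF b], of j] nonneg[OF b, of i] WN[of i j] that by (auto simp: W3_def mult.commute intro!: mult_left_mono)
   have "(\<Sum>(i, j)\<in>KJ. (2 + e) * x b i - x b i * x (y b) j) <= (\<Sum>(i, j)\<in>W3. (2 + e) * x b i - x b i * x (y b) j)" using KJsub finW le by (intro sum_mono2) auto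
   also have "... = (\<Sum>(i, j)\<in>W3. (2 + e) * x b i) - (\<Sum>(i, j)\<in>W3. x b i * x (y b) j)" by (simp add: case_prod_unfold sum_subtractf)
   finally show "(\<Sum>(i, j)\<in>W3. x b i * x (y b) j) <= (\<Sum>(i, j)\<in>W3. (2 + e) * x b i) - (\<Sum>(i, j)\<in>KJ. (2 + e) * x b i - x b i * x (y b) j)" by linarith
  qed
  also have "... = (\<Sum>b\<in>carrier G. \<Sum>(i, j)\<in>W3. (2 + e) * x b i) - Def"
  proof -
   have "(\<Sum>(i, j)\<in>KJ. (2 + e) * x b i - x b i * x (y b) j) = (\<Sum>i\<in>{k1<..k2}. x b i) * ((2 + e) * (real j2 - real j1) - (\<Sum>j\<in>{j1<..j2}. x (y b) j))" for b
   proof -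
    have "(\<Sum>(i, j)\<in>KJ. (2 + e) * x b i - x b i * x (y b) j) = (\<Sum>(i, j)\<in>KJ. x b i * ((2 + e) - x (y b) j))" by (simp add: algebra_simps case_prod_unfold)
    also have "... = (\<Sum>i\<in>{k1<..k2}. x b i) * (\<Sum>j\<in>{j1<..j2}. (2 + e) - x (y b) j)" unfolding KJ_def sum_product by (subst sum.cartesian_product) (simp add: case_prod_unfold)
    also have "(\<Sum>j\<in>{j1<..j2}. (2 + e) - x (y b) j) = (2 + e) * (real j2 - real j1) - (\<Sum>j\<in>{j1<..j2}. x (y b) j)" using K by (simp add: sum_subtractf of_nat_diff mult.commute)
    finally show ?thesis .
   qed
   then show ?thesis by (simp add: sum_subtractf Def_def)
  qed
  also have "(\<Sum>b\<in>carrier G. \<Sum>(i, j)\<in>W3. (2 + e) * x b i) <= (\<Sum>(i, j)\<in>W3. (2 + 4 * e) * h)"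
  proof -
   have "(\<Sum>b\<in>carrier G. \<Sum>(i, j)\<in>W3. (2 + e) * x b i) = (\<Sum>(i, j)\<in>W3. (2 + e) * (\<Sum>b\<in>carrier G. x b i))" by (subst sum.swap) (simp add: case_prod_unfold sum_distrib_left)
   also have "... <= (\<Sum>(i, j)\<in>W3. (2 + 4 * e) * h)"
   proof (intro sum_mono, clarify)
    fix i j assume "(i, j) \<in> W3"
    then have "1 <= i" "i <= N" using WN[of i j] by (auto simp: W3_def)
    then have "(2 + e) * (\<Sum>b\<in>carrier G. x b i) <= (2 + e) * ((1 + e) * h)" unfolding h_def using e by (intro mult_left_mono avg_upper) auto
    also have "... = (2 + 3 * e + e * e) * h" by (simp add: algebra_simps)
    also have "... <= (2 + 4 * e) * h" using e h0 by (intro mult_right_mono) (auto simp: mult_left_le)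
    finally show "(2 + e) * (\<Sum>b\<in>carrier G. x b i) <= (2 + 4 * e) * h" .
   qed
   finally show ?thesis .
  qed
  also have "... = (2 + 4 * e) * h * real (card W3)" by (simp add: case_prod_unfold)
  also have "... <= (2 + 4 * e) * h * real (card W)" using e h0 finW part by (intro mult_left_mono of_nat_mono card_mono) auto
  finally show ?thesis by simp
 qed
 have "F W = F W1 + F W2 + F W3"
 proof -
  have "(\<Sum>(i, j)\<in>W. f i j) = (\<Sum>(i, j)\<in>W1. f i j) + (\<Sum>(i, j)\<in>W2. f i j) + (\<Sum>(i, j)\<in>W3. f i j)" for f :: "nat => nat => real"
   unfolding part(1) using part finW by (subst sum.union_disjoint; simp?)+
  then show ?thesis unfolding F_def by (simp add: sum.distrib)
 qed
 moreover have "h * (real T2 ^ 2 - real T1 ^ 2 - e * real N ^ 2) <= h * real T2 * (\<Sum>i\<in>{T1<..T2}. x c i) + F W" using selberg[OF c T] by (simp add: h_def F_def W_def y_def)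
 moreover have "h * real T2 * (\<Sum>i\<in>{T1<..T2}. x c i) <= h * (s * real N ^ 2)"
 proof -
  have "(\<Sum>i\<in>{T1<..T2}. x c i) >= 0" using c by (intro sum_nonneg nonneg)
  then have "real T2 * (\<Sum>i\<in>{T1<..T2}. x c i) <= real N * (s * N)" using T small by (intro mult_mono) auto
  then show ?thesis using h0 by (simp add: power2_eq_square mult_ac)
 qed
 moreover have "(2 + 4 * e) * h * real (card W) <= h * (real T2 ^ 2 - real T1 ^ 2 + 2 * real N + 6 * e * real N ^ 2)"
 proof -
  define q where "q = real (card W)"
  have q: "2 * q = real T2 ^ 2 - real T1 ^ 2 + real T2 + real T1" unfolding q_def W_def using T i0 by (intro card_sum_window) auto
  have N1: "real N >= 1" using i0 by simp
  have "real T2 + real T1 <= 2 * real N" using T by simp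
  moreover have "real T2 ^ 2 <= real N ^ 2" using T by (intro power_mono) auto
  moreover have "real N <= real N ^ 2" using N1 by (simp add: power2_eq_square)
  ultimately have "2 * q <= 3 * real N ^ 2" using q zero_le_power2[of "real T1"] by linarith
  then have "2 * e * (2 * q) <= 2 * e * (3 * real N ^ 2)" using e by (intro mult_left_mono) auto
  then have "(2 + 4 * e) * q <= 2 * q + 6 * e * real N ^ 2" by (simp add: algebra_simps)
  also have "2 * q <= real T2 ^ 2 - real T1 ^ 2 + 2 * real N" using q T by simp
  finally have "(2 + 4 * e) * q <= real T2 ^ 2 - real T1 ^ 2 + 2 * real N + 6 * e * real N ^ 2" by simp
  then have "h * ((2 + 4 * e) * q) <= h * (real T2 ^ 2 - real T1 ^ 2 + 2 * real N + 6 * e * real N ^ 2)" using h0 by (intro mult_left_mono) auto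
  then show ?thesis by (simp add: q_def mult_ac)
 qed
 ultimately have "Def <= h * (s * real N ^ 2) + 12 * h * real i0 * real N + h * (real T2 ^ 2 - real T1 ^ 2 + 2 * real N + 6 * e * real N ^ 2)
   - h * (real T2 ^ 2 - real T1 ^ 2 - e * real N ^ 2)" using F1 F2 F3 by linarith
 also have "... = h * (s * real N ^ 2 + 12 * real i0 * real N + 2 * real N + 7 * e * real N ^ 2)" by (simp add: algebra_simps)
 also have "... <= h * (s * real N ^ 2 + 14 * real i0 * real N + 7 * e * real N ^ 2)" using h0 i0 by (intro mult_left_mono) auto
 also have "... = h * real N ^ 2 * (s + 7 * e + 14 * real i0 / real N)" using i0 by (simp add: field_simps power2_eq_square)
 finally show ?thesis unfolding Def_def y_def h_def .
qed

end

section \<open>Sets that are almost invariant under translations\<close>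

context comm_group
begin

text \<open>The size of the symmetric difference of B and its translate by the inverse of g; as a
  function of g it is subadditive and symmetric, a length function on the group.\<close>

definition shift_dist :: "'a set => 'a => nat" where
 "shift_dist B g = card {b\<in>carrier G. (b \<in> B) ~= (g \<otimes> b \<in> B)}"

lemma card_shift:
 assumes "finite (carrier G)" "g \<in> carrier G"
 shows "card {b\<in>carrier G. P (g \<otimes> b)} = card {b\<in>carrier G. P b}"
proof -
 have img: "(%b. g \<otimes> b) ` {b\<in>carrier G. P (g \<otimes> b)} = {b\<in>carrier G. P b}"
 proof (intro equalityI subsetI)
  fix b assume b: "b \<in> {b\<in>carrier G. P b}"
  then have eq: "g \<otimes> (inv g \<otimes> b) = b" using m_assoc[of g "inv g" b] assms by simp
  then have "inv g \<otimes> b \<in> {b\<in>carrier G. P (g \<otimes> b)}" using b assms by simp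
  then have "g \<otimes> (inv g \<otimes> b) \<in> (%b. g \<otimes> b) ` {b\<in>carrier G. P (g \<otimes> b)}" by (rule imageI)
  then show "b \<in> (%b. g \<otimes> b) ` {b\<in>carrier G. P (g \<otimes> b)}" by (simp only: eq)
 qed (use assms in auto)
 have inj: "inj_on (%b. g \<otimes> b) {b\<in>carrier G. P (g \<otimes> b)}" using assms by (intro inj_onI) auto
 show ?thesis using card_image[OF inj] unfolding img by simp
qed

lemma shift_dist_mult:
 assumes "finite (carrier G)" "g \<in> carrier G" "k \<in> carrier G"
 shows "shift_dist B (g \<otimes> k) <= shift_dist B g + shift_dist B k"
proof -
 have "{b\<in>carrier G. (b \<in> B) ~= (g \<otimes> k \<otimes> b \<in> B)} \<subseteq>
   {b\<in>carrier G. (k \<otimes> b \<in> B) ~= (g \<otimes> (k \<otimes> b) \<in> B)} \<union> {b\<in>carrier G. (b \<in> B) ~= (k \<otimes> b \<in> B)}" using assms by (auto simp: m_assoc)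
 then have "shift_dist B (g \<otimes> k) <= card ({b\<in>carrier G. (k \<otimes> b \<in> B) ~= (g \<otimes> (k \<otimes> b) \<in> B)} \<union> {b\<in>carrier G. (b \<in> B) ~= (k \<otimes> b \<in> B)})"
  unfolding shift_dist_def using assms by (intro card_mono) auto
 also have "... <= card {b\<in>carrier G. (k \<otimes> b \<in> B) ~= (g \<otimes> (k \<otimes> b) \<in> B)} + card {b\<in>carrier G. (b \<in> B) ~= (k \<otimes> b \<in> B)}" by (rule card_Un_le)
 also have "card {b\<in>carrier G. (k \<otimes> b \<in> B) ~= (g \<otimes> (k \<otimes> b) \<in> B)} = shift_dist B g" unfolding shift_dist_def by (rule card_shift[OF assms(1,3)])
 finally show ?thesis by (simp add: shift_dist_def)
qed

text \<open>Membership has only two values: if both steps change it, their composition does not.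
  This second triangle inequality shows that two elements moving almost everything have a product
  moving almost nothing.\<close>

lemma shift_dist_mult':
 assumes "finite (carrier G)" "g \<in> carrier G" "k \<in> carrier G"
 shows "shift_dist B (g \<otimes> k) + shift_dist B g + shift_dist B k <= 2 * card (carrier G)"
proof -
 define U where "U = {b\<in>carrier G. (b \<in> B) ~= (k \<otimes> b \<in> B)}"
 define V where "V = {b\<in>carrier G. (k \<otimes> b \<in> B) ~= (g \<otimes> (k \<otimes> b) \<in> B)}"
 have UV: "U \<subseteq> carrier G" "V \<subseteq> carrier G" "finite U" "finite V" using assms(1) by (auto simp: U_def V_def)
 have "{b\<in>carrier G. (b \<in> B) ~= (g \<otimes> k \<otimes> b \<in> B)} \<subseteq> (carrier G - U) \<union> (carrier G - V)" using assms by (auto simp: m_assoc U_def V_def)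
 then have "shift_dist B (g \<otimes> k) <= card ((carrier G - U) \<union> (carrier G - V))" unfolding shift_dist_def using assms by (intro card_mono) auto
 also have "... <= card (carrier G - U) + card (carrier G - V)" by (rule card_Un_le)
 also have "... = (card (carrier G) - card U) + (card (carrier G) - card V)" using UV by (simp add: card_Diff_subset)
 finally have "shift_dist B (g \<otimes> k) <= (card (carrier G) - card U) + (card (carrier G) - card V)" .
 moreover have "card U <= card (carrier G)" "card V <= card (carrier G)" using UV assms(1) by (auto intro: card_mono)
 moreover have "card V = shift_dist B g" unfolding shift_dist_def V_def by (rule card_shift[OF assms(1,3)])
 moreover have "card U = shift_dist B k" by (simp add: U_def shift_dist_def)
 ultimately show ?thesis by linarith
qed

lemma shift_dist_inv:
 assumes "finite (carrier G)" "g \<in> carrier G"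
 shows "shift_dist B (inv g) = shift_dist B g"
proof -
 have "card {b\<in>carrier G. (g \<otimes> b \<in> B) ~= (inv g \<otimes> (g \<otimes> b) \<in> B)} = card {b\<in>carrier G. (b \<in> B) ~= (inv g \<otimes> b \<in> B)}" by (rule card_shift[OF assms])
 moreover have "{b\<in>carrier G. (g \<otimes> b \<in> B) ~= (inv g \<otimes> (g \<otimes> b) \<in> B)} = {b\<in>carrier G. (b \<in> B) ~= (g \<otimes> b \<in> B)}"
 proof -
  have "inv g \<otimes> (g \<otimes> b) = b" if "b \<in> carrier G" for b using m_assoc[of "inv g" g b] assms that by simp
  then show ?thesis by auto
 qed
 ultimately show ?thesis by (simp add: shift_dist_def)
qed

lemma sum_shift_dist:
 assumes "finite (carrier G)" "B \<subseteq> carrier G"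
 shows "(\<Sum>g\<in>carrier G. shift_dist B g) = 2 * card B * (card (carrier G) - card B)"
proof -
 have "(\<Sum>g\<in>carrier G. shift_dist B g) = (\<Sum>g\<in>carrier G. \<Sum>b\<in>{b\<in>carrier G. (b \<in> B) ~= (g \<otimes> b \<in> B)}. 1)" by (simp add: shift_dist_def)
 also have "... = (\<Sum>b\<in>carrier G. \<Sum>g\<in>{g\<in>carrier G. (b \<in> B) ~= (g \<otimes> b \<in> B)}. 1)" using assms by (intro sum.swap_restrict) auto
 also have "... = (\<Sum>b\<in>carrier G. if b \<in> B then card (carrier G) - card B else card B)"
 proof (rule sum.cong[OF refl])
  fix b assume b: "b \<in> carrier G"
  have "card {g\<in>carrier G. (b \<in> B) ~= (g \<otimes> b \<in> B)} = card {g\<in>carrier G. (b \<in> B) ~= (b \<otimes> g \<in> B)}" using b by (intro arg_cong[where f=card]) (auto simp: m_comm)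
  also have "... = card {g\<in>carrier G. (b \<in> B) ~= (g \<in> B)}" by (rule card_shift[OF assms(1) b])
  also have "... = (if b \<in> B then card (carrier G) - card B else card B)"
  proof (cases "b \<in> B")
   case True
   then have "{g\<in>carrier G. (b \<in> B) ~= (g \<in> B)} = carrier G - B" by auto
   then show ?thesis using True assms finite_subset[of B] by (simp add: card_Diff_subset)
  next
   case False
   then have "{g\<in>carrier G. (b \<in> B) ~= (g \<in> B)} = B" using assms by auto
   then show ?thesis using False by simp
  qed
  finally show "(\<Sum>g\<in>{g\<in>carrier G. (b \<in> B) ~= (g \<otimes> b \<in> B)}. 1) = (if b \<in> B then card (carrier G) - card B else card B)" by simp
 qed
 also have "... = card B * (card (carrier G) - card B) + (card (carrier G) - card B) * card B"
 proof -
  have "carrier G \<inter> B = B" "carrier G \<inter> - B = carrier G - B" using assms by auto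
  then show ?thesis using assms finite_subset[of B] by (simp add: sum.If_cases card_Diff_subset)
 qed
 finally show ?thesis by (simp add: algebra_simps)
qed

text \<open>As B is almost half of the group, the mean of \<open>shift_dist B\<close> is almost h /
  2. The set Z already fills nearly half of the group with values near 0, so nearly all other values
  are close to h. Writing an arbitrary g as a product of two typical elements excludes intermediate
  values altogether; then the threshold h / 2 is stable under products, and it is exceeded somewhere
  because the mean is not small.\<close>

lemma near_index_two:
 fixes B Z
 defines "h \<equiv> real (card (carrier G))"
 assumes fin: "finite (carrier G)" and B: "B \<subseteq> carrier G" "4998/10000 * h <= card B" "card B <= 5002/10000 * h"
  and Z: "Z \<subseteq> carrier G" "4995/10000 * h <= card Z" "\<And>g. g \<in> Z ==> shift_dist B g <= 16/10000 * h"
 shows "(\<forall>g\<in>carrier G. \<forall>k\<in>carrier G. shift_dist B g <= h / 2 --> shift_dist B k <= h / 2 --> shift_dist B (g \<otimes> k) <= h / 2)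
   & (\<exists>g\<in>carrier G. shift_dist B g > h / 2)"
proof -
 define d where "d = (%g. real (shift_dist B g))"
 have h0: "h > 0" using fin unfolding h_def by (metis card_gt_0_iff of_nat_0_less_iff one_closed empty_iff)
 have finZ: "finite Z" "finite B" using fin Z B finite_subset by auto
 have dh: "d g <= h" if "g \<in> carrier G" for g unfolding d_def shift_dist_def h_def using fin by (intro of_nat_mono card_mono) auto
 have cBh: "real (card B) <= h" using B(3) h0 by linarith
 have sumd: "(\<Sum>g\<in>carrier G. d g) >= 4995/10000 * h * h"
 proof -
  have "(\<Sum>g\<in>carrier G. d g) = real (2 * card B * (card (carrier G) - card B))" unfolding d_def using sum_shift_dist[OF fin B(1)] by (metis of_nat_sum)
  also have "... = 2 * (real (card B) * (h - real (card B)))" using cBh by (simp add: h_def of_nat_diff)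
  finally have "(\<Sum>g\<in>carrier G. d g) = 2 * (real (card B) * (h - real (card B)))" .
  moreover have "(4998/10000 * h) * (4998/10000 * h) <= real (card B) * (h - real (card B))" using B h0 by (intro mult_mono) auto
  moreover have "(4998/10000 * h) * (4998/10000 * h) = 24980004/100000000 * (h * h)" by simp
  moreover have "h * h >= 0" by simp
  moreover have "4995/10000 * h * h = 4995/10000 * (h * h)" by simp
  ultimately show ?thesis by linarith
 qed
 \<comment> \<open>The exceptional elements. The sum of \<open>h - d g\<close> over the complement
   of Z is small, and each exceptional element outside Z contributes at least h / 16 to it.\<close>
 define N where "N = {g\<in>carrier G. h / 16 < d g & d g < 15/16 * h}"
 have finN: "finite N" using fin by (simp add: N_def)
 have "N \<subseteq> carrier G - Z" using Z(3) h0 by (force simp: N_def d_def)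
 then have "(\<Sum>g\<in>N. h - d g) <= (\<Sum>g\<in>carrier G - Z. h - d g)" using fin dh by (intro sum_mono2) auto
 moreover have "(\<Sum>g\<in>N. h - d g) >= (\<Sum>g\<in>N. h / 16)" by (intro sum_mono) (auto simp: N_def)
 moreover have "(\<Sum>g\<in>carrier G - Z. h - d g) = h * h - h * card Z - (\<Sum>g\<in>carrier G. d g) + (\<Sum>g\<in>Z. d g)"
 proof -
  have "card Z <= card (carrier G)" using Z fin by (intro card_mono)
  then have "real (card (carrier G - Z)) = h - real (card Z)" using Z finZ by (simp add: card_Diff_subset h_def of_nat_diff)
  moreover have "(\<Sum>g\<in>carrier G - Z. d g) = (\<Sum>g\<in>carrier G. d g) - (\<Sum>g\<in>Z. d g)" using Z fin by (intro sum_diff)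
  moreover have "(\<Sum>g\<in>carrier G - Z. h - d g) = real (card (carrier G - Z)) * h - (\<Sum>g\<in>carrier G - Z. d g)" by (simp add: sum_subtractf)
  moreover have "(h - real (card Z)) * h = h * h - h * real (card Z)" by (simp add: algebra_simps)
  ultimately show ?thesis by simp
 qed
 moreover have "(\<Sum>g\<in>Z. d g) <= (\<Sum>g\<in>Z. 16/10000 * h)" using Z(3) by (intro sum_mono) (auto simp: d_def)
 moreover have "(\<Sum>g\<in>Z. 16/10000 * h) <= 16/10000 * h * h"
 proof -
  have "real (card Z) <= h" unfolding h_def using fin Z by (intro of_nat_mono card_mono) auto
  then show ?thesis using h0 by (simp add: mult_right_mono)
 qed
 moreover have "h * (4995/10000 * h) <= h * card Z" using Z h0 by (intro mult_left_mono) auto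
 ultimately have "real (card N) * (h / 16) <= 26/10000 * h * h" using sumd by (simp add: mult_ac)
 then have "h * (real (card N)) <= h * (416/10000 * h)" by simp
 then have cN: "real (card N) <= 416/10000 * h" using h0 by simp
 define Good where "Good = carrier G - N"
 have Good: "d g <= h / 16 \<or> d g >= 15/16 * h" if "g \<in> Good" for g using that by (auto simp: Good_def N_def)
 have dich: "d g <= h / 8 \<or> d g >= 7/8 * h" if g: "g \<in> carrier G" for g
 proof -
  \<comment> \<open>Fewer than half of the elements are exceptional, so the good set and its
    reflection by g intersect.\<close>
  have "\<exists>u\<in>Good. g \<otimes> inv u \<in> Good"
  proof (rule ccontr)
   assume "\<not> ?thesis"
   then have "carrier G \<subseteq> N \<union> {u\<in>carrier G. g \<otimes> inv u \<in> N}" using g by (auto simp: Good_def)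
   then have "card (carrier G) <= card (N \<union> {u\<in>carrier G. g \<otimes> inv u \<in> N})" using fin finN by (intro card_mono) auto
   also have "... <= card N + card {u\<in>carrier G. g \<otimes> inv u \<in> N}" by (rule card_Un_le)
   also have "card {u\<in>carrier G. g \<otimes> inv u \<in> N} <= card N"
   proof (rule card_inj_on_le[of "%u. g \<otimes> inv u"])
    show "inj_on (%u. g \<otimes> inv u) {u\<in>carrier G. g \<otimes> inv u \<in> N}" by (rule inj_on_inverseI[of _ "%u. g \<otimes> inv u"]) (use g div_div_cancel in auto)
   qed (use finN in auto)
   finally have "h <= 2 * real (card N)" by (simp add: h_def)
   with cN h0 show False by linarith
  qed
  then obtain u where u: "u \<in> Good" "g \<otimes> inv u \<in> Good" by auto
  define k where "k = g \<otimes> inv u"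
  have uk: "u \<in> carrier G" "k \<in> carrier G" "g = u \<otimes> k" "k = inv u \<otimes> g" "u = g \<otimes> inv k"
  proof -
   show 1: "u \<in> carrier G" and 2: "k \<in> carrier G" using u by (auto simp: Good_def k_def)
   show "k = inv u \<otimes> g" unfolding k_def using 1 g by (simp add: m_comm)
   show "u = g \<otimes> inv k" unfolding k_def using 1 g by (simp add: div_div_cancel)
   show "g = u \<otimes> k" unfolding k_def using 1 g m_assoc[of u "inv u" g] by (simp add: m_comm[of g "inv u"])
  qed
  have 1: "d g <= d u + d k" using shift_dist_mult[OF fin uk(1,2), of B] by (simp add: d_def uk(3)[symmetric])
  have 2: "d g + d u + d k <= 2 * h" using shift_dist_mult'[OF fin uk(1,2), of B] by (simp add: d_def uk(3)[symmetric] h_def)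
  have 3: "d k <= d u + d g" using shift_dist_mult[OF fin inv_closed[OF uk(1)] g, of B] by (simp add: d_def uk(4)[symmetric] shift_dist_inv[OF fin uk(1)])
  have 4: "d u <= d g + d k" using shift_dist_mult[OF fin g inv_closed[OF uk(2)], of B] by (simp add: d_def uk(5)[symmetric] shift_dist_inv[OF fin uk(2)])
  show ?thesis using Good[OF u(1)] Good[OF u(2)[folded k_def]] 1 2 3 4 h0 by linarith
 qed
 have "d (g \<otimes> k) <= h / 2" if gk: "g \<in> carrier G" "k \<in> carrier G" "d g <= h / 2" "d k <= h / 2" for g k using shift_dist_mult[OF fin gk(1,2), of B] dich[OF gk(1)] dich[OF gk(2)] gk(3,4) h0 by (simp add: d_def)
 moreover have "\<exists>g\<in>carrier G. d g > h / 2"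
 proof (rule ccontr)
  assume "\<not> ?thesis"
  then have "d g <= h / 8" if "g \<in> carrier G" for g using dich[OF that] that h0 by force
  then have "(\<Sum>g\<in>carrier G. d g) <= (\<Sum>g\<in>carrier G. h / 8)" by (intro sum_mono)
  also have "... = 1/8 * (h * h)" by (simp add: h_def)
  finally have "4995/10000 * (h * h) <= 1/8 * (h * h)" using sumd by simp
  moreover have "h * h > 0" using h0 by simp
  ultimately show False by simp
 qed
 ultimately show ?thesis by (auto simp: d_def)
qed

end

section \<open>From a class poor in primes to an almost invariant set\<close>

context selberg_density
begin

text \<open>The ranges of cells fit together in two rounds. A cell in (3M, 4M] and one in (6M, 8M]
  combine to cells inside the upper half (8M, 16M], where the class is assumed poor; two cells in
  (3M, 4M] combine to the range (6M, 8M] of \<open>densJ\<close>, where poverty is then deduced for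
  many further classes.\<close>

definition densA :: "nat => 'a => real" where
 "densA M b = (\<Sum>i\<in>{3 * M<..4 * M}. x b i) / M"

definition densJ :: "nat => 'a => real" where
 "densJ M b = (\<Sum>i\<in>{6 * M<..8 * M}. x b i) / (2 * M)"

lemma dens_bounds:
 assumes "N = 16 * M" "i0 <= 3 * M" "b \<in> carrier G"
 shows "0 <= densA M b" "densA M b <= 2 + e" "0 <= densJ M b" "densJ M b <= 2 + e"
proof -
 have M: "real M > 0" using assms i0 by (auto intro!: Nat.gr0I)
 show "0 <= densA M b" "0 <= densJ M b" unfolding densA_def densJ_def using assms by (auto intro!: divide_nonneg_nonneg sum_nonneg nonneg)
 have "(\<Sum>i\<in>{3 * M<..4 * M}. x b i) <= (\<Sum>i\<in>{3 * M<..4 * M}. 2 + e)" using assms by (intro sum_mono upper) auto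
 then show "densA M b <= 2 + e" unfolding densA_def using M by (simp add: pos_divide_le_eq mult.commute)
 have "(\<Sum>i\<in>{6 * M<..8 * M}. x b i) <= (\<Sum>i\<in>{6 * M<..8 * M}. 2 + e)" using assms by (intro sum_mono upper) auto
 then show "densJ M b <= 2 + e" unfolding densJ_def using M by (simp add: pos_divide_le_eq mult.commute)
qed

lemma sum_densA:
 assumes "N = 16 * M" "i0 <= 3 * M"
 shows "(1 - e) * card (carrier G) <= (\<Sum>b\<in>carrier G. densA M b)" "(\<Sum>b\<in>carrier G. densA M b) <= (1 + e) * card (carrier G)"
proof -
 have M: "real M > 0" using assms i0 by (auto intro!: Nat.gr0I)
 have eq: "(\<Sum>b\<in>carrier G. densA M b) = (\<Sum>i\<in>{3 * M<..4 * M}. \<Sum>b\<in>carrier G. x b i) / M" unfolding densA_def by (subst sum.swap) (simp add: sum_divide_distrib)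
 have "(\<Sum>i\<in>{3 * M<..4 * M}. \<Sum>b\<in>carrier G. x b i) <= (\<Sum>i\<in>{3 * M<..4 * M}. (1 + e) * card (carrier G))" using assms by (intro sum_mono avg_upper) auto
 then show "(\<Sum>b\<in>carrier G. densA M b) <= (1 + e) * card (carrier G)" unfolding eq using M by (simp add: pos_divide_le_eq mult_ac)
 have "(\<Sum>i\<in>{3 * M<..4 * M}. \<Sum>b\<in>carrier G. x b i) >= (\<Sum>i\<in>{3 * M<..4 * M}. (1 - e) * card (carrier G))" using assms by (intro sum_mono avg_lower) auto
 then show "(1 - e) * card (carrier G) <= (\<Sum>b\<in>carrier G. densA M b)" unfolding eq using M by (simp add: pos_le_divide_eq mult_ac)
qed

lemma bad_class_deficiency:
 fixes s :: real
 assumes M: "N = 16 * M" "i0 <= M" and c: "c \<in> carrier G"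
  and small: "(\<Sum>i\<in>{8 * M<..16 * M}. x c i) <= s * N"
 shows "(\<Sum>b\<in>carrier G. densA M b * (2 + e - densJ M (c \<otimes> inv b)) + densJ M (c \<otimes> inv b) * (2 + e - densA M b))
   <= 256 * (s + 7 * e + 14 * real i0 / real N) * card (carrier G)"
proof -
 define E where "E = s + 7 * e + 14 * real i0 / real N"
 have M0: "real M > 0" using M i0 by (auto intro!: Nat.gr0I)
 have "(\<Sum>b\<in>carrier G. (\<Sum>i\<in>{3 * M<..4 * M}. x b i) * ((2 + e) * (real (8 * M) - real (6 * M)) - (\<Sum>j\<in>{6 * M<..8 * M}. x (c \<otimes> inv b) j)))
   <= card (carrier G) * real N ^ 2 * E" unfolding E_def by (rule window_deficiency[OF c, of "8 * M" "16 * M"]) (use M small in auto)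
 also have "(\<Sum>b\<in>carrier G. (\<Sum>i\<in>{3 * M<..4 * M}. x b i) * ((2 + e) * (real (8 * M) - real (6 * M)) - (\<Sum>j\<in>{6 * M<..8 * M}. x (c \<otimes> inv b) j)))
   = 2 * real M ^ 2 * (\<Sum>b\<in>carrier G. densA M b * (2 + e - densJ M (c \<otimes> inv b)))" unfolding sum_distrib_left densA_def densJ_def using M0 by (intro sum.cong refl) (simp add: field_simps power2_eq_square)
 finally have 1: "(\<Sum>b\<in>carrier G. densA M b * (2 + e - densJ M (c \<otimes> inv b))) <= 128 * E * card (carrier G)" using M0 M by (simp add: power_mult_distrib mult_ac)
 have "(\<Sum>b\<in>carrier G. (\<Sum>i\<in>{6 * M<..8 * M}. x b i) * ((2 + e) * (real (4 * M) - real (3 * M)) - (\<Sum>j\<in>{3 * M<..4 * M}. x (c \<otimes> inv b) j)))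
   <= card (carrier G) * real N ^ 2 * E" unfolding E_def by (rule window_deficiency[OF c, of "8 * M" "16 * M"]) (use M small in auto)
 also have "(\<Sum>b\<in>carrier G. (\<Sum>i\<in>{6 * M<..8 * M}. x b i) * ((2 + e) * (real (4 * M) - real (3 * M)) - (\<Sum>j\<in>{3 * M<..4 * M}. x (c \<otimes> inv b) j)))
   = 2 * real M ^ 2 * (\<Sum>b\<in>carrier G. densJ M b * (2 + e - densA M (c \<otimes> inv b)))" unfolding sum_distrib_left densA_def densJ_def using M0 by (intro sum.cong refl) (simp add: field_simps power2_eq_square)
 finally have "(\<Sum>b\<in>carrier G. densJ M b * (2 + e - densA M (c \<otimes> inv b))) <= 128 * E * card (carrier G)" using M0 M by (simp add: power_mult_distrib mult_ac)
 then have 2: "(\<Sum>b\<in>carrier G. densJ M (c \<otimes> inv b) * (2 + e - densA M b)) <= 128 * E * card (carrier G)" using sum_div_reindex[OF c, of "%u b. densJ M u * (2 + e - densA M b)"] by simp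
 show ?thesis using 1 2 unfolding E_def [symmetric] by (simp add: sum.distrib)
qed

lemma half_scale_deficiency:
 fixes s :: real
 assumes M: "N = 16 * M" "i0 <= M" and c: "c \<in> carrier G"
  and small: "densJ M c <= s"
 shows "(\<Sum>b\<in>carrier G. densA M b * (2 + e - densA M (c \<otimes> inv b)))
   <= 256 * (s / 8 + 7 * e + 14 * real i0 / real N) * card (carrier G)"
proof -
 define E where "E = s / 8 + 7 * e + 14 * real i0 / real N"
 have M0: "real M > 0" using M i0 by (auto intro!: Nat.gr0I)
 have small': "(\<Sum>i\<in>{6 * M<..8 * M}. x c i) <= s / 8 * N" using small M0 M by (simp add: densJ_def pos_divide_le_eq)
 have "(\<Sum>b\<in>carrier G. (\<Sum>i\<in>{3 * M<..4 * M}. x b i) * ((2 + e) * (real (4 * M) - real (3 * M)) - (\<Sum>j\<in>{3 * M<..4 * M}. x (c \<otimes> inv b) j)))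
   <= card (carrier G) * real N ^ 2 * E" unfolding E_def by (rule window_deficiency[OF c, of "6 * M" "8 * M"]) (use M small' in auto)
 also have "(\<Sum>b\<in>carrier G. (\<Sum>i\<in>{3 * M<..4 * M}. x b i) * ((2 + e) * (real (4 * M) - real (3 * M)) - (\<Sum>j\<in>{3 * M<..4 * M}. x (c \<otimes> inv b) j)))
   = real M ^ 2 * (\<Sum>b\<in>carrier G. densA M b * (2 + e - densA M (c \<otimes> inv b)))" unfolding sum_distrib_left densA_def using M0 by (intro sum.cong refl) (simp add: field_simps power2_eq_square)
 finally show ?thesis unfolding E_def [symmetric] using M0 M by (simp add: power_mult_distrib mult_ac)
qed

text \<open>With u = densA b and v = densJ (c / b), the products u (2 + e - v) and v (2 + e - u)
  have a small mean, so by Markov's inequality both are tiny outside a set X of relative size 10^-4.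
  This forces u and v to lie both near 0 or both near 2.\<close>

lemma exceptional_classes:
 assumes M: "N = 16 * M" "i0 <= M" and c: "c \<in> carrier G"
  and small: "(\<Sum>i\<in>{8 * M<..16 * M}. x c i) <= N / 10^12" and err: "7 * e + 14 * real i0 / real N <= 1 / 10^13"
 shows "\<exists>X\<subseteq>carrier G. card X <= card (carrier G) / 10^4 & (\<forall>b\<in>carrier G - X.
   densA M b <= 1/10^5 & densJ M (c \<otimes> inv b) <= 1/10^5 \<or> densA M b >= 2 - 1/10^5)"
proof -
 define h where "h = real (card (carrier G))"
 define d where "d = (%b. densA M b * (2 + e - densJ M (c \<otimes> inv b)) + densJ M (c \<otimes> inv b) * (2 + e - densA M b))"
 have bd: "0 <= densA M b" "densA M b <= 2 + e" "0 <= densJ M (c \<otimes> inv b)" "densJ M (c \<otimes> inv b) <= 2 + e" if "b \<in> carrier G" for b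
  using that c M dens_bounds[of M b] dens_bounds[of M "c \<otimes> inv b"] by auto
 have d0: "d b >= 0" if "b \<in> carrier G" for b unfolding d_def using bd[OF that] by (intro add_nonneg_nonneg mult_nonneg_nonneg) auto
 have "(\<Sum>b\<in>carrier G. d b) <= 256 * (1 / 10^12 + 7 * e + 14 * real i0 / real N) * h" unfolding d_def h_def by (rule bad_class_deficiency[OF M c]) (use small in simp)
 also have "... <= (1 / 10^9) * h" using err by (intro mult_right_mono) (auto simp: h_def)
 finally have sumd: "(\<Sum>b\<in>carrier G. d b) <= (1 / 10^9) * h" .
 define X where "X = {b\<in>carrier G. d b > 1/10^5}"
 have "(\<Sum>b\<in>X. 1/10^5) <= (\<Sum>b\<in>X. d b)" by (intro sum_mono) (auto simp: X_def)
 also have "... <= (\<Sum>b\<in>carrier G. d b)" using fin d0 by (intro sum_mono2) (auto simp: X_def)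
 finally have "real (card X) <= h / 10^4" using sumd by simp
 moreover have "densA M b <= 1/10^5 & densJ M (c \<otimes> inv b) <= 1/10^5 \<or> densA M b >= 2 - 1/10^5" if b: "b \<in> carrier G - X" for b
 proof -
  have bc: "b \<in> carrier G" and db: "d b <= 1/10^5" using b by (auto simp: X_def)
  define u v where "u = densA M b" and "v = densJ M (c \<otimes> inv b)"
  have uv: "0 <= u" "u <= 2 + e" "0 <= v" "v <= 2 + e" using bd[OF bc] by (auto simp: u_def v_def)
  have 1: "u * (2 + e - v) <= 1/10^5" and 2: "v * (2 + e - u) <= 1/10^5"
  proof -
   have "u * (2 + e - v) >= 0" "v * (2 + e - u) >= 0" using uv by auto
   then show "u * (2 + e - v) <= 1/10^5" "v * (2 + e - u) <= 1/10^5" using db by (auto simp: d_def u_def v_def)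
  qed
  show ?thesis
  proof (cases "u <= 1")
   case True
   have "v * 1 <= v * (2 + e - u)" using True uv e by (intro mult_left_mono) auto
   then have v: "v <= 1/10^5" using 2 by simp
   then have "u * 1 <= u * (2 + e - v)" using uv e by (intro mult_left_mono) auto
   then have "u <= 1/10^5" using 1 by simp
   then show ?thesis using v by (simp add: u_def v_def)
  next
   case False
   then have "1 * (2 + e - v) <= u * (2 + e - v)" using uv by (intro mult_right_mono) auto
   then have "v >= 1" using 1 e by simp
   then have "1 * (2 + e - u) <= v * (2 + e - u)" using uv by (intro mult_right_mono) auto
   then have "u >= 2 - 1/10^5" using 2 e by simp
   then show ?thesis by (simp add: u_def)
  qed
 qed
 ultimately show ?thesis unfolding h_def by (intro exI[of _ X]) (auto simp: X_def)
qed

text \<open>The densities are almost 0 or almost 2 with mean 1, so B is about half of the group. For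
  b outside B the class u = c / b is itself poor at the half scale, and
  \<open>half_scale_deficiency\<close> shows that the reflection b -> u / b nearly preserves B.
  Quotients of two such reflections are translations nearly preserving B, and there are enough of
  them for \<open>near_index_two\<close>.\<close>

lemma bad_class_index_two:
 assumes M: "N = 16 * M" "i0 <= M" and c: "c \<in> carrier G"
  and small: "(\<Sum>i\<in>{8 * M<..16 * M}. x c i) <= N / 10^12" and err: "7 * e + 14 * real i0 / real N <= 1 / 10^13"
 defines "B \<equiv> {b\<in>carrier G. densA M b > 1}" and "h \<equiv> real (card (carrier G))"
 shows "(\<forall>g\<in>carrier G. \<forall>k\<in>carrier G. shift_dist B g <= h / 2 --> shift_dist B k <= h / 2 --> shift_dist B (g \<otimes> k) <= h / 2)
   & (\<exists>g\<in>carrier G. shift_dist B g > h / 2)"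
proof -
 obtain X where X: "X \<subseteq> carrier G" "card X <= h / 10^4"
  "\<And>b. b \<in> carrier G ==> b \<notin> X ==> densA M b <= 1/10^5 & densJ M (c \<otimes> inv b) <= 1/10^5 \<or> densA M b >= 2 - 1/10^5" using exceptional_classes[OF M c small err] unfolding h_def by auto
 have h0: "h > 0" using card_pos by (simp add: h_def)
 have finB: "finite B" "finite X" using fin X finite_subset by (auto simp: B_def)
 have i0N: "14 * real i0 / real N >= 0" by simp
 have e13: "e <= 1/10^13" using err i0N e by linarith
 have M3: "i0 <= 3 * M" using M by simp
 note bd = dens_bounds[OF M(1) M3]
 define a where "a = densA M"
 have Bsub: "B \<subseteq> carrier G" by (auto simp: B_def)
 have upB: "real (card B) <= 5002/10000 * h"
 proof -
  have "card B - card X <= card (B - X)" using finB by (intro diff_card_le_card_Diff)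
  then have "real (card B) - real (card X) <= real (card (B - X))" by linarith
  moreover have "real (card (B - X)) * (199999/100000) <= (\<Sum>b\<in>carrier G. a b)"
  proof -
   have "(\<Sum>b\<in>B - X. 2 - 1/10^5) <= (\<Sum>b\<in>B - X. a b)" using X(3) by (intro sum_mono) (force simp: B_def a_def)
   also have "... <= (\<Sum>b\<in>carrier G. a b)" using fin bd by (intro sum_mono2) (auto simp: B_def a_def)
   finally show ?thesis by simp
  qed
  moreover have "(\<Sum>b\<in>carrier G. a b) <= (1 + e) * h" unfolding a_def h_def by (rule sum_densA[OF M(1) M3])
  moreover have "(1 + e) * h <= 100001/100000 * h" using e13 h0 by (intro mult_right_mono) auto
  moreover have "h / 10^4 = h / 10000" by simp
  ultimately show ?thesis using X(2) h0 by linarith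
 qed
 have loB: "real (card B) >= 4998/10000 * h"
 proof -
  have "(\<Sum>b\<in>carrier G. a b) <= (\<Sum>b\<in>carrier G. (if b \<in> B then 2 + e else 0) + (if b \<in> X then 3 else 0) + 1/10^5)"
  proof (rule sum_mono)
   fix b assume b: "b \<in> carrier G"
   show "a b <= (if b \<in> B then 2 + e else 0) + (if b \<in> X then 3 else 0) + 1/10^5" using bd[OF b] X(3)[OF b] e b by (auto simp: B_def a_def)
  qed
  also have "... = (2 + e) * card B + 3 * card X + h / 10^5"
  proof -
   have "carrier G \<inter> {b. b \<in> B} = B" "carrier G \<inter> {b. b \<in> X} = X" using X Bsub by auto
   then show ?thesis using fin by (simp add: sum.distrib sum.If_cases h_def mult.commute)
  qed
  also have "(2 + e) * card B <= 200001/100000 * card B" using e13 by (intro mult_right_mono) auto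
  finally have "(\<Sum>b\<in>carrier G. a b) <= 200001/100000 * card B + 3 * card X + h / 100000" by simp
  moreover have "(1 - e) * h <= (\<Sum>b\<in>carrier G. a b)" unfolding a_def h_def by (rule sum_densA[OF M(1) M3])
  moreover have "99999/100000 * h <= (1 - e) * h" using e13 h0 by (intro mult_right_mono) auto
  moreover have "h / 10^4 = h / 10000" by simp
  ultimately show ?thesis using X(2) h0 upB by linarith
 qed
 define Y where "Y = {u\<in>carrier G. densJ M u <= 1/10^5}"
 have cY: "real (card Y) >= 4995/10000 * h"
 proof -
  have "card (carrier G - (B \<union> X)) <= card Y"
  proof (rule card_inj_on_le[of "%b. c \<otimes> inv b"])
   show "inj_on (%u. c \<otimes> inv u) (carrier G - (B \<union> X))" by (rule inj_on_inverseI[of _ "%u. c \<otimes> inv u"]) (use c div_div_cancel in auto)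
   show "(%b. c \<otimes> inv b) ` (carrier G - (B \<union> X)) \<subseteq> Y" using X(3) c by (force simp: Y_def B_def)
  qed (use fin in \<open>auto simp: Y_def\<close>)
  moreover have "card (carrier G) - card (B \<union> X) <= card (carrier G - (B \<union> X))" by (rule diff_card_le_card_Diff) (use finB in auto)
  moreover have "card (B \<union> X) <= card B + card X" by (rule card_Un_le)
  ultimately have "h <= real (card Y) + real (card B) + real (card X)" unfolding h_def by linarith
  moreover have "h / 10^4 = h / 10000" by simp
  ultimately show ?thesis using upB X(2) h0 by linarith
 qed
 \<comment> \<open>A point b of B reflected outside B contributes at least 1 to the deficiency of u.
   The reflection is an involution, so the points moved in the other direction are no more
   numerous.\<close>
 have near: "real (card {b\<in>carrier G. (b \<in> B) ~= (u \<otimes> inv b \<in> B)}) <= 8/10000 * h" if u: "u \<in> Y" for u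
 proof -
  have uc: "u \<in> carrier G" using u by (simp add: Y_def)
  define V where "V = {b\<in>carrier G. b \<in> B & u \<otimes> inv b \<notin> B}"
  have "(\<Sum>b\<in>V. 1) <= (\<Sum>b\<in>V. a b * (2 + e - a (u \<otimes> inv b)))"
  proof (rule sum_mono)
   fix b assume b: "b \<in> V"
   then have "a b >= 1" "a (u \<otimes> inv b) <= 1" using uc by (auto simp: V_def B_def a_def)
   then have "1 * 1 <= a b * (2 + e - a (u \<otimes> inv b))" using e by (intro mult_mono) auto
   then show "1 <= a b * (2 + e - a (u \<otimes> inv b))" by simp
  qed
  also have "... <= (\<Sum>b\<in>carrier G. a b * (2 + e - a (u \<otimes> inv b)))" using fin bd uc by (intro sum_mono2 mult_nonneg_nonneg) (auto simp: V_def a_def)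
  also have "... <= 256 * ((1/10^5) / 8 + 7 * e + 14 * real i0 / real N) * h" unfolding a_def h_def by (rule half_scale_deficiency[OF M uc]) (use u in \<open>simp add: Y_def\<close>)
  also have "... <= 4/10000 * h" using err h0 by (intro mult_right_mono) auto
  finally have V: "real (card V) <= 4/10000 * h" by simp
  define V' where "V' = {b\<in>carrier G. b \<notin> B & u \<otimes> inv b \<in> B}"
  have "card V' <= card V"
  proof (rule card_inj_on_le[of "%b. u \<otimes> inv b"])
   show "inj_on (%b. u \<otimes> inv b) V'" by (rule inj_on_inverseI[of _ "%b. u \<otimes> inv b"]) (use uc div_div_cancel in \<open>auto simp: V'_def\<close>)
   show "(%b. u \<otimes> inv b) ` V' \<subseteq> V" using uc div_div_cancel by (auto simp: V_def V'_def)
  qed (use fin in \<open>auto simp: V_def\<close>)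
  moreover have "{b\<in>carrier G. (b \<in> B) ~= (u \<otimes> inv b \<in> B)} = V \<union> V'" by (auto simp: V_def V'_def)
  then have "card {b\<in>carrier G. (b \<in> B) ~= (u \<otimes> inv b \<in> B)} <= card V + card V'" by (simp add: card_Un_le)
  ultimately show ?thesis using V by linarith
 qed
 have "Y ~= {}" using cY h0 by auto
 then obtain w where w: "w \<in> Y" by auto
 then have wc: "w \<in> carrier G" by (simp add: Y_def)
 \<comment> \<open>Composing the reflections by u and by one fixed w gives the translation by u / w,
   so twice the bound for reflections applies.\<close>
 define Z where "Z = (%u. u \<otimes> inv w) ` Y"
 have "card Z = card Y" unfolding Z_def by (intro card_image inj_onI) (use wc in \<open>auto simp: Y_def\<close>)
 moreover have "shift_dist B g <= 16/10000 * h" if "g \<in> Z" for g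
 proof -
  obtain u where u: "u \<in> Y" "g = u \<otimes> inv w" using \<open>g \<in> Z\<close> by (auto simp: Z_def)
  have uc: "u \<in> carrier G" and gc: "g \<in> carrier G" using u wc by (auto simp: Y_def)
  have eq: "u \<otimes> inv (w \<otimes> inv b) = g \<otimes> b" if "b \<in> carrier G" for b using that uc wc u by (simp add: inv_mult m_assoc)
  have "{b\<in>carrier G. (b \<in> B) ~= (g \<otimes> b \<in> B)} \<subseteq> {b\<in>carrier G. (b \<in> B) ~= (w \<otimes> inv b \<in> B)} \<union>
    {b\<in>carrier G. (w \<otimes> inv b \<in> B) ~= (u \<otimes> inv (w \<otimes> inv b) \<in> B)}" using eq by auto
  then have "shift_dist B g <= card ({b\<in>carrier G. (b \<in> B) ~= (w \<otimes> inv b \<in> B)} \<union>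
    {b\<in>carrier G. (w \<otimes> inv b \<in> B) ~= (u \<otimes> inv (w \<otimes> inv b) \<in> B)})" unfolding shift_dist_def using fin by (intro card_mono) auto
  also have "... <= card {b\<in>carrier G. (b \<in> B) ~= (w \<otimes> inv b \<in> B)} +
    card {b\<in>carrier G. (w \<otimes> inv b \<in> B) ~= (u \<otimes> inv (w \<otimes> inv b) \<in> B)}" by (rule card_Un_le)
  also have "card {b\<in>carrier G. (w \<otimes> inv b \<in> B) ~= (u \<otimes> inv (w \<otimes> inv b) \<in> B)} <= card {b\<in>carrier G. (b \<in> B) ~= (u \<otimes> inv b \<in> B)}"
  proof (rule card_inj_on_le[of "%b. w \<otimes> inv b"])
   show "inj_on (%b. w \<otimes> inv b) {b\<in>carrier G. (w \<otimes> inv b \<in> B) ~= (u \<otimes> inv (w \<otimes> inv b) \<in> B)}" by (rule inj_on_inverseI[of _ "%b. w \<otimes> inv b"]) (use wc div_div_cancel in auto)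
  qed (use fin wc in auto)
  finally have "real (shift_dist B g) <= real (card {b\<in>carrier G. (b \<in> B) ~= (w \<otimes> inv b \<in> B)}) + real (card {b\<in>carrier G. (b \<in> B) ~= (u \<otimes> inv b \<in> B)})" by linarith
  then show ?thesis using near[OF w] near[OF u(1)] by linarith
 qed
 moreover have "Z \<subseteq> carrier G" using wc by (auto simp: Z_def Y_def)
 ultimately show ?thesis unfolding h_def using cY loB upB fin Bsub by (intro near_index_two[of B Z]) (auto simp: h_def)
qed

end

section \<open>Selberg's formula in residue classes\<close>

definition moebius_mu :: "nat => real" where
 "moebius_mu n = (if \<Prod>(prime_factors n) = n then (-1) ^ card (prime_factors n) else 0)"

lemma abs_moebius_mu_le: "\<bar>moebius_mu n\<bar> <= 1"
 unfolding moebius_mu_def by (simp add: power_abs del: abs_le_iff)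

lemma prime_factors_prod_primes:
 assumes "finite A" "\<And>p. p \<in> A ==> prime (p::nat)"
 shows "prime_factors (\<Prod>A) = A"
proof -
 have pos: "\<Prod>A > 0" using assms(2) by (rule prod_primes_pos)
 show ?thesis
 proof (intro equalityI subsetI)
  fix p assume "p \<in> prime_factors (\<Prod>A)"
  then show "p \<in> A" using assms by (intro prime_dvd_prod_primes[of A p]) auto
 next
  fix p assume p: "p \<in> A"
  then have "p dvd \<Prod>A" using assms by (intro dvd_prodI) auto
  then show "p \<in> prime_factors (\<Prod>A)" using assms(2)[OF p] pos by (intro prime_factorsI) auto
 qed
qed

lemma sum_moebius_mu_divisors:
 assumes "n > 0"
 shows "(\<Sum>d | d dvd n. moebius_mu d) = (if n = 1 then 1 else 0)"
proof -
 let ?P = "prime_factors n"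
 have P: "finite A" "\<And>p. p \<in> A ==> prime p" if "A \<subseteq> ?P" for A using that finite_subset[of A ?P] by auto
 have dvd: "\<Prod>A dvd n" if "A \<subseteq> ?P" for A
 proof -
  have "\<Prod>A dvd \<Prod>?P" using that by (intro prod_dvd_prod_subset) auto
  also have "... dvd (\<Prod>p\<in>?P. p ^ multiplicity p n)" by (intro prod_dvd_prod dvd_power) (auto simp: prime_factors_multiplicity)
  also have "... = n" using prime_factorization_nat[OF assms] by simp
  finally show ?thesis .
 qed
 have "(\<Sum>d | d dvd n. moebius_mu d) = (\<Sum>d\<in>(%A. \<Prod>A) ` Pow ?P. moebius_mu d)"
 proof (rule sum.mono_neutral_right)
  show "\<forall>d\<in>{d. d dvd n} - (%A. \<Prod>A) ` Pow ?P. moebius_mu d = 0"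
  proof
   fix d assume d: "d \<in> {d. d dvd n} - (%A. \<Prod>A) ` Pow ?P"
   then have "prime_factors d \<subseteq> ?P" using assms by (intro dvd_prime_factors) auto
   then have "\<Prod>(prime_factors d) ~= d" using d by (metis DiffD2 PowI imageI)
   then show "moebius_mu d = 0" by (simp add: moebius_mu_def)
  qed
 qed (use assms dvd in auto)
 also have "... = (\<Sum>A\<in>Pow ?P. moebius_mu (\<Prod>A))" using P by (intro sum.reindex[unfolded o_def] inj_on_prod_primes) auto
 also have "... = (\<Sum>A\<in>Pow ?P. (-1) ^ card A)" using P by (intro sum.cong refl) (simp add: moebius_mu_def prime_factors_prod_primes)
 also have "... = (\<Prod>p\<in>?P. 1 - 1)" using prod_diff_conv_sum[of ?P "%_. 1::real" "%_. 1"] by simp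
 also have "... = (if n = 1 then 1 else 0)"
 proof (cases "n = 1")
  case False
  then obtain p where "prime p" "p dvd n" using prime_factor_nat by blast
  then have "p \<in> ?P" using assms by (intro prime_factorsI) auto
  then have "?P ~= {}" by blast
  then have "card ?P > 0" by (simp add: card_gt_0_iff)
  then have "(\<Prod>p\<in>?P. 1 - 1 :: real) = 0" by (simp only: prod_constant power_0_left) simp
  then show ?thesis using False by simp
 qed simp
 finally show ?thesis .
qed

lemma sum_divisors_flip: "n > 0 ==> (\<Sum>d | d dvd n. f d (n div d)) = (\<Sum>d | d dvd n. f (n div d) (d::nat))"
 by (rule sum.reindex_bij_witness[of _ "%d. n div d" "%d. n div d"])
   (auto intro: dvd_div_eq_mult div_dvd_iff_mult elim!: dvdE)

lemma sum_divisors_swap: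
 assumes "n > (0::nat)"
 shows "(\<Sum>e | e dvd n. \<Sum>d | d dvd e. F d (e div d)) = (\<Sum>d | d dvd n. \<Sum>k | k dvd n div d. F d k)"
proof -
 have "(\<Sum>e | e dvd n. \<Sum>d | d dvd e. F d (e div d)) = (\<Sum>e | e dvd n. \<Sum>d\<in>{d. d \<in> {d. d dvd n} & d dvd e}. F d (e div d))" by (intro sum.cong refl) (auto intro: dvd_trans)
 also have "... = (\<Sum>d | d dvd n. \<Sum>e\<in>{e. e \<in> {e. e dvd n} & d dvd e}. F d (e div d))" using assms by (intro sum.swap_restrict) auto
 also have "... = (\<Sum>d | d dvd n. \<Sum>k | k dvd n div d. F d k)"
 proof (rule sum.cong[OF refl])
  fix d assume "d \<in> {d. d dvd n}"
  then obtain k where k: "n = d * k" "d > 0" "k > 0" using assms by (auto elim!: dvdE intro!: Nat.gr0I)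
  show "(\<Sum>e\<in>{e. e \<in> {e. e dvd n} & d dvd e}. F d (e div d)) = (\<Sum>k | k dvd n div d. F d k)" by (rule sum.reindex_bij_witness[of _ "%k. d * k" "%e. e div d"]) (use k in \<open>auto elim!: dvdE\<close>)
 qed
 finally show ?thesis .
qed

text \<open>Selberg's generalised von Mangoldt function of order two, the Dirichlet convolution of
  the Moebius function with the squared logarithm. Its second summand counts products of two
  primes.\<close>

definition mangoldt2 :: "nat => real" where
 "mangoldt2 n = mangoldt n * ln (real n) + (\<Sum>d | d dvd n. mangoldt d * mangoldt (n div d))"

lemma sum_mangoldt2:
 assumes "n > 0"
 shows "(\<Sum>e | e dvd n. mangoldt2 e) = (ln (real n))\<^sup>2"
proof -
 have "(\<Sum>e | e dvd n. \<Sum>d | d dvd e. mangoldt d * mangoldt (e div d) :: real) =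
   (\<Sum>d | d dvd n. \<Sum>k | k dvd n div d. mangoldt d * mangoldt k)" by (rule sum_divisors_swap[OF assms])
 also have "... = (\<Sum>d | d dvd n. mangoldt d * ln (real (n div d)))"
 proof (rule sum.cong[OF refl])
  fix d assume "d \<in> {d. d dvd n}"
  then have "n div d > 0" using assms by (auto elim!: dvdE)
  then have "(\<Sum>k | k dvd n div d. mangoldt k :: real) = ln (real (n div d))" using mangoldt_sum[of "n div d", where 'a = real] by simp
  then show "(\<Sum>k | k dvd n div d. mangoldt d * mangoldt k) = mangoldt d * ln (real (n div d))" by (simp flip: sum_distrib_left)
 qed
 finally have "(\<Sum>e | e dvd n. mangoldt2 e) = (\<Sum>d | d dvd n. mangoldt d * ln (real d) + mangoldt d * ln (real (n div d)))" by (simp add: mangoldt2_def sum.distrib)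
 also have "... = (\<Sum>d | d dvd n. mangoldt d * ln (real n))"
 proof (rule sum.cong[OF refl])
  fix d assume "d \<in> {d. d dvd n}"
  then obtain k where k: "n = d * k" "d > 0" "k > 0" using assms by (auto elim!: dvdE intro!: Nat.gr0I)
  then show "mangoldt d * ln (real d) + mangoldt d * ln (real (n div d)) = (mangoldt d * ln (real n) :: real)" by (simp add: ln_mult distrib_left)
 qed
 also have "... = (ln (real n))\<^sup>2" using mangoldt_sum[of n, where 'a = real] assms by (simp flip: sum_distrib_right add: power2_eq_square)
 finally show ?thesis .
qed

lemma mangoldt2_conv_moebius_mu:
 assumes "n > 0"
 shows "mangoldt2 n = (\<Sum>d | d dvd n. moebius_mu d * (ln (real (n div d)))\<^sup>2)"
proof -
 have "(\<Sum>d | d dvd n. moebius_mu d * (ln (real (n div d)))\<^sup>2) = (\<Sum>d | d dvd n. \<Sum>e | e dvd n div d. moebius_mu d * mangoldt2 e)"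
 proof (rule sum.cong[OF refl])
  fix d assume "d \<in> {d. d dvd n}"
  then have "n div d > 0" using assms by (auto elim!: dvdE)
  then show "moebius_mu d * (ln (real (n div d)))\<^sup>2 = (\<Sum>e | e dvd n div d. moebius_mu d * mangoldt2 e)" by (simp add: sum_mangoldt2 flip: sum_distrib_left)
 qed
 also have "... = (\<Sum>m | m dvd n. \<Sum>d | d dvd m. moebius_mu d * mangoldt2 (m div d))" by (rule sum_divisors_swap[OF assms, symmetric])
 also have "... = (\<Sum>m | m dvd n. \<Sum>e | e dvd m. moebius_mu (m div e) * mangoldt2 e)" using assms by (intro sum.cong refl sum_divisors_flip[of _ "%d e. moebius_mu d * mangoldt2 e"]) (auto intro: Nat.gr0I)
 also have "... = (\<Sum>e | e dvd n. \<Sum>d | d dvd n div e. moebius_mu d * mangoldt2 e)" by (rule sum_divisors_swap[OF assms, of "%e d. moebius_mu d * mangoldt2 e"])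
 also have "... = (\<Sum>e | e dvd n. if e = n then mangoldt2 e else 0)"
 proof (rule sum.cong[OF refl])
  fix e assume "e \<in> {e. e dvd n}"
  then obtain k where k: "n = e * k" "e > 0" "k > 0" using assms by (auto elim!: dvdE intro!: Nat.gr0I)
  then have "(\<Sum>d | d dvd n div e. moebius_mu d) = (if e = n then 1 else 0)" using sum_moebius_mu_divisors[of "n div e"] by auto
  then show "(\<Sum>d | d dvd n div e. moebius_mu d * mangoldt2 e) = (if e = n then mangoldt2 e else 0)" by (simp flip: sum_distrib_right)
 qed
 also have "... = mangoldt2 n" using assms by simp
 finally show ?thesis ..
qed

section \<open>Rough numbers and the group of units modulo Q\<close>

definition rough :: "real => nat => bool" where
 "rough w n \<longleftrightarrow> n > 0 & (\<forall>p. prime p --> p dvd n --> w < real p)"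

lemma rough_pos: "rough w n ==> n > 0"
 by (simp add: rough_def)

lemma rough_mult_iff: "rough w (a * b) \<longleftrightarrow> rough w a & rough w b"
 by (auto simp: rough_def prime_dvd_mult_iff)

text \<open>Reduced classes are represented by their least residues. The unit is
  \<open>1 mod Q\<close> rather than 1 so that Q = 1, the empty product of primes, gives the trivial
  group with element 0.\<close>

definition residue_units :: "nat => nat monoid" where
 "residue_units Q = \<lparr>carrier = {a. a < Q & coprime a Q}, mult = (%a b. (a * b) mod Q), one = 1 mod Q\<rparr>"

abbreviation unit_residues :: "nat => nat set" where
 "unit_residues Q \<equiv> carrier (residue_units Q)"

lemma carrier_residue_units: "a \<in> unit_residues Q \<longleftrightarrow> a < Q & coprime a Q"
 by (simp add: residue_units_def)

lemma finite_residue_units: "finite (unit_residues Q)"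
 by (simp add: residue_units_def)

lemma mult_residue_units: "a \<otimes>\<^bsub>residue_units Q\<^esub> b = (a * b) mod Q"
 by (simp add: residue_units_def)

lemma mod_in_residue_units: "Q > 0 ==> coprime n Q ==> n mod Q \<in> unit_residues Q"
 by (simp add: carrier_residue_units)

lemma comm_group_residue_units:
 assumes "Q > 0"
 shows "comm_group (residue_units Q)"
proof (rule comm_groupI)
 fix a b c assume abc: "a \<in> unit_residues Q" "b \<in> unit_residues Q" "c \<in> unit_residues Q"
 show "a \<otimes>\<^bsub>residue_units Q\<^esub> b \<otimes>\<^bsub>residue_units Q\<^esub> c = a \<otimes>\<^bsub>residue_units Q\<^esub> (b \<otimes>\<^bsub>residue_units Q\<^esub> c)"
  by (simp add: mult_residue_units mod_mult_left_eq mod_mult_right_eq mult.assoc)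
next
 fix a b assume "a \<in> unit_residues Q" "b \<in> unit_residues Q"
 then show "a \<otimes>\<^bsub>residue_units Q\<^esub> b \<in> unit_residues Q" using assms by (simp add: mult_residue_units carrier_residue_units)
 show "a \<otimes>\<^bsub>residue_units Q\<^esub> b = b \<otimes>\<^bsub>residue_units Q\<^esub> a" by (simp add: mult_residue_units mult.commute)
next
 show "\<one>\<^bsub>residue_units Q\<^esub> \<in> unit_residues Q" using assms by (simp add: residue_units_def)
next
 fix a assume a: "a \<in> unit_residues Q"
 then show "\<one>\<^bsub>residue_units Q\<^esub> \<otimes>\<^bsub>residue_units Q\<^esub> a = a" by (simp add: residue_units_def mod_mult_left_eq)
 show "\<exists>b\<in>unit_residues Q. b \<otimes>\<^bsub>residue_units Q\<^esub> a = \<one>\<^bsub>residue_units Q\<^esub>"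
 proof -
  obtain b where b: "[a * b = 1] (mod Q)" using a cong_solve_coprime_nat[of a Q] by (auto simp: carrier_residue_units)
  then have "[b * a = Suc 0] (mod Q)" by (simp add: mult.commute)
  then have "coprime b Q" unfolding coprime_iff_invertible_nat by blast
  then have "b mod Q \<in> unit_residues Q" by (rule mod_in_residue_units[OF assms])
  moreover have "(b mod Q) \<otimes>\<^bsub>residue_units Q\<^esub> a = \<one>\<^bsub>residue_units Q\<^esub>"
  proof -
   have "(b mod Q * a) mod Q = (a * b) mod Q" by (simp add: mod_mult_left_eq mult.commute[of a b])
   also have "... = 1 mod Q" using b by (simp add: Cong.cong_def)
   finally show ?thesis by (simp add: residue_units_def)
  qed
  ultimately show ?thesis by blast
 qed
qed

lemma residue_units_div_iff:
 assumes "Q > 0" "a \<in> unit_residues Q" "coprime d Q" "coprime m Q"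
 shows "d * m mod Q = a \<longleftrightarrow> m mod Q = a \<otimes>\<^bsub>residue_units Q\<^esub> inv\<^bsub>residue_units Q\<^esub> (d mod Q)"
proof -
 interpret comm_group "residue_units Q" by (rule comm_group_residue_units[OF assms(1)])
 have dm: "d mod Q \<in> unit_residues Q" "m mod Q \<in> unit_residues Q" using assms by (auto intro: mod_in_residue_units)
 have "d * m mod Q = (d mod Q) \<otimes>\<^bsub>residue_units Q\<^esub> (m mod Q)" by (simp add: mult_residue_units mod_mult_eq)
 also have "... = a \<longleftrightarrow> m mod Q = a \<otimes>\<^bsub>residue_units Q\<^esub> inv\<^bsub>residue_units Q\<^esub> (d mod Q)" using dm assms(2) by (metis inv_solve_left m_comm inv_closed)
 finally show ?thesis .
qed

text \<open>Abel summation: partial sums are replaced by their bound k t, and since the weight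
  decreases, summing back recovers the plain sum of the weight.\<close>

lemma sum_mult_antimono_bound:
 fixes f g :: "nat => real"
 assumes k: "k >= 0" and M: "M0 <= M1"
  and f: "\<And>t. M0 <= t ==> t <= M1 ==> \<bar>\<Sum>m\<in>{M0<..t}. f m\<bar> <= k * real t"
  and g: "\<And>m. M0 < m ==> g m >= 0" "\<And>m. M0 < m ==> g (Suc m) <= g m"
 shows "\<bar>\<Sum>m\<in>{M0<..M1}. f m * g m\<bar> <= k * ((\<Sum>m\<in>{M0<..M1}. g m) + real M0 * g (Suc M0))"
proof -
 define F where "F = (%t. \<Sum>m\<in>{M0<..t}. f m)"
 have ins: "{M0<..Suc t} = insert (Suc t) {M0<..t}" if "M0 <= t" for t using that by auto
 have abel: "(\<Sum>m\<in>{M0<..t}. f m * g m) = F t * g (Suc t) + (\<Sum>m\<in>{M0<..t}. F m * (g m - g (Suc m)))" if "M0 <= t" for t using that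
 proof (induction t rule: dec_induct)
  case base
  then show ?case by (simp add: F_def)
 next
  case (step t)
  have "F (Suc t) = F t + f (Suc t)" unfolding F_def using ins[of t] step by simp
  then show ?case using step ins[of t] by (simp add: algebra_simps)
 qed
 have tel: "(\<Sum>m\<in>{M0<..t}. real m * (g m - g (Suc m))) + real t * g (Suc t) = (\<Sum>m\<in>{M0<..t}. g m) + real M0 * g (Suc M0)"
  if "M0 <= t" for t using that
 proof (induction t rule: dec_induct)
  case (step t)
  then show ?case using ins[of t] by (simp add: algebra_simps)
 qed simp
 have "\<bar>\<Sum>m\<in>{M0<..M1}. f m * g m\<bar> <= \<bar>F M1 * g (Suc M1)\<bar> + \<bar>\<Sum>m\<in>{M0<..M1}. F m * (g m - g (Suc m))\<bar>" unfolding abel[OF M] by (rule abs_triangle_ineq)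
 also have "\<bar>F M1 * g (Suc M1)\<bar> <= k * real M1 * g (Suc M1)" unfolding abs_mult using f[OF M order.refl] g(1)[of "Suc M1"] M by (intro mult_mono) (auto simp: F_def)
 also have "\<bar>\<Sum>m\<in>{M0<..M1}. F m * (g m - g (Suc m))\<bar> <= (\<Sum>m\<in>{M0<..M1}. k * (real m * (g m - g (Suc m))))"
 proof (intro order.trans[OF sum_abs] sum_mono)
  fix m assume m: "m \<in> {M0<..M1}"
  then have "\<bar>F m\<bar> <= k * real m" unfolding F_def by (intro f) auto
  then have "\<bar>F m\<bar> * \<bar>g m - g (Suc m)\<bar> <= (k * real m) * (g m - g (Suc m))" using g(2)[of m] m k by (intro mult_mono) auto
  then show "\<bar>F m * (g m - g (Suc m))\<bar> <= k * (real m * (g m - g (Suc m)))" by (simp add: abs_mult mult.assoc)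
 qed
 also have "k * real M1 * g (Suc M1) + (\<Sum>m\<in>{M0<..M1}. k * (real m * (g m - g (Suc m)))) = k * ((\<Sum>m\<in>{M0<..M1}. g m) + real M0 * g (Suc M0))"
  unfolding tel[OF M, symmetric] by (simp add: sum_distrib_left algebra_simps)
 finally show ?thesis by simp
qed

lemma sum_inverse_le_ln: "n >= 1 ==> (\<Sum>m=1..n. 1 / real m) <= ln (real n) + 1"
proof (induction n rule: dec_induct)
 case (step n)
 have "ln (real n / real (Suc n)) <= real n / real (Suc n) - 1" using step by (intro ln_le_minus_one) auto
 then have "1 / real (Suc n) <= ln (real (Suc n)) - ln (real n)" using step by (simp add: ln_div field_simps)
 then show ?case using step by simp
qed auto

text \<open>The derivative of (ln t)^2 / t has the sign of ln t * (2 - ln t), and 8 exceeds exp 2;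
  this is the reason for the assumption \<open>T0 >= 8\<close> later on.\<close>

lemma ln_squared_over_antimono: "m >= 8 ==> (ln (real (Suc m)))\<^sup>2 / real (Suc m) <= (ln (real m))\<^sup>2 / real m"
proof -
 assume m: "m >= 8"
 have d: "((%t. (ln t)\<^sup>2 / t) has_real_derivative (ln t * (2 - ln t) / t\<^sup>2)) (at t)" if "t > 0" for t :: real using that by (auto intro!: derivative_eq_intros simp: field_simps power2_eq_square)
 have "(%t. (ln t)\<^sup>2 / t) (real (Suc m)) <= (%t. (ln t)\<^sup>2 / t) (real m)"
 proof (rule DERIV_nonpos_imp_nonincreasing[where a = "real m" and b = "real (Suc m)" and f = "%t. (ln t)\<^sup>2 / t"])
  fix t assume t: "real m <= t" "t <= real (Suc m)"
  have "ln (8::real) >= 2"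
  proof -
   have "exp (2::real) = exp 1 ^ 2" by (simp flip: exp_of_nat_mult)
   also have "... <= (272/100)^2" using e_less_272 by (intro power_mono) auto
   also have "... <= 8" by (simp add: power2_eq_square)
   finally show ?thesis by (subst ln_ge_iff) auto
  qed
  moreover have "ln 8 <= ln t" using t m by (subst ln_le_cancel_iff) auto
  ultimately have "ln t >= 2" by linarith
  then have "ln t * (2 - ln t) / t\<^sup>2 <= 0" by (intro divide_nonpos_nonneg mult_nonneg_nonpos) auto
  then show "\<exists>y. ((%t. (ln t)\<^sup>2 / t) has_real_derivative y) (at t) & y <= 0" using d[of t] t m by (intro exI conjI) auto
 qed auto
 then show ?thesis by simp
qed

lemma sum_divisors_pairs:
 fixes F :: "nat => nat => real"
 assumes "finite S" "finite D" "\<And>n. n \<in> S ==> n > 0" "\<And>d. d \<in> D ==> d > 0" "\<And>n d. n \<in> S ==> d dvd n ==> d \<in> D"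
 shows "(\<Sum>n\<in>S. \<Sum>d | d dvd n. F d (n div d)) = (\<Sum>d\<in>D. \<Sum>m\<in>{m. d * m \<in> S}. F d m)"
proof -
 have fin: "finite {m. d * m \<in> S}" if "d \<in> D" for d using finite_vimage_IntI[OF assms(1), of "%m. d * m" UNIV] assms(4)[OF that] by (auto simp: inj_on_def vimage_def)
 have "(\<Sum>n\<in>S. \<Sum>d | d dvd n. F d (n div d)) = (\<Sum>(n, d)\<in>(SIGMA n:S. {d. d dvd n}). F d (n div d))" using assms by (subst sum.Sigma) auto
 also have "... = (\<Sum>(d, m)\<in>(SIGMA d:D. {m. d * m \<in> S}). F d m)" by (rule sum.reindex_bij_witness[of _ "%(d, m). (d * m, d)" "%(n, d). (d, n div d)"])
    (use assms in \<open>force simp: dvd_def\<close>)+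
 also have "... = (\<Sum>d\<in>D. \<Sum>m\<in>{m. d * m \<in> S}. F d m)" using assms fin by (subst sum.Sigma) auto
 finally show ?thesis .
qed

lemma natseg_floor:
 assumes "0 <= s"
 shows "natseg s t = {nat \<lfloor>s\<rfloor><..nat \<lfloor>t\<rfloor>}"
proof (rule Set.set_eqI)
 fix n
 have "s < real n \<longleftrightarrow> \<lfloor>s\<rfloor> < int n" by (simp add: floor_less_iff)
 also have "... \<longleftrightarrow> nat \<lfloor>s\<rfloor> < n" using assms by (simp add: nat_less_iff)
 finally have 1: "s < real n \<longleftrightarrow> nat \<lfloor>s\<rfloor> < n" .
 have "real n <= t \<longleftrightarrow> int n <= \<lfloor>t\<rfloor>" by (simp add: le_floor_iff)
 also have "... \<longleftrightarrow> n <= nat \<lfloor>t\<rfloor>" if "n > 0"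
 proof (cases "0 <= \<lfloor>t\<rfloor>")
  case False
  then have "nat \<lfloor>t\<rfloor> = 0" "\<not> int n <= \<lfloor>t\<rfloor>" by linarith+
  then show ?thesis using that by simp
 qed (simp add: le_nat_iff)
 finally have 2: "n > 0 ==> real n <= t \<longleftrightarrow> n <= nat \<lfloor>t\<rfloor>" .
 show "n \<in> natseg s t \<longleftrightarrow> n \<in> {nat \<lfloor>s\<rfloor><..nat \<lfloor>t\<rfloor>}" using 1 2 assms by (auto simp: natseg_def)
qed

lemma sum_inverse_natseg_le:
 assumes "T >= 1"
 shows "(\<Sum>m\<in>natseg 0 T. 1 / real m) <= ln T + 1"
proof -
 define n where "n = nat \<lfloor>T\<rfloor>"
 have "1 <= \<lfloor>T\<rfloor>" using assms by simp
 then have "n > 0" "real n = of_int \<lfloor>T\<rfloor>" unfolding n_def zero_less_nat_eq by linarith+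
 then have n: "n >= 1" "real n <= T" by linarith+
 have "(\<Sum>m\<in>natseg 0 T. 1 / real m) <= ln (real n) + 1" unfolding natseg_0 n_def[symmetric] using n by (intro sum_inverse_le_ln)
 also have "ln (real n) <= ln T" using n by simp
 finally show ?thesis by simp
qed

section \<open>Comparison of Selberg's sum in different residue classes\<close>

abbreviation rough_class where
 "rough_class w Q b s t \<equiv> {n\<in>natseg s t. rough w n & n mod Q = b}"

definition rough_upto :: "real => real => nat set" where
 "rough_upto w T = {n\<in>natseg 0 T. rough w n}"

lemma finite_rough_upto [simp]: "finite (rough_upto w T)"
 by (simp add: rough_upto_def)

lemma rough_upto_pos: "n \<in> rough_upto w T ==> n > 0"
 by (simp add: rough_upto_def rough_def)

text \<open>All that is taken from the sieve. Beyond T0 the w-rough numbers are evenly spread over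
  the reduced classes up to the relative error \<open>\<eta>\<close>, with density at most
  \<open>\<kappa>\<close>; below T0 nothing is known except the bound \<open>\<gamma>\<close> for
  their reciprocals. Restricting to rough numbers is what keeps \<open>\<kappa> * \<gamma>\<close>
  small.\<close>

locale rough_classes =
 fixes Q :: nat and w T0 X \<eta> \<kappa> \<gamma> :: real and h :: real
 assumes h_def: "h = real (card (unit_residues Q))" and Q: "Q > 0" and coprime: "\<And>n. rough w n ==> coprime n Q"
  and T0: "T0 >= 8" and X: "X >= T0"
  and nonneg: "\<eta> >= 0" "\<kappa> >= 0" "\<gamma> >= 0"
  and equidist: "\<And>b b' t. b \<in> unit_residues Q ==> b' \<in> unit_residues Q ==> T0 <= t ==> t <= X ==>
   \<bar>real (card (rough_class w Q b T0 t)) - real (card (rough_class w Q b' T0 t))\<bar> <= \<eta> * t / h"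
  and count_le: "\<And>b t. b \<in> unit_residues Q ==> T0 <= t ==> t <= X ==>
   real (card (rough_class w Q b T0 t)) <= \<kappa> * t / h"
  and small_sum: "(\<Sum>m\<in>rough_upto w T0. 1 / real m) <= \<gamma>"
begin

sublocale comm_group "residue_units Q" by (rule comm_group_residue_units[OF Q])

abbreviation "G \<equiv> unit_residues Q"
abbreviation dv :: "nat => nat => nat" where "dv a d \<equiv> a \<otimes>\<^bsub>residue_units Q\<^esub> inv\<^bsub>residue_units Q\<^esub> (d mod Q)"

definition cls :: "nat => real => real => nat set" where
 "cls b s t = rough_class w Q b s t"

lemma finite_cls [simp]: "finite (cls b s t)"
 by (simp add: cls_def)

lemma h_pos: "h > 0"
 unfolding h_def using finite_residue_units[of Q] by (metis card_gt_0_iff of_nat_0_less_iff one_closed empty_iff)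

lemma mod_rough: "rough w d ==> d mod Q \<in> G"
 using coprime Q by (intro mod_in_residue_units)

lemma dv_closed: "a \<in> G ==> rough w d ==> dv a d \<in> G"
 using mod_rough by auto

lemma lnX: "ln X >= 1"
proof -
 have "exp 1 <= X" using X T0 exp_le by linarith
 then show ?thesis using X T0 by (subst ln_ge_iff) auto
qed

lemma mult_mem_cls_iff:
 assumes "a \<in> G" "rough w d"
 shows "d * m \<in> cls a s t \<longleftrightarrow> m \<in> cls (dv a d) (s / real d) (t / real d)"
proof -
 have d: "real d > 0" using assms by (simp add: rough_def)
 have "d * m mod Q = a \<longleftrightarrow> m mod Q = dv a d" if "rough w m" using residue_units_div_iff[OF Q assms(1)] coprime that assms(2) by auto
 then show ?thesis using assms(2) d by (auto simp: cls_def natseg_def rough_mult_iff field_simps)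
qed

lemma card_cls_split:
 assumes "T0 <= s" "s <= t"
 shows "real (card (cls b T0 t)) = real (card (cls b T0 s)) + real (card (cls b s t))"
proof -
 have "cls b T0 t = cls b T0 s \<union> cls b s t" "cls b T0 s \<inter> cls b s t = {}" using assms by (auto simp: cls_def natseg_def)
 then show ?thesis by (simp add: card_Un_disjoint)
qed

lemma sum_cls_antimono:
 fixes g :: "nat => real"
 assumes s: "T0 <= s" "s <= t" "t <= X" and b: "b \<in> G" "b' \<in> G"
  and g: "\<And>m. m >= 8 ==> g m >= 0" "\<And>m. m >= 8 ==> g (Suc m) <= g m"
 shows "\<bar>(\<Sum>m\<in>cls b s t. g m) - (\<Sum>m\<in>cls b' s t. g m)\<bar> <= 2 * \<eta> / h * ((\<Sum>m\<in>natseg s t. g m) + s * g (Suc (nat \<lfloor>s\<rfloor>)))"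
  and "(\<Sum>m\<in>cls b s t. g m) <= \<kappa> / h * ((\<Sum>m\<in>natseg s t. g m) + s * g (Suc (nat \<lfloor>s\<rfloor>)))"
proof -
 define M0 M1 where "M0 = nat \<lfloor>s\<rfloor>" and "M1 = nat \<lfloor>t\<rfloor>"
 define ind where "ind = (%b m. if rough w m & m mod Q = b then 1 else 0 :: real)"
 have s0: "s >= 0" "s >= 8" using s T0 by auto
 have "8 <= \<lfloor>s\<rfloor>" using s0 by simp
 then have M: "M0 >= 8" "real M0 <= s" "s < real M0 + 1" unfolding M0_def by linarith+
 have M01: "M0 <= M1" using s unfolding M0_def M1_def by (intro nat_mono floor_mono)
 have M1t: "real M1 <= t" unfolding M1_def using s s0 by linarith
 have seg: "natseg s t = {M0<..M1}" unfolding M0_def M1_def by (rule natseg_floor[OF s0(1)])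
 have cls_sum: "(\<Sum>m\<in>cls b s t. f m) = (\<Sum>m\<in>{M0<..M1}. ind b m * f m)" for b and f :: "nat => real" unfolding cls_def seg by (subst sum.inter_filter) (auto simp: ind_def intro!: sum.cong)
 have part: "(\<Sum>m\<in>{M0<..u}. ind b m) = real (card (cls b s (real u)))" for b u
 proof -
  have "natseg s (real u) = {M0<..u}" using natseg_floor[OF s0(1), of "real u"] by (simp add: M0_def)
  then show ?thesis unfolding cls_def ind_def by (simp add: sum.If_cases Int_def conj_commute)
 qed
 have u: "u = M0 \<or> s <= real u" if "M0 <= u" for u using that M by linarith
 have f1: "\<bar>\<Sum>m\<in>{M0<..u}. ind b m - ind b' m\<bar> <= (2 * \<eta> / h) * real u" if u': "M0 <= u" "u <= M1" for u using u[OF u'(1)]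
 proof
  assume "u = M0"
  then show ?thesis using nonneg h_pos by simp
 next
  assume su: "s <= real u"
  have ux: "T0 <= real u" "real u <= X" using su s u' M1t by auto
  have "\<bar>real (card (cls b T0 (real u))) - real (card (cls b' T0 (real u)))\<bar> <= \<eta> * real u / h" unfolding cls_def by (rule equidist[OF b ux])
  moreover have "\<bar>real (card (cls b T0 s)) - real (card (cls b' T0 s))\<bar> <= \<eta> * s / h" unfolding cls_def by (rule equidist[OF b]) (use s in auto)
  moreover have "\<eta> * s / h <= \<eta> * real u / h" using su nonneg h_pos by (intro divide_right_mono mult_left_mono) auto
  moreover have "(\<Sum>m\<in>{M0<..u}. ind b m - ind b' m) = real (card (cls b s (real u))) - real (card (cls b' s (real u)))" by (simp add: sum_subtractf part)
  ultimately have "\<bar>\<Sum>m\<in>{M0<..u}. ind b m - ind b' m\<bar> <= 2 * (\<eta> * real u / h)" using card_cls_split[OF s(1) su, of b] card_cls_split[OF s(1) su, of b'] by linarith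
  then show ?thesis by simp
 qed
 have f2: "\<bar>\<Sum>m\<in>{M0<..u}. ind b m\<bar> <= (\<kappa> / h) * real u" if u': "M0 <= u" "u <= M1" for u using u[OF u'(1)]
 proof
  assume "u = M0"
  then show ?thesis using nonneg h_pos by simp
 next
  assume su: "s <= real u"
  have ux: "T0 <= real u" "real u <= X" using su s u' M1t by auto
  have "real (card (cls b T0 (real u))) <= \<kappa> * real u / h" unfolding cls_def by (rule count_le[OF b(1) ux])
  then show ?thesis using card_cls_split[OF s(1) su, of b] by (simp add: part)
 qed
 have tail: "real M0 * g (Suc M0) <= s * g (Suc M0)" using M g by (intro mult_right_mono) auto
 have "(\<Sum>m\<in>cls b s t. g m) - (\<Sum>m\<in>cls b' s t. g m) = (\<Sum>m\<in>{M0<..M1}. (ind b m - ind b' m) * g m)" by (simp add: cls_sum sum_subtractf left_diff_distrib)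
 also have "\<bar>...\<bar> <= (2 * \<eta> / h) * ((\<Sum>m\<in>{M0<..M1}. g m) + real M0 * g (Suc M0))" using nonneg h_pos M g by (intro sum_mult_antimono_bound f1 M01) auto
 also have "... <= (2 * \<eta> / h) * ((\<Sum>m\<in>natseg s t. g m) + s * g (Suc M0))" unfolding seg using tail nonneg h_pos by (intro mult_left_mono) auto
 finally show "\<bar>(\<Sum>m\<in>cls b s t. g m) - (\<Sum>m\<in>cls b' s t. g m)\<bar> <= 2 * \<eta> / h * ((\<Sum>m\<in>natseg s t. g m) + s * g (Suc (nat \<lfloor>s\<rfloor>)))" by (simp add: M0_def)
 have "(\<Sum>m\<in>cls b s t. g m) = (\<Sum>m\<in>{M0<..M1}. ind b m * g m)" by (rule cls_sum)
 also have "... <= \<bar>...\<bar>" by simp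
 also have "... <= (\<kappa> / h) * ((\<Sum>m\<in>{M0<..M1}. g m) + real M0 * g (Suc M0))" using nonneg h_pos M g by (intro sum_mult_antimono_bound f2 M01) auto
 also have "... <= (\<kappa> / h) * ((\<Sum>m\<in>natseg s t. g m) + s * g (Suc M0))" unfolding seg using tail nonneg h_pos by (intro mult_left_mono) auto
 finally show "(\<Sum>m\<in>cls b s t. g m) <= \<kappa> / h * ((\<Sum>m\<in>natseg s t. g m) + s * g (Suc (nat \<lfloor>s\<rfloor>)))" by (simp add: M0_def)
qed

lemma sum_inverse_cls_le:
 assumes s: "T0 <= s" "t <= X" and b: "b \<in> G"
 shows "(\<Sum>m\<in>cls b s t. 1 / real m) <= 3 * \<kappa> * ln X / h"
proof (cases "s <= t")
 case True
 have "(\<Sum>m\<in>cls b s t. 1 / real m) <= \<kappa> / h * ((\<Sum>m\<in>natseg s t. 1 / real m) + s * (1 / real (Suc (nat \<lfloor>s\<rfloor>))))"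
  by (rule sum_cls_antimono(2)[OF s(1) True s(2) b b]) (auto intro!: divide_left_mono)
 also have "... <= \<kappa> / h * ((ln X + 1) + 1)"
 proof (intro mult_left_mono add_mono)
  have "(\<Sum>m\<in>natseg s t. 1 / real m) <= (\<Sum>m\<in>natseg 0 X. 1 / real m)" using s T0 by (intro sum_mono2) (simp, auto simp: natseg_def)
  also have "... <= ln X + 1" using X T0 by (intro sum_inverse_natseg_le) auto
  finally show "(\<Sum>m\<in>natseg s t. 1 / real m) <= ln X + 1" .
  have "s <= real (Suc (nat \<lfloor>s\<rfloor>))" using s T0 by linarith
  then show "s * (1 / real (Suc (nat \<lfloor>s\<rfloor>))) <= 1" by (simp add: divide_simps)
 qed (use nonneg h_pos in auto)
 also have "... <= \<kappa> / h * (3 * ln X)" using lnX nonneg h_pos by (intro mult_left_mono) auto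
 finally show ?thesis by (simp add: mult_ac)
next
 case False
 then have "cls b s t = {}" by (auto simp: cls_def natseg_def)
 then show ?thesis using nonneg h_pos lnX by simp
qed

lemma sum_ln_squared_cls_diff:
 assumes s: "T0 <= s" "t <= X" and b: "b \<in> G" "b' \<in> G"
 shows "\<bar>(\<Sum>m\<in>cls b s t. (ln (real m))\<^sup>2 / real m) - (\<Sum>m\<in>cls b' s t. (ln (real m))\<^sup>2 / real m)\<bar> <= 6 * \<eta> * ln X ^ 3 / h"
proof (cases "natseg s t = {}")
 case False
 then have st: "s < t" by (auto simp: natseg_def)
 define M0 where "M0 = nat \<lfloor>s\<rfloor>"
 obtain n where n: "s < real n" "real n <= t" using False by (auto simp: natseg_def)
 have "8 <= \<lfloor>s\<rfloor>" using s T0 by simp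
 then have "real M0 <= s" "s < real M0 + 1" unfolding M0_def by linarith+
 then have "M0 < n" "s <= real (Suc M0)" using n by linarith+
 moreover from this have "real (Suc M0) <= real n" by simp
 ultimately have M0: "real (Suc M0) <= X" "s <= real (Suc M0)" using n s by linarith+
 have "\<bar>(\<Sum>m\<in>cls b s t. (ln (real m))\<^sup>2 / real m) - (\<Sum>m\<in>cls b' s t. (ln (real m))\<^sup>2 / real m)\<bar> <=
   2 * \<eta> / h * ((\<Sum>m\<in>natseg s t. (ln (real m))\<^sup>2 / real m) + s * ((ln (real (Suc M0)))\<^sup>2 / real (Suc M0)))" unfolding M0_def using st by (intro sum_cls_antimono(1) s b ln_squared_over_antimono) auto
 also have "... <= 2 * \<eta> / h * ((ln X)\<^sup>2 * (ln X + 1) + (ln X)\<^sup>2)"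
 proof (intro mult_left_mono add_mono)
  have "(\<Sum>m\<in>natseg s t. (ln (real m))\<^sup>2 / real m) <= (\<Sum>m\<in>natseg s t. (ln X)\<^sup>2 * (1 / real m))"
  proof (rule sum_mono)
   fix m assume "m \<in> natseg s t"
   then have m: "real m >= 1" "real m <= X" using s T0 by (auto simp: natseg_def)
   then have "(ln (real m))\<^sup>2 <= (ln X)\<^sup>2" by (intro power_mono) auto
   then show "(ln (real m))\<^sup>2 / real m <= (ln X)\<^sup>2 * (1 / real m)" using m by (simp add: divide_right_mono)
  qed
  also have "... = (ln X)\<^sup>2 * (\<Sum>m\<in>natseg s t. 1 / real m)" by (simp only: sum_distrib_left)
  also have "(\<Sum>m\<in>natseg s t. 1 / real m) <= (\<Sum>m\<in>natseg 0 X. 1 / real m)" using s T0 by (intro sum_mono2) (simp, auto simp: natseg_def)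
  also have "... <= ln X + 1" using X T0 by (intro sum_inverse_natseg_le) auto
  finally show "(\<Sum>m\<in>natseg s t. (ln (real m))\<^sup>2 / real m) <= (ln X)\<^sup>2 * (ln X + 1)" by (simp add: mult_left_mono)
  have "s * ((ln (real (Suc M0)))\<^sup>2 / real (Suc M0)) <= real (Suc M0) * ((ln (real (Suc M0)))\<^sup>2 / real (Suc M0))" using M0 by (intro mult_right_mono) auto
  also have "... = (ln (real (Suc M0)))\<^sup>2" by simp
  also have "... <= (ln X)\<^sup>2" using M0 by (intro power_mono) auto
  finally show "s * ((ln (real (Suc M0)))\<^sup>2 / real (Suc M0)) <= (ln X)\<^sup>2" .
 qed (use nonneg h_pos in auto)
 also have "... <= 2 * \<eta> / h * (3 * ln X ^ 3)"
 proof (intro mult_left_mono)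
  have "(ln X)\<^sup>2 * 1 <= (ln X)\<^sup>2 * ln X" using lnX by (intro mult_left_mono) auto
  then show "(ln X)\<^sup>2 * (ln X + 1) + (ln X)\<^sup>2 <= 3 * ln X ^ 3" by (simp add: power2_eq_square power3_eq_cube algebra_simps)
 qed (use nonneg h_pos in auto)
 finally show ?thesis by (simp add: mult_ac)
next
 case True
 then show ?thesis using nonneg h_pos lnX by (simp add: cls_def)
qed

definition selberg_sum :: "nat => real => real => real" where
 "selberg_sum a s t = (\<Sum>n\<in>cls a s t. mangoldt2 n / real n)"

lemma cls_pos: "n \<in> cls a s t ==> n > 0"
 by (auto simp: cls_def rough_def)

lemma dvd_cls: "n \<in> cls a s t ==> t <= X ==> d dvd n ==> d \<in> rough_upto w X"
proof -
 assume n: "n \<in> cls a s t" "t <= X" "d dvd n"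
 then have "d <= n" using cls_pos dvd_imp_le by blast
 then have "real d <= real n" by simp
 moreover have "real n <= X" using n by (auto simp: cls_def natseg_def)
 moreover have "rough w d" using n by (auto simp: cls_def rough_mult_iff elim!: dvdE)
 ultimately show "d \<in> rough_upto w X" by (auto simp: rough_upto_def natseg_def rough_def)
qed

lemma sum_cls_pairs:
 fixes F :: "nat => nat => real"
 assumes "a \<in> G" "t <= X"
 shows "(\<Sum>n\<in>cls a s t. \<Sum>d | d dvd n. F d (n div d)) =
   (\<Sum>d\<in>rough_upto w X. \<Sum>m\<in>cls (dv a d) (s / real d) (t / real d). F d m)"
proof -
 have "(\<Sum>n\<in>cls a s t. \<Sum>d | d dvd n. F d (n div d)) = (\<Sum>d\<in>rough_upto w X. \<Sum>m\<in>{m. d * m \<in> cls a s t}. F d m)" by (rule sum_divisors_pairs) (use cls_pos dvd_cls assms rough_upto_pos in auto)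
 also have "... = (\<Sum>d\<in>rough_upto w X. \<Sum>m\<in>cls (dv a d) (s / real d) (t / real d). F d m)" by (intro sum.cong refl) (use assms mult_mem_cls_iff in \<open>auto simp: rough_upto_def\<close>)
 finally show ?thesis .
qed

lemma selberg_sum_eq:
 assumes "a \<in> G" "t <= X"
 shows "selberg_sum a s t = (\<Sum>d\<in>rough_upto w X. moebius_mu d / real d * (\<Sum>m\<in>cls (dv a d) (s / real d) (t / real d). (ln (real m))\<^sup>2 / real m))"
proof -
 have "selberg_sum a s t = (\<Sum>n\<in>cls a s t. \<Sum>d | d dvd n. moebius_mu d / real d * ((ln (real (n div d)))\<^sup>2 / real (n div d)))" unfolding selberg_sum_def
 proof (rule sum.cong[OF refl])
  fix n assume "n \<in> cls a s t"
  then have n: "n > 0" by (rule cls_pos)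
  have "mangoldt2 n / real n = (\<Sum>d | d dvd n. moebius_mu d * (ln (real (n div d)))\<^sup>2 / real n)" by (simp add: mangoldt2_conv_moebius_mu[OF n] sum_divide_distrib)
  also have "... = (\<Sum>d | d dvd n. moebius_mu d / real d * ((ln (real (n div d)))\<^sup>2 / real (n div d)))"
  proof (rule sum.cong[OF refl])
   fix d assume "d \<in> {d. d dvd n}"
   then obtain k where k: "n = d * k" "d > 0" "k > 0" using n by (auto elim!: dvdE intro!: Nat.gr0I)
   then show "moebius_mu d * (ln (real (n div d)))\<^sup>2 / real n = moebius_mu d / real d * ((ln (real (n div d)))\<^sup>2 / real (n div d))" by simp
  qed
  finally show "mangoldt2 n / real n = (\<Sum>d | d dvd n. moebius_mu d / real d * ((ln (real (n div d)))\<^sup>2 / real (n div d)))" .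
 qed
 also have "... = (\<Sum>d\<in>rough_upto w X. \<Sum>m\<in>cls (dv a d) (s / real d) (t / real d). moebius_mu d / real d * ((ln (real m))\<^sup>2 / real m))" by (rule sum_cls_pairs[OF assms])
 finally show ?thesis by (simp only: sum_distrib_left)
qed

text \<open>For cofactors m up to T0 there is no equidistribution. Exchanging the roles makes d the
  long variable: it runs through one class in the interval (s / m, t / m], which begins beyond T0
  because \<open>T0^2 <= s\<close>, so the density bound applies.\<close>

lemma selberg_sum_small_part:
 assumes a: "a \<in> G" and st: "T0\<^sup>2 <= s" "t <= X"
 shows "(\<Sum>d\<in>rough_upto w X. (1 / real d) * (\<Sum>m\<in>{m\<in>cls (dv a d) (s / real d) (t / real d). real m <= T0}. (ln (real m))\<^sup>2 / real m))
  <= 3 * \<kappa> * \<gamma> * ln X * (ln T0)\<^sup>2 / h"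
proof -
 have eq: "{m\<in>cls (dv a d) (s / real d) (t / real d). real m <= T0} = {m. m \<in> rough_upto w T0 & d * m \<in> cls a s t}" if "d \<in> rough_upto w X" for d
 proof -
  have rd: "rough w d" using that by (simp add: rough_upto_def)
  show ?thesis unfolding mult_mem_cls_iff[OF a rd] by (auto simp: rough_upto_def cls_def natseg_def rough_def)
 qed
 have "(\<Sum>d\<in>rough_upto w X. (1 / real d) * (\<Sum>m\<in>{m\<in>cls (dv a d) (s / real d) (t / real d). real m <= T0}. (ln (real m))\<^sup>2 / real m))
   = (\<Sum>d\<in>rough_upto w X. \<Sum>m\<in>{m. m \<in> rough_upto w T0 & d * m \<in> cls a s t}. (1 / real d) * ((ln (real m))\<^sup>2 / real m))" by (intro sum.cong refl) (simp only: eq sum_distrib_left)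
 also have "... = (\<Sum>m\<in>rough_upto w T0. \<Sum>d\<in>{d. d \<in> rough_upto w X & d * m \<in> cls a s t}. (1 / real d) * ((ln (real m))\<^sup>2 / real m))" by (rule sum.swap_restrict) auto
 also have "... <= (\<Sum>m\<in>rough_upto w T0. (3 * \<kappa> * ln X / h) * ((ln T0)\<^sup>2 * (1 / real m)))"
 proof (rule sum_mono)
  fix m assume m: "m \<in> rough_upto w T0"
  then have rm: "rough w m" "real m >= 1" "real m <= T0" by (auto simp: rough_upto_def natseg_def)
  have sub: "{d. d \<in> rough_upto w X & d * m \<in> cls a s t} \<subseteq> cls (dv a m) (s / real m) (t / real m)" using mult_mem_cls_iff[OF a rm(1)] by (auto simp: mult.commute)
  have "(\<Sum>d\<in>{d. d \<in> rough_upto w X & d * m \<in> cls a s t}. 1 / real d) <= (\<Sum>d\<in>cls (dv a m) (s / real m) (t / real m). 1 / real d)" using sub by (intro sum_mono2) auto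
  also have "... <= 3 * \<kappa> * ln X / h"
  proof (rule sum_inverse_cls_le)
   have "T0 * real m <= T0 * T0" using rm T0 by (intro mult_left_mono) auto
   also have "... <= s" using st by (simp add: power2_eq_square)
   finally show "T0 <= s / real m" using rm by (simp add: pos_le_divide_eq)
   have "t / real m <= X / 1" using st rm X T0 by (intro frac_le) auto
   then show "t / real m <= X" by simp
   show "dv a m \<in> G" by (rule dv_closed[OF a rm(1)])
  qed
  finally have 1: "(\<Sum>d\<in>{d. d \<in> rough_upto w X & d * m \<in> cls a s t}. 1 / real d) <= 3 * \<kappa> * ln X / h" .
  have "(ln (real m))\<^sup>2 <= (ln T0)\<^sup>2" using rm by (intro power_mono) auto
  then have 2: "(ln (real m))\<^sup>2 / real m <= (ln T0)\<^sup>2 * (1 / real m)" using rm by (simp add: divide_right_mono)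
  have "(\<Sum>d\<in>{d. d \<in> rough_upto w X & d * m \<in> cls a s t}. (1 / real d) * ((ln (real m))\<^sup>2 / real m)) =
   (\<Sum>d\<in>{d. d \<in> rough_upto w X & d * m \<in> cls a s t}. 1 / real d) * ((ln (real m))\<^sup>2 / real m)" by (simp only: sum_distrib_right)
  also have "... <= (3 * \<kappa> * ln X / h) * ((ln T0)\<^sup>2 * (1 / real m))" using 1 2 nonneg h_pos lnX by (intro mult_mono) auto
  finally show "(\<Sum>d\<in>{d. d \<in> rough_upto w X & d * m \<in> cls a s t}. (1 / real d) * ((ln (real m))\<^sup>2 / real m)) <= (3 * \<kappa> * ln X / h) * ((ln T0)\<^sup>2 * (1 / real m))" .
 qed
 also have "... = (3 * \<kappa> * ln X / h) * (ln T0)\<^sup>2 * (\<Sum>m\<in>rough_upto w T0. 1 / real m)" by (simp only: sum_distrib_left mult.assoc)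
 also have "... <= (3 * \<kappa> * ln X / h) * (ln T0)\<^sup>2 * \<gamma>" using small_sum nonneg h_pos lnX by (intro mult_left_mono) auto
 finally show ?thesis by (simp add: mult_ac)
qed

text \<open>The first term collects the failure of equidistribution over all d, the second the
  cofactors up to T0 in both classes compared.\<close>

definition class_error :: real where
 "class_error = 12 * \<eta> * ln X ^ 4 + 6 * \<kappa> * \<gamma> * ln X * (ln T0)\<^sup>2"

text \<open>Expanding by the Moebius function leaves, for each d, smooth sums over the classes a / d
  and a' / d, which cancel by equidistribution. Only differences are estimated, so the sum in a
  class need not be evaluated asymptotically: its value is read off from the average over all
  classes.\<close>

lemma selberg_sum_diff:
 assumes a: "a \<in> G" "a' \<in> G" and st: "T0\<^sup>2 <= s" "t <= X"
 shows "selberg_sum a s t - selberg_sum a' s t <= class_error / h"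
proof -
 define f where "f = (%m::nat. (ln (real m))\<^sup>2 / real m)"
 define I where "I = (%a d. \<Sum>m\<in>cls (dv a d) (s / real d) (t / real d). f m)"
 define Sm where "Sm = (%a d. \<Sum>m\<in>{m\<in>cls (dv a d) (s / real d) (t / real d). real m <= T0}. f m)"
 have f0: "f m >= 0" for m by (simp add: f_def)
 have Sm0: "Sm a d >= 0" for a d unfolding Sm_def by (intro sum_nonneg f0)
 have split: "I a d = Sm a d + (\<Sum>m\<in>cls (dv a d) (max T0 (s / real d)) (t / real d). f m)" if "d \<in> rough_upto w X" for a d
 proof -
  have "cls (dv a d) (s / real d) (t / real d) = {m\<in>cls (dv a d) (s / real d) (t / real d). real m <= T0} \<union> cls (dv a d) (max T0 (s / real d)) (t / real d)" by (auto simp: cls_def natseg_def)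
  moreover have "{m\<in>cls (dv a d) (s / real d) (t / real d). real m <= T0} \<inter> cls (dv a d) (max T0 (s / real d)) (t / real d) = {}" by (auto simp: cls_def natseg_def)
  ultimately show ?thesis unfolding I_def Sm_def by (metis (no_types, lifting) finite_Un finite_cls sum.union_disjoint)
 qed
 have diff: "\<bar>I a d - I a' d\<bar> <= Sm a d + Sm a' d + 6 * \<eta> * ln X ^ 3 / h" if d: "d \<in> rough_upto w X" for d
 proof -
  have rd: "rough w d" "real d >= 1" using d by (auto simp: rough_upto_def natseg_def)
  have "t / real d <= X / 1" using st rd X T0 by (intro frac_le) auto
  then have "\<bar>(\<Sum>m\<in>cls (dv a d) (max T0 (s / real d)) (t / real d). f m) - (\<Sum>m\<in>cls (dv a' d) (max T0 (s / real d)) (t / real d). f m)\<bar> <= 6 * \<eta> * ln X ^ 3 / h"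
   unfolding f_def using dv_closed rd a by (intro sum_ln_squared_cls_diff) auto
  then show ?thesis using split[OF d, of a] split[OF d, of a'] Sm0[of a d] Sm0[of a' d] by linarith
 qed
 have "selberg_sum a s t - selberg_sum a' s t = (\<Sum>d\<in>rough_upto w X. moebius_mu d / real d * (I a d - I a' d))" unfolding selberg_sum_eq[OF a(1) st(2)] selberg_sum_eq[OF a(2) st(2)] I_def f_def
  by (simp add: sum_subtractf right_diff_distrib)
 also have "... <= (\<Sum>d\<in>rough_upto w X. (1 / real d) * Sm a d + (1 / real d) * Sm a' d + (6 * \<eta> * ln X ^ 3 / h) * (1 / real d))"
 proof (rule sum_mono)
  fix d assume d: "d \<in> rough_upto w X"
  have "moebius_mu d / real d * (I a d - I a' d) <= \<bar>moebius_mu d / real d * (I a d - I a' d)\<bar>" by (rule abs_ge_self)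
  also have "... = (\<bar>moebius_mu d\<bar> / real d) * \<bar>I a d - I a' d\<bar>" by (simp add: abs_mult)
  also have "... <= (1 / real d) * (Sm a d + Sm a' d + 6 * \<eta> * ln X ^ 3 / h)" using abs_moebius_mu_le[of d] diff[OF d] by (intro mult_mono divide_right_mono) auto
  finally show "moebius_mu d / real d * (I a d - I a' d) <= (1 / real d) * Sm a d + (1 / real d) * Sm a' d + (6 * \<eta> * ln X ^ 3 / h) * (1 / real d)" by (simp add: distrib_left mult.commute)
 qed
 also have "... = (\<Sum>d\<in>rough_upto w X. (1 / real d) * Sm a d) + (\<Sum>d\<in>rough_upto w X. (1 / real d) * Sm a' d) + (6 * \<eta> * ln X ^ 3 / h) * (\<Sum>d\<in>rough_upto w X. 1 / real d)"
  by (simp only: sum.distrib sum_distrib_left)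
 also have "... <= 3 * \<kappa> * \<gamma> * ln X * (ln T0)\<^sup>2 / h + 3 * \<kappa> * \<gamma> * ln X * (ln T0)\<^sup>2 / h + (6 * \<eta> * ln X ^ 3 / h) * (2 * ln X)"
 proof (intro add_mono mult_left_mono)
  show "(\<Sum>d\<in>rough_upto w X. (1 / real d) * Sm a d) <= 3 * \<kappa> * \<gamma> * ln X * (ln T0)\<^sup>2 / h" unfolding Sm_def f_def by (rule selberg_sum_small_part[OF a(1) st])
  show "(\<Sum>d\<in>rough_upto w X. (1 / real d) * Sm a' d) <= 3 * \<kappa> * \<gamma> * ln X * (ln T0)\<^sup>2 / h" unfolding Sm_def f_def by (rule selberg_sum_small_part[OF a(2) st])
  have "(\<Sum>d\<in>rough_upto w X. 1 / real d) <= (\<Sum>d\<in>natseg 0 X. 1 / real d)" by (intro sum_mono2) (auto simp: rough_upto_def)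
  also have "... <= ln X + 1" using X T0 by (intro sum_inverse_natseg_le) auto
  finally show "(\<Sum>d\<in>rough_upto w X. 1 / real d) <= 2 * ln X" using lnX by simp
 qed (use nonneg h_pos lnX in auto)
 also have "... = class_error / h" unfolding class_error_def by (simp add: add_divide_distrib power_Suc2 eval_nat_numeral mult_ac)
 finally show ?thesis .
qed

lemma sum_cls:
 "(\<Sum>a\<in>G. \<Sum>n\<in>cls a s t. f n) = (\<Sum>n\<in>{n\<in>natseg s t. rough w n}. f n)"
proof -
 have "(\<Sum>n\<in>{n\<in>natseg s t. rough w n}. f n) = (\<Sum>a\<in>G. \<Sum>n\<in>{n. n \<in> {n\<in>natseg s t. rough w n} & n mod Q = a}. f n)"
  using finite_residue_units mod_rough by (subst sum.group[symmetric, where g = "%n. n mod Q" and T = G]) auto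
 also have "... = (\<Sum>a\<in>G. \<Sum>n\<in>cls a s t. f n)" by (intro sum.cong refl) (auto simp: cls_def)
 finally show ?thesis ..
qed

lemma selberg_sum_average:
 assumes a: "a \<in> G" and st: "T0\<^sup>2 <= s" "t <= X"
 shows "\<bar>h * selberg_sum a s t - (\<Sum>n\<in>{n\<in>natseg s t. rough w n}. mangoldt2 n / real n)\<bar> <= class_error"
proof -
 define S where "S = (\<Sum>n\<in>{n\<in>natseg s t. rough w n}. mangoldt2 n / real n)"
 have S: "S = (\<Sum>b\<in>G. selberg_sum b s t)" unfolding S_def selberg_sum_def by (rule sum_cls[symmetric])
 have "h * selberg_sum a s t - S = (\<Sum>b\<in>G. selberg_sum a s t - selberg_sum b s t)" unfolding S by (simp add: sum_subtractf h_def)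
 moreover have "... <= (\<Sum>b\<in>G. class_error / h)" using selberg_sum_diff a st by (intro sum_mono) auto
 moreover have "(\<Sum>b\<in>G. selberg_sum a s t - selberg_sum b s t) >= (\<Sum>b\<in>G. - (class_error / h))"
 proof (rule sum_mono)
  fix b assume "b \<in> G"
  then show "- (class_error / h) <= selberg_sum a s t - selberg_sum b s t" using selberg_sum_diff[of b a s t] a st by linarith
 qed
 moreover have "(\<Sum>b\<in>G. class_error / h) = class_error" "(\<Sum>b\<in>G. - (class_error / h)) = - class_error" using h_pos by (simp_all add: h_def)
 ultimately show ?thesis unfolding S_def [symmetric] by linarith
qed

end

section \<open>Averages over all classes from Mertens' estimate\<close>

abbreviation rough_log_sum where
 "rough_log_sum w t \<equiv> (\<Sum>n\<in>rough_upto w t. mangoldt n / real n)"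

text \<open>Discarding numbers that are not rough removes the primes up to w, at a cost of ln w, and
  proper prime powers, at a bounded cost.\<close>

lemma mertens_rough:
 "\<exists>C>0. \<forall>w\<ge>2. \<forall>t\<ge>1. \<bar>rough_log_sum w t - ln t\<bar> <= ln w + C"
proof -
 obtain C where C: "C > 0" "\<And>T. T >= 1 ==> \<bar>log_sum T - ln T\<bar> <= C" using mertens_primes by blast
 obtain C' where C': "C' >= 0" "\<And>D. finite D ==> prime_power_sum D <= C'" using prime_power_sum_bounded by blast
 have "\<bar>rough_log_sum w t - ln t\<bar> <= ln w + (C + C' + 4)" if w: "w >= 2" and t: "t >= 1" for w t
 proof -
  define D where "D = {n\<in>natseg 0 t. \<not> rough w n}"
  have fD: "finite D" by (simp add: D_def)
  have "natseg 0 t = rough_upto w t \<union> D" "rough_upto w t \<inter> D = {}" by (auto simp: rough_upto_def D_def)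
  then have split: "(\<Sum>n\<in>natseg 0 t. mangoldt n / real n) = rough_log_sum w t + (\<Sum>n\<in>D. mangoldt n / real n)" by (simp add: sum.union_disjoint fD)
  have D0: "(\<Sum>n\<in>D. mangoldt n / real n) >= 0" by (intro sum_nonneg divide_nonneg_nonneg mangoldt_nonneg) auto
  have "(\<Sum>n\<in>D. mangoldt n / real n) = (\<Sum>n\<in>{n\<in>D. prime n}. mangoldt n / real n) + (\<Sum>n\<in>{n\<in>D. \<not> prime n}. mangoldt n / real n)"
   using fD by (subst sum.union_disjoint[symmetric]) (auto intro!: sum.cong)
  also have "(\<Sum>n\<in>{n\<in>D. prime n}. mangoldt n / real n) = (\<Sum>n\<in>{n\<in>D. prime n}. ln (real n) / real n)" by (intro sum.cong) auto
  also have "... <= log_sum w"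
  proof (intro sum_mono2)
   show "{n\<in>D. prime n} \<subseteq> primes_in 0 w"
   proof
    fix p assume p: "p \<in> {n\<in>D. prime n}"
    then obtain q where q: "prime q" "q dvd p" "real q <= w" by (auto simp: D_def rough_def not_less prime_gt_0_nat)
    then have "q = p" using p primes_dvd_imp_eq by auto
    then show "p \<in> primes_in 0 w" using p q by (auto simp: natseg_def prime_gt_0_nat)
   qed
  qed (simp, auto simp: natseg_def)
  also have "... <= ln w + C"
  proof -
   have "1 <= w" using w by simp
   from C(2)[OF this] show ?thesis by linarith
  qed
  also have "(\<Sum>n\<in>{n\<in>D. \<not> prime n}. mangoldt n / real n) <= (\<Sum>n\<in>{n\<in>D. \<not> prime n}. mangoldt n / real n powr (3/4))"
  proof (intro sum_mono frac_le mangoldt_nonneg order.refl)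
   fix d assume "d \<in> {n\<in>D. \<not> prime n}"
   then have "real d >= 1" by (auto simp: natseg_def D_def)
   then have "real d powr (3/4) <= real d powr 1" by (intro powr_mono) auto
   then show "real d powr (3/4) <= real d" "0 < real d powr (3/4)" using \<open>real d >= 1\<close> by auto
  qed
  also have "... <= C'" by (rule C'(2)[OF fD])
  finally have "(\<Sum>n\<in>D. mangoldt n / real n) <= ln w + C + C'" by simp
  moreover have "ln w > 0" using w by simp
  ultimately show ?thesis using mertens[OF t] split D0 C(1) C'(1) by linarith
 qed
 then show ?thesis using C(1) C'(1) by (intro exI[of _ "C + C' + 4"]) auto
qed

text \<open>After exchanging the summations, d carries the factor ln d + M (t / d). Mertens'
  estimate for M (t / d) turns this into ln t + O(E0) for every d, so a second use of Mertens
  suffices; divisors of rough numbers are rough, which keeps the sums within the same class of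
  numbers.\<close>

lemma mangoldt2_rough_sum:
 assumes E0: "\<And>t. t >= 1 ==> \<bar>rough_log_sum w t - ln t\<bar> <= E0" and t: "t >= 1"
 shows "\<bar>(\<Sum>n\<in>rough_upto w t. mangoldt2 n / real n) - (ln t)\<^sup>2\<bar> <= E0 * (2 * ln t + E0)"
proof -
 define M where "M = (%t. \<Sum>n\<in>rough_upto w t. mangoldt n / real n :: real)"
 have "(\<Sum>n\<in>rough_upto w t. mangoldt2 n / real n) = (\<Sum>n\<in>rough_upto w t. mangoldt n / real n * ln (real n)) +
   (\<Sum>n\<in>rough_upto w t. \<Sum>d | d dvd n. mangoldt d / real d * (mangoldt (n div d) / real (n div d)))" unfolding sum.distrib [symmetric]
 proof (rule sum.cong[OF refl])
  fix n assume "n \<in> rough_upto w t"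
  then have n: "n > 0" by (rule rough_upto_pos)
  have "(\<Sum>d | d dvd n. mangoldt d * mangoldt (n div d)) / real n = (\<Sum>d | d dvd n. mangoldt d / real d * (mangoldt (n div d) / real (n div d)))" unfolding sum_divide_distrib
  proof (rule sum.cong[OF refl])
   fix d assume "d \<in> {d. d dvd n}"
   then obtain k where k: "n = d * k" "d > 0" "k > 0" using n by (auto elim!: dvdE intro!: Nat.gr0I)
   then show "mangoldt d * mangoldt (n div d) / real n = mangoldt d / real d * (mangoldt (n div d) / real (n div d))" by simp
  qed
  then show "mangoldt2 n / real n = mangoldt n / real n * ln (real n) + (\<Sum>d | d dvd n. mangoldt d / real d * (mangoldt (n div d) / real (n div d)))" by (simp add: mangoldt2_def add_divide_distrib)
 qed
 also have "(\<Sum>n\<in>rough_upto w t. \<Sum>d | d dvd n. mangoldt d / real d * (mangoldt (n div d) / real (n div d))) =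
  (\<Sum>d\<in>rough_upto w t. \<Sum>m\<in>{m. d * m \<in> rough_upto w t}. mangoldt d / real d * (mangoldt m / real m))"
 proof (rule sum_divisors_pairs)
  fix n d assume n: "n \<in> rough_upto w t" "d dvd n"
  then have "d <= n" using rough_upto_pos dvd_imp_le by blast
  then have "real d <= real n" by simp
  then show "d \<in> rough_upto w t" using n by (auto simp: rough_upto_def natseg_def rough_mult_iff rough_def elim!: dvdE)
 qed (auto simp: rough_upto_pos)
 also have "... = (\<Sum>d\<in>rough_upto w t. mangoldt d / real d * M (t / real d))"
 proof (rule sum.cong[OF refl])
  fix d assume d: "d \<in> rough_upto w t"
  then have "real d > 0" "rough w d" by (auto simp: rough_upto_def rough_def)
  then have "{m. d * m \<in> rough_upto w t} = rough_upto w (t / real d)" by (auto simp: rough_upto_def natseg_def rough_mult_iff field_simps dest: rough_pos)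
  then show "(\<Sum>m\<in>{m. d * m \<in> rough_upto w t}. mangoldt d / real d * (mangoldt m / real m)) = mangoldt d / real d * M (t / real d)" by (simp only: M_def sum_distrib_left)
 qed
 finally have eq: "(\<Sum>n\<in>rough_upto w t. mangoldt2 n / real n) = (\<Sum>d\<in>rough_upto w t. mangoldt d / real d * (ln (real d) + M (t / real d)))" by (simp only: sum.distrib distrib_left)
 have "\<bar>(\<Sum>n\<in>rough_upto w t. mangoldt2 n / real n) - ln t * M t\<bar> = \<bar>\<Sum>d\<in>rough_upto w t. mangoldt d / real d * (ln (real d) + M (t / real d) - ln t)\<bar>"
  unfolding eq by (simp add: M_def sum_distrib_left sum_subtractf [symmetric] algebra_simps)
 also have "... <= (\<Sum>d\<in>rough_upto w t. mangoldt d / real d * E0)"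
 proof (rule order.trans[OF sum_abs], rule sum_mono)
  fix d assume "d \<in> rough_upto w t"
  then have d: "real d > 0" "real d <= t" by (auto simp: rough_upto_def natseg_def)
  then have "\<bar>M (t / real d) - ln (t / real d)\<bar> <= E0" unfolding M_def by (intro E0) auto
  then have "\<bar>ln (real d) + M (t / real d) - ln t\<bar> <= E0" using d t by (simp add: ln_div)
  then have "mangoldt d / real d * \<bar>ln (real d) + M (t / real d) - ln t\<bar> <= mangoldt d / real d * E0" by (intro mult_left_mono divide_nonneg_nonneg mangoldt_nonneg) auto
  then show "\<bar>mangoldt d / real d * (ln (real d) + M (t / real d) - ln t)\<bar> <= mangoldt d / real d * E0" by (simp add: abs_mult)
 qed
 also have "... = M t * E0" by (simp add: M_def sum_distrib_right)
 finally have 1: "\<bar>(\<Sum>n\<in>rough_upto w t. mangoldt2 n / real n) - ln t * M t\<bar> <= M t * E0" .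
 have Mt: "\<bar>M t - ln t\<bar> <= E0" unfolding M_def by (rule E0[OF t])
 have "E0 >= 0" using Mt by linarith
 have lt: "ln t >= 0" using t by simp
 have "M t * E0 <= (ln t + E0) * E0" using Mt \<open>E0 >= 0\<close> by (intro mult_right_mono) auto
 moreover have "\<bar>ln t * M t - (ln t)\<^sup>2\<bar> <= ln t * E0"
 proof -
  have "ln t * M t - (ln t)\<^sup>2 = ln t * (M t - ln t)" by (simp add: power2_eq_square algebra_simps)
  then show ?thesis using Mt lt by (simp add: abs_mult mult_left_mono)
 qed
 moreover have "(ln t + E0) * E0 + ln t * E0 = E0 * (2 * ln t + E0)" by (simp add: algebra_simps)
 ultimately show ?thesis using 1 by linarith
qed

section \<open>The density of primes in the cells of the logarithmic scale\<close>

context rough_classes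
begin

text \<open>Scaled to have mean about 1: a cell has length x / N in the logarithm and is shared by h
  classes. Proper prime powers are still counted here and are removed only in
  \<open>good_modulus\<close>.\<close>

definition prime_density :: "real => nat => nat => nat => real" where
 "prime_density x N a i = real N * h / x * (\<Sum>n\<in>cls a (exp (x * real (i - 1) / real N)) (exp (x * real i / real N)). mangoldt n / real n)"

lemma selberg_density_prime_density:
 fixes x E0 e :: real and N i0 :: nat
 assumes Xx: "X = exp x"
  and E0: "\<And>t. t >= 1 ==> \<bar>rough_log_sum w t - ln t\<bar> <= E0"
  and i0: "1 <= i0" "2 * i0 <= N" and e: "0 < e" "e <= 1" "2 / real i0 <= e"
  and T0x: "2 * ln T0 <= x * real i0 / real N"
  and err: "2 * E0 * (2 * x + E0) + class_error <= x\<^sup>2 / (real N)\<^sup>2"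
  and err2: "2 * E0 * real N / x <= e"
 shows "selberg_density (residue_units Q) (prime_density x N) N i0 e"
proof -
 define u where "u = (%i::nat. exp (x * real i / real N))"
 define mass where "mass = (%a i. \<Sum>n\<in>cls a (u (i - 1)) (u i). mangoldt n / real n :: real)"
 define M where "M = (%t. \<Sum>n\<in>rough_upto w t. mangoldt n / real n :: real)"
 define W where "W = (%t. \<Sum>n\<in>rough_upto w t. mangoldt2 n / real n)"
 have N0: "real N > 0" using i0 by simp
 have x0: "x > 0" using lnX Xx by simp
 have u1: "u i >= 1" for i using x0 N0 by (simp add: u_def)
 have umono: "u i <= u j" if "i <= j" for i j using that x0 N0 by (simp add: u_def divide_right_mono)
 have uX: "u i <= X" if "i <= N" for i using that x0 N0 by (simp add: u_def Xx divide_simps)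
 have lnu: "ln (u i) = x * real i / real N" for i by (simp add: u_def)
 have uT: "T0\<^sup>2 <= u i" if "i0 <= i" for i
 proof -
  have "2 * ln T0 <= x * real i / real N" using T0x that x0 N0 by (meson divide_right_mono less_imp_le mult_left_mono of_nat_le_iff order.trans)
  then have "exp (2 * ln T0) <= u i" by (simp add: u_def)
  moreover have "exp (2 * ln T0) = T0\<^sup>2" using T0 by (simp add: exp_double)
  ultimately show ?thesis by simp
 qed
 have E00: "E0 >= 0" using E0[of 1] by linarith
 have dens: "prime_density x N a i = real N * h / x * mass a i" for a i by (simp add: prime_density_def mass_def u_def)
 have mass0: "mass a i >= 0" for a i unfolding mass_def by (intro sum_nonneg divide_nonneg_nonneg mangoldt_nonneg) auto
 have diffset: "(\<Sum>n\<in>{n\<in>natseg s t. rough w n}. f n) = (\<Sum>n\<in>rough_upto w t. f n) - (\<Sum>n\<in>rough_upto w s. f n)" if "s <= t" for s t and f :: "nat => real"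
 proof -
  have "rough_upto w t = rough_upto w s \<union> {n\<in>natseg s t. rough w n}" "rough_upto w s \<inter> {n\<in>natseg s t. rough w n} = {}" using that by (auto simp: rough_upto_def natseg_def rough_def)
  then have "(\<Sum>n\<in>rough_upto w t. f n) = (\<Sum>n\<in>rough_upto w s. f n) + (\<Sum>n\<in>{n\<in>natseg s t. rough w n}. f n)" by (simp add: sum.union_disjoint)
  then show ?thesis by simp
 qed
 have Wsum: "\<bar>h * selberg_sum a (u i) (u j) - x\<^sup>2 / (real N)\<^sup>2 * (real j ^ 2 - real i ^ 2)\<bar> <= 2 * E0 * (2 * x + E0) + class_error"
  if a: "a \<in> G" and ij: "i0 <= i" "i <= j" "j <= N" for a i j
 proof -
  have "\<bar>h * selberg_sum a (u i) (u j) - (W (u j) - W (u i))\<bar> <= class_error" using selberg_sum_average[OF a uT[OF ij(1)] uX[OF ij(3)]] diffset[OF umono[OF ij(2)], of "%n. mangoldt2 n / real n"] by (simp add: W_def)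
  moreover have "\<bar>W (u k) - x\<^sup>2 / (real N)\<^sup>2 * real k ^ 2\<bar> <= E0 * (2 * x + E0)" if "k <= N" for k
  proof -
   have "\<bar>W (u k) - (ln (u k))\<^sup>2\<bar> <= E0 * (2 * ln (u k) + E0)" unfolding W_def by (rule mangoldt2_rough_sum[OF E0 u1])
   also have "ln (u k) <= x" unfolding lnu using that x0 N0 by (simp add: divide_simps)
   finally show ?thesis using E00 by (simp add: lnu power_divide power_mult_distrib mult_left_mono)
  qed
  from this[of i] this[of j] have "\<bar>W (u i) - x\<^sup>2 / (real N)\<^sup>2 * real i ^ 2\<bar> <= E0 * (2 * x + E0)" "\<bar>W (u j) - x\<^sup>2 / (real N)\<^sup>2 * real j ^ 2\<bar> <= E0 * (2 * x + E0)" using ij by auto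
  ultimately show ?thesis unfolding right_diff_distrib by linarith
 qed
 have Ms: "(\<Sum>a\<in>G. mass a i) = M (u i) - M (u (i - 1))" for i unfolding mass_def sum_cls M_def by (rule diffset) (simp add: umono)
 have Mu: "\<bar>M (u k) - x * real k / real N\<bar> <= E0" for k using E0[OF u1, of k] by (simp add: M_def lnu)
 have avg: "\<bar>(\<Sum>a\<in>G. prime_density x N a i) - h\<bar> <= e * h" if i: "1 <= i" for i
 proof -
  have "x * real i / real N - x * real (i - 1) / real N = x / real N" using i N0 by (simp add: of_nat_diff field_simps)
  then have "\<bar>(\<Sum>a\<in>G. mass a i) - x / real N\<bar> <= 2 * E0" using Mu[of i] Mu[of "i - 1"] unfolding Ms by linarith
  then have "real N * h / x * \<bar>(\<Sum>a\<in>G. mass a i) - x / real N\<bar> <= real N * h / x * (2 * E0)" using h_pos x0 by (intro mult_left_mono) auto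
  also have "... = (2 * E0 * real N / x) * h" by simp
  also have "... <= e * h" using err2 h_pos by (intro mult_right_mono) auto
  finally have "\<bar>real N * h / x * ((\<Sum>a\<in>G. mass a i) - x / real N)\<bar> <= e * h" using h_pos x0 by (simp add: abs_mult)
  moreover have "real N * h / x * ((\<Sum>a\<in>G. mass a i) - x / real N) = (\<Sum>a\<in>G. prime_density x N a i) - h"
  proof -
   have "(\<Sum>a\<in>G. prime_density x N a i) = real N * h / x * (\<Sum>a\<in>G. mass a i)" unfolding dens by (simp only: sum_distrib_left)
   then show ?thesis using x0 N0 by (simp add: right_diff_distrib)
  qed
  ultimately show ?thesis by (simp only:)
 qed
 have first: "(\<Sum>n\<in>cls a (u i) (u j). mangoldt n * ln (real n) / real n) <= selberg_sum a (u i) (u j)" for a i j unfolding selberg_sum_def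
  by (intro sum_mono divide_right_mono) (auto simp: mangoldt2_def intro!: sum_nonneg mult_nonneg_nonneg mangoldt_nonneg)
 \<comment> \<open>Over cell j + 1 the squared position grows by 2 j + 1, and the error is at most
   one more unit. Division by the position j gives 2 + 2 / j, and 2 / j <= e since j >= i0.\<close>
 have up: "prime_density x N a i <= 2 + e" if a: "a \<in> G" and i: "i0 < i" "i <= N" for a i
 proof -
  define j where "j = i - 1"
  have j: "i = Suc j" "i0 <= j" "j >= 1" using i i0 by (auto simp: j_def)
  have "(x * real j / real N) * mass a i <= (\<Sum>n\<in>cls a (u j) (u i). mangoldt n * ln (real n) / real n)" unfolding mass_def j_def [symmetric] sum_distrib_left
  proof (rule sum_mono)
   fix n assume "n \<in> cls a (u j) (u i)"
   then have "u j < real n" by (simp add: cls_def natseg_def)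
   then have "ln (u j) <= ln (real n)" using u1[of j] by (subst ln_le_cancel_iff) auto
   then have "x * real j / real N <= ln (real n)" by (simp add: lnu)
   then have "x * real j / real N * (mangoldt n / real n) <= ln (real n) * (mangoldt n / real n)" by (intro mult_right_mono divide_nonneg_nonneg mangoldt_nonneg) auto
   then show "x * real j / real N * (mangoldt n / real n) <= mangoldt n * ln (real n) / real n" by (simp add: mult.commute)
  qed
  also have "... <= selberg_sum a (u j) (u i)" by (rule first)
  finally have "h * ((x * real j / real N) * mass a i) <= h * selberg_sum a (u j) (u i)" using h_pos by (intro mult_left_mono) auto
  also have "... <= x\<^sup>2 / (real N)\<^sup>2 * (real i ^ 2 - real j ^ 2) + x\<^sup>2 / (real N)\<^sup>2" using Wsum[OF a, of j i] j i err by linarith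
  also have "... = x\<^sup>2 / (real N)\<^sup>2 * (2 * real j + 2)"
  proof -
   have "real i ^ 2 - real j ^ 2 = 2 * real j + 1" unfolding j(1) by (simp add: power2_eq_square algebra_simps)
   moreover have "y * (2 * real j + 1) + y = y * (2 * real j + 2)" for y by (simp add: algebra_simps)
   ultimately show ?thesis by (simp only:)
  qed
  finally have *: "h * ((x * real j / real N) * mass a i) <= x\<^sup>2 / (real N)\<^sup>2 * (2 * real j + 2)" .
  have "(x\<^sup>2 / (real N)\<^sup>2) * (real j * prime_density x N a i) = h * ((x * real j / real N) * mass a i)" unfolding dens using x0 N0 by (simp add: power2_eq_square)
  with * have "(x\<^sup>2 / (real N)\<^sup>2) * (real j * prime_density x N a i) <= x\<^sup>2 / (real N)\<^sup>2 * (2 * real j + 2)" by simp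
  then have "real j * prime_density x N a i <= 2 * real j + 2" using x0 N0 by (subst (asm) mult_le_cancel_left_pos) auto
  also have "... <= real j * (2 + e)"
  proof -
   have "2 <= e * real i0" using e i0 by (simp add: pos_divide_le_eq)
   also have "... <= e * real j" using j e by (intro mult_left_mono) auto
   finally show ?thesis by (simp add: algebra_simps)
  qed
  finally show ?thesis using j by simp
 qed
 have sel: "h * (real T2 ^ 2 - real T1 ^ 2 - e * real N ^ 2) <= h * real T2 * (\<Sum>i\<in>{T1<..T2}. prime_density x N c i) +
    (\<Sum>b\<in>G. \<Sum>(i, j)\<in>sum_window T1 T2. prime_density x N b i * prime_density x N (c \<otimes>\<^bsub>residue_units Q\<^esub> inv\<^bsub>residue_units Q\<^esub> b) j)"
  if c: "c \<in> G" and T: "2 * i0 <= T1" "T1 <= T2" "T2 <= N" for c T1 T2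
 proof -
  have T2X: "u T2 <= X" using T uX by auto
  define A where "A = (\<Sum>n\<in>cls c (u T1) (u T2). mangoldt n / real n * ln (real n))"
  define L where "L = (%n. mangoldt n / real n :: real)"
  have L0: "L n >= 0" for n unfolding L_def by (intro divide_nonneg_nonneg mangoldt_nonneg) auto
  define S where "S = (\<Sum>n\<in>cls c (u T1) (u T2). \<Sum>d | d dvd n. L d * L (n div d))"
  have VAS: "selberg_sum c (u T1) (u T2) = A + S" unfolding selberg_sum_def A_def S_def sum.distrib [symmetric]
  proof (rule sum.cong[OF refl])
   fix n assume "n \<in> cls c (u T1) (u T2)"
   then have n: "n > 0" by (rule cls_pos)
   have "(\<Sum>d | d dvd n. mangoldt d * mangoldt (n div d)) / real n = (\<Sum>d | d dvd n. L d * L (n div d))" unfolding sum_divide_distrib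
   proof (rule sum.cong[OF refl])
    fix d assume "d \<in> {d. d dvd n}"
    then obtain k where k: "n = d * k" "d > 0" "k > 0" using n by (auto elim!: dvdE intro!: Nat.gr0I)
    then show "mangoldt d * mangoldt (n div d) / real n = L d * L (n div d)" by (simp add: L_def)
   qed
   then show "mangoldt2 n / real n = mangoldt n / real n * ln (real n) + (\<Sum>d | d dvd n. L d * L (n div d))" by (simp add: mangoldt2_def add_divide_distrib)
  qed
  have A: "A <= (x * real T2 / real N) * (\<Sum>i\<in>{T1<..T2}. mass c i)"
  proof -
   have "A <= (\<Sum>n\<in>cls c (u T1) (u T2). (x * real T2 / real N) * L n)" unfolding A_def
   proof (rule sum_mono)
    fix n assume n: "n \<in> cls c (u T1) (u T2)"
    then have "real n <= u T2" "n > 0" using cls_pos by (auto simp: cls_def natseg_def)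
    then have "ln (real n) <= ln (u T2)" using u1[of T2] by (subst ln_le_cancel_iff) auto
    then have "L n * ln (real n) <= L n * (x * real T2 / real N)" using L0 by (intro mult_left_mono) (auto simp: lnu)
    then show "mangoldt n / real n * ln (real n) <= (x * real T2 / real N) * L n" by (simp only: L_def mult.commute)
   qed
   also have "... = (x * real T2 / real N) * (\<Sum>n\<in>cls c (u T1) (u T2). L n)" by (simp only: sum_distrib_left)
   also have "(\<Sum>n\<in>cls c (u T1) (u T2). L n) = (\<Sum>i\<in>{T1<..T2}. mass c i)" using T(2)
   proof (induction T2 rule: dec_induct)
    case base
    have "cls c (u T1) (u T1) = {}" by (auto simp: cls_def natseg_def)
    then show ?case by simp
   next
    case (step k)
    have "cls c (u T1) (u (Suc k)) = cls c (u T1) (u k) \<union> cls c (u k) (u (Suc k))"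
     "cls c (u T1) (u k) \<inter> cls c (u k) (u (Suc k)) = {}" using umono[of T1 k] umono[of k "Suc k"] step by (auto simp: cls_def natseg_def)
    then have "(\<Sum>n\<in>cls c (u T1) (u (Suc k)). L n) = (\<Sum>n\<in>cls c (u T1) (u k). L n) + (\<Sum>n\<in>cls c (u k) (u (Suc k)). L n)" by (simp add: sum.union_disjoint)
    moreover have "{T1<..Suc k} = insert (Suc k) {T1<..k}" using step by auto
    ultimately show ?case using step.IH by (simp add: mass_def L_def)
   qed
   finally show ?thesis .
  qed
  define dd where "dd = (%b. c \<otimes>\<^bsub>residue_units Q\<^esub> inv\<^bsub>residue_units Q\<^esub> b)"
  have S: "S <= (\<Sum>b\<in>G. \<Sum>(i, j)\<in>sum_window T1 T2. mass b i * mass (dd b) j)"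
  proof -
   define P where "P = (SIGMA d:rough_upto w X. cls (dd (d mod Q)) (u T1 / real d) (u T2 / real d))"
   \<comment> \<open>Pairs with a trivial factor contribute nothing as
     \<open>mangoldt 1 = 0\<close>. They have to go, because 1 has position 0 and lies in no
     cell.\<close>
   define P' where "P' = {(d, m)\<in>P. d ~= 1 & m ~= 1}"
   define Z where "Z = (SIGMA b:G. SIGMA ij:sum_window T1 T2. cls b (u (fst ij - 1)) (u (fst ij)) \<times> cls (dd b) (u (snd ij - 1)) (u (snd ij)))"
   have "S = (\<Sum>d\<in>rough_upto w X. \<Sum>m\<in>cls (dv c d) (u T1 / real d) (u T2 / real d). L d * L m)" unfolding S_def by (rule sum_cls_pairs[OF c T2X])
   also have "... = (\<Sum>(d, m)\<in>P. L d * L m)" unfolding P_def dd_def by (subst sum.Sigma) auto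
   also have "... = (\<Sum>(d, m)\<in>P'. L d * L m)" unfolding P'_def by (rule sum.mono_neutral_right) (auto simp: L_def P_def)
   also have "... <= (\<Sum>(b, ij, d, m)\<in>Z. L d * L m)"
   proof (rule sum_le_included[where i = "%(b, ij, dm). dm"])
    show "finite P'" unfolding P'_def P_def by (rule finite_subset[of _ "SIGMA d:rough_upto w X. cls (dd (d mod Q)) (u T1 / real d) (u T2 / real d)"]) auto
    show "finite Z" unfolding Z_def using finite_residue_units by (intro finite_SigmaI) auto
    show "\<forall>y\<in>Z. 0 <= (case y of (b, ij, d, m) => L d * L m)" using L0 by auto
    show "\<forall>z\<in>P'. \<exists>y\<in>Z. (case y of (b, ij, dm) => dm) = z & (case z of (d, m) => L d * L m) <= (case y of (b, ij, d, m) => L d * L m)"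
    proof
     fix z assume z: "z \<in> P'"
     obtain d m where dm: "z = (d, m)" by (cases z)
     have d: "rough w d" "d > 1" and m: "m \<in> cls (dd (d mod Q)) (u T1 / real d) (u T2 / real d)" "m ~= 1" using z dm by (auto simp: P'_def P_def rough_upto_def rough_def)
     have m': "rough w m" "m > 1" "m mod Q = dd (d mod Q)" "u T1 < real d * real m" "real d * real m <= u T2" using m d by (auto simp: cls_def natseg_def rough_def field_simps)
     define td tm where "td = ln (real d) * real N / x" and "tm = ln (real m) * real N / x"
     have t0: "td > 0" "tm > 0" using d m' x0 N0 by (auto simp: td_def tm_def)
     have lsum: "td + tm = ln (real d * real m) * real N / x" using d m' by (simp add: td_def tm_def ln_mult add_divide_distrib distrib_right)
     have "ln (u T1) < ln (real d * real m)" using m' u1[of T1] by (subst ln_less_cancel_iff) auto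
     then have s1: "real T1 < td + tm" unfolding lsum lnu using x0 N0 by (simp add: field_simps)
     have "ln (real d * real m) <= ln (u T2)" using m' d u1[of T2] by (subst ln_le_cancel_iff) auto
     then have s2: "td + tm <= real T2" unfolding lsum lnu using x0 N0 by (simp add: field_simps)
     \<comment> \<open>\<open>td\<close> and \<open>tm\<close> are the positions of d and m measured
       in cells. Rounding up finds the cells, and the strict inequalities \<open>i - 1 < td\<close>
       and \<open>j - 1 < tm\<close> account for the extra 1 in the upper end of
       \<open>sum_window\<close>.\<close>
     define i j where "i = nat \<lceil>td\<rceil>" and "j = nat \<lceil>tm\<rceil>"
     have i: "1 <= i" "real i - 1 < td" "td <= real i" using t0 unfolding i_def by linarith+
     have j: "1 <= j" "real j - 1 < tm" "tm <= real j" using t0 unfolding j_def by linarith+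
     have "real T1 < real (i + j)" "real (i + j) < real (T2 + 2)" using i j s1 s2 by linarith+
     then have ij: "(i, j) \<in> sum_window T1 T2" using i j by (auto simp: sum_window_def)
     have cell: "n \<in> natseg (u (k - 1)) (u k)" if "1 <= k" "real k - 1 < ln (real n) * real N / x" "ln (real n) * real N / x <= real k" "n > 1" for n k
     proof -
      have "x * real (k - 1) / real N < ln (real n)" "ln (real n) <= x * real k / real N" using that x0 N0 by (auto simp: of_nat_diff field_simps)
      then have "exp (x * real (k - 1) / real N) < exp (ln (real n))" "exp (ln (real n)) <= exp (x * real k / real N)" by auto
      then show ?thesis using that by (simp add: natseg_def u_def)
     qed
     have "d \<in> cls (d mod Q) (u (i - 1)) (u i)" using d i cell[of i d] by (simp add: cls_def td_def)
     moreover have "m \<in> cls (dd (d mod Q)) (u (j - 1)) (u j)" using m' j cell[of j m] by (simp add: cls_def tm_def)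
     ultimately have "(d mod Q, (i, j), d, m) \<in> Z" using ij mod_rough[OF d(1)] by (auto simp: Z_def)
     then show "\<exists>y\<in>Z. (case y of (b, ij, dm) => dm) = z & (case z of (d, m) => L d * L m) <= (case y of (b, ij, d, m) => L d * L m)" using dm by (intro bexI[of _ "(d mod Q, (i, j), d, m)"]) auto
    qed
   qed
   also have "... = (\<Sum>b\<in>G. \<Sum>ij\<in>sum_window T1 T2. \<Sum>dm\<in>cls b (u (fst ij - 1)) (u (fst ij)) \<times> cls (dd b) (u (snd ij - 1)) (u (snd ij)). L (fst dm) * L (snd dm))"
    unfolding Z_def using finite_residue_units by (subst sum.Sigma, (auto)[2], subst sum.Sigma) (auto simp: case_prod_unfold intro!: sum.cong)
   also have "... = (\<Sum>b\<in>G. \<Sum>(i, j)\<in>sum_window T1 T2. mass b i * mass (dd b) j)" by (intro sum.cong refl) (simp add: case_prod_unfold mass_def sum_product sum.cartesian_product L_def)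
   finally show ?thesis .
  qed
  define R where "R = (\<Sum>b\<in>G. \<Sum>(i, j)\<in>sum_window T1 T2. prime_density x N b i * prime_density x N (dd b) j)"
  have R: "R = (real N * h / x)\<^sup>2 * (\<Sum>b\<in>G. \<Sum>(i, j)\<in>sum_window T1 T2. mass b i * mass (dd b) j)" unfolding R_def dens by (simp add: sum_distrib_left case_prod_unfold power2_eq_square mult_ac)
  have D: "(\<Sum>i\<in>{T1<..T2}. prime_density x N c i) = (real N * h / x) * (\<Sum>i\<in>{T1<..T2}. mass c i)" unfolding dens by (simp add: sum_distrib_left)
  have "x\<^sup>2 / (real N)\<^sup>2 * (real T2 ^ 2 - real T1 ^ 2) - x\<^sup>2 / (real N)\<^sup>2 <= h * (A + S)" using Wsum[OF c, of T1 T2] T err i0 unfolding VAS by linarith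
  also have "... <= h * ((x * real T2 / real N) * (\<Sum>i\<in>{T1<..T2}. mass c i) + (\<Sum>b\<in>G. \<Sum>(i, j)\<in>sum_window T1 T2. mass b i * mass (dd b) j))" using A S h_pos by (intro mult_left_mono add_mono) auto
  finally have "(h * ((real N)\<^sup>2 / x\<^sup>2)) * (x\<^sup>2 / (real N)\<^sup>2 * (real T2 ^ 2 - real T1 ^ 2) - x\<^sup>2 / (real N)\<^sup>2) <=
    (h * ((real N)\<^sup>2 / x\<^sup>2)) * (h * ((x * real T2 / real N) * (\<Sum>i\<in>{T1<..T2}. mass c i) + (\<Sum>b\<in>G. \<Sum>(i, j)\<in>sum_window T1 T2. mass b i * mass (dd b) j)))"
   using h_pos by (intro mult_left_mono) auto
  also have "(h * ((real N)\<^sup>2 / x\<^sup>2)) * (x\<^sup>2 / (real N)\<^sup>2 * (real T2 ^ 2 - real T1 ^ 2) - x\<^sup>2 / (real N)\<^sup>2) = h * (real T2 ^ 2 - real T1 ^ 2 - 1)" using x0 N0 by (simp add: field_simps)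
  also have "(h * ((real N)\<^sup>2 / x\<^sup>2)) * (h * ((x * real T2 / real N) * (\<Sum>i\<in>{T1<..T2}. mass c i) + (\<Sum>b\<in>G. \<Sum>(i, j)\<in>sum_window T1 T2. mass b i * mass (dd b) j)))
    = h * real T2 * (\<Sum>i\<in>{T1<..T2}. prime_density x N c i) + R" unfolding R D using x0 N0 by (simp add: field_simps power2_eq_square)
  finally have "h * (real T2 ^ 2 - real T1 ^ 2 - 1) <= h * real T2 * (\<Sum>i\<in>{T1<..T2}. prime_density x N c i) + R" .
  moreover have "h * (real T2 ^ 2 - real T1 ^ 2 - e * real N ^ 2) <= h * (real T2 ^ 2 - real T1 ^ 2 - 1)"
  proof -
   have "2 <= e * real i0" using e i0 by (simp add: pos_divide_le_eq)
   also have "... <= e * (real N)\<^sup>2"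
   proof -
    have "real i0 <= real N" using i0 by simp
    also have "... <= (real N)\<^sup>2" using i0 by (simp add: power2_eq_square)
    finally show ?thesis using e by (intro mult_left_mono) auto
   qed
   finally show ?thesis using h_pos by (intro mult_left_mono) auto
  qed
  ultimately show ?thesis unfolding R_def dd_def by linarith
 qed
 show ?thesis
 proof (unfold_locales, goal_cases)
  case 1 show ?case by (rule finite_residue_units)
 next
  case 2 show ?case using i0 by simp
 next
  case 3 show ?case using i0 by simp
 next
  case 4 show ?case using e by simp
 next
  case 5 show ?case using e by simp
 next
  case (6 a i) show ?case unfolding dens using mass0 h_pos x0 by (intro mult_nonneg_nonneg) auto
 next
  case (7 a i) then show ?case by (rule up)
 next
  case (8 i) then show ?case using avg[of i] by (simp add: h_def algebra_simps abs_le_iff)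
 next
  case (9 i) then show ?case using avg[of i] i0 by (simp add: h_def algebra_simps abs_le_iff)
 next
  case (10 c T1 T2) then show ?case using sel[of c T1 T2] unfolding h_def by simp
 qed
qed

end

section \<open>Equidistribution of rough numbers in residue classes\<close>

lemma residue_of_linear_form:
 assumes "prime (p::nat)" "\<not> p dvd Q"
 shows "\<exists>c<p. \<forall>k. p dvd b + Q * k \<longleftrightarrow> k mod p = c"
proof -
 have p: "p > 0" using assms by (simp add: prime_gt_0_nat)
 have "coprime Q p" using assms by (metis coprime_commute prime_imp_coprime)
 then obtain q where q: "[Q * q = 1] (mod p)" using cong_solve_coprime_nat by auto
 \<comment> \<open>The root - b / Q modulo p within the natural numbers: \<open>(p - 1) * b\<close>
   stands for - b, and q inverts Q.\<close>
 define c where "c = ((p - 1) * b * q) mod p"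
 have "b + Q * ((p - 1) * b * q) = b + (p - 1) * b * (Q * q)" by (simp add: mult_ac)
 also have "[... = b + (p - 1) * b * 1] (mod p)" using q by (intro cong_add cong_mult cong_refl)
 also have "b + (p - 1) * b * 1 = p * b" using p by (cases p) auto
 also have "[p * b = 0] (mod p)" by (simp add: Cong.cong_def)
 finally have "[b + Q * ((p - 1) * b * q) = 0] (mod p)" .
 moreover have "[b + Q * c = b + Q * ((p - 1) * b * q)] (mod p)" unfolding c_def by (intro cong_add cong_mult cong_refl) (simp add: Cong.cong_def)
 ultimately have c: "[b + Q * c = 0] (mod p)" using cong_trans by blast
 have "p dvd b + Q * k \<longleftrightarrow> k mod p = c" for k
 proof -
  have "p dvd b + Q * k \<longleftrightarrow> [b + Q * k = b + Q * c] (mod p)" using c by (metis cong_0_iff cong_sym cong_trans)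
  also have "... \<longleftrightarrow> [Q * k = Q * c] (mod p)" by (rule cong_add_lcancel_nat)
  also have "... \<longleftrightarrow> [k = c] (mod p)" using \<open>coprime Q p\<close> by (rule cong_mult_lcancel_nat)
  also have "... \<longleftrightarrow> k mod p = c" by (simp add: Cong.cong_def c_def)
  finally show ?thesis .
 qed
 moreover have "c < p" using p by (simp add: c_def)
 ultimately show ?thesis by blast
qed

text \<open>Multiply by the harmonic sum up to w. A rough number m and a number k <= w are coprime,
  so the products m k are distinct, and the product of the two sums is at most the harmonic sum up
  to T w.\<close>

lemma sum_inverse_rough_le:
 assumes w: "w >= 2" and T: "T >= 1"
 shows "(\<Sum>m\<in>rough_upto w T. 1 / real m) <= (ln T + ln w + 1) / ln w"
proof -
 have ge: "ln w <= (\<Sum>k\<in>natseg 0 w. 1 / real k)"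
 proof -
  define n where "n = nat \<lfloor>w\<rfloor>"
  have "ln (real (Suc n)) <= (\<Sum>k=1..n. 1 / real k)" for n
  proof (induction n)
   case (Suc n)
   have "ln (1 + 1 / real (Suc n)) <= 1 / real (Suc n)" by (intro ln_add_one_self_le_self) auto
   moreover have "1 + 1 / real (Suc n) = real (Suc (Suc n)) / real (Suc n)" by (simp add: field_simps)
   ultimately have "ln (real (Suc (Suc n))) - ln (real (Suc n)) <= 1 / real (Suc n)" by (simp only:) (subst (asm) ln_div, auto)
   then show ?case using Suc by simp
  qed simp
  note h = this[of n]
  have "w <= real (Suc n)" using w unfolding n_def by linarith
  then have "ln w <= ln (real (Suc n))" using w by (subst ln_le_cancel_iff) auto
  then show ?thesis using h by (simp add: natseg_0 n_def)
 qed
 have "(\<Sum>m\<in>rough_upto w T. 1 / real m) * (\<Sum>k\<in>natseg 0 w. 1 / real k) = (\<Sum>(m,k)\<in>rough_upto w T \<times> natseg 0 w. 1 / real (m * k))" by (simp add: sum_product sum.cartesian_product)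
 also have "... = (\<Sum>n\<in>(%(m,k). m * k) ` (rough_upto w T \<times> natseg 0 w). 1 / real n)"
 proof (subst sum.reindex)
  show "inj_on (%(m,k). m * k) (rough_upto w T \<times> natseg 0 w)"
  proof (rule inj_onI, clarify)
   fix m k m' k' assume mk: "m \<in> rough_upto w T" "k \<in> natseg 0 w" "m' \<in> rough_upto w T" "k' \<in> natseg 0 w" "m * k = m' * k'"
   have cop: "coprime m k" if "m \<in> rough_upto w T" "k \<in> natseg 0 w" for m k
   proof (rule ccontr)
    assume "\<not> coprime m k"
    then have "gcd m k ~= 1" using coprime_iff_gcd_eq_1 by blast
    then obtain p where "prime p" "p dvd gcd m k" using prime_factor_nat by blast
    then have p: "prime p" "p dvd m" "p dvd k" by auto
    then have "w < real p" using that by (auto simp: rough_upto_def rough_def)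
    moreover have "p <= k" using p that by (intro dvd_imp_le) (auto simp: natseg_def)
    then have "real p <= real k" by simp
    ultimately show False using that by (auto simp: natseg_def)
   qed
   have "m dvd m' * k'" "m' dvd m * k" using mk(5) by (metis dvd_triv_left)+
   then have "m dvd m'" "m' dvd m" using cop[OF mk(1,4)] cop[OF mk(3,2)] by (simp_all add: coprime_dvd_mult_left_iff)
   then have "m = m'" by (simp add: dvd_antisym)
   moreover have "m > 0" using mk by (auto simp: rough_upto_def rough_def)
   ultimately show "m = m' & k = k'" using mk by auto
  qed
 qed (simp add: case_prod_unfold o_def)
 also have "... <= (\<Sum>n\<in>natseg 0 (T * w). 1 / real n)" using T w by (intro sum_mono2) (simp, auto simp: rough_upto_def natseg_def intro!: mult_mono)
 also have "... <= ln (T * w) + 1"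
 proof (rule sum_inverse_natseg_le)
  have "1 * 1 <= T * w" using T w by (intro mult_mono) auto
  then show "1 <= T * w" by simp
 qed
 also have "ln (T * w) = ln T + ln w" using T w by (simp add: ln_mult)
 finally have "(\<Sum>m\<in>rough_upto w T. 1 / real m) * (\<Sum>k\<in>natseg 0 w. 1 / real k) <= ln T + ln w + 1" .
 moreover have "(\<Sum>m\<in>rough_upto w T. 1 / real m) * ln w <= (\<Sum>m\<in>rough_upto w T. 1 / real m) * (\<Sum>k\<in>natseg 0 w. 1 / real k)" using ge by (intro mult_left_mono sum_nonneg) auto
 moreover have "ln w > 0" using w by simp
 ultimately show ?thesis by (simp add: pos_le_divide_eq)
qed

lemma card_residue_units_prod:
 assumes "finite A" "\<And>p. p \<in> A ==> prime (p::nat)"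
 shows "real (card (unit_residues (\<Prod>A))) = real (\<Prod>A) * (\<Prod>p\<in>A. 1 - 1 / real p)"
proof -
 have "unit_residues (\<Prod>A) = {r\<in>{..<\<Prod>A}. \<forall>p\<in>A. r mod p \<in> {1..<p}}"
 proof -
  have "coprime r (\<Prod>A) \<longleftrightarrow> (\<forall>p\<in>A. r mod p \<in> {1..<p})" for r
  proof
   assume r: "coprime r (\<Prod>A)"
   show "\<forall>p\<in>A. r mod p \<in> {1..<p}"
   proof
    fix p assume p: "p \<in> A"
    then have "p dvd \<Prod>A" using assms by (intro dvd_prodI) auto
    then have "\<not> p dvd r" using r assms(2)[OF p] by (meson coprime_common_divisor not_prime_unit)
    then show "r mod p \<in> {1..<p}" using assms(2)[OF p] prime_gt_0_nat by (auto simp: dvd_eq_mod_eq_0 Suc_le_eq)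
   qed
  next
   assume "\<forall>p\<in>A. r mod p \<in> {1..<p}"
   then have "coprime r p" if "p \<in> A" for p using that assms(2)[OF that] by (metis atLeastLessThan_iff coprime_commute dvd_eq_mod_eq_0 not_one_le_zero prime_imp_coprime)
   then show "coprime r (\<Prod>A)" by (intro prod_coprime_right) auto
  qed
  then show ?thesis by (auto simp: residue_units_def)
 qed
 then have "card (unit_residues (\<Prod>A)) = (\<Prod>p\<in>A. card {1..<p})" using assms by (simp only:) (rule card_residue_system, auto)
 then have "real (card (unit_residues (\<Prod>A))) = (\<Prod>p\<in>A. real p - 1)" using assms prime_ge_1_nat by (simp add: of_nat_diff)
 also have "... = (\<Prod>p\<in>A. real p * (1 - 1 / real p))" using assms prime_gt_0_nat by (intro prod.cong refl) (auto simp: field_simps)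
 finally show ?thesis by (simp add: prod.distrib)
qed

text \<open>Along the progression b + Q k the primes of A never divide, as b is coprime to Q; Brun's
  sieve removes the other primes up to w. The main term does not depend on b, which is the
  equidistribution wanted.\<close>

lemma card_rough_in_class:
 assumes A: "finite A" "\<And>p. p \<in> A ==> prime p" "\<And>p. p \<in> A ==> real p <= w"
  and w: "w >= 2" and b: "b < \<Prod>A" "coprime b (\<Prod>A)" and s: "real (\<Prod>A) <= s" "s <= t"
  and S1: "reciprocal_sum w <= \<sigma>"
 shows "\<bar>real (card (rough_class w (\<Prod>A) b s t)) - (t - s) / card (unit_residues (\<Prod>A)) * mertens_prod w\<bar>
   <= 4 * (t / real (\<Prod>A)) * exp (3 * \<sigma> - real r) + 2 * (w + 1) ^ Suc r"
proof -
 define Q where "Q = \<Prod>A"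
 define h where "h = real (card (unit_residues Q))"
 have Q0: "Q > 0" unfolding Q_def using A by (intro prod_primes_pos) auto
 define P where "P = {p\<in>natseg 0 w. prime p & p \<notin> A}"
 have fP: "finite P" by (simp add: P_def)
 have Pp: "prime p" "\<not> p dvd Q" if "p \<in> P" for p using that prime_dvd_prod_primes[OF A(1,2), of p] by (auto simp: P_def Q_def)
 define c where "c = (%p. SOME c. c < p & (\<forall>k. p dvd b + Q * k \<longleftrightarrow> k mod p = c))"
 have c': "c p < p & (\<forall>k. p dvd b + Q * k \<longleftrightarrow> k mod p = c p)" if "p \<in> P" for p unfolding c_def by (rule someI_ex) (rule residue_of_linear_form[OF Pp[OF that]])
 have c: "c p < p" "\<And>k. p dvd b + Q * k \<longleftrightarrow> k mod p = c p" if "p \<in> P" for p using c'[OF that] by auto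
 define M where "M = nat \<lfloor>(s - real b) / real Q\<rfloor>"
 define L where "L = nat \<lfloor>(t - real b) / real Q\<rfloor>"
 define K where "K = L - M"
 have "b < Q" using b(1) by (simp only: Q_def)
 then have "real b < real Q" by (simp only: of_nat_less_iff)
 moreover have Qs: "real Q <= s" using s(1) by (simp only: Q_def)
 ultimately have bs: "real b < s" by linarith
 then have s0: "(s - real b) / real Q >= 0" using Q0 by simp
 have MleL: "M <= L" unfolding M_def L_def using s Q0 by (intro nat_mono floor_mono divide_right_mono) auto
 have t0: "(t - real b) / real Q >= 0" using bs s Q0 by simp
 have Mr: "real M <= (s - real b) / real Q" "(s - real b) / real Q < real M + 1" unfolding M_def using s0 by linarith+
 have Lr: "real L <= (t - real b) / real Q" "(t - real b) / real Q < real L + 1" unfolding L_def using t0 by linarith+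
 have Kr: "real K = real L - real M" using MleL by (simp add: K_def of_nat_diff)
 have diff: "(t - real b) / real Q - (s - real b) / real Q = (t - s) / real Q" by (simp add: diff_divide_distrib)
 have K: "\<bar>real K - (t - s) / real Q\<bar> <= 1" using Mr Lr Kr diff by linarith
 have rough_iff: "rough w (b + Q * k) \<longleftrightarrow> (\<forall>p\<in>P. k mod p ~= c p)" if "b + Q * k > 0" for k
 proof
  assume r: "rough w (b + Q * k)"
  show "\<forall>p\<in>P. k mod p ~= c p"
  proof
   fix p assume p: "p \<in> P"
   then have "real p <= w" "prime p" by (auto simp: P_def natseg_def)
   then show "k mod p ~= c p" using r c(2)[OF p, of k] by (auto simp: rough_def)
  qed
 next
  assume r: "\<forall>p\<in>P. k mod p ~= c p"
  show "rough w (b + Q * k)" unfolding rough_def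
  proof (intro conjI allI impI, rule that, rule ccontr)
   fix p assume p: "prime p" "p dvd b + Q * k" "\<not> w < real p"
   show False
   proof (cases "p \<in> A")
    case True
    then have "p dvd Q" unfolding Q_def using A by (intro dvd_prodI) auto
    then have "p dvd b" using p(2) by (metis dvd_add_left_iff dvd_mult2)
    then show False using b \<open>p dvd Q\<close> p(1) unfolding Q_def by (meson coprime_common_divisor not_prime_unit)
   next
    case False
    then have "p \<in> P" using p by (auto simp: P_def natseg_def prime_gt_0_nat)
    then show False using r c(2)[of p k] p by auto
   qed
  qed
 qed
 have "bij_betw (%k. b + Q * k) (sieved P c M K) (rough_class w Q b s t)"
 proof (rule bij_betwI[where g = "%n. n div Q"])
  have seg: "s < real (b + Q * k) & real (b + Q * k) <= t \<longleftrightarrow> k \<in> {M<..M + K}" for k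
  proof -
   have "{M<..M + K} = natseg ((s - real b) / real Q) ((t - real b) / real Q)" unfolding natseg_floor[OF s0] using MleL by (simp add: M_def L_def K_def)
   moreover have "k \<in> natseg ((s - real b) / real Q) ((t - real b) / real Q) \<longleftrightarrow> s < real (b + Q * k) & real (b + Q * k) <= t" using Q0 by (auto simp: natseg_def field_simps)
   ultimately show ?thesis by simp
  qed
  show "(%k. b + Q * k) \<in> sieved P c M K \<rightarrow> rough_class w Q b s t"
  proof
   fix k assume k: "k \<in> sieved P c M K"
   then have "k > 0" by auto
   then have "b + Q * k > 0" using Q0 by simp
   then show "b + Q * k \<in> rough_class w Q b s t" using k seg[of k] rough_iff[of k] b by (auto simp: natseg_def Q_def)
  qed
  show "(%n. n div Q) \<in> rough_class w Q b s t \<rightarrow> sieved P c M K"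
  proof
   fix n assume n: "n \<in> rough_class w Q b s t"
   then have "n mod Q = b" by blast
   then have eq: "n = b + Q * (n div Q)" using mult_div_mod_eq[of Q n] by linarith
   define k where "k = n div Q"
   have nk: "n = b + Q * k" using eq by (simp add: k_def)
   have "b + Q * k > 0" using n nk by (auto simp: rough_def)
   then show "n div Q \<in> sieved P c M K" using n rough_iff[of k] seg[of k] unfolding k_def[symmetric] by (auto simp: nk natseg_def)
  qed
  show "(b + Q * k) div Q = k" if "k \<in> sieved P c M K" for k using b Q0 by (simp add: Q_def)
  show "b + Q * (n div Q) = n" if "n \<in> rough_class w Q b s t" for n
  proof -
   have "n mod Q = b" using that by blast
   then show ?thesis using mult_div_mod_eq[of Q n] by linarith
  qed
 qed
 then have card_eq: "card (rough_class w Q b s t) = card (sieved P c M K)" by (rule bij_betw_same_card[symmetric])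
 define G where "G = (\<Prod>p\<in>P. 1 - 1 / real p)"
 have G: "0 <= G" "G <= 1" unfolding G_def using Pp(1) prime_ge_1_nat by (auto intro!: prod_nonneg prod_le_1 simp: divide_simps)
 have AG: "(\<Prod>p\<in>A. 1 - 1 / real p) * G = mertens_prod w"
 proof -
  have "primes_in 0 w = A \<union> P" "A \<inter> P = {}" using A by (auto simp: P_def natseg_def prime_gt_0_nat)
  then show ?thesis unfolding mertens_prod_def G_def using A fP by (simp add: prod.union_disjoint)
 qed
 have A0: "(\<Prod>p\<in>A. 1 - 1 / real p) > 0"
 proof (intro prod_pos)
  fix p assume "p \<in> A"
  then show "0 < 1 - 1 / real p" using prime_gt_1_nat[OF A(2), of p] by simp
 qed
 have hQ: "h = real Q * (\<Prod>p\<in>A. 1 - 1 / real p)" unfolding h_def Q_def by (rule card_residue_units_prod[OF A(1,2)])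
 have main: "(t - s) / real Q * G = (t - s) / h * mertens_prod w" unfolding AG[symmetric] hQ using A0 by simp
 have tQ: "t / real Q >= 0" using Qs s Q0 by (intro divide_nonneg_nonneg) auto
 have "\<bar>real (card (sieved P c M K)) - real K * G\<bar> <=
  2 * real K * (exp (- real (Suc r)) * exp (exp 1 * (\<Sum>p\<in>P. 1 / real p))) + (real (card P) + 1) ^ Suc r" unfolding G_def using fP Pp c by (intro brun_sieve) auto
 also have "... <= 2 * (2 * (t / real Q)) * exp (3 * \<sigma> - real r) + (w + 1) ^ Suc r"
 proof (intro add_mono mult_mono power_mono)
  have "real K <= (t - s) / real Q + 1" using K by linarith
  also have "... <= t / real Q + t / real Q" using s Q0 by (intro add_mono divide_right_mono) (auto simp: Q_def[symmetric])
  finally show "real K <= 2 * (t / real Q)" by simp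
  have "exp 1 * (\<Sum>p\<in>P. 1 / real p) <= 3 * \<sigma>"
  proof (intro mult_mono)
   have "(\<Sum>p\<in>P. 1 / real p) <= reciprocal_sum w" by (intro sum_mono2) (auto simp: P_def)
   then show "(\<Sum>p\<in>P. 1 / real p) <= \<sigma>" using S1 by linarith
  qed (use exp_le in \<open>auto intro: sum_nonneg\<close>)
  then show "exp (- real (Suc r)) * exp (exp 1 * (\<Sum>p\<in>P. 1 / real p)) <= exp (3 * \<sigma> - real r)" by (simp flip: exp_add)
  have "card P <= card {1..nat \<lfloor>w\<rfloor>}" unfolding natseg_0[symmetric] by (intro card_mono) (auto simp: P_def)
  then show "real (card P) <= w" using w by simp linarith
 qed (use tQ w in auto)
 finally have 1: "\<bar>real (card (sieved P c M K)) - real K * G\<bar> <= 4 * (t / real Q) * exp (3 * \<sigma> - real r) + (w + 1) ^ Suc r" by simp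
 have "\<bar>real K * G - (t - s) / real Q * G\<bar> <= 1 * 1" unfolding left_diff_distrib[symmetric] abs_mult using K G by (intro mult_mono) auto
 moreover have "1 <= (w + 1) ^ Suc r" using w by (intro one_le_power) auto
 ultimately have "\<bar>real (card (rough_class w Q b s t)) - (t - s) / h * mertens_prod w\<bar>
   <= 4 * (t / real Q) * exp (3 * \<sigma> - real r) + 2 * (w + 1) ^ Suc r" using 1 unfolding main[symmetric] card_eq by linarith
 then show ?thesis by (simp only: h_def Q_def)
qed

text \<open>This is z: it bounds the primes of the modulus, while exp z is the roughness level, so
  rough numbers are coprime to the modulus. The dominant part of \<open>class_error\<close> is (ln
  x)^3 z x, and the fifth power leaves x^2 / (ln x)^2, which is negligible against x^2.\<close>

definition rough_level :: "real => real" where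
 "rough_level x = x / ln x ^ 5"

definition class_density :: "real => nat => nat => nat => nat => real" where
 "class_density x Q N a i = real N * real (card (unit_residues Q)) / x *
   (\<Sum>n\<in>{n\<in>natseg (exp (x * real (i - 1) / real N)) (exp (x * real i / real N)). rough (exp (rough_level x)) n & n mod Q = a}. mangoldt n / real n)"

lemma prod_primes_le_exp:
 assumes "finite A" "\<And>p. p \<in> A ==> prime p" "\<And>p. p \<in> A ==> real p <= z" "z >= 0"
 shows "real (\<Prod>A) <= exp (3 * z)"
proof -
 have "ln (real (\<Prod>A)) = (\<Sum>p\<in>A. ln (real p))" using assms(1,2) prime_gt_0_nat by (simp add: ln_prod)
 also have "... = (\<Sum>p\<in>A. mangoldt p)" using assms(2) by (intro sum.cong) auto
 also have "... <= (\<Sum>d=1..nat \<lfloor>z\<rfloor>. mangoldt d)" using assms prime_ge_1_nat by (intro sum_mono2 mangoldt_nonneg) (auto simp: le_nat_floor)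
 also have "... <= 3 * real (nat \<lfloor>z\<rfloor>)" by (rule psi_le)
 also have "... <= 3 * z" using assms(4) by simp
 finally have "ln (real (\<Prod>A)) <= 3 * z" .
 moreover have "real (\<Prod>A) > 0" using prod_primes_pos[of A] assms(2) by (metis of_nat_0_less_iff)
 ultimately show ?thesis by (metis exp_le_cancel_iff exp_ln)
qed

text \<open>The sieve parameters are fixed here so that the hypotheses of
  \<open>rough_classes\<close> hold for every set A of primes up to z at once. This uniformity is
  needed because the modulus and its quotients by single primes are compared at the same x.\<close>

lemma selberg_density_class_density:
 assumes i0: "1 <= i0" "2 * i0 <= N" and e: "0 < e" "e <= 1" "2 / real i0 <= e"
 shows "\<exists>x0>1. \<forall>x\<ge>x0. \<forall>A. finite A --> (\<forall>p\<in>A. prime p & real p <= rough_level x) -->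
  selberg_density (residue_units (\<Prod>A)) (class_density x (\<Prod>A) N) N i0 e"
proof -
 obtain C0 where C0: "C0 > 0" and mert: "\<forall>w\<ge>2. \<forall>t\<ge>1. \<bar>rough_log_sum w t - ln t\<bar> <= ln w + C0" using mertens_rough by (elim exE conjE) (rule that; assumption)
 obtain C1 where C1: "C1 > 0" and mprod: "\<And>T. T >= 2 ==> mertens_prod T <= C1 / ln T" using mertens_prod_bounds by blast
 obtain C2 where C2: "C2 > 0" and sinv: "\<And>T. T >= 2 ==> \<bar>reciprocal_sum T - ln (ln T)\<bar> <= C2" using sum_inverse_primes by blast
 \<comment> \<open>52800 = 6 * 22 * 20^2, from the second term of \<open>class_error\<close> with
   the values of \<open>kappa\<close>, \<open>gam\<close> and \<open>T0\<close> below.\<close>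
 define D where "D = 52800 * (C1 + 1)"
 have D0: "D > 0" using C1 by (simp add: D_def)
 have N0: "real N > 0" "real i0 > 0" using i0 by auto
 have N2: "1 / (real N)\<^sup>2 > 0" "real i0 / real N > 0" "e / (2 * real N) > 0" using N0 e by auto
 have ev: "eventually (%x. x > 1 & ln x > 1 & rough_level x >= 2 & rough_level x <= x & x >= 16 * exp (3 * C2)
   & ln 8 + 6 * ln x + (rough_level x + 1) * (10 * ln x + 2) + 3 * rough_level x <= 20 * ln x * rough_level x
   & 20 * ln x * rough_level x <= x & 20 * ln x * rough_level x >= 3
   & 20 * ln x * rough_level x + rough_level x + 1 <= 22 * ln x * rough_level x
   & 1 / x ^ 6 <= 1 / rough_level x
   & 2 * (20 * ln x * rough_level x) <= x * (real i0 / real N)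
   & 2 * (rough_level x + C0) * (2 * x + (rough_level x + C0)) + (12 / x\<^sup>2 + D * (x\<^sup>2 / (ln x)\<^sup>2)) <= x\<^sup>2 * (1 / (real N)\<^sup>2)
   & (rough_level x + C0) / x <= e / (2 * real N)) at_top" unfolding rough_level_def using N2 D0 C0 by (intro eventually_conj; real_asymp)
 then obtain x0 where x0: "\<And>x. x >= x0 ==> x > 1 & ln x > 1 & rough_level x >= 2 & rough_level x <= x & x >= 16 * exp (3 * C2)
   & ln 8 + 6 * ln x + (rough_level x + 1) * (10 * ln x + 2) + 3 * rough_level x <= 20 * ln x * rough_level x
   & 20 * ln x * rough_level x <= x & 20 * ln x * rough_level x >= 3
   & 20 * ln x * rough_level x + rough_level x + 1 <= 22 * ln x * rough_level x
   & 1 / x ^ 6 <= 1 / rough_level x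
   & 2 * (20 * ln x * rough_level x) <= x * (real i0 / real N)
   & 2 * (rough_level x + C0) * (2 * x + (rough_level x + C0)) + (12 / x\<^sup>2 + D * (x\<^sup>2 / (ln x)\<^sup>2)) <= x\<^sup>2 * (1 / (real N)\<^sup>2)
   & (rough_level x + C0) / x <= e / (2 * real N)" by (auto simp: eventually_at_top_linorder)
 have "selberg_density (residue_units (\<Prod>A)) (class_density x (\<Prod>A) N) N i0 e"
  if xx: "x >= x0" and A: "finite A" "\<forall>p\<in>A. prime p & real p <= rough_level x" for x A
 proof -
  define z where "z = rough_level x"
  define l where "l = ln x"
  define w where "w = exp z"
  define Q where "Q = \<Prod>A"
  define h where "h = real (card (unit_residues Q))"
  \<comment> \<open>Beyond T0 the remainder \<open>(w + 1) ^ Suc r\<close> of Brun's sieve, about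
    exp (10 l z), must be negligible even after multiplication by h and x^6. The value eta = x^-6 is
    small enough to survive the factor \<open>ln X ^ 4 = x ^ 4\<close> in
    \<open>class_error\<close>.\<close>
  define T0 where "T0 = exp (20 * l * z)"
  define X where "X = exp x"
  define eta where "eta = 1 / x ^ 6"
  define kappa where "kappa = (C1 + 1) / z"
  define gam where "gam = 22 * l"
  have x: "x > 1" "l > 1" "z >= 2" "z <= x" "x >= 16 * exp (3 * C2)"
   "ln 8 + 6 * l + (z + 1) * (10 * l + 2) + 3 * z <= 20 * l * z" "20 * l * z <= x" "20 * l * z >= 3"
   "20 * l * z + z + 1 <= 22 * l * z" "eta <= 1 / z" "2 * (20 * l * z) <= x * (real i0 / real N)"
   "2 * (z + C0) * (2 * x + (z + C0)) + (12 / x\<^sup>2 + D * (x\<^sup>2 / l\<^sup>2)) <= x\<^sup>2 * (1 / (real N)\<^sup>2)"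
   "(z + C0) / x <= e / (2 * real N)" using x0[OF xx] unfolding z_def l_def eta_def by auto
  have expl: "exp (real k * l) = x ^ k" for k :: nat
  proof -
   have "exp l = x" using x(1) by (simp add: l_def)
   then show ?thesis by (simp add: exp_of_nat_mult)
  qed
  have exp6: "exp (6 * l) = x ^ 6" using expl[of 6] by simp
  have exp7: "exp (- (7 * l)) = 1 / x ^ 7" using expl[of 7] by (simp add: exp_minus divide_inverse)
  have Ap: "prime p" "real p <= z" if "p \<in> A" for p using A that by (auto simp: z_def)
  have Q0: "Q > 0" unfolding Q_def using Ap by (intro prod_primes_pos) auto
  have zw: "z <= w" unfolding w_def using exp_ge_add_one_self[of z] by linarith
  have w2: "w >= 2" using zw x by linarith
  have lw: "ln w = z" by (simp add: w_def)
  have hQ: "h <= real Q" unfolding h_def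
  proof (intro of_nat_mono)
   have "card (unit_residues Q) <= card {..<Q}" by (intro card_mono) (auto simp: residue_units_def)
   then show "card (unit_residues Q) <= Q" by simp
  qed
  have h0: "h > 0"
  proof -
   interpret comm_group "residue_units Q" by (rule comm_group_residue_units[OF Q0])
   show ?thesis unfolding h_def using finite_residue_units[of Q] by (metis card_gt_0_iff of_nat_0_less_iff one_closed empty_iff)
  qed
  have Qle: "real Q <= exp (3 * z)" unfolding Q_def using A Ap x by (intro prod_primes_le_exp) auto
  have l8: "ln 8 >= (0::real)" by simp
  have zl: "(z + 1) * (10 * l + 2) >= 0" using x by (intro mult_nonneg_nonneg) auto
  have "3 * z <= 20 * l * z" using x(6) l8 zl x(2) by linarith
  then have QT: "real Q <= T0" using Qle unfolding T0_def by (meson exp_le_cancel_iff order.trans)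
  \<comment> \<open>The tail of Brun's sieve is exp (3 (ln z + C2) - r) with ln z <= l, so that r >=
    10 l leaves x^-7 up to a constant.\<close>
  define r where "r = nat \<lceil>10 * l\<rceil>"
  have r: "10 * l <= real r" "real r <= 10 * l + 1" unfolding r_def using x(2) by linarith+
  have E1: "4 * (t / real Q) * exp (3 * (z' + C2) - real r) <= eta / 4 * (t / h)" if "t >= 0" "z' <= l" for t z'
  proof -
   have "exp (3 * (z' + C2) - real r) <= exp (3 * C2 + - (7 * l))" using that r by simp
   also have "... = exp (3 * C2) * (1 / x ^ 7)" by (simp only: exp_add exp7)
   also have "... <= (x / 16) * (1 / x ^ 7)" using x by (intro mult_right_mono) auto
   also have "... = eta / 16"
   proof -
    have "x ^ 7 = x * x ^ 6" by (simp add: eval_nat_numeral)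
    then show ?thesis using x(1) by (simp add: eta_def)
   qed
   finally have "exp (3 * (z' + C2) - real r) <= eta / 16" .
   moreover have "t / real Q <= t / h" using that hQ h0 by (intro divide_left_mono) auto
   ultimately have "4 * (t / real Q) * exp (3 * (z' + C2) - real r) <= 4 * (t / h) * (eta / 16)" using that h0 by (intro mult_mono) auto
   then show ?thesis by (simp add: mult_ac)
  qed
  have E2: "2 * (w + 1) ^ Suc r <= eta / 4 * (t / h)" if "t >= T0" for t
  proof -
   have "w + 1 <= exp (z + 1)"
   proof -
    have "1 <= exp z" using x(3) by simp
    then have "exp z + 1 <= exp z * 2" by linarith
    also have "... <= exp z * exp 1" using exp_ge_add_one_self[of 1] by (intro mult_left_mono) auto
    finally show ?thesis by (simp add: w_def exp_add)
   qed
   then have "(w + 1) ^ Suc r <= exp (z + 1) ^ Suc r" using w2 by (intro power_mono) auto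
   also have "... = exp (real (Suc r) * (z + 1))" by (rule exp_of_nat_mult[symmetric])
   also have "... <= exp ((z + 1) * (10 * l + 2))"
   proof -
    have "real (Suc r) * (z + 1) <= (10 * l + 2) * (z + 1)" using r x by (intro mult_right_mono) auto
    then show ?thesis by (simp add: mult.commute)
   qed
   finally have "8 * x ^ 6 * ((w + 1) ^ Suc r * h) <= 8 * x ^ 6 * (exp ((z + 1) * (10 * l + 2)) * exp (3 * z))" using hQ Qle x h0 by (intro mult_left_mono mult_mono) auto
   also have "8 * x ^ 6 = exp (ln 8 + 6 * l)" by (simp add: exp_add exp6)
   also have "exp (ln 8 + 6 * l) * (exp ((z + 1) * (10 * l + 2)) * exp (3 * z)) = exp (ln 8 + 6 * l + (z + 1) * (10 * l + 2) + 3 * z)" by (simp only: exp_add mult.assoc)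
   also have "... <= T0" unfolding T0_def using x(6) by simp
   also have "... <= t" by (rule that)
   finally have "8 * x ^ 6 * ((w + 1) ^ Suc r * h) <= t" by (simp add: exp_add exp6)
   then show ?thesis unfolding eta_def using h0 x by (simp add: field_simps)
  qed
  have T08: "T0 >= 8"
  proof -
   have "(8::real) <= 2 ^ 3" by simp
   also have "... <= exp 1 ^ 3" using exp_ge_add_one_self[of 1] by (intro power_mono) auto
   also have "... = exp 3" using exp_of_nat_mult[of 3 "1::real"] by simp
   also have "... <= T0" unfolding T0_def using x by simp
   finally show ?thesis .
  qed
  have count: "\<bar>real (card (rough_class w Q b T0 t)) - (t - T0) / h * mertens_prod w\<bar> <= eta / 2 * (t / h)"
   if b: "b \<in> unit_residues Q" and t: "T0 <= t" for b t
  proof -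
   have "reciprocal_sum w <= ln z + C2" using sinv[OF w2] unfolding lw by linarith
   then have "\<bar>real (card (rough_class w (\<Prod>A) b T0 t)) - (t - T0) / card (unit_residues (\<Prod>A)) * mertens_prod w\<bar>
    <= 4 * (t / real (\<Prod>A)) * exp (3 * (ln z + C2) - real r) + 2 * (w + 1) ^ Suc r" using A Ap zw w2 b t QT unfolding Q_def by (intro card_rough_in_class) (auto simp: residue_units_def intro: order.trans[OF _ zw])
   also have "... <= eta / 4 * (t / h) + eta / 4 * (t / h)"
   proof -
    have "ln z <= l" unfolding l_def using x(3,4) by simp
    moreover have "t >= 0" using t T08 by linarith
    ultimately show ?thesis unfolding Q_def[symmetric] using t by (intro add_mono E1 E2)
   qed
   finally show ?thesis by (simp add: h_def Q_def)
  qed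
  have mp: "0 <= mertens_prod w" "mertens_prod w <= C1 / z" using mprod[OF w2] mertens_prod_pos[of w] by (auto simp: lw)
  interpret rc: rough_classes Q w T0 X eta kappa gam h
  proof (unfold_locales)
   show "h = real (card (unit_residues Q))" by (rule h_def)
   show "Q > 0" by (rule Q0)
   show "coprime n Q" if n: "rough w n" for n unfolding Q_def
   proof (rule prod_coprime_right)
    fix p assume p: "p \<in> A"
    have "\<not> p dvd n"
    proof
     assume "p dvd n"
     then have "w < real p" using n Ap[OF p] by (auto simp: rough_def)
     then show False using Ap[OF p] zw by linarith
    qed
    then show "coprime n p" using Ap[OF p] prime_imp_coprime coprime_commute by blast
   qed
   show "T0 >= 8" by (rule T08)
   show "X >= T0" unfolding X_def T0_def using x by simp
   show "eta >= 0" using x by (simp add: eta_def)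
   show "kappa >= 0" using x C1 by (simp add: kappa_def)
   show "gam >= 0" using x by (simp add: gam_def)
   show "\<bar>real (card (rough_class w Q b T0 t)) - real (card (rough_class w Q b' T0 t))\<bar> <= eta * t / h"
    if bt: "b \<in> unit_residues Q" "b' \<in> unit_residues Q" "T0 <= t" for b b' t
   proof -
    have "\<bar>real (card (rough_class w Q b T0 t)) - real (card (rough_class w Q b' T0 t))\<bar> <= eta / 2 * (t / h) + eta / 2 * (t / h)" using count[OF bt(1) bt(3)] count[OF bt(2) bt(3)] by linarith
    then show ?thesis by simp
   qed
   show "real (card (rough_class w Q b T0 t)) <= kappa * t / h"
    if bt: "b \<in> unit_residues Q" "T0 <= t" for b t
   proof -
    have "real (card (rough_class w Q b T0 t)) <= (t - T0) / h * mertens_prod w + eta / 2 * (t / h)" using count[OF bt] by linarith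
    also have "(t - T0) / h * mertens_prod w <= t / h * (C1 / z)" using bt T08 h0 mp by (intro mult_mono divide_right_mono) auto
    also have "eta / 2 * (t / h) <= (1 / z) * (t / h)"
    proof (rule mult_right_mono)
     have "eta >= 0" using x by (simp add: eta_def)
     then show "eta / 2 <= 1 / z" using x(10) by linarith
    qed (use bt T08 h0 in auto)
    also have "t / h * (C1 / z) + (1 / z) * (t / h) = kappa * t / h" unfolding kappa_def using h0 x(3) by (simp add: field_simps)
    finally show ?thesis by simp
   qed
   show "(\<Sum>m\<in>rough_upto w T0. 1 / real m) <= gam"
   proof -
    have "(\<Sum>m\<in>rough_upto w T0. 1 / real m) <= (ln T0 + ln w + 1) / ln w" using T08 by (intro sum_inverse_rough_le w2) auto
    also have "... <= 22 * l * z / z" unfolding lw T0_def using x by (intro divide_right_mono) auto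
    finally show ?thesis using x by (simp add: gam_def)
   qed
  qed
  have ce: "rc.class_error <= 12 / x\<^sup>2 + D * (x\<^sup>2 / l\<^sup>2)"
  proof -
   have "rc.class_error = 12 * (1 / x ^ 6) * x ^ 4 + 6 * ((C1 + 1) / z) * (22 * l) * x * (20 * l * z)\<^sup>2"
   proof -
    have "rc.class_error = 12 * eta * ln X ^ 4 + 6 * kappa * gam * ln X * (ln T0)\<^sup>2" by (rule rc.class_error_def)
    then show ?thesis by (simp add: eta_def kappa_def gam_def X_def T0_def)
   qed
   also have "12 * (1 / x ^ 6) * x ^ 4 = 12 / x\<^sup>2" using x by (simp add: field_simps eval_nat_numeral)
   also have "6 * ((C1 + 1) / z) * (22 * l) * x * (20 * l * z)\<^sup>2 = D * (l ^ 3 * z * x)" using x by (simp add: D_def power2_eq_square power3_eq_cube)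
   also have "l ^ 3 * z * x = x\<^sup>2 / l\<^sup>2" using x unfolding z_def rough_level_def l_def[symmetric] by (simp add: field_simps eval_nat_numeral)
   finally show ?thesis by simp
  qed
  have "selberg_density (residue_units Q) (rc.prime_density x N) N i0 e"
  proof (rule rc.selberg_density_prime_density[where ?E0.0 = "z + C0"])
   show "X = exp x" by (simp add: X_def)
   show "\<bar>rough_log_sum w t - ln t\<bar> <= z + C0" if "t >= 1" for t using mert[rule_format, OF w2 that] by (simp add: lw)
   show "2 * ln T0 <= x * real i0 / real N" using x by (simp add: T0_def)
   show "2 * (z + C0) * (2 * x + (z + C0)) + rc.class_error <= x\<^sup>2 / (real N)\<^sup>2" using ce x by simp
   have "(z + C0) / x * (2 * real N) <= e / (2 * real N) * (2 * real N)" using x N0 by (intro mult_right_mono) auto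
   then show "2 * (z + C0) * real N / x <= e" using N0 by (simp add: mult_ac)
  qed (use i0 e in auto)
  moreover have "rc.prime_density x N = class_density x Q N" by (intro ext, unfold rc.prime_density_def class_density_def rc.cls_def) (simp add: h_def w_def z_def)
  ultimately show ?thesis by (simp add: Q_def)
 qed
 then show ?thesis by (intro exI[of _ "max x0 2"] conjI allI impI) simp_all
qed

section \<open>Moduli with primes in every reduced class\<close>

abbreviation primes_mod where
 "primes_mod Q a s t \<equiv> {p\<in>natseg s t. prime p & p mod Q = a}"

abbreviation drop_one :: "'a set => 'a set => bool" where
 "drop_one A B \<equiv> B = A \<or> (\<exists>r\<in>A. B = A - {r})"

section \<open>Reduction of the modulus by one prime\<close>

lemma card_residue_fibre:
 assumes A: "finite A" "\<And>p. p \<in> A ==> prime (p::nat)" "r \<in> A" and b: "b' \<in> carrier (residue_units (\<Prod>(A - {r})))"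
 shows "card {b\<in>unit_residues (\<Prod>A). b mod \<Prod>(A - {r}) = b'} = r - 1"
proof -
 define Q' where "Q' = \<Prod>(A - {r})"
 have Q: "\<Prod>A = r * Q'" unfolding Q'_def using A by (simp add: prod.remove)
 have rp: "prime r" "r > 1" using A prime_gt_1_nat by auto
 have Q'0: "Q' > 0" unfolding Q'_def using A by (intro prod_primes_pos) auto
 have b': "b' < Q'" "coprime b' Q'" using b by (auto simp: residue_units_def Q'_def)
 define W where "W = (%p. if p = r then {1..<r} else {b' mod p})"
 have modmod: "n mod Q' mod p = n mod p" if "p \<in> A - {r}" for n p using that A unfolding Q'_def by (intro mod_mod_cancel dvd_prodI) auto
 have "{b\<in>unit_residues (\<Prod>A). b mod Q' = b'} = {b\<in>{..<\<Prod>A}. \<forall>p\<in>A. b mod p \<in> W p}"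
 proof (intro equalityI subsetI)
  fix b assume b: "b \<in> {b\<in>unit_residues (\<Prod>A). b mod Q' = b'}"
  then have bb: "b < \<Prod>A" "coprime b (\<Prod>A)" "b mod Q' = b'" by (auto simp: residue_units_def)
  have "b mod p \<in> W p" if p: "p \<in> A" for p
  proof (cases "p = r")
   case True
   have "\<not> r dvd b" using bb(2) rp unfolding Q by (meson coprime_common_divisor dvd_triv_left not_prime_unit)
   then show ?thesis using True rp by (simp add: W_def dvd_eq_mod_eq_0 Suc_le_eq)
  next
   case False
   then show ?thesis using modmod[of p b] p bb(3) by (simp add: W_def)
  qed
  then show "b \<in> {b\<in>{..<\<Prod>A}. \<forall>p\<in>A. b mod p \<in> W p}" using bb by auto
 next
  fix b assume b: "b \<in> {b\<in>{..<\<Prod>A}. \<forall>p\<in>A. b mod p \<in> W p}"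
  have "[b = b'] (mod Q')"
  proof -
   have "[b = b'] (mod \<Prod>p\<in>A - {r}. p)"
   proof (rule coprime_cong_prod_nat)
    fix p q assume "p \<in> A - {r}" "q \<in> A - {r}" "p ~= q"
    then show "coprime p q" using A by (intro primes_coprime) auto
   next
    fix p assume "p \<in> A - {r}"
    then have "b mod p \<in> W p" "p ~= r" using b by auto
    then show "[b = b'] (mod p)" by (simp add: W_def Cong.cong_def)
   qed
   then show ?thesis by (simp add: Q'_def)
  qed
  then have bm: "b mod Q' = b'" using b' by (simp add: Cong.cong_def)
  then have "coprime b Q'" using b' by (metis coprime_mod_left_iff Q'0 not_gr_zero)
  moreover have "coprime b r"
  proof -
   have "b mod r \<in> {1..<r}" using b A by (auto simp: W_def)
   then have "\<not> r dvd b" by (auto simp: dvd_eq_mod_eq_0)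
   then show ?thesis using rp prime_imp_coprime coprime_commute by blast
  qed
  ultimately have "coprime b (\<Prod>A)" unfolding Q by simp
  then show "b \<in> {b\<in>unit_residues (\<Prod>A). b mod Q' = b'}" using b bm by (auto simp: residue_units_def)
 qed
 also have "card ... = (\<Prod>p\<in>A. card (W p))" using A b' prime_gt_0_nat by (intro card_residue_system) (auto simp: W_def)
 also have "... = card (W r) * (\<Prod>p\<in>A - {r}. card (W p))" using A by (simp add: prod.remove)
 also have "(\<Prod>p\<in>A - {r}. card (W p)) = 1" by (intro prod.neutral) (auto simp: W_def)
 finally show ?thesis by (simp add: W_def Q'_def)
qed

text \<open>The mean of the density over a fibre of the reduction from Q to Q / r is the density
  modulo Q / r. Nothing is lost, because the rough numbers counted are coprime to r as well, and the
  orders of the two groups differ by the factor r - 1.\<close>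

lemma class_density_fibre:
 assumes A: "finite A" "\<And>p. p \<in> A ==> prime (p::nat)" "\<And>p. p \<in> A ==> real p <= exp (rough_level x)" "r \<in> A"
  and b: "b' \<in> carrier (residue_units (\<Prod>(A - {r})))"
 shows "(\<Sum>b\<in>{b\<in>unit_residues (\<Prod>A). b mod \<Prod>(A - {r}) = b'}. class_density x (\<Prod>A) N b i) =
  (real r - 1) * class_density x (\<Prod>(A - {r})) N b' i"
proof -
 define Q where "Q = \<Prod>A"
 define Q' where "Q' = \<Prod>(A - {r})"
 have Q: "Q = r * Q'" unfolding Q'_def Q_def using A by (simp add: prod.remove)
 have Q0: "Q > 0" unfolding Q_def using A by (intro prod_primes_pos) auto
 define F where "F = {b\<in>unit_residues Q. b mod Q' = b'}"
 define S where "S = {n\<in>natseg (exp (x * real (i - 1) / real N)) (exp (x * real i / real N)). rough (exp (rough_level x)) n}"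
 have fF: "finite F" unfolding F_def using finite_residue_units by auto
 have fS: "finite S" by (simp add: S_def)
 have cop: "coprime n Q" if n: "rough (exp (rough_level x)) n" for n unfolding Q_def
 proof (rule prod_coprime_right)
  fix p assume p: "p \<in> A"
  have "\<not> p dvd n"
  proof
   assume "p dvd n"
   then have "exp (rough_level x) < real p" using n A(2)[OF p] by (simp add: rough_def)
   then show False using A(3)[OF p] by linarith
  qed
  then show "coprime n p" using A(2)[OF p] prime_imp_coprime coprime_commute by blast
 qed
 have h: "real (card (unit_residues Q)) = (real r - 1) * real (card (unit_residues Q'))"
 proof -
  have "real (card (unit_residues Q)) = (real r * (1 - 1 / real r)) * (real Q' * (\<Prod>p\<in>A - {r}. 1 - 1 / real p))" using card_residue_units_prod[OF A(1,2)] A Q by (simp add: Q_def[symmetric] prod.remove[of A r] mult_ac)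
  also have "real Q' * (\<Prod>p\<in>A - {r}. 1 - 1 / real p) = real (card (unit_residues Q'))" unfolding Q'_def using A by (subst card_residue_units_prod) auto
  also have "real r * (1 - 1 / real r) = real r - 1" using A prime_gt_0_nat by (simp add: field_simps)
  finally show ?thesis .
 qed
 have "(\<Sum>b\<in>F. \<Sum>n\<in>{n\<in>S. n mod Q = b}. mangoldt n / real n) = (\<Sum>n\<in>{n\<in>S. n mod Q' = b'}. mangoldt n / real n)"
 proof -
  have "(\<Sum>n\<in>{n\<in>S. n mod Q' = b'}. mangoldt n / real n) = (\<Sum>b\<in>F. \<Sum>n\<in>{n. n \<in> {n\<in>S. n mod Q' = b'} & n mod Q = b}. mangoldt n / real n)"
  proof (subst sum.group[where g = "%n. n mod Q" and T = F])
   show "(%n. n mod Q) ` {n\<in>S. n mod Q' = b'} \<subseteq> F" using cop Q0 by (auto simp: F_def S_def Q mod_mod_cancel intro!: mod_in_residue_units)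
  qed (use fS fF in auto)
  also have "... = (\<Sum>b\<in>F. \<Sum>n\<in>{n\<in>S. n mod Q = b}. mangoldt n / real n)"
  proof (intro sum.cong refl)
   fix b n assume "b \<in> F"
   show "{n. n \<in> {n\<in>S. n mod Q' = b'} & n mod Q = b} = {n\<in>S. n mod Q = b}" using \<open>b \<in> F\<close> by (auto simp: F_def Q) (metis dvd_triv_right mod_mod_cancel)
  qed
  finally show ?thesis ..
 qed
 then have "(\<Sum>b\<in>F. class_density x Q N b i) = (real r - 1) * class_density x Q' N b' i" unfolding class_density_def h sum_distrib_left[symmetric] by (simp add: S_def)
 then show ?thesis by (simp only: F_def Q_def Q'_def)
qed

text \<open>A poor class modulo Q / r makes nearly all densities modulo Q / r extreme, near 0 or
  near 2. A mean over a fibre can be extreme only if most values on the fibre are near the same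
  extreme, so B is nearly a union of fibres. Translation by an element of the kernel permutes each
  fibre and therefore moves few elements of B.\<close>

lemma kernel_shift_dist:
 fixes A :: "nat set" and x e :: real and N M i0 r :: nat
 defines "Q \<equiv> \<Prod>A" and "Q' \<equiv> \<Prod>(A - {r})"
 assumes A: "finite A" "\<And>p. p \<in> A ==> prime (p::nat)" "\<And>p. p \<in> A ==> real p <= exp (rough_level x)" "r \<in> A"
  and S: "selberg_density (residue_units Q) (class_density x Q N) N i0 e"
  and S': "selberg_density (residue_units Q') (class_density x Q' N) N i0 e"
  and M: "N = 16 * M" "i0 <= M" and err: "7 * e + 14 * real i0 / real N <= 1 / 10^13"
  and bad: "c \<in> unit_residues Q'" "(\<Sum>i\<in>{8 * M<..16 * M}. class_density x Q' N c i) <= N / 10^12"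
  and g: "g \<in> unit_residues Q" "[g = 1] (mod Q')"
 shows "real (comm_group.shift_dist (residue_units Q) {b\<in>unit_residues Q. selberg_density.densA (class_density x Q N) M b > 1} g)
   <= real (card (unit_residues Q)) / 2"
proof -
 interpret S: selberg_density "residue_units Q" "class_density x Q N" N i0 e by (rule S)
 interpret S': selberg_density "residue_units Q'" "class_density x Q' N" N i0 e by (rule S')
 define G where "G = unit_residues Q"
 define G' where "G' = unit_residues Q'"
 define a where "a = S.densA M"
 define B where "B = {b\<in>G. a b > 1}"
 define F where "F = (%b'. {b\<in>G. b mod Q' = b'})"
 have fG: "finite G" "finite G'" unfolding G_def G'_def by (rule finite_residue_units)+
 have Qr: "Q = r * Q'" unfolding Q'_def Q_def using A by (simp add: prod.remove)
 have Q0: "Q > 0" "Q' > 0" unfolding Q_def Q'_def by (rule prod_primes_pos, use A(2) in blast)+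
 have r1: "r > 1" using A(2)[OF A(4)] by (rule prime_gt_1_nat)
 have cF: "card (F b') = r - 1" if "b' \<in> G'" for b' unfolding F_def G_def Q_def Q'_def by (rule card_residue_fibre[OF A(1,2,4)]) (use that in \<open>auto simp: G'_def Q'_def\<close>)
 have cFr: "real (card (F b')) = real r - 1" if "b' \<in> G'" for b' using cF[OF that] r1 by (simp add: of_nat_diff)
 have fF: "finite (F b')" for b' using fG by (simp add: F_def)
 have pi: "b mod Q' \<in> G'" if "b \<in> G" for b
 proof -
  have "coprime b Q" using that by (simp add: G_def carrier_residue_units)
  then have "coprime b Q'" unfolding Qr by simp
  then show ?thesis unfolding G'_def by (rule mod_in_residue_units[OF Q0(2)])
 qed
 have aF: "(\<Sum>b\<in>F b'. a b) = (real r - 1) * S'.densA M b'" if "b' \<in> G'" for b'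
 proof -
  have "(\<Sum>b\<in>F b'. a b) = (\<Sum>i\<in>{3 * M<..4 * M}. \<Sum>b\<in>F b'. class_density x Q N b i) / M" unfolding a_def S.densA_def by (subst sum.swap) (simp add: sum_divide_distrib)
  also have "... = (\<Sum>i\<in>{3 * M<..4 * M}. (real r - 1) * class_density x Q' N b' i) / M" unfolding F_def G_def Q_def Q'_def using A that by (subst class_density_fibre) (auto simp: G'_def Q'_def)
  finally show ?thesis by (simp add: S'.densA_def sum_distrib_left[symmetric])
 qed
 have M3: "i0 <= 3 * M" using M by simp
 have bd: "0 <= a b" "a b <= 2 + e" if "b \<in> G" for b using S.dens_bounds[OF M(1) M3, of b] that by (auto simp: a_def G_def)
 obtain X where X: "X \<subseteq> G'" "card X <= card G' / 10^4"
  "\<And>b. b \<in> G' ==> b \<notin> X ==> S'.densA M b <= 1/10^5 \<or> S'.densA M b >= 2 - 1/10^5" using S'.exceptional_classes[OF M bad err] unfolding G'_def by blast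
 have e13: "e <= 1/10^13"
 proof -
  have "14 * real i0 / real N >= 0" "e > 0" using S.e by auto
  then show ?thesis using err by linarith
 qed
 define gm where "gm = (%b. g \<otimes>\<^bsub>residue_units Q\<^esub> b)"
 have gmF: "gm b \<in> F b'" if "b \<in> F b'" for b b'
 proof -
  have "b \<in> G" "b mod Q' = b'" using that by (auto simp: F_def)
  have "gm b mod Q' = (g * b) mod Q'" by (simp add: gm_def mult_residue_units Qr mod_mod_cancel)
  also have "... = b mod Q'" using cong_mult[OF g(2) cong_refl[of b]] by (simp add: Cong.cong_def)
  finally show ?thesis using \<open>b \<in> G\<close> \<open>b mod Q' = b'\<close> g by (simp add: F_def gm_def G_def)
 qed
 have gminj: "inj_on gm (F b')" for b' using g by (intro inj_onI) (auto simp: gm_def F_def G_def)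
 have shift: "card {b\<in>F b'. P (gm b)} <= card {b\<in>F b'. P b}" for b' P by (rule card_inj_on_le[of gm]) (use gmF fF in \<open>auto intro: inj_on_subset[OF gminj]\<close>)
 have fibre: "real (card {b\<in>F b'. (b \<in> B) ~= (gm b \<in> B)}) <= (real r - 1) / 10^4 + (if b' \<in> X then real r - 1 else 0)" if b': "b' \<in> G'" for b'
 proof (cases "b' \<in> X")
  case True
  have "card {b\<in>F b'. (b \<in> B) ~= (gm b \<in> B)} <= card (F b')" using fF by (intro card_mono) auto
  then have "real (card {b\<in>F b'. (b \<in> B) ~= (gm b \<in> B)}) <= real r - 1" using cFr[OF b'] by linarith
  moreover have "(real r - 1) / 10^4 >= 0" using r1 by simp
  ultimately have "real (card {b\<in>F b'. (b \<in> B) ~= (gm b \<in> B)}) <= (real r - 1) / 10^4 + (real r - 1)" by linarith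
  then show ?thesis using True by (simp only: if_True)
 next
  case False
  have half: "real (card {b\<in>F b'. (b \<in> B) ~= (gm b \<in> B)}) <= 2 * real (card {b\<in>F b'. (b \<in> B) = v})" for v
  proof -
   have "card {b\<in>F b'. (b \<in> B) ~= (gm b \<in> B)} <= card ({b\<in>F b'. (b \<in> B) = v} \<union> {b\<in>F b'. (gm b \<in> B) = v})" using fF by (intro card_mono) auto
   also have "... <= card {b\<in>F b'. (b \<in> B) = v} + card {b\<in>F b'. (gm b \<in> B) = v}" by (rule card_Un_le)
   also have "card {b\<in>F b'. (gm b \<in> B) = v} <= card {b\<in>F b'. (b \<in> B) = v}" by (rule shift)
   finally show ?thesis by linarith
  qed
  have FG: "b \<in> G" if "b \<in> F b'" for b using that by (simp add: F_def)
  have "S'.densA M b' <= 1/10^5 \<or> S'.densA M b' >= 2 - 1/10^5" by (rule X(3)[OF b' False])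
  then show ?thesis
  proof
   assume low: "S'.densA M b' <= 1/10^5"
   have "(\<Sum>b\<in>{b\<in>F b'. (b \<in> B) = True}. 1) <= (\<Sum>b\<in>{b\<in>F b'. (b \<in> B) = True}. a b)" by (intro sum_mono) (auto simp: B_def)
   also have "... <= (\<Sum>b\<in>F b'. a b)" using fF bd FG by (intro sum_mono2) auto
   also have "... <= (real r - 1) * (1/10^5)" unfolding aF[OF b'] using low r1 by (intro mult_left_mono) auto
   finally show ?thesis using half[of True] False r1 by simp
  next
   assume high: "S'.densA M b' >= 2 - 1/10^5"
   have "(\<Sum>b\<in>{b\<in>F b'. (b \<in> B) = False}. 1) <= (\<Sum>b\<in>{b\<in>F b'. (b \<in> B) = False}. 2 + e - a b)" using S.e FG by (intro sum_mono) (auto simp: B_def)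
   also have "... <= (\<Sum>b\<in>F b'. 2 + e - a b)" using fF bd FG by (intro sum_mono2) auto
   also have "... = (real r - 1) * (2 + e - S'.densA M b')" unfolding sum_subtractf aF[OF b'] by (simp add: cFr[OF b'] algebra_simps)
   also have "... <= (real r - 1) * (2 / 10^5)" using high e13 r1 by (intro mult_left_mono) auto
   finally show ?thesis using half[of False] False r1 by simp
  qed
 qed
 have "shift_eq": "real (S.shift_dist B g) = (\<Sum>b'\<in>G'. real (card {b\<in>F b'. (b \<in> B) ~= (gm b \<in> B)}))"
 proof -
  have "S.shift_dist B g = (\<Sum>b\<in>{b\<in>G. (b \<in> B) ~= (gm b \<in> B)}. 1)" by (simp add: S.shift_dist_def G_def gm_def)
  also have "... = (\<Sum>b'\<in>G'. \<Sum>b\<in>{b. b \<in> {b\<in>G. (b \<in> B) ~= (gm b \<in> B)} & b mod Q' = b'}. 1)" using fG pi by (subst sum.group[symmetric, where g = "%b. b mod Q'" and T = G']) auto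
  also have "... = (\<Sum>b'\<in>G'. card {b\<in>F b'. (b \<in> B) ~= (gm b \<in> B)})" by (intro sum.cong refl) (auto simp: F_def intro!: arg_cong[where f = card])
  finally show ?thesis by simp
 qed
 have hG: "real (card G) = (real r - 1) * real (card G')"
 proof -
  have "card G = (\<Sum>b\<in>G. 1)" by simp
  also have "... = (\<Sum>b'\<in>G'. \<Sum>b\<in>{b. b \<in> G & b mod Q' = b'}. 1)" using fG pi by (subst sum.group[symmetric, where g = "%b. b mod Q'" and T = G']) auto
  also have "... = (\<Sum>b'\<in>G'. r - 1)" using cF by (intro sum.cong refl) (simp add: F_def)
  finally show ?thesis using r1 by (simp add: of_nat_diff)
 qed
 have "real (S.shift_dist B g) <= (\<Sum>b'\<in>G'. (real r - 1) / 10^4 + (if b' \<in> X then real r - 1 else 0))" unfolding shift_eq by (intro sum_mono fibre)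
 also have "... = real (card G') * ((real r - 1) / 10^4) + real (card X) * (real r - 1)"
 proof -
  have "G' \<inter> {b'. b' \<in> X} = X" using X by auto
  then show ?thesis using fG by (simp add: sum.distrib sum.If_cases)
 qed
 also have "... <= real (card G') * ((real r - 1) / 10^4) + (card G' / 10^4) * (real r - 1)" using X r1 by (intro add_mono mult_right_mono) auto
 also have "... = real (card G) * (2 / 10^4)" unfolding hG by simp
 also have "... <= real (card G) / 2" by simp
 finally show ?thesis by (simp add: B_def a_def G_def)
qed

text \<open>Suppose every candidate modulus has a poor class. The one for Q makes H a proper subset
  closed under products, and the one for Q / r puts into H the kernel of reduction modulo Q / r, the
  local factor of the unit group at r. By the Chinese remainder theorem the local factors generate
  all units, a contradiction.\<close>

lemma selberg_density_good_or_kernels: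
 fixes A :: "nat set" and x e :: real and N M i0 :: nat
 assumes A: "finite A" "\<And>p. p \<in> A ==> prime (p::nat)" "\<And>p. p \<in> A ==> real p <= exp (rough_level x)"
  and S: "\<And>B. B \<subseteq> A ==> selberg_density (residue_units (\<Prod>B)) (class_density x (\<Prod>B) N) N i0 e"
  and M: "N = 16 * M" "i0 <= M" and err: "7 * e + 14 * real i0 / real N <= 1 / 10^13"
 shows "\<exists>B. drop_one A B & (\<forall>c\<in>unit_residues (\<Prod>B). (\<Sum>i\<in>{8 * M<..16 * M}. class_density x (\<Prod>B) N c i) > N / 10^12)"
proof (rule ccontr)
 assume contra: "\<not> ?thesis"
 define Q where "Q = \<Prod>A"
 interpret S: selberg_density "residue_units Q" "class_density x Q N" N i0 e unfolding Q_def by (rule S) simp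
 define G where "G = unit_residues Q"
 define B where "B = {b\<in>unit_residues Q. S.densA M b > 1}"
 define H where "H = {g\<in>G. real (S.shift_dist B g) <= real (card G) / 2}"
 obtain c where c: "c \<in> unit_residues Q" "(\<Sum>i\<in>{8 * M<..16 * M}. class_density x Q N c i) <= N / 10^12" using contra unfolding Q_def not_ex by (metis not_le)
 have idx: "(\<forall>g\<in>G. \<forall>k\<in>G. S.shift_dist B g <= real (card G) / 2 --> S.shift_dist B k <= real (card G) / 2 --> S.shift_dist B (g \<otimes>\<^bsub>residue_units Q\<^esub> k) <= real (card G) / 2)
   & (\<exists>g\<in>G. S.shift_dist B g > real (card G) / 2)" unfolding G_def B_def by (rule S.bad_class_index_two[OF M c err])
 have Hmult: "g \<otimes>\<^bsub>residue_units Q\<^esub> k \<in> H" if "g \<in> H" "k \<in> H" for g k using idx that by (auto simp: H_def G_def)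
 have ker: "g \<in> H" if r: "r \<in> A" and g: "g \<in> G" "[g = 1] (mod \<Prod>(A - {r}))" for r g
 proof -
  obtain c' where c': "c' \<in> carrier (residue_units (\<Prod>(A - {r})))" "(\<Sum>i\<in>{8 * M<..16 * M}. class_density x (\<Prod>(A - {r})) N c' i) <= N / 10^12" using contra r unfolding not_ex by (metis not_le)
  have "real (S.shift_dist B g) <= real (card G) / 2" unfolding G_def B_def Q_def by (rule kernel_shift_dist[OF A r S S M err c']) (use g in \<open>auto simp: G_def Q_def\<close>)
  then show ?thesis using g by (simp add: H_def)
 qed
 have Q0: "Q > 0" unfolding Q_def using A by (intro prod_primes_pos) auto
 have one: "\<one>\<^bsub>residue_units Q\<^esub> \<in> H"
 proof -
  have "{b\<in>unit_residues Q. (b \<in> B) ~= (\<one>\<^bsub>residue_units Q\<^esub> \<otimes>\<^bsub>residue_units Q\<^esub> b \<in> B)} = {}" using S.l_one by auto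
  then have "S.shift_dist B \<one>\<^bsub>residue_units Q\<^esub> = 0" unfolding S.shift_dist_def by (simp only: card.empty)
  then show ?thesis by (simp add: H_def G_def)
 qed
 \<comment> \<open>Induction on the set U of primes at which g may differ from 1; at U = A the
   congruence is modulo the empty product and says nothing.\<close>
 have gen: "\<forall>g\<in>G. [g = 1] (mod \<Prod>(A - U)) --> g \<in> H" if "finite U" "U \<subseteq> A" for U using that
 proof (induction U rule: finite_induct)
  case empty
  show ?case
  proof (intro ballI impI)
   fix g assume "g \<in> G" "[g = 1] (mod \<Prod>(A - {}))"
   then have "g = \<one>\<^bsub>residue_units Q\<^esub>" by (simp add: G_def residue_units_def Cong.cong_def Q_def)
   then show "g \<in> H" using one by simp
  qed
 next
  case (insert r U)
  show ?case
  proof (intro ballI impI)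
   fix g assume g: "g \<in> G" "[g = 1] (mod \<Prod>(A - insert r U))"
   define Q' where "Q' = \<Prod>(A - {r})"
   define R where "R = \<Prod>(A - insert r U)"
   have rA: "r \<in> A" "prime r" using insert A by auto
   have Qr: "Q = r * Q'" unfolding Q'_def Q_def using A rA by (simp add: prod.remove)
   have Q'0: "Q' > 0" using Q0 Qr by auto
   have copr: "coprime r Q'" unfolding Q'_def using A rA by (intro prod_primes_coprime) auto
   have AU: "A - U = insert r (A - insert r U)" using insert by auto
   have PU: "\<Prod>(A - U) = r * R" unfolding AU R_def using A by (subst prod.insert) auto
   have RQ': "R dvd Q'" unfolding R_def Q'_def using A by (intro prod_dvd_prod_subset) auto
   have gQ: "coprime g Q" "g < Q" using g by (auto simp: G_def carrier_residue_units)
   \<comment> \<open>The component of g at r: it lies in the kernel belonging to r, and g / k is 1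
     at r as well, so the induction hypothesis applies to g / k.\<close>
   obtain k where k: "k < r * Q'" "[k = g] (mod r)" "[k = 1] (mod Q')" using binary_chinese_remainder_unique_nat[OF copr, of g 1] rA Q'0 prime_gt_0_nat by auto
   have "coprime k r" using k(2) gQ(1) unfolding Qr by (metis cong_imp_coprime cong_sym coprime_mult_right_iff)
   moreover have "coprime k Q'" using k(3) by (metis cong_imp_coprime cong_sym coprime_1_left)
   ultimately have kG: "k \<in> G" using k(1) by (simp add: G_def carrier_residue_units Qr)
   have kH: "k \<in> H" by (rule ker[OF rA(1) kG]) (use k in \<open>simp add: Q'_def\<close>)
   define u where "u = g \<otimes>\<^bsub>residue_units Q\<^esub> inv\<^bsub>residue_units Q\<^esub> k"
   have uG: "u \<in> G" using g kG by (simp add: u_def G_def)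
   have guk: "g = u \<otimes>\<^bsub>residue_units Q\<^esub> k" unfolding u_def using g kG by (simp add: G_def S.m_assoc)
   then have "g = (u * k) mod Q" by (simp add: mult_residue_units)
   then have uk: "[u * k = g] (mod Q)" by (simp add: Cong.cong_def)
   have "[u = 1] (mod r)"
   proof -
    have "[u * k = g] (mod r)" using uk unfolding Qr by (metis cong_dvd_modulus_nat dvd_triv_left)
    then have "[u * k = 1 * k] (mod r)" using cong_trans[OF _ cong_sym[OF k(2)]] by simp
    then show ?thesis using \<open>coprime k r\<close> by (simp only: cong_mult_rcancel_nat)
   qed
   moreover have "[u = 1] (mod R)"
   proof -
    have "[u * k = g] (mod R)" using uk RQ' unfolding Qr by (metis cong_dvd_modulus_nat dvd_mult)
    then have "[u * k = 1] (mod R)" using g(2) unfolding R_def[symmetric] by (rule cong_trans)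
    moreover have "[k = 1] (mod R)" using k(3) RQ' by (rule cong_dvd_modulus_nat)
    then have "[u * k = u * 1] (mod R)" by (intro cong_mult cong_refl)
    ultimately show ?thesis by (metis cong_sym cong_trans mult.right_neutral)
   qed
   moreover have "coprime r R" using copr RQ' by (metis coprime_divisors dvd_refl)
   ultimately have "[u = 1] (mod r * R)" by (intro coprime_cong_mult_nat)
   then have "u \<in> H" using insert uG unfolding PU[symmetric] by blast
   then show "g \<in> H" using Hmult[OF _ kH] guk by simp
  qed
 qed
 have "G \<subseteq> H" using gen[OF A(1)] by auto
 then show False using idx by (force simp: H_def)
qed

abbreviation good_modulus_bound where
 "good_modulus_bound e x0 \<equiv> \<forall>x\<ge>x0. \<forall>A. finite A --> (\<forall>p\<in>A. prime p & real p <= rough_level x) -->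
   (\<exists>B. drop_one A B & (\<forall>a<\<Prod>B. coprime a (\<Prod>B) -->
    (\<Sum>p\<in>primes_mod (\<Prod>B) a (exp (x / 2)) (exp x). ln (real p) / real p) >= e * x / card (unit_residues (\<Prod>B))))"

text \<open>The abstract density statement is turned back into sums over primes. The upper half of
  the cells is the range from exp (x / 2) to exp x, and since the modulus is at most exp (3 z),
  proper prime powers in that range are negligible even for a single class.\<close>

theorem good_modulus:
 "\<exists>e>0. \<exists>x0>1. good_modulus_bound e x0"
proof -
 \<comment> \<open>Chosen backwards from the margin 10^-13 of \<open>exceptional_classes\<close>: 7
   e = 7 * 10^-14, i0 = 2 / e, and M so large that 14 i0 / N = 1.75 * 10^-14.\<close>
 define M N i0 :: nat and e :: real where "M = 10 ^ 28" and "N = 16 * M" and "i0 = 2 * 10 ^ 14" and "e = 1 / 10 ^ 14"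
 have MN: "N = 16 * M" "i0 <= M" by (auto simp: N_def M_def i0_def)
 have ie: "1 <= i0" "2 * i0 <= N" "0 < e" "e <= 1" "2 / real i0 <= e" by (auto simp: N_def M_def i0_def e_def)
 have err: "7 * e + 14 * real i0 / real N <= 1 / 10^13" by (simp add: N_def M_def i0_def e_def)
 obtain x1 where x1: "x1 > 1" "\<forall>x\<ge>x1. \<forall>A. finite A --> (\<forall>p\<in>A. prime p & real p <= rough_level x) -->
  selberg_density (residue_units (\<Prod>A)) (class_density x (\<Prod>A) N) N i0 e" using selberg_density_class_density[OF ie] by (elim exE conjE) (rule that; assumption)
 obtain C where C: "C >= 0" "\<And>D. finite D ==> prime_power_sum D <= C" using prime_power_sum_bounded by blast
 \<comment> \<open>Twice 10^12: a class that is not poor has prime power density above 2 / K, half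
   of which may be lost to proper prime powers.\<close>
 define K :: real where "K = 2 * 10 ^ 12"
 have "eventually (%x. rough_level x >= 0 & (C + 1) * exp (- (x / 8)) * exp (3 * rough_level x) * K <= x) at_top" unfolding rough_level_def K_def using C by (intro eventually_conj; real_asymp)
 then obtain x2 where x2: "\<And>x. x >= x2 ==> rough_level x >= 0 & (C + 1) * exp (- (x / 8)) * exp (3 * rough_level x) * K <= x" by (auto simp: eventually_at_top_linorder)
 have main: "\<exists>B. drop_one A B & (\<forall>a<\<Prod>B. coprime a (\<Prod>B) -->
    (\<Sum>p\<in>primes_mod (\<Prod>B) a (exp (x / 2)) (exp x). ln (real p) / real p) >= 1 / K * x / card (unit_residues (\<Prod>B)))"
  if xx: "x >= max x1 x2" and A: "finite A" "\<forall>p\<in>A. prime p & real p <= rough_level x" for x A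
 proof -
  have x0: "x > 1" using xx x1 by simp
  have z0: "rough_level x >= 0" and small: "(C + 1) * exp (- (x / 8)) * exp (3 * rough_level x) * K <= x" using x2[of x] xx by auto
  have zw: "rough_level x <= exp (rough_level x)" using exp_ge_add_one_self[of "rough_level x"] by linarith
  have Ap: "prime p" "real p <= exp (rough_level x)" "real p <= rough_level x" if "p \<in> A" for p using A that zw by force+
  have "\<exists>B. drop_one A B & (\<forall>c\<in>unit_residues (\<Prod>B). (\<Sum>i\<in>{8 * M<..16 * M}. class_density x (\<Prod>B) N c i) > N / 10^12)"
  proof (rule selberg_density_good_or_kernels[OF A(1) Ap(1,2) _ MN err])
   fix B assume "B \<subseteq> A"
   then have "finite B" "\<forall>p\<in>B. prime p & real p <= rough_level x" using A finite_subset by auto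
   then show "selberg_density (residue_units (\<Prod>B)) (class_density x (\<Prod>B) N) N i0 e" using x1(2) xx by simp
  qed
  then obtain B where B: "B = A \<or> (\<exists>r\<in>A. B = A - {r})" "\<And>c. c \<in> unit_residues (\<Prod>B) ==> (\<Sum>i\<in>{8 * M<..16 * M}. class_density x (\<Prod>B) N c i) > N / 10^12" by blast
  have BA: "B \<subseteq> A" using B(1) by auto
  define Q where "Q = \<Prod>B"
  define h where "h = real (card (unit_residues Q))"
  have Q0: "Q > 0" unfolding Q_def using BA Ap by (intro prod_primes_pos) auto
  have h0: "h > 0"
  proof -
   interpret comm_group "residue_units Q" by (rule comm_group_residue_units[OF Q0])
   show ?thesis unfolding h_def using finite_residue_units[of Q] by (metis card_gt_0_iff of_nat_0_less_iff one_closed empty_iff)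
  qed
  have hle: "h <= exp (3 * rough_level x)"
  proof -
   have "card (unit_residues Q) <= card {..<Q}" by (intro card_mono) (auto simp: residue_units_def)
   then have "h <= real Q" by (simp add: h_def)
   also have "... <= exp (3 * rough_level x)" unfolding Q_def using BA Ap z0 A finite_subset[OF BA] by (intro prod_primes_le_exp) auto
   finally show ?thesis .
  qed
  have "(\<Sum>p\<in>primes_mod Q a (exp (x / 2)) (exp x). ln (real p) / real p) >= 1 / K * x / h"
   if a: "a < Q" "coprime a Q" for a
  proof -
   define u where "u = (%i::nat. exp (x * real i / real N))"
   define cl where "cl = (%s t. {n\<in>natseg s t. rough (exp (rough_level x)) n & n mod Q = a})"
   have N0: "real N > 0" by (simp add: N_def M_def)
   have umono: "u i <= u j" if "i <= j" for i j using that x0 N0 by (simp add: u_def divide_right_mono)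
   have "(\<Sum>i\<in>{8 * M<..T}. \<Sum>n\<in>cl (u (i - 1)) (u i). mangoldt n / real n :: real) = (\<Sum>n\<in>cl (u (8 * M)) (u T). mangoldt n / real n)" if "8 * M <= T" for T using that
   proof (induction T rule: dec_induct)
    case base
    have "cl (u (8 * M)) (u (8 * M)) = {}" by (auto simp: cl_def natseg_def)
    then show ?case by simp
   next
    case (step k)
    have "cl (u (8 * M)) (u (Suc k)) = cl (u (8 * M)) (u k) \<union> cl (u k) (u (Suc k))"
     "cl (u (8 * M)) (u k) \<inter> cl (u k) (u (Suc k)) = {}" using umono[of "8 * M" k] umono[of k "Suc k"] step by (auto simp: cl_def natseg_def)
    moreover have "finite (cl s t)" for s t by (simp add: cl_def)
    ultimately have "(\<Sum>n\<in>cl (u (8 * M)) (u (Suc k)). mangoldt n / real n :: real) = (\<Sum>n\<in>cl (u (8 * M)) (u k). mangoldt n / real n) + (\<Sum>n\<in>cl (u k) (u (Suc k)). mangoldt n / real n)"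
     by (simp add: sum.union_disjoint)
    moreover have "{8 * M<..Suc k} = insert (Suc k) {8 * M<..k}" using step by auto
    ultimately show ?case using step.IH by simp
   qed
   from this[of "16 * M"] have tel: "(\<Sum>i\<in>{8 * M<..16 * M}. \<Sum>n\<in>cl (u (i - 1)) (u i). mangoldt n / real n :: real) = (\<Sum>n\<in>cl (u (8 * M)) (u (16 * M)). mangoldt n / real n)" by simp
   have u8: "u (8 * M) = exp (x / 2)" "u (16 * M) = exp x" by (auto simp: u_def N_def M_def)
   define S where "S = (\<Sum>n\<in>cl (exp (x / 2)) (exp x). mangoldt n / real n :: real)"
   have "(\<Sum>i\<in>{8 * M<..16 * M}. class_density x Q N a i) = N * h / x * (\<Sum>i\<in>{8 * M<..16 * M}. \<Sum>n\<in>cl (u (i - 1)) (u i). mangoldt n / real n)"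
    by (simp only: class_density_def cl_def u_def h_def sum_distrib_left)
   then have "(\<Sum>i\<in>{8 * M<..16 * M}. class_density x Q N a i) = N * h / x * S" by (simp only: tel S_def u8)
   moreover have "(\<Sum>i\<in>{8 * M<..16 * M}. class_density x Q N a i) > N / 10^12" unfolding Q_def by (rule B(2)) (use a in \<open>simp add: carrier_residue_units Q_def\<close>)
   ultimately have "N * (h / x * S) > N * (1 / 10 ^ 12)" by simp
   then have "h / x * S > 1 / 10 ^ 12" using N0 by (subst (asm) mult_less_cancel_left_pos) auto
   then have S: "S > 2 / K * x / h" using h0 x0 by (simp add: K_def field_simps)
   have "S = (\<Sum>n\<in>{n\<in>cl (exp (x / 2)) (exp x). prime n}. mangoldt n / real n) + (\<Sum>n\<in>{n\<in>cl (exp (x / 2)) (exp x). \<not> prime n}. mangoldt n / real n)"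
    unfolding S_def by (subst sum.union_disjoint[symmetric]) (auto simp: cl_def intro!: sum.cong)
   also have "(\<Sum>n\<in>{n\<in>cl (exp (x / 2)) (exp x). prime n}. mangoldt n / real n) <= (\<Sum>p\<in>primes_mod Q a (exp (x / 2)) (exp x). ln (real p) / real p)"
   proof -
    have "(\<Sum>n\<in>{n\<in>cl (exp (x / 2)) (exp x). prime n}. mangoldt n / real n) = (\<Sum>n\<in>{n\<in>cl (exp (x / 2)) (exp x). prime n}. ln (real n) / real n)" by (intro sum.cong) auto
    also have "... <= (\<Sum>p\<in>primes_mod Q a (exp (x / 2)) (exp x). ln (real p) / real p)" by (intro sum_mono2) (auto simp: cl_def Suc_le_eq prime_gt_0_nat intro!: divide_nonneg_nonneg ln_ge_zero)
    finally show ?thesis .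
   qed
   \<comment> \<open>Here n exceeds exp (x / 2), so the spare quarter power of n is at least exp (x
     / 8).\<close>
   also have "(\<Sum>n\<in>{n\<in>cl (exp (x / 2)) (exp x). \<not> prime n}. mangoldt n / real n) <= exp (- (x / 8)) * (\<Sum>n\<in>{n\<in>cl (exp (x / 2)) (exp x). \<not> prime n}. mangoldt n / real n powr (3/4))"
    unfolding sum_distrib_left
   proof (rule sum_mono)
    fix n assume "n \<in> {n\<in>cl (exp (x / 2)) (exp x). \<not> prime n}"
    then have n: "exp (x / 2) < real n" by (auto simp: cl_def natseg_def)
    then have n0: "real n > 0" using exp_gt_zero less_trans by blast
    have "exp (x / 8) = exp (x / 2) powr (1/4)" by (simp add: powr_def)
    also have "... <= real n powr (1/4)" using n by (intro powr_mono2) auto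
    finally have "exp (x / 8) * real n powr (3/4) <= real n powr (1/4) * real n powr (3/4)" by (intro mult_right_mono) auto
    also have "... = real n" using n0 by (simp flip: powr_add)
    finally have "1 / real n <= 1 / (exp (x / 8) * real n powr (3/4))" using n0 by (intro divide_left_mono) auto
    then have *: "mangoldt n * (1 / real n) <= mangoldt n * (1 / (exp (x / 8) * real n powr (3/4)))" by (intro mult_left_mono mangoldt_nonneg)
    then show "mangoldt n / real n <= exp (- (x / 8)) * (mangoldt n / real n powr (3/4))"
    proof -
     have "exp (- (x / 8)) * (mangoldt n / real n powr (3/4)) = mangoldt n * (1 / (exp (x / 8) * real n powr (3/4)))" unfolding exp_minus inverse_eq_divide times_divide_times_eq by simp
     with * show ?thesis by simp
    qed
   qed
   also have "... <= exp (- (x / 8)) * (C + 1)"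
   proof (rule mult_left_mono)
    have "finite (cl (exp (x / 2)) (exp x))" by (simp add: cl_def)
    from C(2)[OF this] show "(\<Sum>n\<in>{n\<in>cl (exp (x / 2)) (exp x). \<not> prime n}. mangoldt n / real n powr (3/4)) <= C + 1" by linarith
   qed auto
   also have "... <= 1 / K * x / h"
   proof -
    have "(exp (- (x / 8)) * (C + 1)) * (K * h) <= (exp (- (x / 8)) * (C + 1)) * (K * exp (3 * rough_level x))" using hle C by (intro mult_left_mono) (auto simp: K_def)
    also have "... <= x" using small by (simp add: mult_ac)
    finally show ?thesis using h0 by (simp add: K_def field_simps)
   qed
   finally have "S <= (\<Sum>p\<in>primes_mod Q a (exp (x / 2)) (exp x). ln (real p) / real p) + 1 / K * x / h" by simp
   moreover have "2 / K * x / h = 1 / K * x / h + 1 / K * x / h" by simp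
   ultimately show ?thesis using S by linarith
  qed
  then show ?thesis using B(1) unfolding Q_def h_def by (intro exI[of _ B]) auto
 qed
 have K1: "1 / K > 0" and x12: "max x1 x2 > 1" using x1 by (auto simp: K_def)
 show ?thesis by (rule exI[of _ "1 / K"], rule conjI[OF K1], rule exI[of _ "max x1 x2"], rule conjI[OF x12], intro allI impI, rule main)
qed

section \<open>Pairs of primes in translates of a window\<close>

text \<open>For the primes of Q this is Q / phi(Q), the factor by which primes are denser among the
  numbers coprime to Q. For the prime divisors of a difference it plays the part of the singular
  series in the count of prime pairs.\<close>

definition euler_ratio :: "nat set => real" where
 "euler_ratio E = (\<Prod>p\<in>E. real p / (real p - 1))"

abbreviation odd_prime_ratio :: "nat => real" where
 "odd_prime_ratio m \<equiv> euler_ratio {p. prime p & 3 <= p & p dvd m}"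

lemma prime_real_gt_1: "prime (p::nat) ==> real p > 1"
 using prime_gt_1_nat by auto

lemma euler_ratio_ge_1: "(\<And>p. p \<in> E ==> prime p) ==> euler_ratio E >= 1"
 unfolding euler_ratio_def by (intro prod_ge_1) (use prime_real_gt_1 in \<open>force simp: field_simps\<close>)

lemma euler_ratio_Un:
 assumes "finite E" "finite F" "E \<inter> F = {}"
 shows "euler_ratio (E \<union> F) = euler_ratio E * euler_ratio F" unfolding euler_ratio_def using assms by (rule prod.union_disjoint)

lemma euler_ratio_mono:
 assumes "finite F" "E \<subseteq> F" "\<And>p. p \<in> F ==> prime p"
 shows "euler_ratio E <= euler_ratio F"
proof -
 have E: "finite E" using assms(1,2) by (rule rev_finite_subset)
 have "E \<union> (F - E) = F" using assms(2) by auto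
 then have "euler_ratio F = euler_ratio E * euler_ratio (F - E)" using euler_ratio_Un[of E "F - E"] E assms(1) by auto
 moreover have "euler_ratio (F - E) >= 1" "euler_ratio E >= 1" using assms by (auto intro!: euler_ratio_ge_1)
 ultimately show ?thesis by (simp add: mult_le_cancel_left1)
qed

lemma euler_ratio_inverse:
 assumes "\<And>p. p \<in> E ==> prime p"
 shows "(\<Prod>p\<in>E. 1 - 1 / real p) * euler_ratio E = 1"
proof -
 have "(1 - 1 / real p) * (real p / (real p - 1)) = 1" if "p \<in> E" for p using prime_real_gt_1[OF assms[OF that]] by (simp add: field_simps)
 then have "(\<Prod>p\<in>E. (1 - 1 / real p) * (real p / (real p - 1))) = 1" by (intro prod.neutral) blast
 then show ?thesis unfolding euler_ratio_def prod.distrib .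
qed

lemma euler_ratio_mertens:
 "mertens_prod T * euler_ratio (primes_in 0 T) = 1" unfolding mertens_prod_def by (rule euler_ratio_inverse) auto

lemma euler_ratio_expand:
 assumes "finite E" "\<And>p. p \<in> E ==> prime p"
 shows "euler_ratio E = (\<Sum>D\<in>Pow E. \<Prod>p\<in>D. 1 / (real p - 1))"
proof -
 have "euler_ratio E = (\<Prod>p\<in>E. 1 / (real p - 1) + 1)" unfolding euler_ratio_def
 proof (rule prod.cong)
  fix p assume "p \<in> E"
  then have "real p > 1" using assms(2) by (intro prime_real_gt_1)
  then show "real p / (real p - 1) = 1 / (real p - 1) + 1" by (simp add: field_simps)
 qed simp
 also have "... = (\<Sum>D\<in>Pow E. \<Prod>p\<in>D. 1 / (real p - 1))" using assms(1) by (subst prod_add) auto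
 finally show ?thesis .
qed

text \<open>The prime 2 is set aside because two excluded classes would leave nothing modulo 2; this
  costs only a factor 2.\<close>

lemma prod_odd_primes_outside_le:
 "\<exists>C>0. \<forall>v\<ge>3. \<forall>E. finite E --> (\<forall>p\<in>E. prime p) -->
   (\<Prod>p\<in>{p\<in>natseg 2 v. prime p & p \<notin> E}. 1 - 1 / real p) <= C * euler_ratio E / ln v"
proof -
 obtain c C where C: "C > 0" "\<And>T. T >= 2 ==> mertens_prod T <= C / ln T" using mertens_prod_bounds by blast
 have "(\<Prod>p\<in>{p\<in>natseg 2 v. prime p & p \<notin> E}. 1 - 1 / real p) <= 2 * C * euler_ratio E / ln v"
  if v: "v >= 3" and E: "finite E" "\<forall>p\<in>E. prime p" for v E
 proof -
  let ?P = "{p\<in>natseg 2 v. prime p & p \<notin> E}" and ?E = "{p\<in>natseg 2 v. prime p & p \<in> E}"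
  let ?f = "%p. 1 - 1 / real p"
  have f: "?f p > 0" if "prime p" for p using prime_real_gt_1[OF that] by simp
  have U: "primes_in 0 v = insert 2 (?P \<union> ?E)" using v by (auto simp: natseg_def prime_gt_0_nat dest: prime_ge_2_nat)
  have "mertens_prod v = (1/2) * ((\<Prod>p\<in>?P. ?f p) * (\<Prod>p\<in>?E. ?f p))" unfolding mertens_prod_def U by (subst prod.insert, simp, simp add: natseg_def, subst prod.union_disjoint) auto
  then have "(\<Prod>p\<in>?P. ?f p) * (\<Prod>p\<in>?E. ?f p) = 2 * mertens_prod v" by simp
  moreover have "(\<Prod>p\<in>?E. ?f p) * euler_ratio ?E = 1" by (rule euler_ratio_inverse) auto
  ultimately have "(\<Prod>p\<in>?P. ?f p) = 2 * mertens_prod v * euler_ratio ?E"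
  proof -
   assume a: "(\<Prod>p\<in>?P. ?f p) * (\<Prod>p\<in>?E. ?f p) = 2 * mertens_prod v" and b: "(\<Prod>p\<in>?E. ?f p) * euler_ratio ?E = 1"
   have "(\<Prod>p\<in>?P. ?f p) * (\<Prod>p\<in>?E. ?f p) * euler_ratio ?E = (\<Prod>p\<in>?P. ?f p) * 1" by (simp only: mult.assoc b)
   then show ?thesis unfolding a by simp
  qed
  also have "... <= 2 * mertens_prod v * euler_ratio E" using mertens_prod_pos[of v] E by (intro mult_left_mono euler_ratio_mono) auto
  also have "... <= 2 * (C / ln v) * euler_ratio E" using C(2)[of v] v euler_ratio_ge_1[of E] E by (intro mult_right_mono) auto
  finally show ?thesis by simp
 qed
 then show ?thesis using C(1) by (intro exI[of _ "2 * C"]) auto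
qed

abbreviation prime_rows where
 "prime_rows Q j v M K \<equiv> {n\<in>{M<..M + K}. prime (Q * n + j) & v < real (Q * n + j)}"

abbreviation prime_pairs_bound where
 "prime_pairs_bound s C \<equiv> \<forall>v\<ge>3. \<forall>E j j' M K. finite E --> (\<forall>p\<in>E. prime p) --> j <= j' --> real K >= v powr s -->
   real (card {n\<in>{M<..M+K}. prime (\<Prod>E * n + j) & v < real (\<Prod>E * n + j) & prime (\<Prod>E * n + j')})
    <= C * real K * (euler_ratio E / ln v)^2 * euler_ratio {p\<in>natseg 2 v. prime p & p \<notin> E & p dvd j' - j}"

text \<open>Two classes of n are excluded modulo each p outside E, except that they coincide when p
  divides j' - j; then the local factor exceeds the usual (1 - 1/p)^2 by p / (p - 1). The condition
  \<open>v < Q n + j\<close> ensures that the primes counted are not themselves removed by the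
  sieve.\<close>

lemma prime_pairs_le:
 "\<exists>s>0. \<exists>C>0. prime_pairs_bound s C"
proof -
 obtain s C where s: "s > 0" and C: "C > 0" and sieve: "\<forall>v\<ge>3. \<forall>P W M K. finite P -->
   (\<forall>p\<in>P. prime p & 3 <= p & real p <= v & W p \<subseteq> {..<p} & 1 <= card (W p) & card (W p) <= 2) --> real K >= v powr s -->
   real (card (avoiding P W M K)) <= C * real K * (\<Prod>p\<in>P. 1 - real (card (W p)) / real p)" using upper_bound_sieve by (elim exE conjE) (rule that; assumption)
 obtain C1 where C1: "C1 > 0" and out: "\<And>v E. v >= 3 ==> finite E ==> (\<forall>p\<in>E. prime p) ==>
   (\<Prod>p\<in>{p\<in>natseg 2 v. prime p & p \<notin> E}. 1 - 1 / real p) <= C1 * euler_ratio E / ln v" using prod_odd_primes_outside_le by blast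
 have "real (card {n\<in>{M<..M+K}. prime (\<Prod>E * n + j) & v < real (\<Prod>E * n + j) & prime (\<Prod>E * n + j')})
    <= (C * C1^2) * real K * (euler_ratio E / ln v)^2 * euler_ratio {p\<in>natseg 2 v. prime p & p \<notin> E & p dvd j' - j}"
  if v: "v >= 3" and E: "finite E" "\<forall>p\<in>E. prime p" and j: "j <= j'" and K: "real K >= v powr s" for v E j j' M K
 proof -
  define Q where "Q = \<Prod>E"
  define P where "P = {p\<in>natseg 2 v. prime p & p \<notin> E}"
  have fP: "finite P" by (simp add: P_def)
  have Pp: "prime p" "3 <= p" "real p <= v" "\<not> p dvd Q" if "p \<in> P" for p using that prime_dvd_prod_primes[of E p] E by (auto simp: P_def natseg_def Q_def)
  have "\<exists>c. \<forall>p\<in>P. c p < p & (\<forall>k. p dvd b + Q * k \<longleftrightarrow> k mod p = c p)" for b using residue_of_linear_form[OF Pp(1) Pp(4)] by (intro bchoice) blast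
  then obtain c where c: "\<And>b p. p \<in> P ==> c b p < p" "\<And>b p k. p \<in> P ==> p dvd b + Q * k \<longleftrightarrow> k mod p = c b p" by metis
  define W where "W = (%p. {c j p, c j' p})"
  have W: "W p \<subseteq> {..<p}" "1 <= card (W p)" "card (W p) <= 2" if "p \<in> P" for p using c(1)[OF that] by (auto simp: W_def card_insert_if)
  have W2: "card (W p) = 2" if "p \<in> P" "\<not> p dvd j' - j" for p
  proof -
   have "c j p ~= c j' p"
   proof
    assume eq: "c j p = c j' p"
    have "p dvd j + Q * c j p" "p dvd j' + Q * c j p" using c[OF that(1)] eq by (metis mod_less)+
    then have "p dvd (j' + Q * c j p) - (j + Q * c j p)" by (rule dvd_diff_nat[rotated])
    then show False using that(2) by simp
   qed
   then show ?thesis by (simp add: W_def)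
  qed
  let ?g = "%p. if p dvd j' - j then real p / (real p - 1) else 1"
  have fac: "0 <= 1 - real (card (W p)) / real p & 1 - real (card (W p)) / real p <= (1 - 1 / real p) ^ 2 * ?g p" if p: "p \<in> P" for p
  proof -
   have p3: "real p >= 3" using Pp(2)[OF p] by simp
   have "real (card (W p)) / real p <= 2 / real p" using W(3)[OF p] p3 by (intro divide_right_mono) auto
   moreover have "2 / real p <= 1" using p3 by simp
   moreover have "1 - real (card (W p)) / real p <= (1 - 1 / real p) ^ 2 * ?g p"
   proof (cases "p dvd j' - j")
    case True
    have "1 / real p <= real (card (W p)) / real p" using W(2)[OF p] p3 by (intro divide_right_mono) auto
    moreover have "(1 - 1 / real p) ^ 2 * (real p / (real p - 1)) = 1 - 1 / real p" using p3 by (simp add: field_simps power2_eq_square)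
    ultimately show ?thesis using True by simp
   next
    case False
    then show ?thesis using W2[OF p False] p3 by (simp add: power2_diff)
   qed
   ultimately show ?thesis by linarith
  qed
  have sub: "{n\<in>{M<..M+K}. prime (Q * n + j) & v < real (Q * n + j) & prime (Q * n + j')} \<subseteq> avoiding P W M K"
  proof (clarsimp simp: W_def)
   fix n p assume n: "prime (Q * n + j)" "v < real Q * real n + real j" "prime (Q * n + j')" and p: "p \<in> P"
   have "\<not> p dvd i + Q * n" if "j <= i" "prime (Q * n + i)" for i
   proof
    assume "p dvd i + Q * n"
    then have "p = Q * n + i" using that(2) Pp(1)[OF p] by (metis add.commute primes_dvd_imp_eq)
    then have "real p = real Q * real n + real i" by simp
    moreover have "real j <= real i" using that(1) by simp
    ultimately show False using n(2) Pp(3)[OF p] by linarith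
   qed
   from this[of j] this[of j'] show "n mod p ~= c j p & n mod p ~= c j' p" using n j c(2)[OF p] by auto
  qed
  have "real (card {n\<in>{M<..M+K}. prime (Q * n + j) & v < real (Q * n + j) & prime (Q * n + j')}) <= real (card (avoiding P W M K))" by (intro of_nat_mono card_mono sub) simp
  also have "... <= C * real K * (\<Prod>p\<in>P. 1 - real (card (W p)) / real p)"
  proof (rule sieve[rule_format, OF v fP _ K])
   fix p assume p: "p \<in> P"
   show "prime p & 3 <= p & real p <= v & W p \<subseteq> {..<p} & 1 <= card (W p) & card (W p) <= 2" by (intro conjI Pp(1-3)[OF p] W[OF p])
  qed
  also have "... <= C * real K * (\<Prod>p\<in>P. (1 - 1 / real p) ^ 2 * ?g p)" by (intro mult_left_mono prod_mono fac) (use C in auto)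
  also have "(\<Prod>p\<in>P. (1 - 1 / real p) ^ 2 * ?g p) = (\<Prod>p\<in>P. 1 - 1 / real p) ^ 2 * euler_ratio {p\<in>P. p dvd j' - j}"
   unfolding euler_ratio_def prod.distrib prod_power_distrib using fP by (simp add: prod.inter_filter)
  also have "C * real K * ((\<Prod>p\<in>P. 1 - 1 / real p) ^ 2 * euler_ratio {p\<in>P. p dvd j' - j})
    <= C * real K * ((C1 * euler_ratio E / ln v) ^ 2 * euler_ratio {p\<in>P. p dvd j' - j})"
  proof (intro mult_left_mono mult_right_mono power_mono)
   show "(\<Prod>p\<in>P. 1 - 1 / real p) <= C1 * euler_ratio E / ln v" unfolding P_def by (rule out[OF v E])
   show "0 <= (\<Prod>p\<in>P. 1 - 1 / real p)"
   proof (rule prod_nonneg)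
    fix p assume "p \<in> P"
    then have "real p > 1" by (intro prime_real_gt_1 Pp(1))
    then show "0 <= 1 - 1 / real p" by (simp add: field_simps)
   qed
   show "0 <= euler_ratio {p\<in>P. p dvd j' - j}" using Pp by (intro order.trans[OF _ euler_ratio_ge_1]) auto
  qed (use C in auto)
  also have "... = (C * C1^2) * real K * (euler_ratio E / ln v)^2 * euler_ratio {p\<in>P. p dvd j' - j}" by (simp add: power_mult_distrib power_divide)
  also have "{p\<in>P. p dvd j' - j} = {p\<in>natseg 2 v. prime p & p \<notin> E & p dvd j' - j}" by (auto simp: P_def)
  finally show ?thesis unfolding Q_def .
 qed
 moreover have "C * C1^2 > 0" using C C1 by simp
 ultimately show ?thesis using s by (intro exI[of _ s] exI[of _ "C * C1^2"]) blast
qed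

abbreviation primes_in_progression_bound where
 "primes_in_progression_bound s C \<equiv> \<forall>v\<ge>3. \<forall>E j M K. finite E --> (\<forall>p\<in>E. prime p) --> real K >= v powr s -->
   real (card (prime_rows (\<Prod>E) j v M K)) <= C * real K * (euler_ratio E)^2 / ln v"

text \<open>The case j = j' of the bound for pairs: all primes divide j - j = 0, and the singular
  factor grows to at most the order of ln v, which cancels one of the two logarithms. The square of
  the Euler ratio that remains is affordable in both applications.\<close>

lemma primes_in_progression_le:
 "\<exists>s>0. \<exists>C>0. primes_in_progression_bound s C"
proof -
 obtain s C where s: "s > 0" and C: "C > 0" and pairs: "prime_pairs_bound s C" using prime_pairs_le by (elim exE conjE) (rule that; assumption)
 obtain c where c: "c > 0" "\<And>T. T >= 2 ==> c / ln T <= mertens_prod T" using mertens_prod_bounds by blast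
 have "real (card (prime_rows (\<Prod>E) j v M K)) <= C / c * real K * (euler_ratio E)^2 / ln v"
  if v: "v >= 3" and E: "finite E" "\<forall>p\<in>E. prime p" and K: "real K >= v powr s" for v E j M K
 proof -
  have lv: "ln v > 0" using v by simp
  have "euler_ratio {p\<in>natseg 2 v. prime p & p \<notin> E & p dvd j - j} <= euler_ratio (primes_in 0 v)" by (rule euler_ratio_mono, simp, auto simp: natseg_def)
  also have "... = 1 / mertens_prod v" using euler_ratio_mertens[of v] mertens_prod_pos[of v] by (simp add: field_simps)
  also have "... <= 1 / (c / ln v)" using c v lv by (intro divide_left_mono mult_pos_pos mertens_prod_pos) auto
  finally have R: "euler_ratio {p\<in>natseg 2 v. prime p & p \<notin> E & p dvd j - j} <= ln v / c" by simp
  have "real (card (prime_rows (\<Prod>E) j v M K))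
    = real (card {n\<in>{M<..M+K}. prime (\<Prod>E * n + j) & v < real (\<Prod>E * n + j) & prime (\<Prod>E * n + j)})" by (intro arg_cong[where f = "%A. real (card A)"]) auto
  also have "... <= C * real K * (euler_ratio E / ln v)^2 * euler_ratio {p\<in>natseg 2 v. prime p & p \<notin> E & p dvd j - j}" by (rule pairs[rule_format, OF v E(1) _ order.refl K]) (use E(2) in blast)
  also have "... <= C * real K * (euler_ratio E / ln v)^2 * (ln v / c)" using C by (intro mult_left_mono R) auto
  also have "... = C / c * real K * (euler_ratio E)^2 / ln v" using lv by (simp add: power_divide power2_eq_square)
  finally show ?thesis .
 qed
 moreover have "C / c > 0" using C c by simp
 ultimately show ?thesis using s by (intro exI[of _ s] exI[of _ "C / c"]) blast
qed

section \<open>Averages of the singular factor over differences\<close>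

lemma prod_primes_dvd:
 assumes "finite A" "\<And>p. p \<in> A ==> prime p" "\<And>p. p \<in> A ==> p dvd m"
 shows "\<Prod>A dvd (m::nat)" using assms
proof (induction A)
 case (insert p A)
 have "\<not> p dvd \<Prod>A" using prime_dvd_prod_primes[of A p] insert by auto
 then have "coprime p (\<Prod>A)" using insert.prems by (intro prime_imp_coprime) auto
 then have "p * \<Prod>A dvd m" using insert by (intro divides_mult) auto
 then show ?case using insert by simp
qed simp

abbreviation odd_prime_divisors where
 "odd_prime_divisors w k \<equiv> {p\<in>natseg 2 w. prime p & p dvd k}"

text \<open>Primes up to w dominate. Those between w and w^2 contribute a bounded factor by Mertens.
  Of those beyond w^2 there are at most 2 w^2, since their product divides m <= exp (w^2), and each
  contributes at most exp (2 / w^2).\<close>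

lemma euler_ratio_divisors_le:
 "\<exists>C>0. \<forall>w\<ge>2. \<forall>m>0. ln (real m) <= w^2 -->
   odd_prime_ratio m <= C * euler_ratio (odd_prime_divisors w m)"
proof -
 obtain c C where C: "c > 0" "C > 0" "\<And>T. T >= 2 ==> c / ln T <= mertens_prod T" "\<And>T. T >= 2 ==> mertens_prod T <= C / ln T" using mertens_prod_bounds by blast
 have "odd_prime_ratio m <= (exp 4 * (2 * C / c)) * euler_ratio (odd_prime_divisors w m)"
  if w: "w >= 2" and m: "m > 0" "ln (real m) <= w^2" for w m
 proof -
  have w2: "w^2 >= 2 * w" "w^2 >= 4" "w <= w^2" using w power_mono[of 2 w 2] by (auto simp: power2_eq_square)
  define S where "S = odd_prime_divisors w m"
  define M where "M = primes_in w (w^2)"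
  define L where "L = {p. prime p & w^2 < real p & p dvd m}"
  have "L \<subseteq> {p. p dvd m}" by (auto simp: L_def)
  then have fL: "finite L" by (rule finite_subset) (rule finite_divisors_nat[OF m(1)])
  have disj: "S \<inter> M = {}" "(S \<union> M) \<inter> L = {}" using w2(3) by (auto simp: S_def M_def L_def natseg_def)
  have fSM: "finite S" "finite M" by (auto simp: S_def M_def)
  have sub: "{p. prime p & 3 <= p & p dvd m} \<subseteq> S \<union> M \<union> L"
  proof
   fix p assume "p \<in> {p. prime p & 3 <= p & p dvd m}"
   then have "prime p" "2 < real p" "p dvd m" by auto
   then show "p \<in> S \<union> M \<union> L" unfolding S_def M_def L_def natseg_def by (cases "real p <= w"; cases "real p <= w^2") auto
  qed
  have "odd_prime_ratio m <= euler_ratio (S \<union> M \<union> L)" using fL fSM sub by (intro euler_ratio_mono) (auto simp: S_def M_def L_def)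
  also have "... = euler_ratio S * euler_ratio M * euler_ratio L" using fL fSM disj by (simp only: euler_ratio_Un finite_Un simp_thms)
  also have "... <= euler_ratio S * (2 * C / c) * exp 4"
  proof -
  have hM: "euler_ratio M <= 2 * C / c"
  proof -
   have "primes_in 0 (w^2) = primes_in 0 w \<union> M" using w w2 by (auto simp: M_def natseg_def)
   moreover have "primes_in 0 w \<inter> M = {}" by (auto simp: M_def natseg_def)
   ultimately have "euler_ratio (primes_in 0 (w^2)) = euler_ratio (primes_in 0 w) * euler_ratio M" using euler_ratio_Un[of "primes_in 0 w" M] fSM by simp
   then have "mertens_prod w * mertens_prod (w^2) * euler_ratio (primes_in 0 (w^2)) = mertens_prod (w^2) * (mertens_prod w * euler_ratio (primes_in 0 w)) * euler_ratio M" by simp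
   then have "mertens_prod w = mertens_prod (w^2) * euler_ratio M" unfolding mult.assoc euler_ratio_mertens by simp
   moreover have "c / (2 * ln w) <= mertens_prod (w^2)" using C(3)[of "w^2"] w w2 by (simp add: ln_realpow)
   moreover have "euler_ratio M >= 1" by (rule euler_ratio_ge_1) (auto simp: M_def)
   ultimately have "c / (2 * ln w) * euler_ratio M <= mertens_prod w" by (metis mult_right_mono order.trans zero_le_one)
   also have "... <= C / ln w" using C(4)[of w] w by simp
   finally show ?thesis using C(1) w by (simp add: field_simps)
  qed
  have hL: "euler_ratio L <= exp 4"
  proof -
   have "card L <= 2 * w^2"
   proof -
    have "\<Prod>L dvd m" using fL by (intro prod_primes_dvd) (auto simp: L_def)
    then have "\<Prod>L <= m" using m by (intro dvd_imp_le)
    moreover have "(\<Prod>p\<in>L. 2) <= \<Prod>L" using fL by (intro prod_mono) (auto simp: L_def prime_ge_2_nat)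
    ultimately have "2 ^ card L <= m" by simp
    then have "real (2 ^ card L) <= real m" by (rule of_nat_mono)
    then have "ln (2 ^ card L) <= ln (real m)" using m by (subst ln_le_cancel_iff) auto
    then have "real (card L) * ln 2 <= w^2" using m(2) by (simp add: ln_realpow)
    moreover have "real (card L) * (1/2) <= real (card L) * ln 2" using ln2_ge_two_thirds by (intro mult_left_mono) auto
    ultimately show ?thesis by simp
   qed
   have "euler_ratio L <= (\<Prod>p\<in>L. exp (2 / w^2))" unfolding euler_ratio_def
   proof (intro prod_mono conjI)
    fix p assume "p \<in> L"
    then have p: "real p > w^2" "real p - 1 >= w^2 / 2" "real p > 1" using w2 by (auto simp: L_def)
    then show "0 <= real p / (real p - 1)" by simp
    have "real p / (real p - 1) = 1 + 1 / (real p - 1)" using p(3) by (simp add: field_simps)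
    also have "1 / (real p - 1) <= 1 / (w^2 / 2)" using p w2 by (intro divide_left_mono mult_pos_pos) auto
    also have "1 + 1 / (w^2 / 2) <= exp (2 / w^2)" using exp_ge_add_one_self[of "2 / w^2"] by simp
    finally show "real p / (real p - 1) <= exp (2 / w^2)" by simp
   qed
   also have "... = exp (real (card L) * (2 / w^2))" by (simp only: prod_constant exp_of_nat_mult)
   also have "real (card L) * (2 / w^2) <= 2 * w^2 * (2 / w^2)" using \<open>card L <= 2 * w^2\<close> by (intro mult_right_mono) auto
   also have "... = 4" using w by simp
   finally show ?thesis by simp
  qed
  have "euler_ratio S >= 1" "euler_ratio L >= 1" by (auto simp: S_def L_def intro!: euler_ratio_ge_1)
  then show ?thesis using C by (intro mult_mono mult_left_mono hM hL) auto
  qed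
  finally show ?thesis by (simp add: S_def mult_ac)
 qed
 moreover have "exp 4 * (2 * C / c) > 0" using C by simp
 ultimately show ?thesis by blast
qed

text \<open>The subset sum is the product of the factors 1 + f p, at most the exponential of the sum
  of f, and 1 / (n (n - 1)) telescopes to at most 1.\<close>

lemma sum_weighted_subsets_le:
 fixes f :: "nat => real"
 assumes "finite P" "P \<subseteq> {2..}" "\<And>p. p \<in> P ==> 0 <= f p & f p <= A / (real p * (real p - 1))" "A >= 0"
 shows "(\<Sum>D\<in>Pow P. \<Prod>p\<in>D. f p) <= exp A"
proof -
 have tel: "(\<Sum>n=2..N. 1 / (real n * (real n - 1))) <= 1" for N
 proof -
  have "(\<Sum>n=2..N. 1 / (real n * (real n - 1))) <= 1 - (if N >= 1 then 1 / real N else 0)"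
  proof (induction N)
   case (Suc N)
   show ?case
   proof (cases "N >= 1")
    case True
    then have "(\<Sum>n=2..Suc N. 1 / (real n * (real n - 1))) = (\<Sum>n=2..N. 1 / (real n * (real n - 1))) + 1 / (real (Suc N) * real N)" by simp
    also have "... <= 1 - 1 / real N + 1 / (real (Suc N) * real N)" using Suc True by simp
    also have "... = 1 - 1 / real (Suc N)"
    proof -
     have "1 - 1 / t + 1 / ((t + 1) * t) = 1 - 1 / (t + 1)" if "t > 0" for t :: real using that by (simp add: divide_simps) (simp add: algebra_simps)
     from this[of "real N"] show ?thesis using True by (simp add: add.commute)
    qed
    finally show ?thesis by simp
   qed (simp add: not_le)
  qed simp
  moreover have "(if N >= 1 then 1 / real N else 0) >= 0" by simp
  ultimately show ?thesis by linarith
 qed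
 have "(\<Sum>D\<in>Pow P. \<Prod>p\<in>D. f p) = (\<Prod>p\<in>P. f p + 1)" using assms(1) by (subst prod_add) auto
 also have "... <= (\<Prod>p\<in>P. exp (f p))"
 proof (intro prod_mono conjI)
  fix p assume "p \<in> P"
  then show "0 <= f p + 1" using assms(3)[of p] by simp
  show "f p + 1 <= exp (f p)" using exp_ge_add_one_self[of "f p"] by (simp add: add.commute)
 qed
 also have "... = exp (\<Sum>p\<in>P. f p)" using assms(1) by (simp add: exp_sum)
 also have "(\<Sum>p\<in>P. f p) <= (\<Sum>p\<in>P. A * (1 / (real p * (real p - 1))))" using assms(3) by (intro sum_mono) simp
 also have "... = A * (\<Sum>p\<in>P. 1 / (real p * (real p - 1)))" by (simp only: sum_distrib_left)
 also have "(\<Sum>p\<in>P. 1 / (real p * (real p - 1))) <= (\<Sum>p=2..Max (insert 0 P). 1 / (real p * (real p - 1)))" using assms(1,2) by (intro sum_mono2) auto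
 also have "... <= 1" by (rule tel)
 finally show ?thesis using assms(4) by (simp add: mult_left_mono)
qed

lemma euler_ratio_divisor_sum:
 assumes P: "finite P" "\<And>p. p \<in> P ==> prime p"
 shows "euler_ratio {p\<in>P. p dvd k} = (\<Sum>D\<in>Pow P. if \<Prod>D dvd k then \<Prod>p\<in>D. 1 / (real p - 1) else 0)"
proof -
 have dv: "D \<subseteq> {p\<in>P. p dvd k} \<longleftrightarrow> D \<subseteq> P & \<Prod>D dvd k" for D
 proof
  assume D: "D \<subseteq> {p\<in>P. p dvd k}"
  then have "\<Prod>D dvd k" using P finite_subset[of D P] by (intro prod_primes_dvd) auto
  then show "D \<subseteq> P & \<Prod>D dvd k" using D by auto
 next
  assume D: "D \<subseteq> P & \<Prod>D dvd k"
  then have "finite D" using P finite_subset by blast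
  then have "p dvd \<Prod>D" if "p \<in> D" for p using that by (metis dvd_prodI)
  then show "D \<subseteq> {p\<in>P. p dvd k}" using D dvd_trans by blast
 qed
 have "euler_ratio {p\<in>P. p dvd k} = (\<Sum>D\<in>Pow {p\<in>P. p dvd k}. \<Prod>p\<in>D. 1 / (real p - 1))" using P by (subst euler_ratio_expand) auto
 also have "Pow {p\<in>P. p dvd k} = {D\<in>Pow P. \<Prod>D dvd k}" using dv by auto
 also have "(\<Sum>D\<in>{D\<in>Pow P. \<Prod>D dvd k}. \<Prod>p\<in>D. 1 / (real p - 1)) = (\<Sum>D\<in>Pow P. if \<Prod>D dvd k then \<Prod>p\<in>D. 1 / (real p - 1) else 0)" using P by (intro sum.inter_filter) auto
 finally show ?thesis .
qed

text \<open>On average the ratio is bounded: expanded over divisors d, the multiples of d contribute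
  the harmonic sum divided by d, and the series over d that remains is an Euler product with factors
  1 + 1 / (p (p - 1)).\<close>

lemma sum_euler_ratio_divisors_le:
 "(\<Sum>k=1..n. euler_ratio (odd_prime_divisors w k) / real k) <= exp 1 * (ln (real n) + 1)" if "n >= 1"
proof -
 define P where "P = primes_in 2 w"
 have P: "finite P" "\<And>p. p \<in> P ==> prime p" by (auto simp: P_def)
 let ?u = "%D. \<Prod>p\<in>D. 1 / (real p - 1)"
 have u: "?u D >= 0" if "D \<subseteq> P" for D using that P prime_real_gt_1 by (intro prod_nonneg) (fastforce intro: less_imp_le)
 have "(\<Sum>k=1..n. euler_ratio (odd_prime_divisors w k) / real k) = (\<Sum>k=1..n. \<Sum>D\<in>Pow P. if \<Prod>D dvd k then ?u D / real k else 0)"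
 proof (rule sum.cong)
  fix k :: nat
  have "odd_prime_divisors w k = {p\<in>P. p dvd k}" by (auto simp: P_def)
  then have eq: "euler_ratio (odd_prime_divisors w k) = (\<Sum>D\<in>Pow P. if \<Prod>D dvd k then ?u D else 0)" using euler_ratio_divisor_sum[OF P, of k] by simp
  show "euler_ratio (odd_prime_divisors w k) / real k = (\<Sum>D\<in>Pow P. if \<Prod>D dvd k then ?u D / real k else 0)" unfolding eq sum_divide_distrib by (intro sum.cong) auto
 qed simp
 also have "... = (\<Sum>D\<in>Pow P. \<Sum>k=1..n. if \<Prod>D dvd k then ?u D / real k else 0)" by (rule sum.swap)
 also have "... <= (\<Sum>D\<in>Pow P. (\<Prod>p\<in>D. 1 / (real p * (real p - 1))) * (ln (real n) + 1))"
 proof (rule sum_mono)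
  fix D assume D: "D \<in> Pow P"
  define d where "d = \<Prod>D"
  have d0: "d > 0" unfolding d_def using D P by (intro prod_primes_pos) blast
  have "(\<Sum>k=1..n. if d dvd k then ?u D / real k else 0) = (\<Sum>k\<in>{k\<in>{1..n}. d dvd k}. ?u D / real k)" by (intro sum.inter_filter[symmetric]) simp
  also have "... <= (\<Sum>k\<in>(%i. d * i) ` {1..n}. ?u D / real k)"
  proof (rule sum_mono2)
   show "{k\<in>{1..n}. d dvd k} \<subseteq> (%i. d * i) ` {1..n}"
   proof
    fix k assume "k \<in> {k\<in>{1..n}. d dvd k}"
    then obtain i where i: "k = d * i" "1 <= k" "k <= n" by auto
    then have "i >= 1" "i <= k" using d0 by (auto intro: Nat.gr0I simp: Suc_le_eq)
    then have "i \<in> {1..n}" using i(3) by simp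
    then show "k \<in> (%i. d * i) ` {1..n}" using i(1) by (intro image_eqI)
   qed
  qed (use u D in auto)
  also have "... = (\<Sum>i=1..n. ?u D / real d * (1 / real i))" using d0 by (subst sum.reindex) (auto simp: inj_on_def)
  also have "... = ?u D / real d * (\<Sum>i=1..n. 1 / real i)" by (simp only: sum_distrib_left)
  also have "... <= ?u D / real d * (ln (real n) + 1)" using u[of D] D sum_inverse_le_ln[OF that] by (intro mult_left_mono) auto
  also have "?u D / real d = (\<Prod>p\<in>D. 1 / (real p * (real p - 1)))" unfolding d_def by (simp add: prod_dividef prod.distrib mult.commute)
  finally show "(\<Sum>k=1..n. if \<Prod>D dvd k then ?u D / real k else 0) <= (\<Prod>p\<in>D. 1 / (real p * (real p - 1))) * (ln (real n) + 1)" unfolding d_def .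
 qed
 also have "... = (\<Sum>D\<in>Pow P. \<Prod>p\<in>D. 1 / (real p * (real p - 1))) * (ln (real n) + 1)" by (simp only: sum_distrib_right)
 also have "... <= exp 1 * (ln (real n) + 1)"
 proof (intro mult_right_mono sum_weighted_subsets_le)
  show "0 <= 1 / (real p * (real p - 1)) & 1 / (real p * (real p - 1)) <= 1 / (real p * (real p - 1))" if "p \<in> P" for p using prime_real_gt_1[OF P(2)[OF that]] by simp
 qed (use P that in \<open>auto simp: prime_ge_2_nat\<close>)
 finally show ?thesis .
qed

section \<open>Counting primes with a multiple in a short interval\<close>

lemma prime_count_lower:
 "\<exists>K>1. \<forall>T\<ge>2 * K. real (card (primes_in (T / K) T)) >= T / (K * ln T)"
proof -
 obtain C where C: "C > 0" "\<And>T. T >= 1 ==> \<bar>log_sum T - ln T\<bar> <= C" using mertens_primes by blast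
 \<comment> \<open>The gain \<open>ln K\<close> exceeds the two Mertens errors, each at most C, by
   exactly 1.\<close>
 define K where "K = exp (2 * C + 1)"
 have K: "K > 1" "ln K = 2 * C + 1" using C(1) by (auto simp: K_def)
 have "real (card (primes_in (T / K) T)) >= T / (K * ln T)" if T: "T >= 2 * K" for T
 proof -
  have TK: "T / K >= 2" "T / K <= T" "T > 2" using T K by (auto simp: field_simps)
  let ?s = "%p. ln (real p) / real p"
  have un: "primes_in 0 T = primes_in 0 (T / K) \<union> primes_in (T / K) T" using TK by (auto simp: natseg_def)
  have "(\<Sum>p\<in>primes_in 0 T. ?s p) = (\<Sum>p\<in>primes_in 0 (T / K). ?s p) + (\<Sum>p\<in>primes_in (T / K) T. ?s p)" unfolding un by (rule sum.union_disjoint) (simp_all, auto simp: natseg_def)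
  moreover have "ln (T / K) = ln T - ln K" using T K by (intro ln_divide_pos) auto
  ultimately have "1 <= (\<Sum>p\<in>primes_in (T / K) T. ?s p)" using C(2)[of T] C(2)[of "T / K"] TK K(2) by linarith
  also have "... <= (\<Sum>p\<in>primes_in (T / K) T. ln T / (T / K))"
  proof (rule sum_mono)
   fix p assume "p \<in> primes_in (T / K) T"
   then have p: "T / K < real p" "real p <= T" by (auto simp: natseg_def)
   have "ln (real p) <= ln T" using p TK by (subst ln_le_cancel_iff) auto
   then show "?s p <= ln T / (T / K)" using p TK by (intro frac_le) auto
  qed
  also have "... = real (card (primes_in (T / K) T)) * (ln T / (T / K))" by simp
  finally show ?thesis using TK K by (simp add: field_simps)
 qed
 then show ?thesis using K by blast
qed

lemma prime_count_upper:
 assumes "z > 1" "T >= 0"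
 shows "real (card (primes_in z T)) <= 3 * T / ln z"
proof -
 have "real (card (primes_in z T)) * ln z = (\<Sum>p\<in>primes_in z T. ln z)" by simp
 also have "... <= (\<Sum>p\<in>primes_in z T. mangoldt p)" using assms(1) by (intro sum_mono) (auto simp: natseg_def)
 also have "... <= (\<Sum>d=1..nat \<lfloor>T\<rfloor>. mangoldt d)" using assms by (intro sum_mono2) (auto simp: natseg_def le_nat_floor mangoldt_nonneg Suc_le_eq prime_gt_0_nat)
 also have "... <= 3 * real (nat \<lfloor>T\<rfloor>)" by (rule psi_le)
 also have "... <= 3 * T" using assms(2) by simp
 finally show ?thesis using assms(1) by (simp add: field_simps)
qed

abbreviation multiples_in :: "real => nat => nat => real => nat set" where
 "multiples_in z k j D \<equiv> {q. prime q & z < real q & j < k * q & real (k * q) <= real j + D}"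

lemma finite_primes_with_multiple_in:
 assumes "k >= 1" "z >= 0"
 shows "finite (multiples_in z k j D)"
proof (rule finite_subset)
 show "multiples_in z k j D \<subseteq> natseg 0 (real j + D)"
 proof
  fix q assume q: "q \<in> multiples_in z k j D"
  have "q <= k * q" using assms by simp
  then have "real q <= real (k * q)" by (rule of_nat_mono)
  then have "real q <= real j + D" using q by auto
  then show "q \<in> natseg 0 (real j + D)" using q assms by (simp add: natseg_def)
 qed
qed simp

abbreviation multiples_in_class_bound where
 "multiples_in_class_bound s C \<equiv> \<forall>v\<ge>3. \<forall>w\<ge>0. \<forall>z. \<forall>k::nat. \<forall>j::nat. \<forall>D. \<forall>E. z >= v --> z >= exp (3 * w) --> k >= 1 --> D / real k >= exp (3 * w) * v powr s -->
   finite E --> (\<forall>p\<in>E. prime p & real p <= w & \<not> p dvd k) -->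
   real (card {q. prime q & z < real q & j < k * q & real (k * q) <= real j + D & \<Prod>E dvd k * q - j})
    <= C * (D / (real k * real (\<Prod>E))) * (euler_ratio E)^2 / ln v"

text \<open>With d the product of E, coprime to k, all primes q counted are congruent to each other
  modulo d. They therefore lie in one progression of length about D / (k d), to which the bound for
  a single progression applies.\<close>

lemma prime_multiples_in_class_le:
 "\<exists>s>0. \<exists>C>0. multiples_in_class_bound s C"
proof -
 obtain s C where s: "s > 0" and C: "C > 0" and ap: "primes_in_progression_bound s C" using primes_in_progression_le by (elim exE conjE) (rule that; assumption)
 have "real (card {q. prime q & z < real q & j < k * q & real (k * q) <= real j + D & \<Prod>E dvd k * q - j})
    <= 2 * C * (D / (real k * real (\<Prod>E))) * (euler_ratio E)^2 / ln v"
  if v: "v >= 3" and w: "w >= 0" and z: "z >= v" "z >= exp (3 * w)" and k: "k >= 1" and D: "D / real k >= exp (3 * w) * v powr s"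
   and E: "finite E" "\<forall>p\<in>E. prime p & real p <= w & \<not> p dvd k" for v w z :: real and k j :: nat and D :: real and E
 proof -
  define d where "d = \<Prod>E"
  define G where "G = {q. prime q & z < real q & j < k * q & real (k * q) <= real j + D & d dvd k * q - j}"
  have d0: "d > 0" unfolding d_def using E by (intro prod_primes_pos) auto
  have dw: "real d <= exp (3 * w)" unfolding d_def using E w by (intro prod_primes_le_exp) auto
  have vs: "v powr s >= 1" using v s by (intro ge_one_powr_ge_zero) auto
  have "real d * v powr s <= exp (3 * w) * v powr s" using dw by (intro mult_right_mono) auto
  then have "real d * v powr s <= D / real k" using D by linarith
  then have Dkd: "v powr s <= D / (real k * real d)" using d0 k by (simp add: field_simps)
  have D0: "D > 0"
  proof -
   have "0 < exp (3 * w) * v powr s" using v by simp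
   then have "0 < D / real k" using D by linarith
   then show ?thesis using k by (simp add: zero_less_divide_iff)
  qed
  have cop: "coprime d k" unfolding d_def using E by (intro prod_coprime_left) (auto intro: prime_imp_coprime)
  have fG: "finite G" by (rule finite_subset[OF _ finite_primes_with_multiple_in[OF k, of z]]) (use z v in \<open>auto simp: G_def\<close>)
  show ?thesis
  proof (cases "G = {}")
   case True
   then have "card G = 0" by simp
   moreover have "0 <= 2 * C * (D / (real k * real (\<Prod>E))) * (euler_ratio E)^2 / ln v" using C D0 v by (intro divide_nonneg_nonneg mult_nonneg_nonneg) (auto intro: prod_nonneg)
   ultimately show ?thesis unfolding G_def d_def by simp
  next
   case False
   define q0 where "q0 = Min G"
   have q0: "q0 \<in> G" "\<And>q. q \<in> G ==> q0 <= q" using fG False by (auto simp: q0_def)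
   have "real q0 > z" using q0(1) by (simp add: G_def)
   then have "real d <= real q0" using dw z by linarith
   then have dq: "d <= q0" by simp
   define K where "K = nat \<lfloor>D / (real k * real d)\<rfloor> + 1"
   have K: "real K >= v powr s" "real K <= 2 * (D / (real k * real d))"
   proof -
    have "real (nat \<lfloor>t\<rfloor> + 1) >= t & real (nat \<lfloor>t\<rfloor> + 1) <= 2 * t" if "t >= 1" for t :: real using that by linarith
    from this[of "D / (real k * real d)"] show "real K >= v powr s" "real K <= 2 * (D / (real k * real d))" unfolding K_def using Dkd vs by auto
   qed
   \<comment> \<open>The progression starts one step before the least element q0, because
     \<open>prime_rows\<close> begins with n = 1; q0 > z >= exp (3 w) >= d makes
     \<open>q0 - d\<close> a true difference.\<close>
   have sub: "G \<subseteq> (%n. d * n + (q0 - d)) ` prime_rows d (q0 - d) v 0 K"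
   proof
    fix q assume q: "q \<in> G"
    have "d dvd (k * q - j) - (k * q0 - j)" by (rule dvd_diff_nat) (use q q0(1) in \<open>simp_all add: G_def\<close>)
    also have "(k * q - j) - (k * q0 - j) = k * (q - q0)" using q q0(1) by (auto simp: G_def diff_mult_distrib2)
    finally have "d dvd q - q0" using cop by (simp add: coprime_dvd_mult_right_iff)
    then obtain t where t: "q - q0 = d * t" by blast
    then have qt: "q = q0 + d * t" using q0(2)[OF q] by simp
    then have eq: "q = d * (t + 1) + (q0 - d)" using dq by simp
    have "j < k * q0" "real (k * q) <= real j + D" using q q0(1) unfolding G_def by blast+
    moreover from this(1) have "real j < real (k * q0)" by (rule less_imp_of_nat_less)
    ultimately have "real (k * q) - real (k * q0) < D" by linarith
    then have "real k * (real d * real t) < D" unfolding qt by (simp add: algebra_simps)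
    then have "real t <= D / (real k * real d)" using k d0 by (simp add: field_simps)
    then have "t <= nat \<lfloor>D / (real k * real d)\<rfloor>" by (rule le_nat_floor)
    then have "t + 1 \<in> {0<..0+K}" by (simp add: K_def)
    moreover have "v < real q" "prime q" using q z by (auto simp: G_def)
    ultimately show "q \<in> (%n. d * n + (q0 - d)) ` prime_rows d (q0 - d) v 0 K" by (intro image_eqI[of _ _ "t + 1"] CollectI conjI) (simp_all only: eq[symmetric])
   qed
   have "card G <= card (prime_rows d (q0 - d) v 0 K)" using sub by (intro surj_card_le) auto
   then have "real (card G) <= real (card (prime_rows d (q0 - d) v 0 K))" by (rule of_nat_mono)
   also have "... <= C * real K * (euler_ratio E)^2 / ln v" unfolding d_def by (rule ap[rule_format, OF v E(1) _ K(1)]) (use E(2) in blast)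
   also have "... <= C * (2 * (D / (real k * real d))) * (euler_ratio E)^2 / ln v" using C v K(2) by (intro divide_right_mono mult_right_mono mult_left_mono) auto
   also have "C * (2 * (D / (real k * real d))) = 2 * C * (D / (real k * real d))" by (simp only: mult.left_commute mult.assoc)
   finally show ?thesis unfolding G_def d_def .
  qed
 qed
 moreover have "2 * C > 0" using C by simp
 ultimately show ?thesis using s by (intro exI[of _ s] exI[of _ "2 * C"]) blast
qed

abbreviation multiples_weight_bound where
 "multiples_weight_bound s C \<equiv> \<forall>v\<ge>3. \<forall>w\<ge>2. \<forall>z. \<forall>k::nat. \<forall>j::nat. \<forall>D. z >= v --> z >= exp (3 * w) --> k >= 1 --> D / real k >= exp (3 * w) * v powr s --> ln D <= w^2 -->
   (\<Sum>q\<in>multiples_in z k j D. odd_prime_ratio (k * q - j))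
    <= C * D / ln v * (euler_ratio (odd_prime_divisors w k) / real k)"

text \<open>Prime divisors of the difference above w are removed by
  \<open>euler_ratio_divisors_le\<close>, and those dividing k are bounded by the common factor H.
  The rest of the ratio is expanded over sets E of primes prescribed as divisors; counting q for
  each E leaves factors p / (p - 1)^3, whose Euler product converges.\<close>

lemma prime_multiples_weight_le:
 "\<exists>s>0. \<exists>C>0. multiples_weight_bound s C"
proof -
 obtain s C1 where s: "s > 0" and C1: "C1 > 0" and count: "multiples_in_class_bound s C1" using prime_multiples_in_class_le by (elim exE conjE) (rule that; assumption)
 obtain C2 where C2: "C2 > 0" and trunc: "\<And>w m. w >= 2 ==> m > 0 ==> ln (real m) <= w^2 ==>
   odd_prime_ratio m <= C2 * euler_ratio (odd_prime_divisors w m)" using euler_ratio_divisors_le by blast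
 have "(\<Sum>q\<in>multiples_in z k j D. odd_prime_ratio (k * q - j))
    <= (C1 * C2 * exp 4) * D / ln v * (euler_ratio (odd_prime_divisors w k) / real k)"
  if v: "v >= 3" and w: "w >= 2" and z: "z >= v" "z >= exp (3 * w)" and k: "k >= 1" and D: "D / real k >= exp (3 * w) * v powr s" and lD: "ln D <= w^2"
  for v w z :: real and k j :: nat and D :: real
 proof -
  define G where "G = multiples_in z k j D"
  define P where "P = {p\<in>natseg 2 w. prime p & \<not> p dvd k}"
  define H where "H = euler_ratio (odd_prime_divisors w k)"
  let ?u = "%E. \<Prod>p\<in>E. 1 / (real p - 1)"
  have P: "finite P" "\<And>p. p \<in> P ==> prime p" by (auto simp: P_def)
  have P3: "real p > 2" if "p \<in> P" for p using that by (simp add: P_def natseg_def)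
  have D0: "D > 0"
  proof -
   have "0 < exp (3 * w) * v powr s" using v by simp
   then have "0 < D / real k" using D by linarith
   then show ?thesis using k by (simp add: zero_less_divide_iff)
  qed
  have H1: "H >= 1" unfolding H_def by (rule euler_ratio_ge_1) auto
  have "odd_prime_ratio (k * q - j) <= C2 * H * (\<Sum>E\<in>Pow P. if \<Prod>E dvd k * q - j then ?u E else 0)" if q: "q \<in> G" for q
  proof -
   define m where "m = k * q - j"
   have m: "m > 0" "real m <= D" using q by (auto simp: G_def m_def of_nat_diff)
   have "ln (real m) <= ln D" using m by (subst ln_le_cancel_iff) auto
   then have "odd_prime_ratio m <= C2 * euler_ratio (odd_prime_divisors w m)" using lD m(1) by (intro trunc w) auto
   also have "... <= C2 * euler_ratio (odd_prime_divisors w k \<union> {p\<in>P. p dvd m})"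
   proof (intro mult_left_mono euler_ratio_mono)
    show "finite (odd_prime_divisors w k \<union> {p\<in>P. p dvd m})" using P(1) by simp
    show "odd_prime_divisors w m \<subseteq> odd_prime_divisors w k \<union> {p\<in>P. p dvd m}" unfolding P_def by blast
    show "prime p" if "p \<in> odd_prime_divisors w k \<union> {p\<in>P. p dvd m}" for p using that unfolding P_def by blast
   qed (use C2 in simp)
   also have "euler_ratio (odd_prime_divisors w k \<union> {p\<in>P. p dvd m}) = H * euler_ratio {p\<in>P. p dvd m}" unfolding H_def by (intro euler_ratio_Un) (simp_all add: P(1), auto simp: P_def)
   also have "C2 * (H * euler_ratio {p\<in>P. p dvd m}) = C2 * H * (\<Sum>E\<in>Pow P. if \<Prod>E dvd m then ?u E else 0)" by (simp only: euler_ratio_divisor_sum[OF P] mult.assoc)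
   finally show ?thesis unfolding m_def .
  qed
  then have "(\<Sum>q\<in>G. odd_prime_ratio (k * q - j)) <= (\<Sum>q\<in>G. C2 * H * (\<Sum>E\<in>Pow P. if \<Prod>E dvd k * q - j then ?u E else 0))" by (rule sum_mono)
  also have "... = C2 * H * (\<Sum>E\<in>Pow P. \<Sum>q\<in>G. if \<Prod>E dvd k * q - j then ?u E else 0)" unfolding sum_distrib_left[symmetric] by (subst sum.swap) (rule refl)
  also have "... <= C2 * H * (C1 * D / (real k * ln v) * exp 4)"
  proof (rule mult_left_mono)
  have "(\<Sum>E\<in>Pow P. \<Sum>q\<in>G. if \<Prod>E dvd k * q - j then ?u E else 0) <= (\<Sum>E\<in>Pow P. C1 * D / (real k * ln v) * (\<Prod>p\<in>E. real p / (real p - 1) ^ 3))"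
  proof (rule sum_mono)
   fix E assume "E \<in> Pow P"
   then have E: "E \<subseteq> P" "finite E" using P finite_subset by auto
   have fG: "finite G" unfolding G_def using z v by (intro finite_primes_with_multiple_in k) simp
   have u0: "?u E >= 0" using P3 E by (intro prod_nonneg) fastforce
   have "(\<Sum>q\<in>G. if \<Prod>E dvd k * q - j then ?u E else 0) = (\<Sum>q\<in>{q\<in>G. \<Prod>E dvd k * q - j}. ?u E)" using fG by (intro sum.inter_filter[symmetric])
   also have "... = ?u E * real (card {q\<in>G. \<Prod>E dvd k * q - j})" by simp
   also have "{q\<in>G. \<Prod>E dvd k * q - j} = {q. prime q & z < real q & j < k * q & real (k * q) <= real j + D & \<Prod>E dvd k * q - j}" by (auto simp: G_def)
   also have "?u E * real (card {q. prime q & z < real q & j < k * q & real (k * q) <= real j + D & \<Prod>E dvd k * q - j}) <= ?u E * (C1 * (D / (real k * real (\<Prod>E))) * (euler_ratio E)^2 / ln v)"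
   proof (intro mult_left_mono u0 count[rule_format, OF v _ z k D E(2)])
    fix p assume "p \<in> E"
    then show "prime p & real p <= w & \<not> p dvd k" using E(1) by (auto simp: P_def natseg_def)
   qed (use w in simp)
   also have "... = C1 * D / (real k * ln v) * (?u E * (1 / real (\<Prod>E)) * (euler_ratio E)^2)" by (simp add: mult_ac)
   also have "?u E * (1 / real (\<Prod>E)) * (euler_ratio E)^2 = (\<Prod>p\<in>E. real p / (real p - 1) ^ 3)"
   proof -
    have eq: "(\<Prod>p\<in>E. real p / (real p - 1) ^ 3) = (\<Prod>p\<in>E. 1 / (real p - 1) * (1 / real p) * (real p / (real p - 1))^2)"
    proof (rule prod.cong)
     fix p assume "p \<in> E"
     then have "real p > 2" using E P3 by auto
     moreover have "a / t ^ 3 = 1 / t * (1 / a) * (a / t)^2" if "a > 0" "t > 0" for a t :: real using that by (simp add: power2_eq_square power3_eq_cube)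
     ultimately show "real p / (real p - 1) ^ 3 = 1 / (real p - 1) * (1 / real p) * (real p / (real p - 1))^2" by simp
    qed simp
    have inv: "1 / real (\<Prod>E) = (\<Prod>p\<in>E. 1 / real p)" by (simp add: prod_dividef)
    show ?thesis unfolding eq inv euler_ratio_def prod_power_distrib prod.distrib[symmetric] ..
   qed
   finally show "(\<Sum>q\<in>G. if \<Prod>E dvd k * q - j then ?u E else 0) <= C1 * D / (real k * ln v) * (\<Prod>p\<in>E. real p / (real p - 1) ^ 3)" .
  qed
  also have "... = C1 * D / (real k * ln v) * (\<Sum>E\<in>Pow P. \<Prod>p\<in>E. real p / (real p - 1) ^ 3)" by (simp only: sum_distrib_left)
  also have "... <= C1 * D / (real k * ln v) * exp 4"
  proof (intro mult_left_mono sum_weighted_subsets_le[OF P(1)])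
   show "P \<subseteq> {2..}" using P prime_ge_2_nat by auto
   fix p assume "p \<in> P"
   then have p: "real p > 2" by (rule P3)
   have "(real p)^2 <= (2 * (real p - 1))^2" using p by (intro power_mono) auto
   then have "(real p)^2 <= 4 * (real p - 1)^2" by (simp only: power_mult_distrib) simp
   then have "real p * (real p * (real p - 1)) <= 4 * (real p - 1)^3" using p by (simp add: power2_eq_square power3_eq_cube mult.assoc[symmetric])
   then show "0 <= real p / (real p - 1) ^ 3 & real p / (real p - 1) ^ 3 <= 4 / (real p * (real p - 1))" using p by (simp add: divide_simps)
  qed (use C1 v k D0 in auto)
  finally show "(\<Sum>E\<in>Pow P. \<Sum>q\<in>G. if \<Prod>E dvd k * q - j then ?u E else 0) <= C1 * D / (real k * ln v) * exp 4" .
  qed (use C2 H1 in simp)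
  finally show ?thesis unfolding G_def H_def by (simp add: mult_ac)
 qed
 moreover have "C1 * C2 * exp 4 > 0" using C1 C2 by simp
 ultimately show ?thesis using s by (intro exI[of _ s] exI[of _ "C1 * C2 * exp 4"]) blast
qed

section \<open>Smooth numbers by Rankin's trick\<close>

lemma sum_smooth_powr_le:
 assumes "finite F" "\<And>p. p \<in> F ==> prime p" "s > 0"
 shows "(\<Sum>j\<in>{j\<in>{1..N}. \<forall>p. prime p --> p dvd j --> p \<in> F}. real j powr - s) <= (\<Prod>p\<in>F. 1 / (1 - real p powr - s))" using assms(1,2)
proof (induction F)
 case empty
 have "(\<Sum>j\<in>{j\<in>{1..N}. \<forall>p. prime p --> p dvd j --> p \<in> {}}. real j powr - s) <= (\<Sum>j\<in>{1::nat}. real j powr - s)" using prime_factor_nat by (intro sum_mono2) auto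
 then show ?case by simp
next
 case (insert p F)
 let ?S = "%F. {j\<in>{1..N}. \<forall>p. prime p --> p dvd j --> p \<in> F}"
 have p: "prime p" "p >= 2" using insert.prems prime_ge_2_nat by auto
 define t where "t = real p powr - s"
 have t: "t > 0" "t < 1" using p assms(3) by (auto simp: t_def powr_less_one)
 have sub: "?S (insert p F) \<subseteq> (%(a, i). p ^ a * i) ` ({..N} \<times> ?S F)"
 proof
  fix j assume j: "j \<in> ?S (insert p F)"
  then have j0: "j ~= 0" by auto
  obtain i where i: "j = p ^ multiplicity p j * i" "\<not> p dvd i" using multiplicity_decompose'[OF j0, of p] p by auto
  define a where "a = multiplicity p j"
  have ji: "j = p ^ a * i" using i(1) by (simp add: a_def)
  have i0: "i >= 1" "p ^ a >= 1" using ji j0 by (cases i; auto)+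
  have "a < 2 ^ a" by (rule less_exp)
  also have "(2::nat) ^ a <= p ^ a" using p by (intro power_mono) auto
  also have "... <= j" unfolding ji using i0 by simp
  finally have "a <= N" using j by auto
  moreover have "i <= j" unfolding ji using i0 by simp
  then have "i <= N" using j by auto
  moreover have "q \<in> F" if "prime q" "q dvd i" for q
  proof -
   have "q dvd j" using that by (simp add: ji)
   then have "q \<in> insert p F" using j that by blast
   then show ?thesis using that i(2) by auto
  qed
  ultimately show "j \<in> (%(a, i). p ^ a * i) ` ({..N} \<times> ?S F)" using ji i0 j by (intro image_eqI[of _ _ "(a, i)"]) auto
 qed
 have "(\<Sum>j\<in>?S (insert p F). real j powr - s) <= (\<Sum>j\<in>(%(a, i). p ^ a * i) ` ({..N} \<times> ?S F). real j powr - s)" by (intro sum_mono2 sub) auto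
 also have "... <= (\<Sum>(a, i)\<in>{..N} \<times> ?S F. real (p ^ a * i) powr - s)" by (intro order.trans[OF sum_image_le]) (auto simp: case_prod_unfold)
 also have "... = (\<Sum>(a, i)\<in>{..N} \<times> ?S F. t ^ a * real i powr - s)"
 proof (intro sum.cong refl)
  have "(real p ^ a) powr - s = t ^ a" for a
  proof -
   have "(real p ^ a) powr - s = (real p powr real a) powr - s" using p by (simp add: powr_realpow)
   also have "... = (real p powr - s) powr real a" by (simp only: powr_powr mult.commute)
   also have "... = t ^ a" using t by (simp add: t_def powr_realpow)
   finally show ?thesis .
  qed
  then show "(case ai of (a, i) => real (p ^ a * i) powr - s) = (case ai of (a, i) => t ^ a * real i powr - s)" for ai by (auto simp: powr_mult split: prod.split)
 qed
 also have "... = (\<Sum>a\<le>N. t ^ a) * (\<Sum>i\<in>?S F. real i powr - s)" by (simp add: sum_product sum.cartesian_product)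
 also have "... <= 1 / (1 - t) * (\<Prod>p\<in>F. 1 / (1 - real p powr - s))"
 proof (intro mult_mono)
  have "(\<Sum>a\<le>N. t ^ a) = (1 - t ^ Suc N) / (1 - t)" using t by (simp add: sum_gp0)
  also have "... <= 1 / (1 - t)" using t by (intro divide_right_mono) auto
  finally show "(\<Sum>a\<le>N. t ^ a) <= 1 / (1 - t)" .
  show "(\<Sum>i\<in>?S F. real i powr - s) <= (\<Prod>p\<in>F. 1 / (1 - real p powr - s))" using insert by auto
 qed (use t in \<open>auto intro!: sum_nonneg\<close>)
 finally show ?case using insert by (simp add: t_def)
qed

abbreviation smooth_upto where
 "smooth_upto U y r \<equiv> {j\<in>natseg 0 U. \<forall>p. prime p --> p dvd j --> real p <= y \<or> p = r}"

text \<open>Rankin's trick with the exponent 1 - e. The additional prime r, of any size, is the one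
  that may have been dropped from Q; its Euler factor is bounded and accounts for the final summand
  4.\<close>

lemma smooth_count_le:
 assumes y: "y >= 2" and e: "0 <= e" "e <= 1/2" and U: "U >= 1" and r: "prime (r::nat)"
 shows "real (card (smooth_upto U y r))
  <= U powr (1 - e) * exp (4 * (reciprocal_sum y
     + e * y powr e * log_sum y) + 4)"
proof -
 define P where "P = primes_in 0 y"
 define s where "s = 1 - e"
 have s: "s >= 1/2" using e by (simp add: s_def)
 have fP: "finite P" by (simp add: P_def)
 let ?S = "{j\<in>{1..nat \<lfloor>U\<rfloor>}. \<forall>p. prime p --> p dvd j --> p \<in> insert r P}"
 have Seq: "smooth_upto U y r = ?S" unfolding natseg_0 by (auto simp: P_def natseg_def prime_gt_0_nat)
 have "real (card ?S) = (\<Sum>j\<in>?S. 1)" by simp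
 also have "... <= (\<Sum>j\<in>?S. U powr s * real j powr - s)"
 proof (rule sum_mono)
  fix j assume "j \<in> ?S"
  then have j: "1 <= real j" "real j <= U" using U by (auto simp: le_nat_iff le_floor_iff)
  have "real j powr s * real j powr - s <= U powr s * real j powr - s" using j s by (intro mult_right_mono powr_mono2) auto
  then show "1 <= U powr s * real j powr - s" using j by (simp flip: powr_add)
 qed
 also have "... = U powr s * (\<Sum>j\<in>?S. real j powr - s)" by (simp only: sum_distrib_left)
 also have "... <= U powr s * exp (4 * ((\<Sum>p\<in>P. 1 / real p) + e * y powr e * (\<Sum>p\<in>P. ln (real p) / real p)) + 4)"
 proof (rule mult_left_mono)
  have t: "0 <= real p powr - s & real p powr - s <= 3/4" if "prime p" for p
  proof -
   have "real p powr - s <= 2 powr - s" using prime_ge_2_nat[OF that] s by (intro powr_mono2') auto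
   also have "... <= 2 powr - (1/2)" using s by (intro powr_mono) auto
   also have "... = 1 / sqrt 2" by (simp add: powr_minus powr_half_sqrt inverse_eq_divide)
   also have "... <= 3/4"
   proof -
    have "4/3 <= sqrt (2::real)" by (rule real_le_rsqrt) (simp add: power2_eq_square)
    then show ?thesis by (simp add: field_simps)
   qed
   finally show ?thesis by simp
  qed
  have "(\<Sum>j\<in>?S. real j powr - s) <= (\<Prod>p\<in>insert r P. 1 / (1 - real p powr - s))" using fP r s by (intro sum_smooth_powr_le) (auto simp: P_def)
  also have "... <= (\<Prod>p\<in>insert r P. exp (4 * real p powr - s))"
  proof (intro prod_mono conjI)
   fix p assume "p \<in> insert r P"
   then have "prime p" using r by (auto simp: P_def)
   from t[OF this] have t': "0 <= real p powr - s" "real p powr - s <= 3/4" by auto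
   then show "0 <= 1 / (1 - real p powr - s)" by simp
   have "1 / (1 - t) <= exp (4 * t)" if "0 <= t" "t <= 3/4" for t :: real
   proof -
    have "0 <= t * (3 - 4 * t)" using that by (intro mult_nonneg_nonneg) auto
    then have "1 <= (1 + 4 * t) * (1 - t)" by (simp add: algebra_simps)
    then have "1 / (1 - t) <= 1 + 4 * t" using that by (simp add: pos_divide_le_eq)
    then show ?thesis using exp_ge_add_one_self[of "4 * t"] by linarith
   qed
   then show "1 / (1 - real p powr - s) <= exp (4 * real p powr - s)" using t' .
  qed
  also have "... = exp (\<Sum>p\<in>insert r P. 4 * real p powr - s)" using fP by (simp only: exp_sum finite_insert)
  also have "... <= exp (4 * ((\<Sum>p\<in>P. 1 / real p) + e * y powr e * (\<Sum>p\<in>P. ln (real p) / real p)) + 4)"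
  proof -
   have "(\<Sum>p\<in>insert r P. 4 * real p powr - s) = 4 * (\<Sum>p\<in>insert r P. real p powr - s)" by (simp only: sum_distrib_left)
   also have "(\<Sum>p\<in>insert r P. real p powr - s) <= (\<Sum>p\<in>P. real p powr - s) + 1" using fP t[OF r] by (simp add: sum.insert_if)
   also have "(\<Sum>p\<in>P. real p powr - s) <= (\<Sum>p\<in>P. 1 / real p + e * y powr e * (ln (real p) / real p))"
   proof (rule sum_mono)
    fix p assume p: "p \<in> P"
    then have p1: "real p > 1" "real p <= y" using prime_real_gt_1 by (auto simp: P_def natseg_def)
    define u where "u = e * ln (real p)"
    have u0: "u >= 0" using e p1 by (simp add: u_def)
    have "real p powr e = exp u" using p1 by (simp add: u_def powr_def)
    have "real p powr - s = real p powr e / real p" using p1 by (simp add: s_def powr_diff)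
    also have "real p powr e <= 1 + u * real p powr e"
    proof -
     have "exp u * (1 - u) <= exp u * exp (- u)" using exp_ge_add_one_self[of "- u"] by (intro mult_left_mono) auto
     then have "exp u * (1 - u) <= 1" by (simp flip: exp_add)
     then show ?thesis unfolding \<open>real p powr e = exp u\<close> by (simp add: algebra_simps)
    qed
    also have "u * real p powr e <= u * y powr e" using u0 p1 e by (intro mult_left_mono powr_mono2) auto
    finally have "real p powr - s <= (1 + u * y powr e) / real p" using p1 by (simp add: divide_right_mono)
    then show "real p powr - s <= 1 / real p + e * y powr e * (ln (real p) / real p)" by (simp add: u_def add_divide_distrib mult_ac)
   qed
   also have "... = (\<Sum>p\<in>P. 1 / real p) + e * y powr e * (\<Sum>p\<in>P. ln (real p) / real p)" by (simp only: sum.distrib sum_distrib_left)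
   finally show ?thesis by simp
  qed
  finally show "(\<Sum>j\<in>?S. real j powr - s) <= exp (4 * ((\<Sum>p\<in>P. 1 / real p) + e * y powr e * (\<Sum>p\<in>P. ln (real p) / real p)) + 4)" .
 qed simp
 finally show ?thesis unfolding Seq P_def s_def .
qed

text \<open>This is y, chosen as large as Rankin's trick permits up to constants: a larger y would
  shrink Q / phi(Q), about ln z / ln y, no further than necessary, while the smooth numbers in the
  window must stay negligible.\<close>

definition smooth_level :: "real => real" where
 "smooth_level x = exp (ln x * ln (ln (ln x)) / (16 * ln (ln x)))"

text \<open>The set S of multiples of large primes has about U ln ln x / ln x elements, and the
  numbers N + j with j in S are prime with probability about (Q / phi(Q)) / x, where Q / phi(Q) is
  of order ln ln x / ln ln ln x. This U makes the expected number of primes in a row a constant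
  multiple of c.\<close>

definition window :: "real => real => real" where
 "window c x = c * x * ln x * ln (ln (ln x)) / (ln (ln x))^2"

lemma smooth_in_window_le:
 assumes "c > 0"
 shows "eventually (%x. \<forall>r. prime r -->
  real (card (smooth_upto (window c x) (smooth_level x) r)) <= window c x / ln x ^ 3) at_top"
proof -
 obtain C1 where C1: "\<And>T. T >= 2 ==> \<bar>reciprocal_sum T - ln (ln T)\<bar> <= C1" using sum_inverse_primes by blast
 obtain C2 where C2: "\<And>T. T >= 1 ==> \<bar>log_sum T - ln T\<bar> <= C2" using mertens_primes by blast
 have "eventually (%x. smooth_level x >= 2) at_top" unfolding smooth_level_def by real_asymp
 moreover have "eventually (%x. window c x >= x) at_top" unfolding window_def using assms by real_asymp
 moreover have "eventually (%x::real. 8 * ln (ln x) / ln x <= 1/2 & ln (ln x) > 0 & x > 1) at_top" by (intro eventually_conj; real_asymp)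
 moreover have "eventually (%x::real. - 8 * ln (ln x) + (4 * (ln (ln x * ln (ln (ln x)) / (16 * ln (ln x))) + C1
    + 8 * ln (ln x) / ln x * exp (ln (ln (ln x)) / 2) * (ln x * ln (ln (ln x)) / (16 * ln (ln x)) + C2)) + 4) <= - 3 * ln (ln x)) at_top" by real_asymp
 ultimately show ?thesis
 proof eventually_elim
  case (elim x)
  define y where "y = smooth_level x"
  define U where "U = window c x"
  \<comment> \<open>Then U powr (- e) is at most (ln x)^-8 and e ln y = (ln ln ln x) / 2. So y powr
    e is only the square root of ln ln x, and the term with \<open>log_sum\<close> is o(ln ln x).
    The term with \<open>reciprocal_sum\<close> costs at most about (ln x)^4, which leaves more than
    the three powers of ln x required.\<close>
  define e where "e = 8 * ln (ln x) / ln x"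
  have x: "x > 1" "ln (ln x) > 0" and e: "e >= 0" "e <= 1/2" using elim by (auto simp: e_def)
  have lx: "ln x > 0" using x by simp
  have y: "y >= 2" and U: "U >= x" using elim by (auto simp: y_def U_def)
  have ly: "ln y = ln x * ln (ln (ln x)) / (16 * ln (ln x))" by (simp add: y_def smooth_level_def)
  have yp: "y powr e = exp (ln (ln (ln x)) / 2)"
  proof -
   have "e * ln y = ln (ln (ln x)) / 2" unfolding ly e_def using x lx by (simp add: field_simps)
   then show ?thesis using y by (simp add: powr_def)
  qed
  show ?case
  proof (intro allI impI)
   fix r :: nat assume r: "prime r"
   have "real (card (smooth_upto U y r))
    <= U powr (1 - e) * exp (4 * (reciprocal_sum y
     + e * y powr e * log_sum y) + 4)" using y e U x r by (intro smooth_count_le) auto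
   also have "... <= (U * exp (- 8 * ln (ln x))) * exp (4 * (ln (ln y) + C1 + e * y powr e * (ln y + C2)) + 4)"
   proof (intro mult_mono)
    have "U powr (1 - e) = U * U powr (- e)" using U x by (simp add: powr_diff powr_minus divide_inverse)
    also have "U powr (- e) <= x powr (- e)" using U x e by (intro powr_mono2') auto
    also have "x powr (- e) = exp (- 8 * ln (ln x))" using x lx by (simp add: powr_def e_def)
    finally show "U powr (1 - e) <= U * exp (- 8 * ln (ln x))" using U x by (simp add: mult_left_mono)
    have "reciprocal_sum y <= ln (ln y) + C1" using C1[OF y] by linarith
    moreover have "log_sum y <= ln y + C2" using C2[of y] y by linarith
    then have "e * y powr e * log_sum y <= e * y powr e * (ln y + C2)" using e by (intro mult_left_mono) auto
    ultimately show "exp (4 * (reciprocal_sum y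
     + e * y powr e * log_sum y) + 4) <= exp (4 * (ln (ln y) + C1 + e * y powr e * (ln y + C2)) + 4)" by simp
   qed (use U x in auto)
   also have "... = U * exp (- 8 * ln (ln x) + (4 * (ln (ln y) + C1 + e * y powr e * (ln y + C2)) + 4))" by (simp only: exp_add mult.assoc)
   also have "... <= U * exp (- 3 * ln (ln x))"
   proof (intro mult_left_mono, subst exp_le_cancel_iff)
    show "- 8 * ln (ln x) + (4 * (ln (ln y) + C1 + e * y powr e * (ln y + C2)) + 4) <= - 3 * ln (ln x)" using elim(4)[folded e_def] unfolding yp ly .
   qed (use U x in auto)
   also have "exp (- 3 * ln (ln x)) = 1 / ln x ^ 3"
   proof -
    have "exp (- 3 * ln (ln x)) = ln x powr (- 3)" using lx by (simp add: powr_def)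
    then show ?thesis using lx by (simp add: powr_minus_divide)
   qed
   finally show "real (card (smooth_upto (window c x) (smooth_level x) r)) <= window c x / ln x ^ 3" unfolding y_def U_def by simp
  qed
 qed
qed

section \<open>Multiples of large primes in the window\<close>

definition prime_multiples :: "real => real => (nat \<times> nat) set" where
 "prime_multiples z U = {(k, q). 1 <= k & prime q & z < real q & real (k * q) <= U}"

lemma prime_multiples_subset:
 assumes "z > 0" "U >= 0"
 shows "prime_multiples z U \<subseteq> Sigma {1..nat \<lfloor>U / z\<rfloor>} (%k. primes_in z (U / real k))"
proof
 fix kq assume "kq \<in> prime_multiples z U"
 then obtain k q where kq: "kq = (k, q)" "1 <= k" "prime q" "z < real q" "real k * real q <= U" by (auto simp: prime_multiples_def)
 have "real k * z <= real k * real q" using kq by (intro mult_left_mono) auto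
 then have "real k * z <= U" using kq by linarith
 then have "real k <= U / z" using assms by (simp add: pos_le_divide_eq)
 then have "k <= nat \<lfloor>U / z\<rfloor>" by (rule le_nat_floor)
 moreover have "real q <= U / real k" using kq by (simp add: pos_le_divide_eq mult.commute)
 ultimately show "kq \<in> Sigma {1..nat \<lfloor>U / z\<rfloor>} (%k. primes_in z (U / real k))" using kq by (auto simp: natseg_def)
qed

lemma finite_prime_multiples: "z > 0 ==> U >= 0 ==> finite (prime_multiples z U)"
 by (rule finite_subset[OF prime_multiples_subset]) auto

text \<open>A number below z^2 has at most one prime factor above z, so it determines q and hence
  k.\<close>

lemma inj_on_prime_multiples:
 assumes "z > 0" "U < z^2"
 shows "inj_on (%(k, q). k * q) (prime_multiples z U)"
proof (rule inj_onI, clarify)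
 fix k q k' q' assume kq: "(k, q) \<in> prime_multiples z U" "(k', q') \<in> prime_multiples z U" and eq: "k * q = k' * q'"
 then have p: "prime q" "prime q'" "k >= 1" "k' >= 1" "z < real q" "z < real q'" "real (k' * q') <= U" by (auto simp: prime_multiples_def)
 have "\<not> q dvd k'"
 proof
  assume "q dvd k'"
  then have "real q <= real k'" using p by (intro of_nat_mono dvd_imp_le) auto
  then have "z * z <= real k' * real q'" using p assms(1) by (intro mult_mono) auto
  then show False using p(7) assms(2) by (simp add: power2_eq_square)
 qed
 moreover have "q dvd k' * q'" using eq by (metis dvd_triv_right)
 ultimately have "q dvd q'" using p(1) by (simp add: prime_dvd_mult_iff)
 then have "q = q'" using p by (simp add: primes_dvd_imp_eq)
 moreover have "q' > 0" using p(2) prime_gt_0_nat by blast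
 ultimately show "k = k' & q = q'" using eq by simp
qed

lemma card_prime_multiples_le:
 assumes "z > 1" "U >= z"
 shows "real (card (prime_multiples z U)) <= 3 * U / ln z * (ln (U / z) + 1)"
proof -
 define n where "n = nat \<lfloor>U / z\<rfloor>"
 have Uz: "U / z >= 1" using assms by simp
 have n1: "n >= 1" "real n <= U / z" using Uz by (auto simp: n_def le_nat_iff)
 have "card (prime_multiples z U) <= card (Sigma {1..n} (%k. primes_in z (U / real k)))" unfolding n_def using assms by (intro card_mono prime_multiples_subset) auto
 also have "... = (\<Sum>k=1..n. card (primes_in z (U / real k)))" by simp
 finally have "real (card (prime_multiples z U)) <= real (\<Sum>k=1..n. card (primes_in z (U / real k)))" by (rule of_nat_mono)
 also have "... = (\<Sum>k=1..n. real (card (primes_in z (U / real k))))" by (rule of_nat_sum)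
 also have "... <= (\<Sum>k=1..n. 3 * (U / real k) / ln z)" using assms by (intro sum_mono prime_count_upper) auto
 also have "... = 3 * U / ln z * (\<Sum>k=1..n. 1 / real k)" unfolding sum_distrib_left by (intro sum.cong) auto
 also have "... <= 3 * U / ln z * (ln (U / z) + 1)"
 proof (intro mult_left_mono)
  have "(\<Sum>k=1..n. 1 / real k) <= ln (real n) + 1" using n1 by (intro sum_inverse_le_ln)
  also have "ln (real n) <= ln (U / z)" using n1 by (subst ln_le_cancel_iff) auto
  finally show "(\<Sum>k=1..n. 1 / real k) <= ln (U / z) + 1" by simp
 qed (use assms in auto)
 finally show ?thesis .
qed

text \<open>For each k up to H the primes just below U / k are plentiful, and
  \<open>U / H >= K * z\<close> keeps them all above z. Summing over k produces ln H.\<close>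

lemma card_prime_multiples_ge:
 "\<exists>K>1. \<forall>z U H. z >= 2 --> H >= 1 --> U / H >= K * z -->
   real (card (prime_multiples z U)) >= U * ln H / (K * ln U)"
proof -
 obtain K where K: "K > 1" "\<And>T. T >= 2 * K ==> real (card (primes_in (T / K) T)) >= T / (K * ln T)" using prime_count_lower by blast
 have "real (card (prime_multiples z U)) >= U * ln H / (K * ln U)" if z: "z >= 2" and H: "H >= 1" and U: "U / H >= K * z" for z U H
 proof -
  define n where "n = nat \<lfloor>H\<rfloor>"
  have n: "n >= 1" "real n <= H" "H < real n + 1" using H unfolding n_def by linarith+
  have UH: "U >= H * (K * z)" using U H by (simp add: pos_le_divide_eq mult.commute)
  have Kz: "K * z >= 2 * K" using K(1) z by simp
  have "1 * (K * z) <= H * (K * z)" using H Kz K(1) by (intro mult_right_mono) auto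
  then have U0: "U >= K * z" using UH by linarith
  have U1: "U > 1" using U0 Kz K(1) by linarith
  let ?T = "Sigma {1..n} (%k. primes_in (U / real k / K) (U / real k))"
  have T: "U / real k >= K * z" "U / real k <= U" if "k \<in> {1..n}" for k
  proof -
   have k: "real k <= H" "real k >= 1" using that n by auto
   have "K * z * real k <= K * z * H" using k Kz K(1) by (intro mult_left_mono) auto
   then have "K * z * real k <= U" using UH by (simp add: mult_ac)
   then show "U / real k >= K * z" using k by (simp add: pos_le_divide_eq)
   show "U / real k <= U" using k U1 by (simp add: pos_divide_le_eq)
  qed
  have "?T \<subseteq> prime_multiples z U"
  proof
   fix kq assume "kq \<in> ?T"
   then obtain k q where kq: "kq = (k, q)" "k \<in> {1..n}" "prime q" "U / real k / K < real q" "real q <= U / real k" by (auto simp: natseg_def)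
   have "z * K <= U / real k" using T(1)[OF kq(2)] by (simp only: mult.commute)
   then have "z <= U / real k / K" using K(1) by (subst pos_le_divide_eq) auto
   then have "z < real q" using kq(4) by linarith
   moreover have "real (k * q) <= U" using kq(2,5) by (simp add: pos_le_divide_eq mult.commute)
   ultimately show "kq \<in> prime_multiples z U" using kq by (auto simp: prime_multiples_def)
  qed
  then have "card ?T <= card (prime_multiples z U)" using z U1 by (intro card_mono finite_prime_multiples) auto
  moreover have "card ?T = (\<Sum>k=1..n. card (primes_in (U / real k / K) (U / real k)))" by simp
  ultimately have "(\<Sum>k=1..n. card (primes_in (U / real k / K) (U / real k))) <= card (prime_multiples z U)" by (simp only:)
  then have "real (\<Sum>k=1..n. card (primes_in (U / real k / K) (U / real k))) <= real (card (prime_multiples z U))" by (rule of_nat_mono)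
  then have le: "(\<Sum>k=1..n. real (card (primes_in (U / real k / K) (U / real k)))) <= real (card (prime_multiples z U))" by (simp only: of_nat_sum)
  have "ln H <= ln (real n + 1)" using n H by (subst ln_le_cancel_iff) auto
  also have "... <= (\<Sum>k=1..n. 1 / real k)" using ln_le_harm[of n] by (simp add: harm_def inverse_eq_divide)
  finally have lnH: "ln H <= (\<Sum>k=1..n. 1 / real k)" .
  have "U * ln H / (K * ln U) = U / (K * ln U) * ln H" by simp
  also have "... <= U / (K * ln U) * (\<Sum>k=1..n. 1 / real k)" using U1 K(1) by (intro mult_left_mono lnH) auto
  also have "... = (\<Sum>k=1..n. U / real k / (K * ln U))" unfolding sum_distrib_left by (intro sum.cong) auto
  also have "... <= (\<Sum>k=1..n. real (card (primes_in (U / real k / K) (U / real k))))"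
  proof (rule sum_mono)
   fix k assume k: "k \<in> {1..n}"
   have Tk: "U / real k >= 2 * K" "U / real k <= U" "U / real k > 1" using T[OF k] Kz K(1) by linarith+
   have "ln (U / real k) <= ln U" using Tk U1 by (subst ln_le_cancel_iff) auto
   then have "U / real k / (K * ln U) <= U / real k / (K * ln (U / real k))" using Tk K(1) U1 by (intro divide_left_mono mult_left_mono mult_pos_pos ln_gt_zero) auto
   also have "... <= real (card (primes_in (U / real k / K) (U / real k)))" by (rule K(2)[OF Tk(1)])
   finally show "U / real k / (K * ln U) <= real (card (primes_in (U / real k / K) (U / real k)))" .
  qed
  also note le
  finally show ?thesis .
 qed
 then show ?thesis using K(1) by blast
qed

abbreviation window_card_bounds where
 "window_card_bounds b C c \<equiv> eventually (%x.
   b * window c x * ln (ln x) / ln x <= real (card (prime_multiples (rough_level x) (window c x))) &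
   real (card (prime_multiples (rough_level x) (window c x))) <= C * window c x * ln (ln x) / ln x) at_top"

text \<open>As U / z is a bounded power of ln x, up to smaller factors, H = ln x is admissible for
  the lower bound, and in both bounds the sum over k is of order ln ln x.\<close>

lemma prime_multiples_window_card:
 "\<exists>b>0. \<exists>C>0. \<forall>c>0. window_card_bounds b C c"
proof -
 obtain K where K: "K > 1" "\<forall>z U H. z >= 2 --> H >= 1 --> U / H >= K * z -->
   real (card (prime_multiples z U)) >= U * ln H / (K * ln U)" using card_prime_multiples_ge by blast
 have "eventually (%x.
   1 / (2 * K) * window c x * ln (ln x) / ln x <= real (card (prime_multiples (rough_level x) (window c x))) &
   real (card (prime_multiples (rough_level x) (window c x))) <= 48 * window c x * ln (ln x) / ln x) at_top" if c: "c > 0" for c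
 proof -
  have "eventually (%x::real. rough_level x >= 2) at_top" unfolding rough_level_def by real_asymp
  moreover have "eventually (%x::real. ln x >= 1 & ln (ln x) >= 1) at_top" by (intro eventually_conj; real_asymp)
  moreover have "eventually (%x::real. window c x / ln x >= K * rough_level x) at_top" unfolding rough_level_def window_def using c K(1) by real_asymp
  moreover have "eventually (%x::real. ln (window c x) <= 2 * ln x) at_top" unfolding window_def using c by real_asymp
  moreover have "eventually (%x::real. ln (rough_level x) >= ln x / 2) at_top" unfolding rough_level_def by real_asymp
  moreover have "eventually (%x::real. ln (window c x / rough_level x) + 1 <= 8 * ln (ln x)) at_top" unfolding rough_level_def window_def using c by real_asymp
  moreover have "eventually (%x::real. window c x > max 1 (rough_level x)) at_top" unfolding rough_level_def window_def max_less_iff_conj using c by (intro eventually_conj; real_asymp)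
  ultimately show ?thesis
  proof eventually_elim
   case (elim x)
   define U where "U = window c x"
   define z where "z = rough_level x"
   have U: "U > 1" "U >= z" using elim by (auto simp: U_def z_def)
   have l: "ln x >= 1" "ln (ln x) >= 1" "ln U <= 2 * ln x" "ln z >= ln x / 2" "ln (U / z) + 1 <= 8 * ln (ln x)" using elim by (auto simp: U_def z_def)
   have lU: "ln U > 0" using U by simp
   have "z > 0" using elim by (simp add: z_def)
   then have "ln (U / z) >= 0" using U by (intro ln_ge_zero) (simp add: pos_le_divide_eq)
   have "1 / (2 * K) * U * ln (ln x) / ln x = U * ln (ln x) / (K * (2 * ln x))" by simp
   also have "... <= U * ln (ln x) / (K * ln U)" using K(1) l lU U by (intro divide_left_mono mult_left_mono mult_pos_pos mult_nonneg_nonneg) auto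
   also have "... <= real (card (prime_multiples z U))" using elim by (intro K(2)[rule_format]) (auto simp: z_def U_def)
   finally have 1: "1 / (2 * K) * U * ln (ln x) / ln x <= real (card (prime_multiples z U))" .
   have "real (card (prime_multiples z U)) <= 3 * U / ln z * (ln (U / z) + 1)" using elim U by (intro card_prime_multiples_le) (auto simp: z_def)
   also have "... <= 3 * U / (ln x / 2) * (8 * ln (ln x))" using U l \<open>ln (U / z) >= 0\<close> by (intro mult_mono divide_left_mono mult_pos_pos) auto
   also have "... = 48 * U * ln (ln x) / ln x" by simp
   finally show ?case using 1 by (simp add: U_def z_def)
  qed
 qed
 moreover have "1 / (2 * K) > 0" "(48::real) > 0" using K by simp_all
 ultimately show ?thesis by blast
qed

abbreviation sieving_ratio_bounds where
 "sieving_ratio_bounds b C \<equiv> eventually (%x. \<forall>A B. A = primes_in (smooth_level x) (rough_level x) --> B = A \<or> (\<exists>r\<in>A. B = A - {r}) -->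
   b * ln (ln x) / ln (ln (ln x)) <= euler_ratio B & euler_ratio B <= C * ln (ln x) / ln (ln (ln x))) at_top"

text \<open>By Mertens the product over the primes in (y, z] is of the order of ln z / ln y, which
  the choice of y makes ln ln x / ln ln ln x. Dropping one prime divides it by p / (p - 1) <=
  2.\<close>

lemma euler_ratio_sieving_primes:
 "\<exists>b>0. \<exists>C>0. sieving_ratio_bounds b C"
proof -
 obtain c C where C: "c > 0" "C > 0" "\<And>T. T >= 2 ==> c / ln T <= mertens_prod T" "\<And>T. T >= 2 ==> mertens_prod T <= C / ln T" using mertens_prod_bounds by blast
 have "eventually (%x::real. rough_level x >= smooth_level x & smooth_level x >= 2) at_top" unfolding rough_level_def smooth_level_def by (intro eventually_conj; real_asymp)
 moreover have "eventually (%x::real. ln (rough_level x) >= ln x / 2 & ln (rough_level x) <= ln x) at_top" unfolding rough_level_def by (intro eventually_conj; real_asymp)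
 moreover have "eventually (%x::real. ln x > 0 & ln (ln x) > 0 & ln (ln (ln x)) > 0) at_top" by (intro eventually_conj; real_asymp)
 ultimately have "sieving_ratio_bounds (4 * c / C) (16 * C / c)"
 proof eventually_elim
  case (elim x)
  define y where "y = smooth_level x"
  define z where "z = rough_level x"
  define L where "L = ln (ln x) / ln (ln (ln x))"
  have yz: "y <= z" "2 <= y" using elim by (auto simp: y_def z_def)
  have l: "ln x > 0" "L > 0" using elim by (auto simp: L_def)
  have ly: "ln y = ln x / (16 * L)" by (simp add: y_def smooth_level_def L_def)
  have lz: "ln z >= ln x / 2" "ln z <= ln x" using elim by (auto simp: z_def)
  have lpos: "ln y > 0" "ln z > 0" using yz by auto
  show ?case
  proof (intro allI impI)
   fix A B assume A: "A = primes_in (smooth_level x) (rough_level x)" and B: "B = A \<or> (\<exists>r\<in>A. B = A - {r})"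
   have fA: "finite A" and Ap: "\<And>p. p \<in> A ==> prime p" by (auto simp: A)
   have un: "primes_in 0 z = primes_in 0 y \<union> A" using yz by (auto simp: A natseg_def y_def z_def)
   have "euler_ratio (primes_in 0 z) = euler_ratio (primes_in 0 y) * euler_ratio A" unfolding un by (rule euler_ratio_Un) (simp_all add: fA, auto simp: A natseg_def y_def)
   then have "mertens_prod y * (mertens_prod z * euler_ratio (primes_in 0 z)) = mertens_prod z * (mertens_prod y * euler_ratio (primes_in 0 y)) * euler_ratio A" by simp
   then have eq: "mertens_prod y = mertens_prod z * euler_ratio A" unfolding euler_ratio_mertens by simp
   have A1: "euler_ratio A >= 1" using Ap by (rule euler_ratio_ge_1)
   have "c / ln z * euler_ratio A <= mertens_prod y" unfolding eq using C(3)[of z] yz A1 by (intro mult_right_mono) auto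
   also have "... <= C / ln y" using C(4)[of y] yz by simp
   finally have "euler_ratio A <= C / c * (ln z / ln y)" using lpos C(1) by (simp add: field_simps)
   also have "... <= C / c * (ln x / ln y)" using lz lpos C by (intro mult_left_mono divide_right_mono) auto
   also have "... = 16 * C / c * L" unfolding ly using l by simp
   finally have up: "euler_ratio A <= 16 * C / c * L" .
   have "c / ln y <= mertens_prod y" using C(3)[of y] yz by simp
   also have "... <= C / ln z * euler_ratio A" unfolding eq using C(4)[of z] yz A1 by (intro mult_right_mono) auto
   finally have "c / C * (ln z / ln y) <= euler_ratio A" using lpos C by (simp add: field_simps)
   moreover have "c / C * (ln x / 2 / ln y) <= c / C * (ln z / ln y)" using lz lpos C by (intro mult_left_mono divide_right_mono) auto
   moreover have "c / C * (ln x / 2 / ln y) = 8 * c / C * L" unfolding ly using l by simp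
   ultimately have lo: "8 * c / C * L <= euler_ratio A" by linarith
   have BA: "B \<subseteq> A" using B by auto
   have "euler_ratio B <= euler_ratio A" using fA BA Ap by (rule euler_ratio_mono)
   moreover have "euler_ratio A <= 2 * euler_ratio B" using B
   proof
    assume "B = A"
    then show ?thesis using A1 by simp
   next
    assume "\<exists>r\<in>A. B = A - {r}"
    then obtain r where r: "r \<in> A" "B = A - {r}" by blast
    have "A = {r} \<union> B" using r by auto
    then have "euler_ratio A = euler_ratio {r} * euler_ratio B" using euler_ratio_Un[of "{r}" B] fA r by auto
    moreover have "euler_ratio {r} <= 2" using prime_ge_2_nat[OF Ap[OF r(1)]] by (simp add: euler_ratio_def divide_simps)
    moreover have "euler_ratio B >= 1" using BA Ap by (intro euler_ratio_ge_1) auto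
    ultimately show ?thesis by (simp add: mult_right_mono)
   qed
   ultimately show "(4 * c / C) * ln (ln x) / ln (ln (ln x)) <= euler_ratio B & euler_ratio B <= (16 * C / c) * ln (ln x) / ln (ln (ln x))" using up lo by (simp add: L_def)
  qed
 qed
 moreover have "4 * c / C > 0" "16 * C / c > 0" using C by auto
 ultimately show ?thesis by blast
qed

abbreviation near where
 "near S j D \<equiv> {j'\<in>S. j < j' & real j' <= real j + D}"

abbreviation close_pairs_bound where
 "close_pairs_bound C c \<delta> \<equiv> eventually (%x. \<forall>S. S = (%(k, q). k * q) ` prime_multiples (rough_level x) (window c x) -->
   (\<Sum>j\<in>S. \<Sum>j'\<in>near S j (\<delta> * window c x). odd_prime_ratio (j' - j))
    <= C * \<delta> * (window c x * ln (ln x) / ln x)^2) at_top"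

text \<open>For fixed j the partners j' = k q are grouped by k, and the singular factors are bounded
  on average, first over q and then over k. What matters is the factor \<open>\<delta>\<close>:
  close pairs are proportionally rare. With \<open>\<delta> = 1\<close> the same bound covers all
  pairs and serves for the second moment.\<close>

lemma close_pairs_weight_le:
 "\<exists>C>0. \<forall>c>0. \<forall>\<delta>>0. \<delta> <= 1 --> close_pairs_bound C c \<delta>"
proof -
 obtain s C1 where s: "s > 0" and C1: "C1 > 0" and weight: "multiples_weight_bound s C1" using prime_multiples_weight_le by (elim exE conjE) (rule that; assumption)
 obtain C2 where C2: "C2 > 0" "\<And>c. c > 0 ==> eventually (%x. real (card (prime_multiples (rough_level x) (window c x))) <= C2 * window c x * ln (ln x) / ln x) at_top"
 proof -
  obtain b C where "C > 0" and *: "\<forall>c>0. window_card_bounds b C c" using prime_multiples_window_card by blast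
  show ?thesis by (rule that[OF \<open>C > 0\<close>], rule eventually_mono[OF *[rule_format]]) auto
 qed
 define C where "C = C1 * (2 * (s + 1)) * exp 1 * 8 * C2"
 have "close_pairs_bound C c \<delta>" if c: "c > 0" and d: "\<delta> > 0" "\<delta> <= 1" for c \<delta>
 proof -
  have "eventually (%x::real. x powr (1 / (2 * (s + 1))) >= 3 & sqrt (2 * ln x) >= 2) at_top" using s by (intro eventually_conj; real_asymp)
  moreover have "eventually (%x::real. rough_level x >= x powr (1 / 2) & rough_level x >= exp (3 * sqrt (2 * ln x))) at_top" unfolding rough_level_def by (intro eventually_conj; real_asymp)
  moreover have "eventually (%x::real. \<delta> * rough_level x >= exp (3 * sqrt (2 * ln x)) * x powr (1 / 2)) at_top" unfolding rough_level_def using d by real_asymp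
  moreover have "eventually (%x::real. ln (window c x) <= 2 * ln x & window c x > rough_level x) at_top" unfolding window_def rough_level_def using c by (intro eventually_conj; real_asymp)
  moreover have "eventually (%x::real. ln (window c x / rough_level x) + 1 <= 8 * ln (ln x)) at_top" unfolding rough_level_def window_def using c by real_asymp
  moreover have "eventually (%x::real. rough_level x >= 2 & ln x >= 1 & ln (ln x) >= 1 & x > 1) at_top" unfolding rough_level_def by (intro eventually_conj; real_asymp)
  ultimately show ?thesis using C2(2)[OF c]
  proof eventually_elim
   case (elim x)
   define U where "U = window c x"
   define z where "z = rough_level x"
   \<comment> \<open>Large enough for ln D <= w^2, yet exp (3 w) is smaller than any power of x;
     together with v powr s <= sqrt x this meets the length condition of the sieve for all k <= U /
     z.\<close>
   define w where "w = sqrt (2 * ln x)"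
   define v where "v = x powr (1 / (2 * (s + 1)))"
   define D where "D = \<delta> * U"
   define n where "n = nat \<lfloor>U / z\<rfloor>"
   let ?h = "%m. odd_prime_ratio m"
   have l: "ln x >= 1" "ln (ln x) >= 1" "x > 1" using elim by auto
   have z: "z >= 2" "z >= exp (3 * w)" "U > z" using elim by (auto simp: z_def w_def U_def)
   have v3: "v >= 3" and w2: "w >= 2" using elim by (auto simp: v_def w_def)
   have vx: "v powr s <= x powr (1/2)" unfolding v_def powr_powr using s l by (intro powr_mono) (auto simp: field_simps)
   have "v <= x powr (1/2)" unfolding v_def using s l by (intro powr_mono) (auto simp: field_simps)
   then have vz: "z >= v" using elim by (auto simp: z_def)
   have lv: "ln v = ln x / (2 * (s + 1))" using l by (simp add: v_def ln_powr)
   have D0: "D > 0" using d z by (simp add: D_def)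
   have "ln D <= ln U" using d z D0 by (subst ln_le_cancel_iff) (auto simp: D_def)
   then have lD: "ln D <= w^2" using elim l by (simp add: w_def U_def)
   have Uz1: "U / z >= 1" using z by simp
   have n: "n >= 1" "real n <= U / z" using Uz1 unfolding n_def by linarith+
   have Dk: "D / real k >= exp (3 * w) * v powr s" if k: "k \<in> {1..n}" for k
   proof -
    have "real k <= U / z" using k n by simp
    then have "real k * z <= U" using z by (simp add: pos_le_divide_eq)
    then have "\<delta> * (real k * z) <= \<delta> * U" using d by (intro mult_left_mono) auto
    then have "\<delta> * z <= D / real k" using k by (simp add: D_def pos_le_divide_eq mult_ac)
    moreover have "exp (3 * w) * v powr s <= exp (3 * w) * x powr (1/2)" by (intro mult_left_mono vx) simp
    moreover have "exp (3 * w) * x powr (1/2) <= \<delta> * z" using elim by (simp add: w_def z_def)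
    ultimately show ?thesis by linarith
   qed
   have h0: "?h m >= 0" for m by (intro order.trans[OF _ euler_ratio_ge_1]) auto
   show ?case
   proof (intro allI impI)
    fix S assume S: "S = (%(k, q). k * q) ` prime_multiples (rough_level x) (window c x)"
    have fpm: "finite (prime_multiples z U)" using z by (intro finite_prime_multiples) auto
    have fS: "finite S" unfolding S using fpm by (simp add: U_def z_def)
    have inner: "(\<Sum>j'\<in>near S j D. ?h (j' - j)) <= C1 * (2 * (s + 1)) * exp 1 * 8 * D * ln (ln x) / ln x" for j
    proof -
     let ?G = "%k. multiples_in z k j D"
     have fG: "finite (?G k)" if "k \<in> {1..n}" for k using that z(1) by (intro finite_primes_with_multiple_in) auto
     have "near S j D \<subseteq> (%(k, q). k * q) ` (Sigma {1..n} ?G)"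
     proof
      fix j' assume j': "j' \<in> near S j D"
      then obtain k q where kq: "(k, q) \<in> prime_multiples z U" "j' = k * q" by (auto simp: S U_def z_def)
      have "(k, q) \<in> Sigma {1..nat \<lfloor>U / z\<rfloor>} (%k. primes_in z (U / real k))" using prime_multiples_subset[of z U] kq(1) z by auto
      then have "k \<in> {1..n}" "z < real q" "prime q" by (auto simp: n_def natseg_def)
      then show "j' \<in> (%(k, q). k * q) ` (Sigma {1..n} ?G)" using j' kq(2) by (intro image_eqI[of _ _ "(k, q)"]) auto
     qed
     then have "(\<Sum>j'\<in>near S j D. ?h (j' - j)) <= (\<Sum>j'\<in>(%(k, q). k * q) ` (Sigma {1..n} ?G). ?h (j' - j))" by (intro sum_mono2 finite_imageI finite_SigmaI fG h0) simp_all
     also have "... <= (\<Sum>(k, q)\<in>Sigma {1..n} ?G. ?h (k * q - j))" by (intro order.trans[OF sum_image_le] finite_SigmaI fG h0) (simp_all add: case_prod_unfold)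
     also have "... = (\<Sum>k=1..n. \<Sum>q\<in>?G k. ?h (k * q - j))" using fG by (subst sum.Sigma) (simp, blast, rule refl)
     also have "... <= (\<Sum>k=1..n. C1 * D / ln v * (euler_ratio (odd_prime_divisors w k) / real k))" using Dk by (intro sum_mono weight[rule_format] v3 w2 vz z(2) lD) auto
     also have "... = C1 * D / ln v * (\<Sum>k=1..n. euler_ratio (odd_prime_divisors w k) / real k)" by (simp only: sum_distrib_left)
     also have "... <= C1 * D / ln v * (exp 1 * (ln (real n) + 1))" using C1 D0 v3 by (intro mult_left_mono sum_euler_ratio_divisors_le n) auto
     also have "... <= C1 * D / ln v * (exp 1 * (8 * ln (ln x)))"
     proof (intro mult_left_mono)
      have "ln (real n) <= ln (U / z)" using n by (subst ln_le_cancel_iff) auto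
      then show "ln (real n) + 1 <= 8 * ln (ln x)" using elim by (auto simp: U_def z_def)
     qed (use C1 D0 v3 in auto)
     also have "... = C1 * (2 * (s + 1)) * exp 1 * 8 * D * ln (ln x) / ln x" unfolding lv using s l by simp
     finally show ?thesis .
    qed
    have cS: "real (card S) <= C2 * U * ln (ln x) / ln x"
    proof -
     have "card S <= card (prime_multiples z U)" unfolding S U_def[symmetric] z_def[symmetric] by (rule card_image_le[OF fpm])
     then show ?thesis using elim by (simp add: U_def z_def)
    qed
    have "(\<Sum>j\<in>S. \<Sum>j'\<in>near S j D. ?h (j' - j)) <= (\<Sum>j\<in>S. C1 * (2 * (s + 1)) * exp 1 * 8 * D * ln (ln x) / ln x)" by (intro sum_mono inner)
    also have "... = real (card S) * (C1 * (2 * (s + 1)) * exp 1 * 8 * D * ln (ln x) / ln x)" by simp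
    also have "... <= (C2 * U * ln (ln x) / ln x) * (C1 * (2 * (s + 1)) * exp 1 * 8 * D * ln (ln x) / ln x)" using C1 s D0 l by (intro mult_right_mono cS) auto
    also have "... = C * \<delta> * (U * ln (ln x) / ln x)^2" by (simp add: C_def D_def power2_eq_square)
    finally show "(\<Sum>j\<in>S. \<Sum>j'\<in>near S j (\<delta> * window c x). ?h (j' - j)) <= C * \<delta> * (window c x * ln (ln x) / ln x)^2" unfolding U_def D_def .
   qed
  qed
 qed
 moreover have "C > 0" using C1 C2 s by (simp add: C_def)
 ultimately show ?thesis by (intro exI[of _ C]) blast
qed

section \<open>The matrix of translates\<close>

lemma sum_natseg_dyadic:
 fixes f :: "nat => real"
 assumes "a > 0"
 shows "(\<Sum>p\<in>{p\<in>natseg a (2 ^ n * a). P p}. f p) = (\<Sum>i<n. \<Sum>p\<in>{p\<in>natseg (2 ^ i * a) (2 * (2 ^ i * a)). P p}. f p)"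
proof (induction n)
 case 0
 have "{p\<in>natseg a (2 ^ 0 * a). P p} = {}" by (auto simp: natseg_def)
 then show ?case by (simp only: sum.empty lessThan_0)
next
 case (Suc n)
 have "1 * a <= 2 ^ n * a" using assms by (intro mult_right_mono) auto
 moreover have "2 ^ n * a <= 2 ^ Suc n * a" using assms by simp
 ultimately have un: "{p\<in>natseg a (2 ^ Suc n * a). P p} = {p\<in>natseg a (2 ^ n * a). P p} \<union> {p\<in>natseg (2 ^ n * a) (2 ^ Suc n * a). P p}" by (auto simp: natseg_def)
 have "(\<Sum>p\<in>{p\<in>natseg a (2 ^ Suc n * a). P p}. f p) = (\<Sum>p\<in>{p\<in>natseg a (2 ^ n * a). P p}. f p) + (\<Sum>p\<in>{p\<in>natseg (2 ^ n * a) (2 ^ Suc n * a). P p}. f p)"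
  unfolding un by (rule sum.union_disjoint) (simp_all, auto simp: natseg_def)
 then show ?case unfolding Suc.IH by (simp add: mult.assoc)
qed

lemma prime_count_in_class_window:
 fixes Q j :: nat and Y :: real
 assumes "Q > 0" "2 * real j <= Y" "Y > 0"
 shows "card (primes_mod Q (j mod Q) Y (2 * Y))
  <= card {n\<in>{nat \<lfloor>Y / (2 * Q)\<rfloor><..nat \<lfloor>2 * Y / Q\<rfloor>}. prime (Q * n + j)}"
proof (rule surj_card_le)
 show "primes_mod Q (j mod Q) Y (2 * Y) \<subseteq> (%n. Q * n + j) ` {n\<in>{nat \<lfloor>Y / (2 * Q)\<rfloor><..nat \<lfloor>2 * Y / Q\<rfloor>}. prime (Q * n + j)}"
 proof
  fix p assume "p \<in> primes_mod Q (j mod Q) Y (2 * Y)"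
  then have p: "Y < real p" "real p <= 2 * Y" "prime p" "p mod Q = j mod Q" by (auto simp: natseg_def)
  have "j <= p" using p(1) assms(2) by linarith
  then have "Q dvd p - j" using p(4) by (metis mod_eq_dvd_iff_nat)
  then obtain n where n: "p - j = Q * n" by blast
  then have pn: "p = Q * n + j" using \<open>j <= p\<close> by simp
  then have rp: "real p = real Q * real n + real j" by simp
  have "real n <= 2 * Y / Q" using p(2) rp assms(1) by (simp add: pos_le_divide_eq mult.commute)
  then have "n <= nat \<lfloor>2 * Y / Q\<rfloor>" by (rule le_nat_floor)
  moreover have "Y / (2 * Q) < real n" using p(1) rp assms by (simp add: pos_divide_less_eq) (simp add: mult_ac)
  moreover have "0 <= Y / (2 * Q)" using assms by simp
  ultimately have "n \<in> {nat \<lfloor>Y / (2 * Q)\<rfloor><..nat \<lfloor>2 * Y / Q\<rfloor>}" by (simp add: nat_less_iff floor_less_iff)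
  then show "p \<in> (%n. Q * n + j) ` {n\<in>{nat \<lfloor>Y / (2 * Q)\<rfloor><..nat \<lfloor>2 * Y / Q\<rfloor>}. prime (Q * n + j)}" using p(3) pn by blast
 qed
qed simp

lemma sum_card_swap:
 assumes "finite A" "finite B"
 shows "(\<Sum>a\<in>A. card {b\<in>B. R a b}) = (\<Sum>b\<in>B. card {a\<in>A. R a b})"
proof -
 have "(\<Sum>a\<in>A. card {b\<in>B. R a b}) = (\<Sum>a\<in>A. \<Sum>b\<in>B. if R a b then 1 else 0)" using assms by (intro sum.cong refl) (simp add: sum.If_cases Int_def)
 also have "... = (\<Sum>b\<in>B. \<Sum>a\<in>A. if R a b then 1 else 0)" by (rule sum.swap)
 also have "... = (\<Sum>b\<in>B. card {a\<in>A. R a b})" using assms by (intro sum.cong refl) (simp add: sum.If_cases Int_def)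
 finally show ?thesis .
qed

abbreviation dense_rows_bound where
 "dense_rows_bound e \<equiv> eventually (%x. \<forall>A. finite A --> (\<forall>p\<in>A. prime p & real p <= rough_level x) -->
   (\<exists>B. drop_one A B & (\<forall>S. finite S --> (\<forall>j\<in>S. coprime j (\<Prod>B) & real j <= exp (x / 4)) -->
    (\<exists>M K. real K >= exp (x / 4) & real (\<Prod>B) * (real M + 1) >= exp (x / 2) / 2 & real (\<Prod>B) * (real M + real K) <= exp (2 * x) &
     e * real K * euler_ratio B * real (card S) / x <= real (\<Sum>n\<in>{M<..M+K}. card {j\<in>S. prime (\<Prod>B * n + j)}))))) at_top"

text \<open>Abundance of primes on the scale from exp (x / 2) to exp x gives each class its share in
  some dyadic block, but the rows need one block for all j. So the pigeonhole principle is applied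
  to the totals over S, and only the mean over S is claimed. The modulus is chosen before S, since S
  has to be coprime to it.\<close>

lemma dense_rows:
 "\<exists>e>0. dense_rows_bound e"
proof -
 obtain e x0 where e: "e > 0" and good: "good_modulus_bound e x0" using good_modulus by (elim exE conjE) (rule that; assumption)
 have "eventually (%x. x >= x0) at_top" by (rule eventually_ge_at_top)
 moreover have "eventually (%x::real. x >= 1 & exp (3 * rough_level x) <= exp (x / 8) & rough_level x >= 0) at_top" unfolding rough_level_def by (intro eventually_conj; real_asymp)
 moreover have "eventually (%x::real. exp (x / 4) * exp (x / 8) <= exp (x / 2) / 2 & 2 * exp (x / 4) <= exp (x / 2) & 2 * exp x * exp (x / 2) <= exp (2 * x)) at_top" by (intro eventually_conj; real_asymp)
 ultimately have "dense_rows_bound (e / 4)"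
 proof eventually_elim
  case (elim x)
  have x1: "x >= 1" using elim by simp
  show ?case
  proof (intro allI impI)
   fix A :: "nat set" assume A: "finite A" "\<forall>p\<in>A. prime p & real p <= rough_level x"
   obtain B where B: "B = A \<or> (\<exists>r\<in>A. B = A - {r})" and dens: "\<forall>a<\<Prod>B. coprime a (\<Prod>B) -->
    (\<Sum>p\<in>primes_mod (\<Prod>B) a (exp (x / 2)) (exp x). ln (real p) / real p) >= e * x / card (unit_residues (\<Prod>B))" using good[rule_format, OF elim(1) A(1)] A(2) by blast
   have BA: "B \<subseteq> A" using B by auto
   then have fB: "finite B" using A(1) finite_subset by blast
   have Bp: "prime p" "real p <= rough_level x" if "p \<in> B" for p using that BA A(2) by auto
   define Q where "Q = \<Prod>B"
   define \<phi> where "\<phi> = real (card (unit_residues Q))"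
   have Q0: "Q > 0" unfolding Q_def by (intro prod_primes_pos Bp)
   have "real Q <= exp (3 * rough_level x)" unfolding Q_def using fB Bp elim by (intro prod_primes_le_exp) auto
   then have Qx: "real Q <= exp (x / 8)" using elim by linarith
   have phi: "\<phi> = real Q * (\<Prod>p\<in>B. 1 - 1 / real p)" unfolding \<phi>_def Q_def by (subst card_residue_units_prod) (use fB Bp in auto)
   have ratio: "\<phi> * euler_ratio B = real Q" unfolding phi mult.assoc by (subst euler_ratio_inverse) (use Bp in auto)
   have r1: "euler_ratio B >= 1" using Bp by (intro euler_ratio_ge_1)
   have phi0: "\<phi> > 0" using ratio Q0 r1 by (smt (verit) mult_nonpos_nonneg of_nat_0_less_iff)
   have "\<exists>M K. real K >= exp (x / 4) & real Q * (real M + 1) >= exp (x / 2) / 2 & real Q * (real M + real K) <= exp (2 * x) &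
     (e / 4) * real K * euler_ratio B * real (card S) / x <= real (\<Sum>n\<in>{M<..M+K}. card {j\<in>S. prime (Q * n + j)})"
    if S: "finite S" "\<forall>j\<in>S. coprime j Q & real j <= exp (x / 4)" for S
   proof -
    define a where "a = exp (x / 2)"
    define I where "I = nat \<lceil>x\<rceil>"
    have I: "real I >= x" "real I <= 2 * x" "I >= 1" using x1 unfolding I_def by linarith+
    have a0: "a > 0" by (simp add: a_def)
    define T where "T = (%i. \<Sum>j\<in>S. \<Sum>p\<in>primes_mod Q (j mod Q) (2 ^ i * a) (2 * (2 ^ i * a)). 1 / real p)"
    have "real (card S) * (e / \<phi>) <= (\<Sum>i<I. T i)"
    proof -
     have "e / \<phi> <= (\<Sum>i<I. \<Sum>p\<in>primes_mod Q (j mod Q) (2 ^ i * a) (2 * (2 ^ i * a)). 1 / real p)" if j: "j \<in> S" for j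
     proof -
      have "coprime (j mod Q) Q" using S(2) j by (simp add: coprime_mod_left_iff Q0)
      then have "e * x / \<phi> <= (\<Sum>p\<in>primes_mod Q (j mod Q) (exp (x / 2)) (exp x). ln (real p) / real p)" unfolding \<phi>_def Q_def by (intro dens[rule_format]) (use Q0 in \<open>auto simp: Q_def\<close>)
      also have "... <= (\<Sum>p\<in>primes_mod Q (j mod Q) a (2 ^ I * a). x * (1 / real p))"
      proof (rule order.trans[OF sum_mono sum_mono2])
       fix p assume "p \<in> primes_mod Q (j mod Q) (exp (x / 2)) (exp x)"
       then have p: "real p <= exp x" "prime p" by (auto simp: natseg_def)
       then have "ln (real p) <= ln (exp x)" by (subst ln_le_cancel_iff) (auto simp: prime_gt_0_nat)
       then show "ln (real p) / real p <= x * (1 / real p)" by (simp add: divide_right_mono)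
      next
       have "exp x = exp (x / 2) * exp (x / 2)" by (simp flip: exp_add)
       moreover have "exp (x / 2) <= 2 ^ I"
       proof -
        have "exp (x / 2) <= exp (real I * ln 2)"
        proof (subst exp_le_cancel_iff)
         have "x / 2 <= real I * (2/3)" using I x1 by linarith
         also have "... <= real I * ln 2" using ln2_ge_two_thirds by (intro mult_left_mono) auto
         finally show "x / 2 <= real I * ln 2" .
        qed
        then show ?thesis by (simp add: exp_of_nat_mult)
       qed
       ultimately have "exp x <= 2 ^ I * a" by (simp add: a_def)
       then show "primes_mod Q (j mod Q) (exp (x / 2)) (exp x) \<subseteq> primes_mod Q (j mod Q) a (2 ^ I * a)" by (auto simp: natseg_def a_def)
      qed (use x1 in auto)
      also have "... = x * (\<Sum>p\<in>primes_mod Q (j mod Q) a (2 ^ I * a). 1 / real p)" by (simp only: sum_distrib_left)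
      also have "(\<Sum>p\<in>primes_mod Q (j mod Q) a (2 ^ I * a). 1 / real p)
       = (\<Sum>i<I. \<Sum>p\<in>primes_mod Q (j mod Q) (2 ^ i * a) (2 * (2 ^ i * a)). 1 / real p)" by (rule sum_natseg_dyadic[OF a0])
      finally show ?thesis using x1 phi0 by (simp add: mult.commute[of e x] times_divide_eq_right[symmetric] del: times_divide_eq_right)
     qed
     then have "(\<Sum>j\<in>S. e / \<phi>) <= (\<Sum>j\<in>S. \<Sum>i<I. \<Sum>p\<in>primes_mod Q (j mod Q) (2 ^ i * a) (2 * (2 ^ i * a)). 1 / real p)" by (rule sum_mono)
     also have "... = (\<Sum>i<I. T i)" unfolding T_def by (rule sum.swap)
     finally show ?thesis by simp
    qed
    \<comment> \<open>Some block carries at least the mean of the I totals; I is of order x, which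
      is the factor x in the denominator of the claim.\<close>
    moreover have "\<exists>i<I. (\<Sum>i<I. T i) / real I <= T i"
    proof (rule ccontr)
     assume "\<not> ?thesis"
     then have "(\<Sum>i<I. T i) < (\<Sum>i<I. (\<Sum>i<I. T i) / real I)" using I(3) by (intro sum_strict_mono) (auto simp: not_le lessThan_empty_iff)
     then show False using I(3) by simp
    qed
    ultimately obtain i where i: "i < I" "real (card S) * (e / \<phi>) / real I <= T i" using divide_right_mono[of "real (card S) * (e / \<phi>)" "\<Sum>i<I. T i" "real I"] by (meson of_nat_0_le_iff order.trans)
    define Y where "Y = 2 ^ i * a"
    have Ya: "a <= Y" using a0 by (simp add: Y_def)
    have Y0: "Y > 0" using a0 Ya by linarith
    define M where "M = nat \<lfloor>Y / (2 * Q)\<rfloor>"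
    define N where "N = nat \<lfloor>2 * Y / Q\<rfloor>"
    define K where "K = N - M"
    have YQ: "exp (x / 4) <= Y / Q - Y / (2 * Q)" "1 <= exp (x / 4)"
    proof -
     have "exp (x / 4) * real Q <= exp (x / 4) * exp (x / 8)" using Qx by (intro mult_left_mono) auto
     also have "... <= Y / 2" using elim Ya by (simp add: a_def)
     finally show "exp (x / 4) <= Y / Q - Y / (2 * Q)" using Q0 by (simp add: field_simps)
     show "1 <= exp (x / 4)" using x1 by simp
    qed
    have Y2: "2 * Y / Q = 4 * (Y / (2 * Q))" "Y / Q = 2 * (Y / (2 * Q))" by simp_all
    have "M <= N & real N - real M >= Y / (2 * Q) & real N - real M <= 2 * Y / Q"
    proof -
     have fl: "real (nat \<lfloor>t\<rfloor>) <= t" "t - 1 < real (nat \<lfloor>t\<rfloor>)" if "t >= 0" for t :: real using that by linarith+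
     have "real M <= Y / (2 * Q)" "real N <= 2 * Y / Q" "2 * Y / Q - 1 < real N" unfolding M_def N_def using fl Y0 by simp_all
     moreover have "Y / (2 * Q) >= 1" using YQ Y2(2) by linarith
     ultimately have "real M <= real N" "real N - real M >= Y / (2 * Q)" "real N - real M <= 2 * Y / Q" using Y2(1) by linarith+
     then show ?thesis by simp
    qed
    then have K: "M + K = N" "real K >= Y / (2 * Q)" "real K <= 2 * Y / Q" unfolding K_def by (simp_all add: of_nat_diff)
    have "T i <= (\<Sum>j\<in>S. real (card {n\<in>{M<..M+K}. prime (Q * n + j)}) / Y)" unfolding T_def
    proof (rule sum_mono)
     fix j assume j: "j \<in> S"
     have "(\<Sum>p\<in>primes_mod Q (j mod Q) Y (2 * Y). 1 / real p) <= (\<Sum>p\<in>primes_mod Q (j mod Q) Y (2 * Y). 1 / Y)" using Y0 by (intro sum_mono divide_left_mono) (auto simp: natseg_def)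
     also have "... = real (card (primes_mod Q (j mod Q) Y (2 * Y))) / Y" by simp
     also have "... <= real (card {n\<in>{M<..N}. prime (Q * n + j)}) / Y"
     proof (intro divide_right_mono of_nat_mono)
      have "2 * real j <= Y" using S(2) j elim Ya by (auto simp: a_def intro: order.trans)
      then show "card (primes_mod Q (j mod Q) Y (2 * Y)) <= card {n\<in>{M<..N}. prime (Q * n + j)}" unfolding M_def N_def by (rule prime_count_in_class_window[OF Q0 _ Y0])
     qed (use Y0 in simp)
     finally show "(\<Sum>p\<in>primes_mod Q (j mod Q) (2 ^ i * a) (2 * (2 ^ i * a)). 1 / real p) <= real (card {n\<in>{M<..M+K}. prime (Q * n + j)}) / Y" unfolding K(1) Y_def .
    qed
    also have "... = real (\<Sum>j\<in>S. card {n\<in>{M<..M+K}. prime (Q * n + j)}) / Y" by (simp add: sum_divide_distrib)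
    also have "(\<Sum>j\<in>S. card {n\<in>{M<..M+K}. prime (Q * n + j)}) = (\<Sum>n\<in>{M<..M+K}. card {j\<in>S. prime (Q * n + j)})" using S(1) by (intro sum_card_swap) auto
    finally have TY: "T i * Y <= real (\<Sum>n\<in>{M<..M+K}. card {j\<in>S. prime (Q * n + j)})" using Y0 by (simp add: pos_le_divide_eq)
    have "(e / 4) * real K * euler_ratio B * real (card S) / x <= (e / 4) * (2 * Y / Q) * euler_ratio B * real (card S) / x" using e r1 x1 K(3) by (intro divide_right_mono mult_right_mono mult_left_mono) auto
    also have "... = real (card S) * (e / \<phi>) / (2 * x) * Y"
    proof -
     have "euler_ratio B / real Q = 1 / \<phi>" using ratio phi0 Q0 by (simp add: field_simps)
     then have "(e / 4) * (2 * Y) * (euler_ratio B / real Q) * real (card S) / x = (e / 4) * (2 * Y) * (1 / \<phi>) * real (card S) / x" by simp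
     then show ?thesis by (simp add: mult_ac)
    qed
    also have "... <= real (card S) * (e / \<phi>) / real I * Y" using e phi0 I x1 Y0 by (intro mult_right_mono divide_left_mono) auto
    also have "... <= T i * Y" using i(2) Y0 by (intro mult_right_mono) auto
    also note TY
    finally have main: "(e / 4) * real K * euler_ratio B * real (card S) / x <= real (\<Sum>n\<in>{M<..M+K}. card {j\<in>S. prime (Q * n + j)})" .
    have "t <= real (nat \<lfloor>t\<rfloor>) + 1" for t :: real by linarith
    then have "real M + 1 >= Y / (2 * Q)" unfolding M_def .
    then have "real Q * (real M + 1) >= real Q * (Y / (2 * Q))" by (intro mult_left_mono) auto
    then have lower: "real Q * (real M + 1) >= exp (x / 2) / 2" using Q0 Ya by (simp add: a_def)
    have "real M + real K <= 2 * Y / Q"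
    proof -
     have "real M + real K = real N" using K(1) by (metis of_nat_add)
     also have "... <= 2 * Y / Q" unfolding N_def using Y0 by (intro of_nat_floor) simp
     finally show ?thesis .
    qed
    then have "real Q * (real M + real K) <= 2 * Y" using Q0 by (simp add: pos_le_divide_eq mult.commute)
    also have "2 * Y <= 2 * exp x * exp (x / 2)"
    proof -
     have "real i <= x" using i(1) unfolding I_def by linarith
     moreover have "real i * ln 2 <= real i * 1" using ln_2_less_1 by (intro mult_left_mono) auto
     ultimately have "exp (real i * ln 2) <= exp x" by simp
     then have "2 ^ i <= exp x" by (simp add: exp_of_nat_mult)
     then show ?thesis by (simp add: Y_def a_def mult_right_mono)
    qed
    also have "... <= exp (2 * x)" using elim by simp
    finally have upper: "real Q * (real M + real K) <= exp (2 * x)" .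
    have "exp (x / 4) <= real K" using YQ Y2 K(2) by linarith
    then show ?thesis using lower upper main by blast
   qed
   then show "\<exists>B. drop_one A B & (\<forall>S. finite S --> (\<forall>j\<in>S. coprime j (\<Prod>B) & real j <= exp (x / 4)) -->
    (\<exists>M K. real K >= exp (x / 4) & real (\<Prod>B) * (real M + 1) >= exp (x / 2) / 2 & real (\<Prod>B) * (real M + real K) <= exp (2 * x) &
     (e / 4) * real K * euler_ratio B * real (card S) / x <= real (\<Sum>n\<in>{M<..M+K}. card {j\<in>S. prime (\<Prod>B * n + j)})))" using B unfolding Q_def by (intro exI[of _ B] conjI allI impI)
  qed
 qed
 moreover have "e / 4 > 0" using e by simp
 ultimately show ?thesis by blast
qed

text \<open>A set E of few rows cannot carry the first moment. With T = 4 G / l, the inequality t <=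
  T + t^2 / T bounds its share by l / 4 from the size of E and l / 4 from the second moment. Were
  all other rows to contain at most m <= l / 4 primes, the mean would be at most 3 l / 4.\<close>

lemma exists_rich_good_row:
 fixes X :: "'a => nat" and G l m :: real
 assumes R: "finite R" "R ~= {}" and l: "l > 0" and G: "G > 0"
  and first: "(\<Sum>n\<in>R. real (X n)) >= l * real (card R)"
  and second: "(\<Sum>n\<in>R. real (X n) ^ 2) <= G * real (card R)"
  and m: "m <= l / 4" and bad: "E \<subseteq> R" "real (card E) <= l^2 / (16 * G) * real (card R)"
 shows "\<exists>n\<in>R - E. real (X n) > m"
proof (rule ccontr)
 assume "\<not> ?thesis"
 then have le: "real (X n) <= m" if "n \<in> R - E" for n using that by (auto simp: not_less)
 define T where "T = 4 * G / l"
 have T: "T > 0" using l G by (simp add: T_def)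
 have fE: "finite E" using R bad finite_subset by blast
 have c0: "real (card R) > 0" using R by (simp add: card_gt_0_iff)
 have point: "t <= T + t^2 / T" if "t >= 0" for t :: real
 proof (cases "t <= T")
  case True
  then show ?thesis using T by (smt (verit) divide_nonneg_nonneg zero_le_power2)
 next
  case False
  then have "T * t <= t * t" using T by (intro mult_right_mono) auto
  then have "t <= t^2 / T" using T by (simp add: pos_le_divide_eq power2_eq_square mult.commute)
  then show ?thesis using T by linarith
 qed
 have "(\<Sum>n\<in>R. real (X n)) = (\<Sum>n\<in>R - E. real (X n)) + (\<Sum>n\<in>E. real (X n))" using R bad by (intro sum.subset_diff)
 also have "(\<Sum>n\<in>R - E. real (X n)) <= (\<Sum>n\<in>R - E. l / 4)" using le m by (intro sum_mono) force
 also have "(\<Sum>n\<in>R - E. l / 4) <= (\<Sum>n\<in>R. l / 4)" using R l by (intro sum_mono2) auto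
 also have "(\<Sum>n\<in>R. l / 4) = l / 4 * real (card R)" by simp
 finally have 1: "(\<Sum>n\<in>R. real (X n)) <= l / 4 * real (card R) + (\<Sum>n\<in>E. real (X n))" by simp
 have "(\<Sum>n\<in>E. real (X n)) <= (\<Sum>n\<in>E. T + real (X n)^2 / T)" by (intro sum_mono point) simp
 also have "... = T * real (card E) + (\<Sum>n\<in>E. real (X n)^2) / T" by (simp add: sum.distrib sum_divide_distrib)
 finally have 2: "(\<Sum>n\<in>E. real (X n)) <= T * real (card E) + (\<Sum>n\<in>E. real (X n)^2) / T" .
 have "(\<Sum>n\<in>E. real (X n)^2) <= (\<Sum>n\<in>R. real (X n)^2)" using R bad by (intro sum_mono2) auto
 then have "(\<Sum>n\<in>E. real (X n)^2) / T <= G * real (card R) / T" using second T by (intro divide_right_mono) auto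
 also have "... = l / 4 * real (card R)" using G l by (simp add: T_def)
 finally have 3: "(\<Sum>n\<in>E. real (X n)^2) / T <= l / 4 * real (card R)" .
 have "T * real (card E) <= T * (l^2 / (16 * G) * real (card R))" using T by (intro mult_left_mono bad) auto
 also have "... = l / 4 * real (card R)" using G l by (simp add: T_def power2_eq_square)
 finally have "T * real (card E) <= l / 4 * real (card R)" .
 then have "(\<Sum>n\<in>R. real (X n)) <= 3 * (l / 4 * real (card R))" using 1 2 3 by linarith
 moreover have "l * real (card R) > 0" using l c0 by simp
 ultimately show False using first by linarith
qed

text \<open>The cofactor k is at most U / z <= y, below every prime of B, and the prime q lies above
  all of them.\<close>

lemma coprime_prime_multiples:
 assumes "finite B" "\<And>p. p \<in> B ==> prime p & y < real p & real p <= z" "z > 0" "U >= 0" "U / z <= y"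
  and "(k, q) \<in> prime_multiples z U"
 shows "coprime (k * q) (\<Prod>B)"
proof (rule prod_coprime_right)
 fix p assume "p \<in> B"
 then have p: "prime p" "y < real p" "real p <= z" using assms(2) by auto
 have kq: "1 <= k" "prime q" "z < real q" "real k * real q <= U" using assms(6) by (auto simp: prime_multiples_def)
 have "real k * z <= real k * real q" using kq by (intro mult_left_mono) auto
 then have "real k * z <= U" using kq by linarith
 then have "real k <= U / z" using assms(3) by (simp add: pos_le_divide_eq)
 then have "k < p" using p(2) assms(5) by linarith
 then have "\<not> p dvd k" using kq(1) by (auto dest: dvd_imp_le)
 moreover have "\<not> p dvd q" using p kq primes_dvd_imp_eq[of p q] by auto
 ultimately have "\<not> p dvd k * q" using p(1) by (simp add: prime_dvd_mult_iff)
 then show "coprime (k * q) p" using p(1) by (metis coprime_commute prime_imp_coprime)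
qed

text \<open>A prime factor above z exhibits j as an element of S. Otherwise every prime factor is at
  most z and not in B, and the only prime of (y, z] that can be missing from B is r.\<close>

lemma coprime_sieving_cases:
 assumes A: "A = primes_in y z" and B: "A - {r} \<subseteq> B" "B \<subseteq> A"
  and j: "0 < j" "real j <= U" "coprime j (\<Prod>B)"
 shows "j \<in> (%(k, q). k * q) ` prime_multiples z U \<or> (\<forall>p. prime p --> p dvd j --> real p <= y \<or> p = r)"
proof (cases "\<exists>q. prime q & q dvd j & z < real q")
 case True
 then obtain q k where q: "prime q" "z < real q" "j = k * q" by (auto simp: mult.commute)
 then have "(k, q) \<in> prime_multiples z U" using j by (auto simp: prime_multiples_def Suc_le_eq)
 then show ?thesis using q(3) by blast
next
 case False
 have "real p <= y \<or> p = r" if p: "prime p" "p dvd j" for p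
 proof (rule ccontr)
  assume n: "\<not> (real p <= y \<or> p = r)"
  then have "p \<in> B" using False p B(1) A by (auto simp: natseg_def not_less)
  moreover have "finite B" using B(2) A finite_subset by fastforce
  ultimately have "p dvd \<Prod>B" by (metis dvd_prodI)
  then have "p dvd 1" using p(2) j(3) coprime_common_divisor by blast
  then show False using p(1) not_prime_unit by blast
 qed
 then show ?thesis by blast
qed

text \<open>The second moment is reduced to a count of pairs: besides the ordered pairs,
  \<open>card T\<close> itself is at most one more than the number of pairs containing the least
  element.\<close>

lemma card_sq_le_pairs:
 fixes T :: "nat set"
 assumes "finite T"
 shows "real (card T)^2 <= 1 + 4 * real (card {(i, j). i \<in> T & j \<in> T & i < j})"
proof -
 define P where "P = {(i, j). i \<in> T & j \<in> T & i < j}"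
 have fP: "finite P" using assms by (intro finite_subset[of P "T \<times> T"]) (auto simp: P_def)
 have "card (T \<times> T) = card ((%i. (i, i)) ` T \<union> (P \<union> prod.swap ` P))" by (rule arg_cong[where f = card]) (auto simp: P_def image_iff)
 also have "... <= card ((%i. (i, i)) ` T) + (card P + card (prod.swap ` P))" by (intro order.trans[OF card_Un_le] add_left_mono card_Un_le)
 also have "card ((%i. (i, i)) ` T) = card T" by (intro card_image) (auto simp: inj_on_def)
 also have "card (prod.swap ` P) = card P" by (intro card_image) (auto simp: inj_on_def)
 finally have sq: "card T * card T <= card T + 2 * card P" by (simp add: card_cartesian_product)
 have "card T <= 1 + card P"
 proof (cases "T = {}")
  case False
  define t where "t = Min T"
  have t: "t \<in> T" "\<And>i. i \<in> T ==> t <= i" using assms False by (auto simp: t_def)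
  have "(%i. (t, i)) ` (T - {t}) \<subseteq> P" using t by (force simp: P_def order_le_less)
  then have "card ((%i. (t, i)) ` (T - {t})) <= card P" using fP by (intro card_mono)
  moreover have "card ((%i. (t, i)) ` (T - {t})) = card T - 1" using assms t(1) by (subst card_image) (auto simp: inj_on_def)
  ultimately show ?thesis by linarith
 qed simp
 then have "card T * card T <= 1 + 4 * card P" using sq by linarith
 then have "real (card T * card T) <= real (1 + 4 * card P)" by (rule of_nat_mono)
 then show ?thesis by (simp add: P_def power2_eq_square)
qed

abbreviation separated_primes_in_windows where
 "separated_primes_in_windows m c \<delta> \<equiv> eventually (%x. \<exists>N::nat. exp (x / 2) / 2 <= real N & real N <= exp (2 * x) &
   m < card (primes_in (real N) (real N + window c x)) &
   (\<forall>p\<in>primes_in (real N) (real N + window c x). \<forall>p'\<in>primes_in (real N) (real N + window c x).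
    p < p' --> real p' - real p > \<delta> * window c x)) at_top"

text \<open>Rows are discarded for two reasons: they contain two primes N + j closer than
  \<open>\<delta> * U\<close> with j in S, or a prime N + j with j smooth apart from r. In a row
  that remains, all primes of the window come from S and are well separated, and
  \<open>exists_rich_good_row\<close> finds one with more than m primes.\<close>

theorem rows_with_gaps:
 fixes m :: nat
 assumes m: "m >= 1"
 shows "\<exists>c>0. \<exists>\<delta>>0. separated_primes_in_windows m c \<delta>"
proof -
 obtain e where e: "e > 0" and dense: "dense_rows_bound e" using dense_rows by (elim exE conjE) (rule that; assumption)
 obtain b C1 where b: "b > 0" and cardS: "\<forall>c>0. window_card_bounds b C1 c" using prime_multiples_window_card by (elim exE conjE) (rule that; assumption)
 obtain b2 C2 where b2: "b2 > 0" and C2: "C2 > 0" and ratio: "sieving_ratio_bounds b2 C2" using euler_ratio_sieving_primes by (elim exE conjE) (rule that; assumption)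
 obtain C3 where C3: "C3 > 0" and weight: "\<forall>c>0. \<forall>\<delta>>0. \<delta> <= 1 --> close_pairs_bound C3 c \<delta>" using close_pairs_weight_le by (elim exE conjE) (rule that; assumption)
 obtain s4 C4 where s4: "s4 > 0" and C4: "C4 > 0" and pairs: "prime_pairs_bound s4 C4" using prime_pairs_le by (elim exE conjE) (rule that; assumption)
 obtain s5 C5 where s5: "s5 > 0" and C5: "C5 > 0" and single: "primes_in_progression_bound s5 C5" using primes_in_progression_le by (elim exE conjE) (rule that; assumption)
 \<comment> \<open>With v = exp (x / \<open>\<kappa>\<close>) the sieve bounds require at most exp
   (x / 4) rows, which the matrix has, while v stays below every entry.\<close>
 define \<kappa> where "\<kappa> = 8 * (s4 + s5 + 1)"
 \<comment> \<open>This c gives the rows the mean l = 4 m. The constants Cp and G depend on c but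
   not on \<open>\<delta>\<close>, so \<open>\<delta>\<close> can be chosen last, making the close
   pairs fill at most half of the tolerance l^2 / (16 G); the other half is for the smooth
   j.\<close>
 define c where "c = 4 * real m / (e * b * b2)"
 define l where "l = 4 * real m"
 define Cp where "Cp = C4 * C3 * (C2 * \<kappa> * c)^2"
 define G where "G = 1 + 4 * Cp"
 define \<beta> where "\<beta> = l^2 / (32 * G)"
 define \<delta> where "\<delta> = min 1 (\<beta> / Cp)"
 have k8: "\<kappa> > 8" using s4 s5 by (simp add: \<kappa>_def)
 have c0: "c > 0" and l0: "l > 0" using m e b b2 by (auto simp: c_def l_def)
 have Cp0: "Cp > 0" using C4 C3 C2 k8 c0 by (simp add: Cp_def)
 have G0: "G > 0" using Cp0 by (simp add: G_def)
 have beta0: "\<beta> > 0" using l0 G0 by (simp add: \<beta>_def)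
 have d0: "\<delta> > 0" "\<delta> <= 1" "Cp * \<delta> <= \<beta>"
 proof -
  show "\<delta> > 0" "\<delta> <= 1" using beta0 Cp0 by (auto simp: \<delta>_def)
  have "Cp * \<delta> <= Cp * (\<beta> / Cp)" using Cp0 by (intro mult_left_mono) (auto simp: \<delta>_def)
  then show "Cp * \<delta> <= \<beta>" using Cp0 by simp
 qed
 have lc: "l = e * b * b2 * c" using e b b2 by (simp add: l_def c_def)
 have ev1: "eventually (%x::real. 3 <= exp (x / \<kappa>)) at_top" using k8 by real_asymp
 have ev2: "eventually (%x::real. exp (x / \<kappa>) < exp (x / 2) / 2) at_top"
 proof -
  have "eventually (%x::real. exp (x / 8) < exp (x / 2) / 2 & x > 0) at_top" by (intro eventually_conj; real_asymp)
  then show ?thesis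
  proof eventually_elim
   case (elim x)
   have "x / \<kappa> <= x / 8" using elim k8 by (intro divide_left_mono) auto
   then have "exp (x / \<kappa>) <= exp (x / 8)" by simp
   then show ?case using elim by linarith
  qed
 qed
 have ev3: "eventually (%x. rough_level x > 0 & window c x > 0 & window c x < rough_level x ^ 2 & window c x / rough_level x <= smooth_level x & window c x <= exp (x / 4)) at_top"
  unfolding rough_level_def window_def smooth_level_def using c0 by (intro eventually_conj; real_asymp)
 have ev4: "eventually (%x::real. x > 0 & ln x > 0 & ln (ln x) > 0 & ln (ln (ln x)) > 0) at_top" by (intro eventually_conj; real_asymp)
 have ev5: "eventually (%x::real. C5 * C2^2 * \<kappa> * c / (ln x ^ 2 * ln (ln (ln x))) <= \<beta>) at_top" using beta0 by real_asymp
 have "separated_primes_in_windows m c \<delta>" using dense cardS[rule_format, OF c0] ratio weight[rule_format, OF c0 d0(1,2)] weight[rule_format, OF c0 zero_less_one order.refl]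
   smooth_in_window_le[OF c0] ev1 ev2 ev3 ev4 ev5
 proof eventually_elim
  case (elim x)
  define U where "U = window c x"
  define z where "z = rough_level x"
  define y where "y = smooth_level x"
  define v where "v = exp (x / \<kappa>)"
  have lv: "ln v = x / \<kappa>" by (simp add: v_def)
  have v: "v >= 3" "v < exp (x / 2) / 2" using elim by (auto simp: v_def)
  have zU: "z > 0" "U > 0" "U < z^2" "U / z <= y" "U <= exp (x / 4)" using elim by (auto simp: z_def U_def y_def)
  have x0: "x > 0" "ln x > 0" "ln (ln x) > 0" "ln (ln (ln x)) > 0" using elim by auto
  have Ux: "U * (ln (ln x))^2 / (x * ln x * ln (ln (ln x))) = c" using x0 by (simp add: U_def window_def)
  have vs: "v powr t <= exp (x / 4)" if "0 < t" "t <= s4 + s5" for t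
  proof -
   have "t * 4 <= \<kappa>" using that by (simp add: \<kappa>_def)
   then have "x * (t * 4) <= x * \<kappa>" using x0 by (intro mult_left_mono) auto
   then have "t * (x / \<kappa>) <= x / 4" using k8 by (simp add: field_simps)
   then show ?thesis by (simp add: powr_def v_def)
  qed
  define A where "A = primes_in y z"
  have Ap: "finite A" "\<forall>p\<in>A. prime p & real p <= rough_level x" by (simp add: A_def, auto simp: A_def natseg_def z_def)
  obtain B where B: "B = A \<or> (\<exists>r\<in>A. B = A - {r})" and rows: "\<forall>S. finite S --> (\<forall>j\<in>S. coprime j (\<Prod>B) & real j <= exp (x / 4)) -->
    (\<exists>M K. real K >= exp (x / 4) & real (\<Prod>B) * (real M + 1) >= exp (x / 2) / 2 & real (\<Prod>B) * (real M + real K) <= exp (2 * x) &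
     e * real K * euler_ratio B * real (card S) / x <= real (\<Sum>n\<in>{M<..M+K}. card {j\<in>S. prime (\<Prod>B * n + j)}))" using elim(1)[rule_format, OF Ap(1)] Ap(2) by blast
  obtain r where r: "prime r" "A - {r} \<subseteq> B" "B \<subseteq> A"
  proof (cases "B = A")
   case True
   then show ?thesis using that[of 2] by auto
  next
   case False
   then show ?thesis using B that Ap(2) by auto
  qed
  have fB: "finite B" using r(3) Ap(1) finite_subset by blast
  have Bp: "prime p" "y < real p" "real p <= z" if "p \<in> B" for p using that r(3) by (auto simp: A_def natseg_def)
  have rho: "b2 * ln (ln x) / ln (ln (ln x)) <= euler_ratio B" "euler_ratio B <= C2 * ln (ln x) / ln (ln (ln x))" using elim(3)[rule_format, of A B] B by (auto simp: A_def y_def z_def)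
  define \<rho> where "\<rho> = euler_ratio B"
  have rho1: "\<rho> >= 1" unfolding \<rho>_def by (intro euler_ratio_ge_1 Bp)
  define Q where "Q = \<Prod>B"
  define S where "S = (%(k, q). k * q) ` prime_multiples z U"
  have fpm: "finite (prime_multiples z U)" using zU by (intro finite_prime_multiples) auto
  have fS: "finite S" unfolding S_def using fpm by simp
  have cS: "card S = card (prime_multiples z U)" unfolding S_def by (intro card_image inj_on_prime_multiples zU)
  have Sj: "coprime j Q & real j <= exp (x / 4)" if "j \<in> S" for j
  proof -
   obtain k q where kq: "(k, q) \<in> prime_multiples z U" "j = k * q" using \<open>j \<in> S\<close> by (auto simp: S_def)
   have "coprime j Q" unfolding kq(2) Q_def using Bp zU kq(1) by (intro coprime_prime_multiples[where y = y and z = z and U = U] fB) auto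
   moreover have "real j <= U" using kq by (auto simp: prime_multiples_def)
   ultimately show ?thesis using zU(5) by linarith
  qed
  obtain M K where K: "real K >= exp (x / 4)" and lower: "real Q * (real M + 1) >= exp (x / 2) / 2" and upper: "real Q * (real M + real K) <= exp (2 * x)"
   and moment: "e * real K * \<rho> * real (card S) / x <= real (\<Sum>n\<in>{M<..M+K}. card {j\<in>S. prime (Q * n + j)})" using rows[rule_format, OF fS] Sj unfolding Q_def \<rho>_def by blast
  define R where "R = {M<..M+K}"
  define X where "X = (%n. card {j\<in>S. prime (Q * n + j)})"
  have fR: "finite R" and cR: "card R = K" by (auto simp: R_def)
  have K0: "K > 0" using K exp_gt_zero[of "x / 4"] by (metis not_gr_zero not_le of_nat_0)
  have Qn: "exp (x / 2) / 2 <= real (Q * n)" "real (Q * n) <= exp (2 * x)" if "n \<in> R" for n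
  proof -
   have n: "real M + 1 <= real n" "real n <= real M + real K" using that by (auto simp: R_def)
   have "real Q * (real M + 1) <= real Q * real n" using n by (intro mult_left_mono) auto
   then show "exp (x / 2) / 2 <= real (Q * n)" using lower by simp
   have "real Q * real n <= real Q * (real M + real K)" using n by (intro mult_left_mono) auto
   then show "real (Q * n) <= exp (2 * x)" using upper by simp
  qed
  have big: "v < real (Q * n + j)" if "n \<in> R" for n j
  proof -
   have "real (Q * n) <= real (Q * n + j)" by (rule of_nat_mono) simp
   then show ?thesis using Qn(1)[OF that] v(2) by linarith
  qed
  have first: "(\<Sum>n\<in>R. real (X n)) >= l * real (card R)"
  proof -
   have "b * U * ln (ln x) / ln x <= real (card S)" using elim(2) by (simp add: cS U_def z_def)
   moreover have "b2 * ln (ln x) / ln (ln (ln x)) <= \<rho>" using rho by (simp add: \<rho>_def)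
   ultimately have "(b2 * ln (ln x) / ln (ln (ln x))) * (b * U * ln (ln x) / ln x) <= \<rho> * real (card S)" using b x0 zU rho1 by (intro mult_mono) auto
   then have "e * real K / x * ((b2 * ln (ln x) / ln (ln (ln x))) * (b * U * ln (ln x) / ln x)) <= e * real K / x * (\<rho> * real (card S))" using e x0 by (intro mult_left_mono) auto
   moreover have "e * real K / x * ((b2 * ln (ln x) / ln (ln (ln x))) * (b * U * ln (ln x) / ln x))
    = e * b * b2 * (U * (ln (ln x))^2 / (x * ln x * ln (ln (ln x)))) * real K" by (simp add: power2_eq_square mult_ac)
   moreover have "e * real K / x * (\<rho> * real (card S)) = e * real K * \<rho> * real (card S) / x" by simp
   moreover have "real (\<Sum>n\<in>R. X n) = (\<Sum>n\<in>R. real (X n))" by simp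
   moreover have "e * real K * \<rho> * real (card S) / x <= real (\<Sum>n\<in>R. X n)" using moment unfolding X_def R_def .
   ultimately show ?thesis unfolding Ux cR lc by linarith
  qed
  define W where "W = (%d. Sigma S (%j. near S j (d * U)))"
  define P where "P = (%d n. {w\<in>W d. prime (Q * n + fst w) & prime (Q * n + snd w)})"
  have fW: "finite (W d)" for d using fS by (auto simp: W_def)
  have pairsum: "(\<Sum>n\<in>R. real (card (P d n))) <= Cp * d * real K"
   if d: "d > 0" and wt: "(\<Sum>j\<in>S. \<Sum>j'\<in>near S j (d * U). odd_prime_ratio (j' - j))
     <= C3 * d * (U * ln (ln x) / ln x)^2" for d
  proof -
   have "(\<Sum>n\<in>R. card (P d n)) = (\<Sum>w\<in>W d. card {n\<in>R. prime (Q * n + fst w) & prime (Q * n + snd w)})" unfolding P_def by (rule sum_card_swap[OF fR fW])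
   then have "(\<Sum>n\<in>R. real (card (P d n))) = (\<Sum>w\<in>W d. real (card {n\<in>R. prime (Q * n + fst w) & prime (Q * n + snd w)}))" by (simp only: of_nat_sum[symmetric])
   also have "... <= (\<Sum>w\<in>W d. C4 * real K * (\<rho> / ln v)^2 * odd_prime_ratio (snd w - fst w))"
   proof (rule sum_mono)
    fix w assume "w \<in> W d"
    then obtain j j' where w: "w = (j, j')" "j < j'" by (auto simp: W_def)
    have "{n\<in>R. prime (Q * n + fst w) & prime (Q * n + snd w)} = {n\<in>{M<..M+K}. prime (Q * n + j) & v < real (Q * n + j) & prime (Q * n + j')}" using big w(1) by (auto simp: R_def)
    then have "real (card {n\<in>R. prime (Q * n + fst w) & prime (Q * n + snd w)})
      = real (card {n\<in>{M<..M+K}. prime (Q * n + j) & v < real (Q * n + j) & prime (Q * n + j')})" by simp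
    also have "... <= C4 * real K * (\<rho> / ln v)^2 * euler_ratio {p\<in>natseg 2 v. prime p & p \<notin> B & p dvd j' - j}" unfolding Q_def \<rho>_def
     by (rule pairs[rule_format, OF v(1) fB]) (use Bp w vs[of s4] s4 s5 K in auto)
    also have "... <= C4 * real K * (\<rho> / ln v)^2 * odd_prime_ratio (j' - j)"
    proof (intro mult_left_mono euler_ratio_mono)
     have "finite {p. p dvd j' - j}" using w(2) by (intro finite_divisors_nat) simp
     then show "finite {p. prime p & 3 <= p & p dvd j' - j}" by (rule rev_finite_subset) blast
    qed (use C4 in \<open>auto simp: natseg_def\<close>)
    finally show "real (card {n\<in>R. prime (Q * n + fst w) & prime (Q * n + snd w)}) <= C4 * real K * (\<rho> / ln v)^2 * odd_prime_ratio (snd w - fst w)" by (simp add: w(1))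
   qed
   also have "... = C4 * real K * (\<rho> / ln v)^2 * (\<Sum>w\<in>W d. odd_prime_ratio (snd w - fst w))" by (simp only: sum_distrib_left)
   also have "(\<Sum>w\<in>W d. odd_prime_ratio (snd w - fst w))
     = (\<Sum>j\<in>S. \<Sum>j'\<in>near S j (d * U). odd_prime_ratio (j' - j))" unfolding W_def using fS by (subst sum.Sigma) (auto simp: case_prod_unfold)
   also have "C4 * real K * (\<rho> / ln v)^2 * (\<Sum>j\<in>S. \<Sum>j'\<in>near S j (d * U). odd_prime_ratio (j' - j))
     <= C4 * real K * ((C2 * ln (ln x) / ln (ln (ln x))) / ln v)^2 * (C3 * d * (U * ln (ln x) / ln x)^2)"
   proof (intro mult_mono mult_left_mono power_mono divide_right_mono wt)
    show "\<rho> <= C2 * ln (ln x) / ln (ln (ln x))" using rho by (simp add: \<rho>_def)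
    show "0 <= \<rho> / ln v" using v rho1 by simp
    show "0 <= (\<Sum>j\<in>S. \<Sum>j'\<in>near S j (d * U). odd_prime_ratio (j' - j))" by (intro sum_nonneg order.trans[OF zero_le_one euler_ratio_ge_1]) auto
   qed (use C4 v in auto)
   also have "... = C4 * C3 * (C2 * \<kappa> * (U * (ln (ln x))^2 / (x * ln x * ln (ln (ln x)))))^2 * d * real K" unfolding lv by (simp add: power2_eq_square mult_ac)
   finally show ?thesis unfolding Ux Cp_def .
  qed
  have close: "(\<Sum>n\<in>R. real (card (P \<delta> n))) <= \<beta> * real K"
  proof -
   have "(\<Sum>n\<in>R. real (card (P \<delta> n))) <= Cp * \<delta> * real K" by (rule pairsum[OF d0(1)]) (use elim(4) in \<open>simp add: S_def U_def z_def\<close>)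
   also have "... <= \<beta> * real K" using d0 by (intro mult_right_mono) auto
   finally show ?thesis .
  qed
  have second: "(\<Sum>n\<in>R. real (X n) ^ 2) <= G * real (card R)"
  proof -
   have "(\<Sum>n\<in>R. real (X n) ^ 2) <= (\<Sum>n\<in>R. 1 + 4 * real (card (P 1 n)))"
   proof (rule sum_mono)
    fix n
    have SU: "real j <= U" if "j \<in> S" for j using that by (auto simp: S_def prime_multiples_def)
    have "{(i, j). i \<in> {j\<in>S. prime (Q * n + j)} & j \<in> {j\<in>S. prime (Q * n + j)} & i < j} = P 1 n"
    proof (rule Set.set_eqI)
     fix w :: "nat \<times> nat"
     obtain i j where w: "w = (i, j)" by (cases w)
     have "real j <= real i + 1 * U" if "j \<in> S" using SU[OF that] by simp
     then show "w \<in> {(i, j). i \<in> {j\<in>S. prime (Q * n + j)} & j \<in> {j\<in>S. prime (Q * n + j)} & i < j} \<longleftrightarrow> w \<in> P 1 n" unfolding w P_def W_def by (simp, blast)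
    qed
    then show "real (X n) ^ 2 <= 1 + 4 * real (card (P 1 n))" using card_sq_le_pairs[of "{j\<in>S. prime (Q * n + j)}"] fS by (simp add: X_def)
   qed
   also have "... = real K + 4 * (\<Sum>n\<in>R. real (card (P 1 n)))" by (simp add: sum.distrib sum_distrib_left cR)
   also have "... <= real K + 4 * (Cp * 1 * real K)" by (intro add_left_mono mult_left_mono pairsum) (use elim(5) in \<open>simp_all add: S_def U_def z_def\<close>)
   finally show ?thesis by (simp add: G_def cR algebra_simps)
  qed
  \<comment> \<open>For these j a bound for single primes is enough: the saving of (ln x)^3 in their
    number outweighs the squared Euler ratio.\<close>
  define Z where "Z = smooth_upto U y r"
  have fZ: "finite Z" by (simp add: Z_def)
  have smooth: "(\<Sum>n\<in>R. real (card {j\<in>Z. prime (Q * n + j)})) <= \<beta> * real K"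
  proof -
   have "(\<Sum>n\<in>R. card {j\<in>Z. prime (Q * n + j)}) = (\<Sum>j\<in>Z. card {n\<in>R. prime (Q * n + j)})" by (rule sum_card_swap[OF fR fZ])
   then have "(\<Sum>n\<in>R. real (card {j\<in>Z. prime (Q * n + j)})) = (\<Sum>j\<in>Z. real (card {n\<in>R. prime (Q * n + j)}))" by (simp only: of_nat_sum[symmetric])
   also have "... <= (\<Sum>j\<in>Z. C5 * real K * \<rho>^2 / ln v)"
   proof (rule sum_mono)
    fix j
    have "{n\<in>R. prime (Q * n + j)} = prime_rows Q j v M K" using big by (auto simp: R_def)
    then show "real (card {n\<in>R. prime (Q * n + j)}) <= C5 * real K * \<rho>^2 / ln v" using single[rule_format, OF v(1) fB, of K M j] Bp vs[of s5] s4 s5 K by (simp add: Q_def \<rho>_def)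
   qed
   also have "... = real (card Z) * (C5 * real K * \<rho>^2 / ln v)" by simp
   also have "... <= (U / ln x ^ 3) * (C5 * real K * (C2 * ln (ln x) / ln (ln (ln x)))^2 / ln v)"
   proof (intro mult_mono divide_right_mono mult_left_mono power_mono)
    show "real (card Z) <= U / ln x ^ 3" using elim(6) r(1) by (simp add: Z_def U_def y_def)
    show "\<rho> <= C2 * ln (ln x) / ln (ln (ln x))" using rho by (simp add: \<rho>_def)
    show "0 <= \<rho>" using rho1 by simp
   qed (use C5 v zU x0 in auto)
   also have "... = C5 * C2^2 * \<kappa> * (U * (ln (ln x))^2 / (x * ln x * ln (ln (ln x)))) / (ln x ^ 2 * ln (ln (ln x))) * real K" unfolding lv by (simp add: power2_eq_square power3_eq_cube mult_ac)
   also have "... <= \<beta> * real K" unfolding Ux using elim(11) by (intro mult_right_mono) auto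
   finally show ?thesis .
  qed
  define E where "E = {n\<in>R. P \<delta> n ~= {} \<or> {j\<in>Z. prime (Q * n + j)} ~= {}}"
  have fP: "finite (P d n)" for d n using fW by (simp add: P_def)
  have "real (card E) <= l^2 / (16 * G) * real (card R)"
  proof -
   have "real (card E) = (\<Sum>n\<in>E. 1)" by simp
   also have "... <= (\<Sum>n\<in>E. real (card (P \<delta> n)) + real (card {j\<in>Z. prime (Q * n + j)}))"
   proof (rule sum_mono)
    fix n assume "n \<in> E"
    then have "card (P \<delta> n) >= 1 \<or> card {j\<in>Z. prime (Q * n + j)} >= 1" using fP[of \<delta> n] fZ by (auto simp: E_def Suc_le_eq card_gt_0_iff)
    then show "1 <= real (card (P \<delta> n)) + real (card {j\<in>Z. prime (Q * n + j)})" by linarith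
   qed
   also have "... <= (\<Sum>n\<in>R. real (card (P \<delta> n)) + real (card {j\<in>Z. prime (Q * n + j)}))" using fR by (intro sum_mono2) (auto simp: E_def)
   also have "... <= \<beta> * real K + \<beta> * real K" unfolding sum.distrib by (intro add_mono close smooth)
   also have "... = l^2 / (16 * G) * real (card R)" by (simp add: \<beta>_def cR)
   finally show ?thesis .
  qed
  moreover have "R ~= {}" using cR K0 by auto
  moreover have "E \<subseteq> R" by (auto simp: E_def)
  moreover have "real m <= l / 4" by (simp add: l_def)
  ultimately obtain n where n: "n \<in> R" "n \<notin> E" "real (X n) > real m" using exists_rich_good_row[OF fR _ l0 G0 first second, of "real m" E] by auto
  define N where "N = Q * n"
  \<comment> \<open>A prime of the window that is not coprime to Q would be one of the primes q of
    B, and q would divide j and so be at most j < p.\<close>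
  have inS: "p - N \<in> S & prime (Q * n + (p - N)) & p = N + (p - N)" if "p \<in> natseg (real N) (real N + U)" "prime p" for p
  proof -
   define j where "j = p - N"
   have "N < p" using that(1) by (simp add: natseg_def)
   then have pj: "p = N + j" "0 < j" by (auto simp: j_def)
   have jU: "real j <= U" using that(1) pj by (simp add: natseg_def)
   have "coprime j (\<Prod>B)"
   proof (rule prod_coprime_right)
    fix q assume q: "q \<in> B"
    show "coprime j q"
    proof (rule ccontr)
     assume "\<not> coprime j q"
     then have "q dvd j" using Bp(1)[OF q] by (metis coprime_commute prime_imp_coprime)
     moreover have "q dvd N" unfolding N_def Q_def using fB q by (intro dvd_mult2 dvd_prodI)
     ultimately have "q dvd p" using pj(1) by simp
     then have "q = p" using Bp(1)[OF q] that(2) primes_dvd_imp_eq by blast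
     moreover have "q dvd j" by fact
     then have "q <= j" using pj(2) by (rule dvd_imp_le)
     moreover have "real N > 0"
     proof -
      have "exp (x / 2) / 2 > 0" by simp
      then show ?thesis using Qn(1)[OF n(1)] unfolding N_def by linarith
     qed
     ultimately show False using pj(1) by simp
    qed
   qed
   then have "j \<in> S \<or> j \<in> Z" using coprime_sieving_cases[OF A_def r(2,3) pj(2) jU] pj(2) jU by (auto simp: S_def Z_def natseg_def)
   moreover have "j \<notin> Z" using n(1,2) that(2) pj(1) by (auto simp: E_def N_def)
   ultimately show ?thesis using that(2) pj by (auto simp: N_def)
  qed
  let ?T = "primes_in (real N) (real N + U)"
  have "m < card ?T"
  proof -
   have "(%j. N + j) ` {j\<in>S. prime (Q * n + j)} \<subseteq> ?T" by (auto simp: S_def prime_multiples_def natseg_def N_def prime_gt_0_nat)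
   then have "card ((%j. N + j) ` {j\<in>S. prime (Q * n + j)}) <= card ?T" by (intro card_mono) auto
   moreover have "card ((%j. N + j) ` {j\<in>S. prime (Q * n + j)}) = X n" unfolding X_def by (intro card_image) (auto simp: inj_on_def)
   ultimately show ?thesis using n(3) by simp
  qed
  moreover have "\<forall>p\<in>?T. \<forall>p'\<in>?T. p < p' --> real p' - real p > \<delta> * U"
  proof (intro ballI impI)
   fix p p' assume p: "p \<in> ?T" "p' \<in> ?T" "p < p'"
   define j where "j = p - N"
   define j' where "j' = p' - N"
   have j: "j \<in> S" "prime (Q * n + j)" "p = N + j" "j' \<in> S" "prime (Q * n + j')" "p' = N + j'" using inS[of p] inS[of p'] p by (auto simp: j_def j'_def)
   show "real p' - real p > \<delta> * U"
   proof (rule ccontr)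
    assume "\<not> ?thesis"
    then have "(j, j') \<in> P \<delta> n" using j p(3) by (auto simp: P_def W_def)
    then show False using n(1,2) by (auto simp: E_def)
   qed
  qed
  moreover have "exp (x / 2) / 2 <= real N" "real N <= exp (2 * x)" unfolding N_def by (rule Qn[OF n(1)])+
  ultimately show ?case unfolding U_def by blast
 qed
 then show ?thesis using c0 d0(1) by blast
qed

section \<open>From primes in a window to consecutive gaps\<close>

lemma nth_prime_less: "1 <= i ==> i < j ==> nth_prime i < nth_prime j"
 using strict_mono_onD[OF strict_mono_on_nth_prime] by auto

lemma nth_prime_less_iff: "1 <= i ==> 1 <= j ==> nth_prime i < nth_prime j \<longleftrightarrow> i < j"
 using nth_prime_less by (metis linorder_neqE_nat order.asym less_irrefl)

lemma prime_nth_prime: "1 <= i ==> prime (nth_prime i)"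
 using nth_prime_image by blast

lemma nth_prime_index:
 assumes "prime p"
 obtains i where "1 <= i" "p = nth_prime i" using assms nth_prime_image by (metis (mono_tags, lifting) atLeast_iff image_iff mem_Collect_eq)

lemma nth_prime_ge: "1 <= i ==> i <= nth_prime i"
proof (induction i rule: dec_induct)
 case base
 show ?case using prime_nth_prime[of 1] prime_gt_0_nat[of "nth_prime 1"] by simp
next
 case (step n)
 then show ?case using nth_prime_less[of n "Suc n"] by simp
qed

text \<open>All primes of the window are separated, so those following the least one are consecutive
  primes and the gaps between them are large. The two bounds on n are needed because the gaps are
  compared with a function of the index and not of the prime.\<close>

lemma consecutive_gaps_of_separated_primes:
 fixes N m :: nat and U D :: real
 defines "T \<equiv> primes_in (real N) (real N + U)"
 assumes m: "m >= 1" and T: "m < card T" and sep: "\<forall>p\<in>T. \<forall>p'\<in>T. p < p' --> real p' - real p > D"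
 shows "\<exists>n. D < Min (prime_gap ` {n + 1..n + m}) & real n <= real N + U & (\<forall>t\<le>real N. card (primes_in 0 t) <= n)"
proof -
 have fT: "finite T" by (simp add: T_def)
 have "T ~= {}" using T by auto
 define p0 where "p0 = Min T"
 have p0: "p0 \<in> T" "\<And>p. p \<in> T ==> p0 <= p" using fT \<open>T ~= {}\<close> by (auto simp: p0_def)
 obtain i where i: "1 <= i" "p0 = nth_prime i" using nth_prime_index p0(1) by (auto simp: T_def)
 have inT: "nth_prime (i + t) \<in> T" if "t <= m" for t
 proof (rule ccontr)
  assume notT: "nth_prime (i + t) \<notin> T"
  have ge: "p0 <= nth_prime (i + t)" using i nth_prime_less[of i "i + t"] by (cases "t = 0") auto
  moreover have "prime (nth_prime (i + t))" using i by (intro prime_nth_prime) simp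
  ultimately have big: "real N + U < real (nth_prime (i + t))" using notT p0(1) by (auto simp: T_def natseg_def)
  have "T \<subseteq> nth_prime ` {i..<i + t}"
  proof
   fix p assume p: "p \<in> T"
   obtain k where k: "1 <= k" "p = nth_prime k" using nth_prime_index p by (auto simp: T_def)
   have "\<not> k < i" using p0(2)[OF p] nth_prime_less_iff[of k i] k i by auto
   moreover have "nth_prime k < nth_prime (i + t)" using p k big by (auto simp: T_def natseg_def)
   then have "k < i + t" using nth_prime_less_iff[of k "i + t"] k i by simp
   ultimately show "p \<in> nth_prime ` {i..<i + t}" using k by auto
  qed
  then have "card T <= card (nth_prime ` {i..<i + t})" by (intro card_mono) auto
  also have "... <= t" using card_image_le[of "{i..<i + t}" nth_prime] by simp
  finally show False using T that by simp
 qed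
 \<comment> \<open>The least prime of T is number n + 1, so \<open>prime_gap (n + 1)\<close> is the
   gap that starts at it.\<close>
 define n where "n = i - 1"
 have ni: "i = n + 1" using i by (simp add: n_def)
 have "D < prime_gap k" if k: "k \<in> {n + 1..n + m}" for k
 proof -
  define t where "t = k - i"
  have kt: "k = i + t" "Suc t <= m" using k by (auto simp: t_def ni)
  have "nth_prime (i + t) < nth_prime (i + Suc t)" using i by (intro nth_prime_less) auto
  then show ?thesis using sep inT[of t] inT[of "Suc t"] kt by (auto simp: prime_gap_def)
 qed
 then have "D < Min (prime_gap ` {n + 1..n + m})" using m by (subst Min_gr_iff) auto
 moreover have "real n <= real N + U"
 proof -
  have "n <= p0" using nth_prime_ge[OF i(1)] i(2) ni by simp
  moreover have "real p0 <= real N + U" using p0(1) by (simp add: T_def natseg_def)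
  ultimately show ?thesis by linarith
 qed
 moreover have "card (primes_in 0 t) <= n" if "t <= real N" for t
 proof -
  have "primes_in 0 t \<subseteq> nth_prime ` {1..<i}"
  proof
   fix p assume p: "p \<in> primes_in 0 t"
   then obtain k where k: "1 <= k" "p = nth_prime k" using nth_prime_index by auto
   have "real p < real p0" using p p0(1) that by (auto simp: T_def natseg_def)
   then have "k < i" using nth_prime_less_iff[of k i] k i by simp
   then show "p \<in> nth_prime ` {1..<i}" using k by auto
  qed
  then have "card (primes_in 0 t) <= card (nth_prime ` {1..<i})" by (intro card_mono) auto
  also have "... <= n" using card_image_le[of "{1..<i}" nth_prime] by (simp add: n_def)
  finally show ?thesis .
 qed
 ultimately show ?thesis by blast
qed

text \<open>Since ln t lies between x / 4 and 3 x, the further logarithms of t agree with those of x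
  to leading order. The quotient by the window shape is therefore at most 3 + o(1), and 8 leaves
  room.\<close>

lemma gap_scale_times_ln_le:
 assumes c: "c > 0"
 shows "eventually (%x. \<forall>t. exp (x / 4) <= t --> t <= exp (3 * x) -->
  0 < gap_scale t * ln t & gap_scale t * ln t <= 8 / c * window c x) at_top"
proof -
 have "eventually (%x::real. ln (ln (x / 4)) > 1 & ln (x / 4) > 1 & x / 4 > 1) at_top" by (intro eventually_conj; real_asymp)
 moreover have "eventually (%x::real. 3 * x * ln (3 * x) * ln (ln (ln (3 * x))) / (ln (ln (x / 4)))^2 <= 8 / c * window c x) at_top" unfolding window_def using c by real_asymp
 ultimately show ?thesis
 proof eventually_elim
  case (elim x)
  show ?case
  proof (intro allI impI)
   fix t assume t: "exp (x / 4) <= t" "t <= exp (3 * x)"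
   have t0: "t > 0" using t(1) exp_gt_zero[of "x / 4"] by linarith
   have x: "x / 4 > 1" "ln (x / 4) > 1" "ln (ln (x / 4)) > 1" using elim by auto
   have "ln (exp (x / 4)) <= ln t" using t(1) t0 by (subst ln_le_cancel_iff) auto
   then have "x / 4 <= ln t" by simp
   moreover have "ln t <= 3 * x" using t(2) t0 by (metis ln_exp ln_le_cancel_iff exp_gt_zero)
   ultimately have 1: "x / 4 <= ln t" "ln t <= 3 * x" by auto
   have 2: "ln (x / 4) <= ln (ln t)" "ln (ln t) <= ln (3 * x)" using 1 x by (auto simp: ln_le_cancel_iff)
   have 3: "ln (ln (x / 4)) <= ln (ln (ln t))" "ln (ln (ln t)) <= ln (ln (3 * x))" using 2 x by (auto simp: ln_le_cancel_iff)
   have "1 < ln (ln (ln t))" "1 < ln (ln (3 * x))" using 3 x by linarith+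
   then have 4: "ln (ln (ln (ln t))) <= ln (ln (ln (3 * x)))" "0 < ln (ln (ln (ln t)))" using 3 by (auto simp: ln_le_cancel_iff)
   have eq: "gap_scale t * ln t = ln t * ln (ln t) * ln (ln (ln (ln t))) / (ln (ln (ln t)))^2" by (simp add: gap_scale_def iter_ln_def numeral_eq_Suc)
   have "0 < ln t * ln (ln t) * ln (ln (ln (ln t))) / (ln (ln (ln t)))^2" using 1 2 3 4 x by (intro divide_pos_pos mult_pos_pos) auto
   moreover have "ln t * ln (ln t) * ln (ln (ln (ln t))) / (ln (ln (ln t)))^2 <= 3 * x * ln (3 * x) * ln (ln (ln (3 * x))) / (ln (ln (x / 4)))^2" using 1 2 3 4 x by (intro frac_le mult_mono power_mono) auto
   ultimately show "0 < gap_scale t * ln t & gap_scale t * ln t <= 8 / c * window c x" unfolding eq using elim(2) by linarith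
  qed
 qed
qed

theorem theorem4:
  fixes m :: nat
  assumes "m \<ge> 1"
  shows "limsup (\<lambda>n. ereal (Min (prime_gap ` {n + 1..n + m})
                            / (gap_scale (real n) * ln (real n)))) > 0"
proof -
 let ?f = "%n. Min (prime_gap ` {n + 1..n + m}) / (gap_scale (real n) * ln (real n))"
 obtain c \<delta> where c: "c > 0" and d: "\<delta> > 0" and rows: "separated_primes_in_windows m c \<delta>" using rows_with_gaps[OF assms] by (elim exE conjE) (rule that; assumption)
 obtain K where K: "K > 1" "\<And>T. T >= 2 * K ==> real (card (primes_in (T / K) T)) >= T / (K * ln T)" using prime_count_lower by blast
 \<comment> \<open>Cancels the factor 8 / c in the comparison of \<open>gap_scale\<close> with the
   window, so that e times the scale is at most \<open>\<delta> * U\<close>.\<close>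
 define e where "e = \<delta> * c / 8"
 have e0: "e > 0" using c d by (simp add: e_def)
 have "eventually (%x::real. exp (x / 2) / 2 >= 2 * K & exp (x / 2) / 2 / (K * ln (exp (x / 2) / 2)) >= exp (x / 4)
   & exp (2 * x) + window c x <= exp (3 * x) & window c x > 0) at_top" unfolding window_def using c K(1) by (intro eventually_conj; real_asymp)
 then have main: "eventually (%x. \<exists>n. exp (x / 4) <= real n & ?f n >= e) at_top" using rows gap_scale_times_ln_le[OF c]
 proof eventually_elim
  case (elim x)
  define U where "U = window c x"
  define T where "T = exp (x / 2) / 2"
  obtain N :: nat where N: "T <= real N" "real N <= exp (2 * x)" "m < card (primes_in (real N) (real N + U))"
   "\<forall>p\<in>primes_in (real N) (real N + U). \<forall>p'\<in>primes_in (real N) (real N + U). p < p' --> real p' - real p > \<delta> * U" using elim(2) unfolding U_def T_def by blast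
  obtain n where n: "\<delta> * U < Min (prime_gap ` {n + 1..n + m})" "real n <= real N + U" "\<And>t. t <= real N ==> card (primes_in 0 t) <= n" using consecutive_gaps_of_separated_primes[OF assms N(3,4)] by blast
  have T2: "T >= 2 * K" "T / (K * ln T) >= exp (x / 4)" and U0: "U > 0" and up: "exp (2 * x) + U <= exp (3 * x)" using elim(1) by (auto simp: T_def U_def)
  have "exp (x / 4) <= real (card (primes_in (T / K) T))" using K(2)[OF T2(1)] T2(2) by linarith
  also have "... <= real (card (primes_in 0 T))"
  proof (intro of_nat_mono card_mono)
   have "T / K >= 0" using K(1) by (simp add: T_def)
   then show "primes_in (T / K) T \<subseteq> primes_in 0 T" by (auto simp: natseg_def)
  qed simp
  also have "... <= real n" by (intro of_nat_mono n(3) N(1))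
  finally have lo: "exp (x / 4) <= real n" .
  have "real n <= exp (3 * x)" using n(2) N(2) up by linarith
  then have g: "0 < gap_scale (real n) * ln (real n)" "gap_scale (real n) * ln (real n) <= 8 / c * U" using elim(3) lo by (auto simp: U_def)
  have "e * (gap_scale (real n) * ln (real n)) <= e * (8 / c * U)" using e0 g by (intro mult_left_mono) auto
  also have "... = \<delta> * U" using c by (simp add: e_def)
  finally have "e * (gap_scale (real n) * ln (real n)) <= Min (prime_gap ` {n + 1..n + m})" using n(1) by linarith
  then have "?f n >= e" using g(1) by (simp add: pos_le_divide_eq)
  then show ?case using lo by blast
 qed
 have lim: "limsup (%n. ereal (?f n)) >= ereal e"
 proof (rule ccontr)
  assume "\<not> ?thesis"
  then have "limsup (%n. ereal (?f n)) < ereal e" by simp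
  then have "eventually (%n. ereal (?f n) < ereal e) sequentially" by (rule Limsup_lessD)
  then obtain n0 where n0: "\<And>n. n >= n0 ==> ?f n < e" by (auto simp: eventually_sequentially)
  \<comment> \<open>The indices found are at least exp (x / 4), hence unbounded as x grows, which
    contradicts an upper bound e from n0 on.\<close>
  have "eventually (%x::real. exp (x / 4) > real n0) at_top" by real_asymp
  with main have "eventually (%x::real. \<exists>n. n >= n0 & ?f n >= e) at_top"
  proof eventually_elim
   case (elim x)
   then obtain n where n: "exp (x / 4) <= real n" "?f n >= e" by blast
   then have "real n0 <= real n" using elim by linarith
   then show ?case using n(2) by (intro exI[of _ n]) auto
  qed
  then have "\<exists>n. n >= n0 & ?f n >= e" by (auto simp: eventually_at_top_linorder)
  then obtain n where "n >= n0" "?f n >= e" by blast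
  then show False using n0[of n] by linarith
 qed
 have "0 < ereal e" using e0 by simp
 then show ?thesis using lim by (rule less_le_trans)
qed

end
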